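(* Let $(\boldsymbol X_t)_{t\in\mathbb Z}$ be a time series in $\mathbb R^d$ satisfying the multivariate max-domain of attraction condition (MDA), and let $r=r_n$ be a block size sequence satisfying the block size and mixing condition (BM) with constant $\omega>0$. Fix an integer $k\ge 2$. Let $\boldsymbol h=(h_1,\dots,h_q)^\top:\mathbb R^d\to\mathbb R^q$ satisfy the integrability condition (INT) for this $k$ with some $\nu>2/\omega$. Then $\lim_{n\to\infty}\operatorname{Cov}(\bar{\mathbb G}_{n,r}^{[c]}\boldsymbol h)=\Sigma_{\boldsymbol h}^{[s]}$ and $$\bar{\mathbb G}_{n,r}^{[c]}\boldsymbol h\rightsquigarrow\mathcal N_q(\boldsymbol 0,\Sigma_{\boldsymbol h}^{[s]})\qquad(n\to\infty).$$ Moreover, if the expectations and limits $D_{\boldsymbol h,k}$ and $E_{\boldsymbol h}$ in (CB) exist, then $$\tilde{\mathbb G}_{n,r}^{[c]}\boldsymbol h\rightsquigarrow\mathcal N_q\Big(\tfrac{D_{\boldsymbol h,k}+E_{\boldsymbol h}}{k},\Sigma_{\boldsymbol h}^{[s]}\Big),$$ and if additionally the limit $B_{\boldsymbol h}$ in (B) exists, then $$\mathbb G_{n,r}^{[c]}\boldsymbol h\rightsquigarrow\mathcal N_q\Big(B_{\boldsymbol h}+\tfrac{D_{\boldsymbol h,k}+E_{\boldsymbol h}}{k},\Sigma_{\boldsymbol h}^{[s]}\Big).$$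
   Context: Maxima, minima, inequalities and divisions of vectors in $\mathbb R^d$ are componentwise; $\rightsquigarrow$ denotes weak convergence. (MDA) $(\boldsymbol X_t)_{t\in\mathbb Z}$ is a strictly stationary time series in $\mathbb R^d$ with continuous margins. There are sequences $(\boldsymbol a_r)_r\subset(0,\infty)^d$, $(\boldsymbol b_r)_r\subset\mathbb R^d$ and $\boldsymbol\gamma\in\mathbb R^d$ such that for all $s>0$, $j\in\{1,\dots,d\}$: $a^{(j)}_{\lfloor rs\rfloor}/a^{(j)}_r\to s^{\gamma^{(j)}}$ and $(b^{(j)}_{\lfloor rs\rfloor}-b^{(j)}_r)/a^{(j)}_r\to (s^{\gamma^{(j)}}-1)/\gamma^{(j)}$ as $r\to\infty$ (the last limit read as $\log s$ if $\gamma^{(j)}=0$). Moreover $\boldsymbol Z_r:=(\max(\boldsymbol X_1,\dots,\boldsymbol X_r)-\boldsymbol b_r)/\boldsymbol a_r\rightsquigarrow \boldsymbol Z\sim G$ as $r\to\infty$, where $G$ is the CDF of a $d$-variate extreme-value distribution with margins $G_{\gamma^{(j)}}$, $G_\gamma(x)=\exp(-(1+\gamma x)^{-1/\gamma})\mathbf 1(1+\gamma x>0)$ (GEV($\gamma$)). (BM) With $\alpha(p)=\sup\{|\mathbb P(A\cap B)-\mathbb P(A)\mathbb P(B)|:A\in\sigma((\boldsymbol X_t)_{t\le 0}),B\in\sigma((\boldsymbol X_t)_{t\ge p})\}$: (a) $r_n\to\infty$, $r_n=o(n)$; (b) there are integers $\ell_n\to\infty$ with $\ell_n=o(r_n)$,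 $\frac{r_n}{\ell_n}\alpha(\ell_n)=o(1)$, $\frac n{r_n}\alpha(\ell_n)=o(1)$; (c) $(n/r_n)^{1+\omega}\alpha(r_n)=o(1)$ for some $\omega>0$. Circular block maxima. Assume $m(k):=n/(kr)\in\mathbb N$ and let $I_{kr,i}=\{(i-1)kr+1,\dots,ikr\}$, $i=1,\dots,m(k)$. For each $i$, extend $(\boldsymbol X_{(i-1)kr+1},\dots,\boldsymbol X_{ikr})$ to a vector of length $kr+r-1$ by appending its first $r-1$ entries $\boldsymbol X_{(i-1)kr+1},\dots,\boldsymbol X_{(i-1)kr+r-1}$ at the end; for $j=1,\dots,kr$ let $\boldsymbol M^{[c]}_{r,(i-1)kr+j}$ be the maximum of entries $j,\dots,j+r-1$ of the extended vector. Put $\boldsymbol Z^{[c]}_{r,s}=(\boldsymbol M^{[c]}_{r,s}-\boldsymbol b_r)/\boldsymbol a_r$, $s=1,\dots,n$ (dependence on $k$ suppressed). Empirical processes: $\mathbb P^{[c]}_{n,r}=\frac1n\sum_{s=1}^n\delta_{\boldsymbol Z^{[c]}_{r,s}}$, $P^{[c]}_{n,r}=\frac1{kr}\sum_{s=1}^{kr}\mathbb P(\boldsymbol Z^{[c]}_{r,s}\in\cdot)$, $P_r=\mathbb P(\boldsymbol Z_r\in\cdot)$, $P=\mathbb P(\boldsymbol Z\in\cdot)$; $\bar{\mathbb G}^{[c]}_{n,r}=\sqrt{n/r}(\mathbb P^{[c]}_{n,r}-P^{[c]}_{n,r})$, $\tilde{\mathbb G}^{[c]}_{n,r}=\sqrt{n/r}(\mathbb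 P^{[c]}_{n,r}-P_r)$, $\mathbb G^{[c]}_{n,r}=\sqrt{n/r}(\mathbb P^{[c]}_{n,r}-P)$. For a signed measure $\mu$, $\mu h=\int h\,d\mu$ and $\mu\boldsymbol h=(\mu h_1,\dots,\mu h_q)^\top$. (INT) $\boldsymbol h$ is Lebesgue-a.e. continuous and $\limsup_{r\to\infty}\sup_{t=1,\dots,r}\mathbb E\big[\|\boldsymbol h((\max\{\boldsymbol X_1,\dots,\boldsymbol X_t,\boldsymbol X_{(k-1)r+t+1},\dots,\boldsymbol X_{kr}\}-\boldsymbol b_r)/\boldsymbol a_r)\|^{2+\nu}\big]<\infty$. Limit covariance: $(\Sigma^{[s]}_{\boldsymbol h})_{j,j'}=2\int_0^1\operatorname{Cov}(h_j(\boldsymbol Z_{1,\xi}),h_{j'}(\boldsymbol Z_{2,\xi}))\,d\xi$, where $(\boldsymbol Z_{1,\xi},\boldsymbol Z_{2,\xi})$ has the $2d$-variate CDF $G_\xi(\boldsymbol x,\boldsymbol y)=G(\boldsymbol x)^{\xi\wedge1}G(\boldsymbol y)^{\xi\wedge1}G(\boldsymbol x\wedge\boldsymbol y)^{1-(\xi\wedge1)}$. Bias conditions. (B): $h(\boldsymbol Z_r)$ and $h(\boldsymbol Z)$ are integrable and the limit $B_{\boldsymbol h}=\lim_{n}\sqrt{n/r}\{\mathbb E[\boldsymbol h(\boldsymbol Z_r)]-\mathbb E[\boldsymbol h(\boldsymbol Z)]\}$ exists. (CB): with $(\tilde{\boldsymbol X}_t)_t$ an independent copy of $(\boldsymbol X_t)_t$,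 the following expectations and limits exist: $D_{\boldsymbol h,k}=\lim_n\sqrt{\tfrac nr}\,\tfrac1r\sum_{t=1}^{r-1}\mathbb E\big[\boldsymbol h\big(\tfrac{\max(\boldsymbol X_1,\dots,\boldsymbol X_t,\boldsymbol X_{(k-1)r+t+1},\dots,\boldsymbol X_{kr})-\boldsymbol b_r}{\boldsymbol a_r}\big)-\boldsymbol h\big(\tfrac{\max(\boldsymbol X_1,\dots,\boldsymbol X_t,\tilde{\boldsymbol X}_1,\dots,\tilde{\boldsymbol X}_{r-t})-\boldsymbol b_r}{\boldsymbol a_r}\big)\big]$ and $E_{\boldsymbol h}=\lim_n\sqrt{\tfrac nr}\,\tfrac1r\sum_{t=1}^{r-1}\mathbb E\big[\boldsymbol h\big(\tfrac{\max(\boldsymbol X_1,\dots,\boldsymbol X_t,\tilde{\boldsymbol X}_1,\dots,\tilde{\boldsymbol X}_{r-t})-\boldsymbol b_r}{\boldsymbol a_r}\big)-\boldsymbol h(\boldsymbol Z_r)\big]$.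
   Formalization: h is also assumed Borel and continuous almost everywhere under the law of Z (automatic if that law has a density; false without it for singular laws, d≥2); the GEV CDF is taken as 1 beyond its upper endpoint when γ<0; n→∞ runs over n divisible by k·r_n. *)

theory Defs
  imports "HOL-Probability.Probability" "HOL-Library.Landau_Symbols"
begin

section \<open>Componentwise operations and weak convergence\<close>

definition cmax :: "('i \<Rightarrow> real^'d) \<Rightarrow> 'i set \<Rightarrow> real^'d" where
  "cmax x S = (\<chi> j. Max ((\<lambda>t. x t $ j) ` S))"

definition rescale :: "real^'d \<Rightarrow> real^'d \<Rightarrow> real^'d \<Rightarrow> real^'d" where
  "rescale a b x = (\<chi> j. (x $ j - b $ j) / a $ j)"

definition weak_conv_law ::
  "('n \<Rightarrow> 'b::topological_space measure) \<Rightarrow> 'b measure \<Rightarrow> 'n filter \<Rightarrow> bool" where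
  "weak_conv_law \<mu> \<nu> F \<longleftrightarrow>
     (\<forall>f :: 'b \<Rightarrow> real. continuous_on UNIV f \<and> bounded (range f) \<longrightarrow>
        ((\<lambda>n. \<integral>x. f x \<partial>\<mu> n) \<longlongrightarrow> (\<integral>x. f x \<partial>\<nu>)) F)"

definition mcdf :: "(real^'d) measure \<Rightarrow> real^'d \<Rightarrow> real" where
  "mcdf \<mu> x = measure \<mu> {..x}"

definition covariance :: "'a measure \<Rightarrow> ('a \<Rightarrow> real) \<Rightarrow> ('a \<Rightarrow> real) \<Rightarrow> real" where
  "covariance M f g =
     (\<integral>\<omega>. (f \<omega> - (\<integral>\<omega>'. f \<omega>' \<partial>M)) * (g \<omega> - (\<integral>\<omega>'. g \<omega>' \<partial>M)) \<partial>M)"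

definition cov_matrix :: "'a measure \<Rightarrow> ('a \<Rightarrow> real^'q) \<Rightarrow> real^'q^'q" where
  "cov_matrix M V = (\<chi> i j. covariance M (\<lambda>\<omega>. V \<omega> $ i) (\<lambda>\<omega>. V \<omega> $ j))"

text \<open>The normal law, possibly degenerate, is the law of \<open>m + A W\<close> with \<open>W\<close> standard normal and
  \<open>A A\<^sup>T = S\<close>. Every positive semidefinite \<open>S\<close> has such a root \<open>A\<close>, and the law does not depend
  on the root.\<close>

definition mv_normal :: "real^'q \<Rightarrow> real^'q^'q \<Rightarrow> (real^'q) measure" where
  "mv_normal m S =
     (let A = (SOME A :: real^'q^'q. A ** transpose A = S)
      in distr (Pi\<^sub>M (UNIV :: 'q set) (\<lambda>_. std_normal_distribution)) borel
           (\<lambda>w. m + A *v (\<chi> i. w i)))"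

section \<open>Max-domain of attraction\<close>

text \<open>The distribution function of GEV(\<open>g\<close>). For \<open>g < 0\<close> it equals 1, not 0, to the right of
  the upper end point \<open>-1/g\<close>.\<close>

definition gev :: "real \<Rightarrow> real \<Rightarrow> real" where
  "gev g x =
     (if g = 0 then exp (- exp (- x))
      else if 1 + g * x > 0 then exp (- ((1 + g * x) powr (- 1 / g)))
      else if g > 0 then 0 else 1)"

text \<open>Extreme-value distributions are the weak limits of affinely normalised componentwise
  maxima of iid random vectors. Nondegeneracy of the margins is imposed separately, by
  prescribing them in \<open>cond_MDA\<close>.\<close>

definition extreme_value :: "(real^'d) measure \<Rightarrow> bool" where
  "extreme_value P \<longleftrightarrow> prob_space P \<and> sets P = sets borel \<and>
     (\<exists>(Q :: (real^'d) measure) (c :: nat \<Rightarrow> real^'d) (e :: nat \<Rightarrow> real^'d).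
        prob_space Q \<and> sets Q = sets borel \<and> (\<forall>n j. c n $ j > 0) \<and>
        weak_conv_law
          (\<lambda>n. distr (Pi\<^sub>M {1..n} (\<lambda>_. Q)) borel (\<lambda>x. rescale (c n) (e n) (cmax x {1..n})))
          P sequentially)"

definition strictly_stationary :: "'a measure \<Rightarrow> (int \<Rightarrow> 'a \<Rightarrow> real^'d) \<Rightarrow> bool" where
  "strictly_stationary M X \<longleftrightarrow> (\<forall>t. X t \<in> borel_measurable M) \<and>
     (\<forall>(J :: int set) u. finite J \<longrightarrow>
        distr M (Pi\<^sub>M J (\<lambda>_. borel)) (\<lambda>\<omega>. \<lambda>t\<in>J. X (t + u) \<omega>) =
        distr M (Pi\<^sub>M J (\<lambda>_. borel)) (\<lambda>\<omega>. \<lambda>t\<in>J. X t \<omega>))"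

definition block_Z ::
  "(nat \<Rightarrow> real^'d) \<Rightarrow> (nat \<Rightarrow> real^'d) \<Rightarrow> nat \<Rightarrow> (int \<Rightarrow> real^'d) \<Rightarrow> real^'d" where
  "block_Z a b r x = rescale (a r) (b r) (cmax x {1..int r})"

text \<open>\<open>P\<close> is the law of the limit vector \<open>Z\<close>; its distribution function is \<open>G = mcdf P\<close>.\<close>

definition cond_MDA ::
  "'a measure \<Rightarrow> (int \<Rightarrow> 'a \<Rightarrow> real^'d) \<Rightarrow> (nat \<Rightarrow> real^'d) \<Rightarrow> (nat \<Rightarrow> real^'d) \<Rightarrow> real^'d \<Rightarrow>
   (real^'d) measure \<Rightarrow> bool" where
  "cond_MDA M X a b \<gamma> P \<longleftrightarrow>
     strictly_stationary M X \<and>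
     (\<forall>t j. continuous_on UNIV (cdf (distr M borel (\<lambda>\<omega>. X t \<omega> $ j)))) \<and>
     (\<forall>r\<ge>1. \<forall>j. a r $ j > 0) \<and>
     (\<forall>s>0. \<forall>j.
        (\<lambda>r. a (nat \<lfloor>real r * s\<rfloor>) $ j / a r $ j) \<longlonglongrightarrow> s powr (\<gamma> $ j) \<and>
        (\<lambda>r. (b (nat \<lfloor>real r * s\<rfloor>) $ j - b r $ j) / a r $ j) \<longlonglongrightarrow>
          (if \<gamma> $ j = 0 then ln s else (s powr (\<gamma> $ j) - 1) / \<gamma> $ j)) \<and>
     extreme_value P \<and>
     (\<forall>j x. cdf (distr P borel (\<lambda>z. z $ j)) x = gev (\<gamma> $ j) x) \<and>
     weak_conv_law (\<lambda>r. distr M borel (\<lambda>\<omega>. block_Z a b r (\<lambda>t. X t \<omega>))) P sequentially"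

section \<open>Block sizes and mixing\<close>

text \<open>Circular block maxima require \<open>k r\<^sub>n\<close> to divide \<open>n\<close>. This cannot hold for every large \<open>n\<close>
  when \<open>r\<^sub>n\<close> is \<open>o(n)\<close> and \<open>k \<ge> 2\<close> (take \<open>n\<close> prime). Hence \<open>n \<rightarrow> \<infinity>\<close> always means along the
  sample sizes for which the divisibility holds.\<close>

definition sample_sizes :: "nat \<Rightarrow> (nat \<Rightarrow> nat) \<Rightarrow> nat filter" where
  "sample_sizes k r = inf sequentially (principal {n. k * r n dvd n})"

definition gen_events :: "'a measure \<Rightarrow> (int \<Rightarrow> 'a \<Rightarrow> real^'d) \<Rightarrow> int set \<Rightarrow> 'a set set" where
  "gen_events M X T =
     sigma_sets (space M) (\<Union>t\<in>T. (\<lambda>S. X t -` S \<inter> space M) ` sets borel)"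

definition alpha_mix :: "'a measure \<Rightarrow> (int \<Rightarrow> 'a \<Rightarrow> real^'d) \<Rightarrow> nat \<Rightarrow> real" where
  "alpha_mix M X p =
     (SUP (A, B) \<in> gen_events M X {..0} \<times> gen_events M X {int p..}.
        \<bar>measure M (A \<inter> B) - measure M A * measure M B\<bar>)"

definition cond_BM ::
  "'a measure \<Rightarrow> (int \<Rightarrow> 'a \<Rightarrow> real^'d) \<Rightarrow> (nat \<Rightarrow> nat) \<Rightarrow> real \<Rightarrow> nat filter \<Rightarrow> bool" where
  "cond_BM M X r \<omega> F \<longleftrightarrow>
     filterlim r at_top F \<and>
     (\<lambda>n. real (r n)) \<in> o[F](\<lambda>n. real n) \<and>
     (\<exists>l :: nat \<Rightarrow> nat.
        filterlim l at_top F \<and>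
        (\<lambda>n. real (l n)) \<in> o[F](\<lambda>n. real (r n)) \<and>
        ((\<lambda>n. real (r n) / real (l n) * alpha_mix M X (l n)) \<longlongrightarrow> 0) F \<and>
        ((\<lambda>n. real n / real (r n) * alpha_mix M X (l n)) \<longlongrightarrow> 0) F) \<and>
     \<omega> > 0 \<and>
     ((\<lambda>n. (real n / real (r n)) powr (1 + \<omega>) * alpha_mix M X (r n)) \<longlongrightarrow> 0) F"

section \<open>Circular block maxima and empirical processes\<close>

text \<open>Entry \<open>l \<in> {1..k r + r - 1}\<close> of the extended \<open>i\<close>-th block.\<close>

definition circ_entry :: "nat \<Rightarrow> nat \<Rightarrow> (int \<Rightarrow> 'b) \<Rightarrow> nat \<Rightarrow> nat \<Rightarrow> 'b" where
  "circ_entry k r x i l =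
     x (int ((i - 1) * (k * r) + (if l \<le> k * r then l else l - k * r)))"

text \<open>For \<open>s \<ge> 1\<close>, \<open>i\<close> and \<open>j\<close> below are the unique numbers with
  \<open>s = (i - 1) k r + j\<close> and \<open>1 \<le> j \<le> k r\<close>.\<close>

definition circ_max :: "nat \<Rightarrow> nat \<Rightarrow> (int \<Rightarrow> real^'d) \<Rightarrow> nat \<Rightarrow> real^'d" where
  "circ_max k r x s =
     (let i = (s - 1) div (k * r) + 1; j = (s - 1) mod (k * r) + 1
      in cmax (circ_entry k r x i) {j..j + r - 1})"

definition circ_Z ::
  "(nat \<Rightarrow> real^'d) \<Rightarrow> (nat \<Rightarrow> real^'d) \<Rightarrow> nat \<Rightarrow> nat \<Rightarrow> (int \<Rightarrow> real^'d) \<Rightarrow> nat \<Rightarrow> real^'d" where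
  "circ_Z a b k r x s = rescale (a r) (b r) (circ_max k r x s)"

definition emp_circ ::
  "(int \<Rightarrow> 'a \<Rightarrow> real^'d) \<Rightarrow> (nat \<Rightarrow> real^'d) \<Rightarrow> (nat \<Rightarrow> real^'d) \<Rightarrow> nat \<Rightarrow> nat \<Rightarrow> nat \<Rightarrow>
   (real^'d \<Rightarrow> real^'q) \<Rightarrow> 'a \<Rightarrow> real^'q" where
  "emp_circ X a b k n r h \<omega> =
     (1 / real n) *\<^sub>R (\<Sum>s=1..n. h (circ_Z a b k r (\<lambda>t. X t \<omega>) s))"

definition mean_circ ::
  "'a measure \<Rightarrow> (int \<Rightarrow> 'a \<Rightarrow> real^'d) \<Rightarrow> (nat \<Rightarrow> real^'d) \<Rightarrow> (nat \<Rightarrow> real^'d) \<Rightarrow> nat \<Rightarrow> nat \<Rightarrow>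
   (real^'d \<Rightarrow> real^'q) \<Rightarrow> real^'q" where
  "mean_circ M X a b k r h =
     (1 / real (k * r)) *\<^sub>R
       (\<Sum>s=1..k * r. \<integral>\<omega>. h (circ_Z a b k r (\<lambda>t. X t \<omega>) s) \<partial>M)"

definition mean_block ::
  "'a measure \<Rightarrow> (int \<Rightarrow> 'a \<Rightarrow> real^'d) \<Rightarrow> (nat \<Rightarrow> real^'d) \<Rightarrow> (nat \<Rightarrow> real^'d) \<Rightarrow> nat \<Rightarrow>
   (real^'d \<Rightarrow> real^'q) \<Rightarrow> real^'q" where
  "mean_block M X a b r h = (\<integral>\<omega>. h (block_Z a b r (\<lambda>t. X t \<omega>)) \<partial>M)"

definition G_bar ::
  "'a measure \<Rightarrow> (int \<Rightarrow> 'a \<Rightarrow> real^'d) \<Rightarrow> (nat \<Rightarrow> real^'d) \<Rightarrow> (nat \<Rightarrow> real^'d) \<Rightarrow> nat \<Rightarrow> nat \<Rightarrow> nat \<Rightarrow>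
   (real^'d \<Rightarrow> real^'q) \<Rightarrow> 'a \<Rightarrow> real^'q" where
  "G_bar M X a b k n r h \<omega> =
     sqrt (real n / real r) *\<^sub>R (emp_circ X a b k n r h \<omega> - mean_circ M X a b k r h)"

definition G_tilde ::
  "'a measure \<Rightarrow> (int \<Rightarrow> 'a \<Rightarrow> real^'d) \<Rightarrow> (nat \<Rightarrow> real^'d) \<Rightarrow> (nat \<Rightarrow> real^'d) \<Rightarrow> nat \<Rightarrow> nat \<Rightarrow> nat \<Rightarrow>
   (real^'d \<Rightarrow> real^'q) \<Rightarrow> 'a \<Rightarrow> real^'q" where
  "G_tilde M X a b k n r h \<omega> =
     sqrt (real n / real r) *\<^sub>R (emp_circ X a b k n r h \<omega> - mean_block M X a b r h)"

definition G_circ ::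
  "(real^'d) measure \<Rightarrow> (int \<Rightarrow> 'a \<Rightarrow> real^'d) \<Rightarrow> (nat \<Rightarrow> real^'d) \<Rightarrow> (nat \<Rightarrow> real^'d) \<Rightarrow>
   nat \<Rightarrow> nat \<Rightarrow> nat \<Rightarrow> (real^'d \<Rightarrow> real^'q) \<Rightarrow> 'a \<Rightarrow> real^'q" where
  "G_circ P X a b k n r h \<omega> =
     sqrt (real n / real r) *\<^sub>R (emp_circ X a b k n r h \<omega> - (\<integral>z. h z \<partial>P))"

section \<open>Integrability, limit covariance and bias\<close>

definition split_Z ::
  "(nat \<Rightarrow> real^'d) \<Rightarrow> (nat \<Rightarrow> real^'d) \<Rightarrow> nat \<Rightarrow> nat \<Rightarrow> nat \<Rightarrow> (int \<Rightarrow> real^'d) \<Rightarrow> real^'d" where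
  "split_Z a b k r t x =
     rescale (a r) (b r) (cmax x ({1..int t} \<union> {int ((k - 1) * r + t + 1)..int (k * r)}))"

definition mixed_Z ::
  "(nat \<Rightarrow> real^'d) \<Rightarrow> (nat \<Rightarrow> real^'d) \<Rightarrow> nat \<Rightarrow> nat \<Rightarrow> (int \<Rightarrow> real^'d) \<Rightarrow> (int \<Rightarrow> real^'d) \<Rightarrow>
   real^'d" where
  "mixed_Z a b r t x x' =
     rescale (a r) (b r) (sup (cmax x {1..int t}) (cmax x' {1..int (r - t)}))"

text \<open>Borel measurability makes \<open>h(Z)\<close> a random vector for every Borel law of \<open>Z\<close>; almost
  everywhere continuity alone would only give Lebesgue measurability.\<close>

definition cond_INT ::
  "'a measure \<Rightarrow> (int \<Rightarrow> 'a \<Rightarrow> real^'d) \<Rightarrow> (nat \<Rightarrow> real^'d) \<Rightarrow> (nat \<Rightarrow> real^'d) \<Rightarrow> nat \<Rightarrow>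
   (real^'d \<Rightarrow> real^'q) \<Rightarrow> real \<Rightarrow> bool" where
  "cond_INT M X a b k h \<nu> \<longleftrightarrow>
     h \<in> borel_measurable borel \<and>
     (AE z in lborel. isCont h z) \<and>
     limsup (\<lambda>r. SUP t\<in>{1..r}.
       \<integral>\<^sup>+\<omega>. ennreal (norm (h (split_Z a b k r t (\<lambda>u. X u \<omega>))) powr (2 + \<nu>)) \<partial>M) < \<infinity>"

text \<open>The law with distribution function \<open>G\<^sub>\<xi>\<close>. The convention \<open>0 powr 0 = 0\<close> is harmless:
  extreme-value distributions satisfy \<open>G(x) G(y) \<le> G(x \<and> y)\<close>, so that a factor \<open>0 powr 0\<close>
  only occurs where the product vanishes anyway.\<close>

definition G_xi_law :: "(real^'d) measure \<Rightarrow> real \<Rightarrow> ((real^'d) \<times> (real^'d)) measure" where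
  "G_xi_law P \<xi> =
     (THE Q. prob_space Q \<and> sets Q = sets borel \<and>
        (\<forall>x y. measure Q ({..x} \<times> {..y}) =
           mcdf P x powr min \<xi> 1 * mcdf P y powr min \<xi> 1 * mcdf P (inf x y) powr (1 - min \<xi> 1)))"

definition Sigma_s :: "(real^'d) measure \<Rightarrow> (real^'d \<Rightarrow> real^'q) \<Rightarrow> real^'q^'q" where
  "Sigma_s P h =
     (\<chi> i j. 2 * (LBINT \<xi>:{0..1}.
        covariance (G_xi_law P \<xi>) (\<lambda>z. h (fst z) $ i) (\<lambda>z. h (snd z) $ j)))"

definition cond_B ::
  "'a measure \<Rightarrow> (int \<Rightarrow> 'a \<Rightarrow> real^'d) \<Rightarrow> (nat \<Rightarrow> real^'d) \<Rightarrow> (nat \<Rightarrow> real^'d) \<Rightarrow>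
   (real^'d) measure \<Rightarrow> (nat \<Rightarrow> nat) \<Rightarrow> (real^'d \<Rightarrow> real^'q) \<Rightarrow> nat filter \<Rightarrow> real^'q \<Rightarrow> bool" where
  "cond_B M X a b P r h F B \<longleftrightarrow>
     (\<forall>\<^sub>F n in F. integrable M (\<lambda>\<omega>. h (block_Z a b (r n) (\<lambda>t. X t \<omega>)))) \<and>
     integrable P h \<and>
     ((\<lambda>n. sqrt (real n / real (r n)) *\<^sub>R (mean_block M X a b (r n) h - (\<integral>z. h z \<partial>P)))
        \<longlongrightarrow> B) F"

text \<open>The independent copy is realised on the product space: \<open>X\<close> is evaluated at \<open>fst w\<close> and
  its copy is \<open>X\<close> evaluated at \<open>snd w\<close>.\<close>

definition D_integrand ::
  "(int \<Rightarrow> 'a \<Rightarrow> real^'d) \<Rightarrow> (nat \<Rightarrow> real^'d) \<Rightarrow> (nat \<Rightarrow> real^'d) \<Rightarrow> nat \<Rightarrow>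
   (real^'d \<Rightarrow> real^'q) \<Rightarrow> nat \<Rightarrow> nat \<Rightarrow> 'a \<times> 'a \<Rightarrow> real^'q" where
  "D_integrand X a b k h r t w =
     h (split_Z a b k r t (\<lambda>u. X u (fst w))) -
     h (mixed_Z a b r t (\<lambda>u. X u (fst w)) (\<lambda>u. X u (snd w)))"

definition E_integrand ::
  "(int \<Rightarrow> 'a \<Rightarrow> real^'d) \<Rightarrow> (nat \<Rightarrow> real^'d) \<Rightarrow> (nat \<Rightarrow> real^'d) \<Rightarrow>
   (real^'d \<Rightarrow> real^'q) \<Rightarrow> nat \<Rightarrow> nat \<Rightarrow> 'a \<times> 'a \<Rightarrow> real^'q" where
  "E_integrand X a b h r t w =
     h (mixed_Z a b r t (\<lambda>u. X u (fst w)) (\<lambda>u. X u (snd w))) -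
     h (block_Z a b r (\<lambda>u. X u (fst w)))"

definition cond_CB ::
  "'a measure \<Rightarrow> (int \<Rightarrow> 'a \<Rightarrow> real^'d) \<Rightarrow> (nat \<Rightarrow> real^'d) \<Rightarrow> (nat \<Rightarrow> real^'d) \<Rightarrow> nat \<Rightarrow>
   (nat \<Rightarrow> nat) \<Rightarrow> (real^'d \<Rightarrow> real^'q) \<Rightarrow> nat filter \<Rightarrow> real^'q \<Rightarrow> real^'q \<Rightarrow> bool" where
  "cond_CB M X a b k r h F D E \<longleftrightarrow>
     (\<forall>\<^sub>F n in F. \<forall>t\<in>{1..r n - 1}.
        integrable (M \<Otimes>\<^sub>M M) (D_integrand X a b k h (r n) t) \<and>
        integrable (M \<Otimes>\<^sub>M M) (E_integrand X a b h (r n) t)) \<and>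
     ((\<lambda>n. (sqrt (real n / real (r n)) * (1 / real (r n))) *\<^sub>R
        (\<Sum>t=1..r n - 1. \<integral>w. D_integrand X a b k h (r n) t w \<partial>(M \<Otimes>\<^sub>M M))) \<longlongrightarrow> D) F \<and>
     ((\<lambda>n. (sqrt (real n / real (r n)) * (1 / real (r n))) *\<^sub>R
        (\<Sum>t=1..r n - 1. \<integral>w. E_integrand X a b h (r n) t w \<partial>(M \<Otimes>\<^sub>M M))) \<longlongrightarrow> E) F"

text \<open>For \<open>d \<ge> 2\<close> the law \<open>P\<close> of \<open>Z\<close> may be singular, and a Lebesgue-null set of discontinuities
  of \<open>h\<close> may then carry mass of \<open>P\<close>. The limit theorem fails in such a case. Let
  \<open>X\<^sub>t = (Y\<^sub>t, Y\<^sub>t)\<close> with \<open>Y\<^sub>t\<close> iid, having a singular continuous law with tail asymptotic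
  to \<open>1/y\<close> (so \<open>a\<^sub>r = b\<^sub>r = r\<close>) and a Lebesgue-null carrier \<open>C\<close>, and let \<open>h(x, y) = 1\<close> if \<open>x = y \<le> 0\<close> and \<open>x\<close> lies in the union
  over \<open>r\<close> of \<open>(C - b\<^sub>r) / a\<^sub>r\<close>, and \<open>h(x, y) = 0\<close> otherwise. Then \<open>h(Z) = 0\<close> almost surely, so
  the limit covariance vanishes, whereas \<open>h(Z\<^sub>r)\<close> is almost surely the indicator of \<open>Z\<^sub>r \<le> 0\<close>.
  The following condition excludes this. It follows from Lebesgue-a.e. continuity whenever \<open>P\<close> is
  absolutely continuous, in particular always for \<open>d = 1\<close>.\<close>

definition limit_ae_continuous :: "(real^'d) measure \<Rightarrow> (real^'d \<Rightarrow> real^'q) \<Rightarrow> bool" where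
  "limit_ae_continuous P h \<longleftrightarrow> (AE z in P. isCont h z)"

end

theory Submission
  imports Defs
begin

text \<open>By the Cramer-Wold device it suffices to treat a real function. Let \<open>\<ell> = o(r)\<close> be the gap length
  of the mixing condition. Dropping \<open>\<ell>\<close> positions changes the probability that a block maximum
  stays below a level by a negligible amount, and afterwards the two sides of the gap are nearly
  independent. Hence a circle of length \<open>k r\<close> may be rotated, and two windows of length \<open>r\<close> at lag
  \<open>\<xi> r\<close> with \<open>\<xi> < 1\<close> split into three nearly independent stretches of lengths \<open>\<xi> r\<close>,
  \<open>(1 - \<xi>) r\<close>, \<open>\<xi> r\<close>, whose maxima have limiting distribution functions \<open>G\<close> to the powers \<open>\<xi>\<close>,
  \<open>1 - \<xi>\<close>, \<open>\<xi>\<close>. The joint law of the two window maxima therefore tends to the law with distribution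
  function \<open>G\<^sub>\<xi>\<close>, while for disjoint windows it tends to a product law.

  Consequently the variance of a block average, multiplied by \<open>k\<close>, is asymptotically a Riemann sum of
  the lag covariances; the lags \<open>d\<close> and \<open>k r - d\<close> contribute equally, which gives the factor 2 in the
  limit covariance. Averages of adjacent blocks are asymptotically uncorrelated, and the
  covariances of all other pairs of blocks are summable by truncation and mixing. A Bernstein-type
  grouping of the block averages, with characteristic functions, then yields the normal limit.

  The bias comes from the \<open>r - 1\<close> windows per block that wrap around its end: all other windows
  have the law of an ordinary block maximum.\<close>

section \<open>Weak convergence of distribution functions\<close>

text \<open>Three obstacles shape the argument. Dropping a gap is harmless only at points x with
  \<open>G x > 0\<close>: a gap with non-negligible exceedance probability, repeated many times
  inside one block, would force the limit to 0. Where \<open>G x = 0\<close> the limits are 0 for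
  another reason: every window, even a wrapped one, contains an interval of half its length. The law
  \<open>P\<close> may be singular. Convergence of joint distribution functions is therefore proved
  at every point and extended directly to integrands that are continuous \<open>P\<close>-almost
  everywhere; unbounded integrands are truncated, with an error that is uniform under moments of
  order 2 + \<nu>. Averages over windows and blocks need limits that are uniform in the position. A
  limit that holds along every selection of positions holds along the worst one, so pair limits are
  stated for arbitrary sequences of positions. For the same reason all asymptotics run along plain
  sequences \<open>R\<close>, \<open>L\<close>, \<open>m\<close>; the limit along the sample sizes
  is reduced to subsequences at the end.\<close>

definition staircase :: "nat \<Rightarrow> real \<Rightarrow> real" where
  "staircase N y = (\<Sum>i=1..N. of_bool (real i / real N < y)) / real N"

lemma staircase_approx:
  assumes "0 \<le> y" "y \<le> 1" "N \<ge> 1"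
  shows "\<bar>y - staircase N y\<bar> \<le> 1 / real N"
proof -
  \<comment> \<open>The number of positive integers strictly below \<open>real N * y\<close>;
    strictness makes it the ceiling minus 1, and \<open>nat\<close> covers
    \<open>y = 0\<close>.\<close>
  define c where "c = nat (\<lceil>real N * y\<rceil> - 1)"
  have N: "real N > 0" using assms by simp
  have ceil_le: "\<lceil>real N * y\<rceil> \<le> int N"
    using assms mult_left_le[of y "real N"] by (simp add: ceiling_le_iff)
  have "{i\<in>{1..N}. real i / real N < y} = {1..c}"
  proof (intro set_eqI)
    fix i
    have "real i / real N < y \<longleftrightarrow> real i < real N * y"
      using N by (simp add: field_simps)
    also have "\<dots> \<longleftrightarrow> int i < \<lceil>real N * y\<rceil>"
      by (simp add: less_ceiling_iff)
    finally show "i \<in> {i\<in>{1..N}. real i / real N < y} \<longleftrightarrow> i \<in> {1..c}"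
      using ceil_le unfolding c_def by auto
  qed
  moreover have "(\<Sum>i=1..N. of_bool (real i / real N < y)) = real (card {i\<in>{1..N}. real i / real N < y})"
    by (simp add: sum.If_cases of_bool_def Int_def)
  ultimately have st: "staircase N y = real c / real N"
    by (simp add: staircase_def)
  have "real c \<le> real N * y" "real N * y \<le> real c + 1"
    using assms(1) N mult_nonneg_nonneg[of "real N" y] unfolding c_def by linarith+
  then have "\<bar>real N * y - real c\<bar> \<le> 1"
    by (simp add: abs_le_iff)
  moreover have "y - real c / real N = (real N * y - real c) / real N"
    using N by (simp add: field_simps)
  ultimately show ?thesis
    using N unfolding st by (simp add: divide_right_mono)
qed

lemma staircase_borel [measurable]: "staircase N \<in> borel_measurable borel"
  unfolding staircase_def by measurable

lemma staircase_bounds: "0 \<le> staircase N y" "staircase N y \<le> 1"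
proof -
  have "(\<Sum>i=1..N. of_bool (real i / real N < y)) \<le> (\<Sum>i=1..N. 1::real)"
    by (intro sum_mono) auto
  then show "staircase N y \<le> 1"
    by (simp add: staircase_def divide_le_eq)
qed (simp add: staircase_def sum_nonneg)

text \<open>Turns an integral into an average of probabilities with an error independent of the
  measure. Strict superlevel sets are used because at its continuity points a function lies strictly
  above a level on a whole neighbourhood.\<close>

lemma (in prob_space) staircase_expectation:
  assumes [measurable]: "f \<in> borel_measurable M" and "\<And>x. x \<in> space M \<Longrightarrow> 0 \<le> f x" "\<And>x. x \<in> space M \<Longrightarrow> f x \<le> 1" "N \<ge> 1"
  shows "\<bar>expectation f - (\<Sum>i=1..N. prob {x\<in>space M. real i / real N < f x}) / real N\<bar> \<le> 1 / real N"
proof -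
  have int: "integrable M f"
    by (rule integrable_const_bound[where B=1]) (use assms in auto)
  have int2: "integrable M (\<lambda>x. staircase N (f x))"
    by (rule integrable_const_bound[where B=1]) (use staircase_bounds in auto)
  have "expectation (\<lambda>x. staircase N (f x)) = (\<Sum>i=1..N. expectation (\<lambda>x. of_bool (real i / real N < f x))) / real N"
    unfolding staircase_def
    by (subst Bochner_Integration.integral_divide_zero, subst Bochner_Integration.integral_sum)
       (auto intro!: integrable_const_bound[where B=1])
  also have "\<dots> = (\<Sum>i=1..N. prob {x\<in>space M. real i / real N < f x}) / real N"
  proof (intro arg_cong2[where f="(/)"] sum.cong refl)
    fix i
    have "expectation (\<lambda>x. of_bool (real i / real N < f x)) = expectation (indicator {x\<in>space M. real i / real N < f x})"
      by (intro Bochner_Integration.integral_cong) (auto simp: indicator_def)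
    also have "\<dots> = prob ({x\<in>space M. real i / real N < f x} \<inter> space M)"
      by simp
    finally show "expectation (\<lambda>x. of_bool (real i / real N < f x)) = prob {x\<in>space M. real i / real N < f x}"
      by (simp add: Int_absorb2)
  qed
  finally have *: "(\<Sum>i=1..N. prob {x\<in>space M. real i / real N < f x}) / real N = expectation (\<lambda>x. staircase N (f x))" ..
  have "expectation (\<lambda>x. f x - staircase N (f x)) \<le> expectation (\<lambda>x. 1 / real N)"
    by (intro integral_mono) (use int int2 assms staircase_approx in \<open>auto simp: abs_le_iff\<close>)
  moreover have "expectation (\<lambda>x. staircase N (f x) - f x) \<le> expectation (\<lambda>x. 1 / real N)"
    by (intro integral_mono) (use int int2 assms staircase_approx in \<open>auto simp: abs_le_iff\<close>)
  ultimately show ?thesis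
    using int int2 unfolding * by (simp add: abs_le_iff prob_space)
qed

text \<open>Inclusion and exclusion, one coordinate at a time: imposing the lower bound in
  coordinate \<open>j\<close> removes the same set with its upper corner lowered to \<open>l\<close>
  in that coordinate. The induction runs over the coordinates that carry a lower bound, for all
  upper corners at once.\<close>

lemma half_open_box_convergence:
  fixes \<mu> :: "nat \<Rightarrow> 'a::ordered_euclidean_space measure"
  assumes \<mu>: "\<And>n. prob_space (\<mu> n)" "\<And>n. sets (\<mu> n) = sets borel"
    and \<nu>: "prob_space \<nu>" "sets \<nu> = sets borel"
    and conv: "\<And>z. (\<lambda>n. measure (\<mu> n) {..z}) \<longlonglongrightarrow> measure \<nu> {..z}"
  shows "(\<lambda>n. measure (\<mu> n) {z. \<forall>i\<in>Basis. l \<bullet> i < z \<bullet> i \<and> z \<bullet> i \<le> u \<bullet> i}) \<longlonglongrightarrow>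
    measure \<nu> {z. \<forall>i\<in>Basis. l \<bullet> i < z \<bullet> i \<and> z \<bullet> i \<le> u \<bullet> i}"
proof -
  define S where "S J u = {z::'a. (\<forall>i\<in>Basis. z \<bullet> i \<le> u \<bullet> i) \<and> (\<forall>i\<in>J. l \<bullet> i < z \<bullet> i)}" for J u
  have meas: "S J u \<in> sets borel" if "J \<subseteq> Basis" for J u
    using finite_subset[OF that finite_Basis] unfolding S_def by measurable
  have "(\<lambda>n. measure (\<mu> n) (S J u)) \<longlonglongrightarrow> measure \<nu> (S J u)" if "J \<subseteq> Basis" for J u
    using finite_subset[OF that finite_Basis] that
  proof (induction J arbitrary: u rule: finite_induct)
    case empty
    have "S {} u = {..u}" by (auto simp: S_def eucl_le[where 'a='a])
    then show ?case using conv by simp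
  next
    case (insert j J)
    \<comment> \<open>The minimum keeps the removed set inside \<open>S J u\<close> when
      \<open>l\<close> exceeds \<open>u\<close> in coordinate \<open>j\<close>; both sets then
      coincide and the difference is empty.\<close>
    define u' where "u' = u + (min (u \<bullet> j) (l \<bullet> j) - u \<bullet> j) *\<^sub>R j"
    have u': "u' \<bullet> i = (if i = j then min (u \<bullet> j) (l \<bullet> j) else u \<bullet> i)" if "i \<in> Basis" for i
      using that insert.prems by (auto simp: u'_def inner_simps inner_Basis)
    have eq: "S (insert j J) u = S J u - S J u'" and sub: "S J u' \<subseteq> S J u"
      using insert.prems by (auto simp: S_def u' split: if_splits)
    have m: "measure N (S (insert j J) u) = measure N (S J u) - measure N (S J u')"
      if "prob_space N" "sets N = sets borel" for N
    proof -
      interpret prob_space N by fact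
      show ?thesis unfolding eq
        by (rule finite_measure_Diff) (use meas insert.prems sub that in auto)
    qed
    have J: "J \<subseteq> Basis" using insert.prems by auto
    show ?case unfolding m[OF \<mu>] m[OF \<nu>]
      by (intro tendsto_diff insert.IH J)
  qed
  from this[of Basis u] show ?thesis
    by (simp add: S_def conj_commute ball_conj_distrib)
qed

text \<open>Half-open boxes are closed under intersection, so inclusion and exclusion gives
  convergence on their finite unions. An open set is a countable union of them, and continuity from
  below of \<nu> leaves the lower bound.\<close>

lemma open_liminf:
  fixes \<mu> :: "nat \<Rightarrow> 'a::ordered_euclidean_space measure"
  assumes \<mu>: "\<And>n. prob_space (\<mu> n)" "\<And>n. sets (\<mu> n) = sets borel"
    and \<nu>: "prob_space \<nu>" "sets \<nu> = sets borel"
    and conv: "\<And>z. (\<lambda>n. measure (\<mu> n) {..z}) \<longlonglongrightarrow> measure \<nu> {..z}"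
    and U: "open U" and e: "e > 0"
  shows "\<forall>\<^sub>F n in sequentially. measure \<nu> U - e < measure (\<mu> n) U"
proof -
  interpret \<nu>: prob_space \<nu> by (rule \<nu>)
  interpret \<mu>: prob_space "\<mu> n" for n by (rule \<mu>)
  define H where "H p = {z::'a. \<forall>i\<in>Basis. fst p \<bullet> i < z \<bullet> i \<and> z \<bullet> i \<le> snd p \<bullet> i}" for p
  have Hm [measurable]: "H p \<in> sets borel" for p
    unfolding H_def by measurable
  have Hint: "\<exists>r. H p \<inter> H q = H r" for p q
  proof
    show "H p \<inter> H q = H ((\<Sum>i\<in>Basis. max (fst p \<bullet> i) (fst q \<bullet> i) *\<^sub>R i), (\<Sum>i\<in>Basis. min (snd p \<bullet> i) (snd q \<bullet> i) *\<^sub>R i))"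
      by (auto simp: H_def)
  qed
  have fin: "(\<lambda>n. measure (\<mu> n) (\<Union>p\<in>I. H (g p))) \<longlonglongrightarrow> measure \<nu> (\<Union>p\<in>I. H (g p))" if "finite I"
    for I :: "nat set" and g
    using that
  proof (induction I arbitrary: g rule: finite_induct)
    case (insert x I)
    have "\<forall>i. \<exists>r. H (g x) \<inter> H (g i) = H r"
      using Hint by blast
    then obtain r where r: "H (g x) \<inter> H (g i) = H (r i)" for i
      by metis
    have m: "measure N (\<Union>p\<in>insert x I. H (g p)) =
       measure N (H (g x)) + measure N (\<Union>p\<in>I. H (g p)) - measure N (\<Union>p\<in>I. H (r p))"
      if "prob_space N" and [simp]: "sets N = sets borel" for N
    proof -
      interpret prob_space N by fact
      have "(\<Union>p\<in>I. H (r p)) = H (g x) \<inter> (\<Union>p\<in>I. H (g p))"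
        by (auto simp: r[symmetric])
      then show ?thesis
        by (simp add: fmeasurable_eq_sets insert.hyps measure_Un3 sets.finite_UN)
    qed
    show ?case unfolding m[OF \<mu>] m[OF \<nu>]
      by (intro tendsto_diff tendsto_add insert.IH)
         (use half_open_box_convergence[OF \<mu> \<nu> conv] in \<open>simp add: H_def\<close>)
  qed simp
  define F where "F = {box l u |l u. cbox l u \<subseteq> U}"
  have "\<Union>F = U"
  proof
    show "\<Union>F \<subseteq> U" using box_subset_cbox unfolding F_def by fast
    show "U \<subseteq> \<Union>F"
    proof
      fix x assume "x \<in> U"
      then obtain e where e: "e > 0" "cball x e \<subseteq> U"
        using U open_contains_cball by blast
      define d where "d = e / (2 * real DIM('a))"
      have d: "d > 0" using e by (simp add: d_def)
      have "x \<in> box (x - d *\<^sub>R One) (x + d *\<^sub>R One)"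
        using d by (auto simp: mem_box inner_simps)
      moreover have "cbox (x - d *\<^sub>R One) (x + d *\<^sub>R One) \<subseteq> cball x e"
      proof
        fix y assume "y \<in> cbox (x - d *\<^sub>R One) (x + d *\<^sub>R One)"
        then have "\<bar>(x - y) \<bullet> i\<bar> \<le> d" if "i \<in> Basis" for i
          using that by (auto simp: mem_box inner_simps abs_le_iff)
        then have "(\<Sum>i\<in>Basis. \<bar>(x - y) \<bullet> i\<bar>) \<le> (\<Sum>i\<in>(Basis::'a set). d)"
          by (intro sum_mono)
        then have "norm (x - y) \<le> real DIM('a) * d"
          using norm_le_l1[of "x - y"] by simp
        also have "\<dots> \<le> e" using e by (simp add: d_def)
        finally show "y \<in> cball x e" by (simp add: dist_norm)
      qed
      ultimately show "x \<in> \<Union>F" using e unfolding F_def by blast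
    qed
  qed
  moreover have "open S" if "S \<in> F" for S using that by (auto simp: F_def)
  ultimately obtain F' where F': "F' \<subseteq> F" "countable F'" "\<Union>F' = U"
    using Lindelof[of F] by metis
  have "\<forall>S\<in>F'. \<exists>p. S \<subseteq> H p \<and> H p \<subseteq> U"
  proof
    fix S assume "S \<in> F'"
    then obtain l u where lu: "S = box l u" "cbox l u \<subseteq> U" using F'(1) by (auto simp: F_def)
    have "S \<subseteq> H (l, u) \<and> H (l, u) \<subseteq> cbox l u"
      by (auto simp: lu(1) H_def mem_box less_imp_le)
    then show "\<exists>p. S \<subseteq> H p \<and> H p \<subseteq> U" using lu by blast
  qed
  then obtain p where p: "\<And>S. S \<in> F' \<Longrightarrow> S \<subseteq> H (p S)" "\<And>S. S \<in> F' \<Longrightarrow> H (p S) \<subseteq> U"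
    by metis
  have UH: "U = (\<Union>S\<in>F'. H (p S))"
    using p F'(3) by blast
  show ?thesis
  proof (cases "F' = {}")
    case True
    then show ?thesis using UH e by simp
  next
    case False
    define A where "A k = (\<Union>i\<le>k. H (p (from_nat_into F' i)))" for k :: nat
    have rng: "range (from_nat_into F') = F'"
      using False F'(2) by (simp add: range_from_nat_into)
    have UA: "(\<Union>k. A k) = U"
    proof -
      have "(\<Union>k. A k) = (\<Union>i. H (p (from_nat_into F' i)))" by (auto simp: A_def)
      also have "\<dots> = (\<Union>S\<in>range (from_nat_into F'). H (p S))" by simp
      finally show ?thesis using UH rng by simp
    qed
    have "(\<lambda>k. measure \<nu> (A k)) \<longlonglongrightarrow> measure \<nu> (\<Union>k. A k)"
    proof (rule \<nu>.finite_Lim_measure_incseq[where A=A])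
      have "A k \<in> sets borel" for k
        unfolding A_def by (intro sets.finite_UN) (auto intro: Hm)
      then show "range A \<subseteq> sets \<nu>" unfolding \<nu>(2) by blast
      show "incseq A" unfolding A_def by (intro monoI UN_mono) auto
    qed
    then have "\<forall>\<^sub>F k in sequentially. measure \<nu> U - e/2 < measure \<nu> (A k)"
      using e unfolding UA by (intro order_tendstoD(1)) auto
    then obtain k where k: "measure \<nu> U - e/2 < measure \<nu> (A k)"
      by (auto simp: eventually_sequentially)
    have "(\<lambda>n. measure (\<mu> n) (A k)) \<longlonglongrightarrow> measure \<nu> (A k)"
      unfolding A_def by (rule fin) simp
    then have "\<forall>\<^sub>F n in sequentially. measure \<nu> (A k) - e/2 < measure (\<mu> n) (A k)"
      using e by (intro order_tendstoD(1)) auto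
    then show ?thesis
    proof eventually_elim
      case (elim n)
      have "measure (\<mu> n) (A k) \<le> measure (\<mu> n) U"
      proof (rule \<mu>.finite_measure_mono)
        show "A k \<subseteq> U" using UA by blast
        show "U \<in> sets (\<mu> n)" unfolding \<mu>(2) using U by (rule borel_open)
      qed
      with elim k show ?case by linarith
    qed
  qed
qed

text \<open>A point of a strict superlevel set at which \<open>f\<close> is continuous is interior
  to it. So the set and its interior have the same \<nu>-measure, \<open>open_liminf\<close> applies
  at finitely many levels, and the staircase leads back to integrals.\<close>

lemma ae_continuous_liminf:
  fixes \<mu> :: "nat \<Rightarrow> 'a::ordered_euclidean_space measure" and f :: "'a \<Rightarrow> real"
  assumes \<mu>: "\<And>n. prob_space (\<mu> n)" "\<And>n. sets (\<mu> n) = sets borel"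
    and \<nu>: "prob_space \<nu>" "sets \<nu> = sets borel"
    and conv: "\<And>z. (\<lambda>n. measure (\<mu> n) {..z}) \<longlonglongrightarrow> measure \<nu> {..z}"
    and f [measurable]: "f \<in> borel_measurable borel" and f01: "\<And>x. 0 \<le> f x" "\<And>x. f x \<le> 1"
    and cont: "AE x in \<nu>. isCont f x" and e: "e > 0"
  shows "\<forall>\<^sub>F n in sequentially. (\<integral>x. f x \<partial>\<nu>) - e < (\<integral>x. f x \<partial>\<mu> n)"
proof -
  interpret \<nu>: prob_space \<nu> by (rule \<nu>)
  interpret \<mu>: prob_space "\<mu> n" for n by (rule \<mu>)
  have sp: "space (\<mu> n) = UNIV" "space \<nu> = UNIV" for n
    using \<mu>(2)[THEN sets_eq_imp_space_eq] \<nu>(2)[THEN sets_eq_imp_space_eq] by auto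
  have fm: "f \<in> borel_measurable (\<mu> n)" "f \<in> borel_measurable \<nu>" for n
    using f measurable_cong_sets[OF \<mu>(2) refl] measurable_cong_sets[OF \<nu>(2) refl] by blast+
  obtain N :: nat where N: "N \<ge> 1" "1 / real N < e / 3"
    using ex_inverse_of_nat_less[of "e / 3"] e by (auto simp: inverse_eq_divide Suc_le_eq)
  have ev: "\<forall>\<^sub>F n in sequentially. measure \<nu> {x. t < f x} - e/3 < measure (\<mu> n) {x. t < f x}" for t
  proof -
    have "measure \<nu> {x. t < f x} \<le> measure \<nu> (interior {x. t < f x})"
    proof (rule \<nu>.finite_measure_mono_AE)
      show "AE x in \<nu>. x \<in> {x. t < f x} \<longrightarrow> x \<in> interior {x. t < f x}"
        using cont
      proof eventually_elim
        case (elim x)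
        show ?case
        proof
          assume "x \<in> {x. t < f x}"
          then have "eventually (\<lambda>y. t < f y) (nhds x)"
            using elim by (intro order_tendstoD(1)[of f "f x"]) (auto simp: isCont_def tendsto_at_iff_tendsto_nhds)
          then show "x \<in> interior {x. t < f x}"
            unfolding eventually_nhds interior_def by blast
        qed
      qed
      show "interior {x. t < f x} \<in> sets \<nu>" using \<nu>(2) by auto
    qed
    moreover have "\<forall>\<^sub>F n in sequentially. measure \<nu> (interior {x. t < f x}) - e/3 < measure (\<mu> n) (interior {x. t < f x})"
      by (rule open_liminf[OF \<mu> \<nu> conv]) (use e in auto)
    moreover have "measure (\<mu> n) (interior {x. t < f x}) \<le> measure (\<mu> n) {x. t < f x}" for n
      by (rule \<mu>.finite_measure_mono) (use \<mu>(2) interior_subset in auto)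
    ultimately show ?thesis
      by (auto elim!: eventually_mono) (smt (verit))
  qed
  have "\<forall>\<^sub>F n in sequentially. \<forall>i\<in>{1..N}. measure \<nu> {x. real i / real N < f x} - e/3 < measure (\<mu> n) {x. real i / real N < f x}"
    using ev by (intro eventually_ball_finite) auto
  then show ?thesis
  proof eventually_elim
    case (elim n)
    have "(\<Sum>i=1..N. measure \<nu> {x. real i / real N < f x} - e/3) \<le> (\<Sum>i=1..N. measure (\<mu> n) {x. real i / real N < f x})"
      using elim by (intro sum_mono less_imp_le) auto
    then have "(\<Sum>i=1..N. measure \<nu> {x. real i / real N < f x}) / N - e/3 \<le> (\<Sum>i=1..N. measure (\<mu> n) {x. real i / real N < f x}) / N"
    proof -
      assume le: "(\<Sum>i=1..N. measure \<nu> {x. real i / real N < f x} - e/3) \<le> (\<Sum>i=1..N. measure (\<mu> n) {x. real i / real N < f x})"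
      have "(\<Sum>i=1..N. measure \<nu> {x. real i / real N < f x}) / N - e/3 = (\<Sum>i=1..N. measure \<nu> {x. real i / real N < f x} - e/3) / N"
        using N by (simp add: sum_subtractf diff_divide_distrib)
      with divide_right_mono[OF le, of "real N"] show ?thesis by simp
    qed
    then show ?case
      using \<nu>.staircase_expectation[OF fm(2) f01 N(1)] \<mu>.staircase_expectation[OF fm(1)[of n] f01 N(1)] N(2)
      by (simp add: sp abs_le_iff)
  qed
qed

text \<open>The lower bound is applied to \<open>f\<close> and to \<open>- f\<close>, each mapped
  affinely into [0, 1]; the sign is the parameter \<open>s\<close> of \<open>g\<close>.\<close>

lemma cdf_convergence_ae_continuous:
  fixes \<mu> :: "nat \<Rightarrow> 'a::ordered_euclidean_space measure" and f :: "'a \<Rightarrow> real"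
  assumes \<mu>: "\<And>n. prob_space (\<mu> n)" "\<And>n. sets (\<mu> n) = sets borel"
    and \<nu>: "prob_space \<nu>" "sets \<nu> = sets borel"
    and conv: "\<And>z. (\<lambda>n. measure (\<mu> n) {..z}) \<longlonglongrightarrow> measure \<nu> {..z}"
    and f [measurable]: "f \<in> borel_measurable borel" and fK: "\<And>x. \<bar>f x\<bar> \<le> K"
    and cont: "AE x in \<nu>. isCont f x"
  shows "(\<lambda>n. \<integral>x. f x \<partial>\<mu> n) \<longlonglongrightarrow> (\<integral>x. f x \<partial>\<nu>)"
proof -
  interpret \<nu>: prob_space \<nu> by (rule \<nu>)
  interpret \<mu>: prob_space "\<mu> n" for n by (rule \<mu>)
  have fm: "f \<in> borel_measurable (\<mu> n)" "f \<in> borel_measurable \<nu>" for n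
    using f measurable_cong_sets[OF \<mu>(2) refl] measurable_cong_sets[OF \<nu>(2) refl] by blast+
  have int: "integrable (\<mu> n) f" "integrable \<nu> f" for n
    using fm fK by (auto intro!: \<mu>.integrable_const_bound[where B=K] \<nu>.integrable_const_bound[where B=K])
  define K' where "K' = K + 1"
  have K': "K' > 0" "\<bar>f x\<bar> \<le> K'" for x
    using fK[of undefined] fK[of x] by (auto simp: K'_def)
  define g where "g s x = (s * f x + K') / (2 * K')" for s :: real and x
  have ev: "\<forall>\<^sub>F n in sequentially. (\<integral>x. g s x \<partial>\<nu>) - d < (\<integral>x. g s x \<partial>\<mu> n)" if "\<bar>s\<bar> = 1" "d > 0" for s d
  proof (rule ae_continuous_liminf[OF \<mu> \<nu> conv _ _ _ _ \<open>d > 0\<close>])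
    show "g s \<in> borel_measurable borel" unfolding g_def by measurable
    have "\<bar>s * f x\<bar> \<le> K'" for x using K'(2)[of x] that by (simp add: abs_mult)
    then have *: "- K' \<le> s * f x" "s * f x \<le> K'" for x
      using abs_le_iff by (smt (verit))+
    show "0 \<le> g s x" "g s x \<le> 1" for x
      using K'(1) *[of x] by (auto simp: g_def divide_le_eq_1)
    show "AE x in \<nu>. isCont (g s) x"
      using cont
    proof eventually_elim
      case (elim x)
      then show ?case unfolding g_def[abs_def] using K' by (intro continuous_intros) auto
    qed
  qed
  have gi: "(\<integral>x. g s x \<partial>N) = (s * (\<integral>x. f x \<partial>N) + K') / (2 * K')" if "integrable N f" "prob_space N" for s N
  proof -
    interpret prob_space N by fact
    show ?thesis using that unfolding g_def by (simp add: prob_space)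
  qed
  show ?thesis
  proof (rule tendstoI)
    fix d :: real assume d: "d > 0"
    have d': "d / (2 * K') > 0" using d K' by simp
    from ev[OF _ d', of 1, simplified] ev[OF _ d', of "-1", simplified]
    show "\<forall>\<^sub>F n in sequentially. dist (\<integral>x. f x \<partial>\<mu> n) (\<integral>x. f x \<partial>\<nu>) < d"
    proof eventually_elim
      case (elim n)
      have *: "x / (2 * K') - d / (2 * K') < y / (2 * K') \<longleftrightarrow> x - d < y" for x y
        using K' by (simp add: diff_divide_distrib[symmetric] divide_less_cancel)
      show ?case
        using elim unfolding gi[OF int(1) \<mu>(1)] gi[OF int(2) \<nu>(1)] *
        by (simp add: dist_real_def abs_less_iff)
    qed
  qed
qed

section \<open>Covariances, mixing and truncation\<close>

text \<open>The uncentred form, convenient for bilinear expansions; \<open>covariance_eq_cv\<close>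
  identifies it with \<open>covariance\<close> when all integrals exist.\<close>

definition cv :: "'a measure \<Rightarrow> ('a \<Rightarrow> real) \<Rightarrow> ('a \<Rightarrow> real) \<Rightarrow> real" where
  "cv M f g = (\<integral>x. f x * g x \<partial>M) - (\<integral>x. f x \<partial>M) * (\<integral>x. g x \<partial>M)"

section \<open>Covariance inequalities under strong mixing\<close>

definition alpha_bound :: "'a measure \<Rightarrow> 'a measure \<Rightarrow> 'a measure \<Rightarrow> real \<Rightarrow> bool" where
  "alpha_bound M N1 N2 \<beta> \<longleftrightarrow> space N1 = space M \<and> space N2 = space M \<and> sets N1 \<subseteq> sets M \<and> sets N2 \<subseteq> sets M \<and>
     (\<forall>A\<in>sets N1. \<forall>B\<in>sets N2. \<bar>measure M (A \<inter> B) - measure M A * measure M B\<bar> \<le> \<beta>)"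

lemma alpha_bound_measurable:
  assumes "alpha_bound M N1 N2 \<beta>"
  shows "f \<in> borel_measurable N1 \<Longrightarrow> f \<in> borel_measurable M"
    and "g \<in> borel_measurable N2 \<Longrightarrow> g \<in> borel_measurable M"
  using assms unfolding alpha_bound_def measurable_def by auto

text \<open>The covariance of two staircases is an average of N^2 differences, each at most \<beta>.
  Replacing the functions by staircases costs 2/N in the integral of the product and 2/N in the
  product of the integrals, and \<open>N\<close> is arbitrary.\<close>

lemma alpha_bound_cv_unit:
  assumes "prob_space M" and ab: "alpha_bound M N1 N2 \<beta>"
    and f: "f \<in> borel_measurable N1" "\<And>x. 0 \<le> f x" "\<And>x. f x \<le> 1"
    and g: "g \<in> borel_measurable N2" "\<And>x. 0 \<le> g x" "\<And>x. g x \<le> 1"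
  shows "\<bar>cv M f g\<bar> \<le> \<beta>"
proof -
  interpret prob_space M by fact
  note [measurable] = alpha_bound_measurable(1)[OF ab f(1)] alpha_bound_measurable(2)[OF ab g(1)]
  have main: "\<bar>cv M f g\<bar> \<le> \<beta> + 4 / real N" if N: "N \<ge> 1" for N
  proof -
    define F where "F i = {x\<in>space M. real i / real N < f x}" for i
    define G where "G i = {x\<in>space M. real i / real N < g x}" for i
    have FG: "F i \<in> sets N1" "G i \<in> sets N2" for i
    proof -
      have "{x\<in>space N1. real i / real N < f x} \<in> sets N1" "{x\<in>space N2. real i / real N < g x} \<in> sets N2"
        using f(1) g(1) by measurable
      then show "F i \<in> sets N1" "G i \<in> sets N2"
        using ab unfolding F_def G_def alpha_bound_def by auto
    qed
    then have FM [measurable]: "F i \<in> events" "G i \<in> events" for i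
      using ab by (auto simp: alpha_bound_def)
    have st: "staircase N (f x) = (\<Sum>i=1..N. indicator (F i) x) / real N"
      "staircase N (g x) = (\<Sum>i=1..N. indicator (G i) x) / real N" if "x \<in> space M" for x
      using that by (auto simp: staircase_def F_def G_def indicator_def intro!: sum.cong arg_cong2[where f="(/)"])
    define u v where "u x = (\<Sum>i=1..N. indicator (F i) x) / real N"
      and "v x = (\<Sum>i=1..N. indicator (G i) x) / real N" for x
    have uv01: "0 \<le> u x" "u x \<le> 1" "0 \<le> v x" "v x \<le> 1" "\<bar>f x - u x\<bar> \<le> 1 / N" "\<bar>g x - v x\<bar> \<le> 1 / N"
      if "x \<in> space M" for x
      using staircase_bounds[of N "f x"] staircase_bounds[of N "g x"] staircase_approx[OF f(2,3) N, of x]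
        staircase_approx[OF g(2,3) N, of x] st[OF that] by (auto simp: u_def v_def)
    have [measurable]: "u \<in> borel_measurable M" "v \<in> borel_measurable M"
      unfolding u_def[abs_def] v_def[abs_def] by measurable
    have int: "integrable M f" "integrable M g" "integrable M u" "integrable M v"
      "integrable M (\<lambda>x. f x * g x)" "integrable M (\<lambda>x. u x * v x)"
      using uv01 f g by (auto intro!: integrable_const_bound[where B=1] AE_I2 mult_le_one simp: abs_mult)
    have FS: "F i \<inter> space M = F i" "G i \<inter> space M = G i" "F i \<inter> G j \<inter> space M = F i \<inter> G j" for i j
      by (auto simp: F_def G_def)
    have Eu: "expectation u = (\<Sum>i=1..N. prob (F i)) / N"
      unfolding u_def by (subst Bochner_Integration.integral_divide_zero, subst Bochner_Integration.integral_sum)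
        (auto simp: FS intro!: integrable_real_indicator FM simp: emeasure_eq_measure)
    have Ev: "expectation v = (\<Sum>i=1..N. prob (G i)) / N"
      unfolding v_def by (subst Bochner_Integration.integral_divide_zero, subst Bochner_Integration.integral_sum)
        (auto simp: FS intro!: integrable_real_indicator FM simp: emeasure_eq_measure)
    have "u x * v x = (\<Sum>i=1..N. \<Sum>j=1..N. indicator (F i \<inter> G j) x) / (N * N)" for x
      unfolding u_def v_def by (simp add: sum_product indicator_inter_arith)
    moreover have II: "integrable M (indicat_real (F i \<inter> G j))" for i j
      by (intro integrable_real_indicator) (auto simp: emeasure_eq_measure)
    have "expectation (\<lambda>x. \<Sum>i=1..N. \<Sum>j=1..N. indicat_real (F i \<inter> G j) x) = (\<Sum>i=1..N. \<Sum>j=1..N. prob (F i \<inter> G j))"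
      by (subst Bochner_Integration.integral_sum, intro Bochner_Integration.integrable_sum II)
        (intro sum.cong refl, subst Bochner_Integration.integral_sum, intro II, simp add: FS)
    ultimately have "expectation (\<lambda>x. u x * v x) = (\<Sum>i=1..N. \<Sum>j=1..N. prob (F i \<inter> G j)) / (N * N)"
      by simp
    then have "cv M u v = (\<Sum>i=1..N. \<Sum>j=1..N. prob (F i \<inter> G j) - prob (F i) * prob (G j)) / (N * N)"
      unfolding cv_def Eu Ev by (simp add: sum_product sum_subtractf diff_divide_distrib)
    also have "\<bar>\<dots>\<bar> \<le> (\<Sum>i=1..N. \<Sum>j=1..N. \<beta>) / (N * N)"
      unfolding abs_divide abs_mult abs_of_nat using FG ab
      by (intro divide_right_mono order_trans[OF sum_abs] sum_mono) (auto simp: alpha_bound_def)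
    also have "\<dots> = \<beta>" using N by simp
    finally have 1: "\<bar>cv M u v\<bar> \<le> \<beta>" .
    have 2: "\<bar>expectation (\<lambda>x. f x * g x) - expectation (\<lambda>x. u x * v x)\<bar> \<le> 2 / N"
    proof -
      have "\<bar>f x * g x - u x * v x\<bar> \<le> 2 / N" if "x \<in> space M" for x
      proof -
        have "f x * g x - u x * v x = (f x - u x) * g x + u x * (g x - v x)" by algebra
        also have "\<bar>\<dots>\<bar> \<le> \<bar>f x - u x\<bar> * 1 + 1 * \<bar>g x - v x\<bar>"
          using uv01[OF that] g(2,3)[of x]
          by (intro order_trans[OF abs_triangle_ineq] add_mono) (auto simp: abs_mult intro: mult_left_le mult_left_le_one_le)
        finally show ?thesis using uv01[OF that] by (simp add: field_simps)
      qed
      then have "expectation (\<lambda>x. \<bar>f x * g x - u x * v x\<bar>) \<le> expectation (\<lambda>x. 2 / N)"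
        using int by (intro integral_mono) auto
      then show ?thesis
        using integral_abs_bound[of M "\<lambda>x. f x * g x - u x * v x"] int by (simp add: prob_space)
    qed
    have d: "\<bar>expectation f - expectation u\<bar> \<le> 1 / N" "\<bar>expectation g - expectation v\<bar> \<le> 1 / N"
    proof -
      have "expectation (\<lambda>x. \<bar>f x - u x\<bar>) \<le> expectation (\<lambda>x. 1 / N)"
        by (intro integral_mono) (use int uv01 in auto)
      moreover have "expectation (\<lambda>x. \<bar>g x - v x\<bar>) \<le> expectation (\<lambda>x. 1 / N)"
        by (intro integral_mono) (use int uv01 in auto)
      ultimately show "\<bar>expectation f - expectation u\<bar> \<le> 1 / N" "\<bar>expectation g - expectation v\<bar> \<le> 1 / N"
        using integral_abs_bound[of M "\<lambda>x. f x - u x"] integral_abs_bound[of M "\<lambda>x. g x - v x"] int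
        by (auto simp: prob_space)
    qed
    have e01: "\<bar>expectation g\<bar> \<le> 1" "\<bar>expectation u\<bar> \<le> 1"
    proof -
      have "expectation g \<le> expectation (\<lambda>x. 1)"
        by (intro integral_mono) (use int g in auto)
      moreover have "expectation u \<le> expectation (\<lambda>x. 1)"
        by (intro integral_mono) (use int uv01 in auto)
      moreover have "0 \<le> expectation g"
        using g by (intro Bochner_Integration.integral_nonneg) auto
      moreover have "0 \<le> expectation u"
        unfolding u_def by (intro Bochner_Integration.integral_nonneg) (auto intro!: divide_nonneg_nonneg sum_nonneg)
      ultimately show "\<bar>expectation g\<bar> \<le> 1" "\<bar>expectation u\<bar> \<le> 1" by (auto simp: prob_space)
    qed
    have 3: "\<bar>expectation f * expectation g - expectation u * expectation v\<bar> \<le> 2 / N"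
    proof -
      have "expectation f * expectation g - expectation u * expectation v =
        (expectation f - expectation u) * expectation g + expectation u * (expectation g - expectation v)" by algebra
      also have "\<bar>\<dots>\<bar> \<le> (1 / N) * 1 + 1 * (1 / N)"
        using mult_mono[OF d(1) e01(1)] mult_mono[OF e01(2) d(2)]
        by (intro order_trans[OF abs_triangle_ineq] add_mono) (simp_all add: abs_mult)
      finally show ?thesis by simp
    qed
    show ?thesis using 1 2 3 unfolding cv_def by linarith
  qed
  show ?thesis
  proof (rule field_le_epsilon)
    fix e :: real assume e: "e > 0"
    obtain N :: nat where "N > 0" "inverse (real N) < e / 4"
      using ex_inverse_of_nat_less[of "e / 4"] e by auto
    then show "\<bar>cv M f g\<bar> \<le> \<beta> + e" using main[of N] by (simp add: inverse_eq_divide)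
  qed
qed

text \<open>Mapping [-K, K] affinely onto [0, 1] divides the covariance by 4 K^2.\<close>

lemma alpha_bound_cv:
  assumes M: "prob_space M" and ab: "alpha_bound M N1 N2 \<beta>"
    and f: "f \<in> borel_measurable N1" "\<And>x. \<bar>f x\<bar> \<le> K"
    and g: "g \<in> borel_measurable N2" "\<And>x. \<bar>g x\<bar> \<le> K" and K: "K > 0"
  shows "\<bar>cv M f g\<bar> \<le> 4 * K\<^sup>2 * \<beta>"
proof -
  interpret prob_space M by fact
  note [measurable] = alpha_bound_measurable(1)[OF ab f(1)] alpha_bound_measurable(2)[OF ab g(1)]
  define u v where "u x = (f x + K) / (2 * K)" and "v x = (g x + K) / (2 * K)" for x
  have b: "- K \<le> f x" "f x \<le> K" "- K \<le> g x" "g x \<le> K" for x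
    using f(2)[of x] g(2)[of x] by (auto simp: abs_le_iff)
  have "0 \<le> u x" "u x \<le> 1" "0 \<le> v x" "v x \<le> 1" for x
    using b[of x] K by (auto simp: u_def v_def divide_le_eq_1)
  moreover have "u \<in> borel_measurable N1" "v \<in> borel_measurable N2"
    using f(1) g(1) unfolding u_def[abs_def] v_def[abs_def] by measurable
  ultimately have uv: "\<bar>cv M u v\<bar> \<le> \<beta>"
    by (intro alpha_bound_cv_unit[OF M ab])
  have int: "integrable M f" "integrable M g" "integrable M (\<lambda>x. f x * g x)"
  proof -
    have "\<bar>f x * g x\<bar> \<le> K * K" for x
      using mult_mono[OF f(2)[of x] g(2)[of x]] K by (simp add: abs_mult)
    then show "integrable M f" "integrable M g" "integrable M (\<lambda>x. f x * g x)"
      using f(2) g(2) by (auto intro: integrable_const_bound[where B=K] integrable_const_bound[where B="K * K"])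
  qed
  have Eu: "expectation u = (expectation f + K) / (2 * K)" "expectation v = (expectation g + K) / (2 * K)"
    unfolding u_def v_def using int by (simp_all add: prob_space)
  have "u x * v x = (f x * g x + K * f x + K * g x + K * K) / (4 * K\<^sup>2)" for x
    using K by (simp add: u_def v_def field_simps power2_eq_square)
  then have "expectation (\<lambda>x. u x * v x) = (expectation (\<lambda>x. f x * g x) + K * expectation f + K * expectation g + K * K) / (4 * K\<^sup>2)"
    using int by (simp add: prob_space)
  then have "cv M u v = cv M f g / (4 * K\<^sup>2)"
    unfolding cv_def Eu using K by (simp add: field_simps power2_eq_square)
  with uv show ?thesis using K by (simp add: abs_divide field_simps)
qed

text \<open>By the addition formulas the real and the imaginary part are each a sum or difference of
  two covariances of sines and cosines, every one at most 4 \<beta>; 8 for each part gives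
  16.\<close>

lemma alpha_bound_iexp:
  assumes M: "prob_space M" and ab: "alpha_bound M N1 N2 \<beta>"
    and U: "U \<in> borel_measurable N1" and V: "V \<in> borel_measurable N2"
  shows "cmod ((CLINT x|M. iexp (U x + V x)) - (CLINT x|M. iexp (U x)) * (CLINT x|M. iexp (V x))) \<le> 16 * \<beta>"
proof -
  interpret prob_space M by fact
  note [measurable] = alpha_bound_measurable(1)[OF ab U] alpha_bound_measurable(2)[OF ab V]
  have c: "\<bar>cv M (\<lambda>x. f (U x)) (\<lambda>x. g (V x))\<bar> \<le> 4 * \<beta>"
    if "f \<in> {cos, sin}" "g \<in> {cos, sin}" for f g :: "real \<Rightarrow> real"
  proof -
    have [measurable]: "f \<in> borel_measurable borel" "g \<in> borel_measurable borel" using that by auto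
    have "\<bar>cv M (\<lambda>x. f (U x)) (\<lambda>x. g (V x))\<bar> \<le> 4 * 1\<^sup>2 * \<beta>"
      by (rule alpha_bound_cv[OF M ab]) (use U V that in auto)
    then show ?thesis by simp
  qed
  have int: "integrable M (\<lambda>x. f (W x))" if "f \<in> {cos, sin}" "W \<in> borel_measurable M" for f :: "real \<Rightarrow> real" and W
    using that by (auto intro!: integrable_const_bound[where B=1])
  have int2: "integrable M (\<lambda>x. f (U x) * g (V x))" if "f \<in> {cos, sin}" "g \<in> {cos, sin}" for f g :: "real \<Rightarrow> real"
    using that by (auto intro!: integrable_const_bound[where B=1] AE_I2 mult_le_one simp: abs_mult)
  have iexp: "(CLINT x|M. iexp (W x)) = Complex (expectation (\<lambda>x. cos (W x))) (expectation (\<lambda>x. sin (W x)))"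
    if [measurable]: "W \<in> borel_measurable M" for W
  proof -
    have i: "integrable M (\<lambda>x. iexp (W x))" by (intro integrable_const_bound[where B=1]) auto
    show ?thesis
      by (rule complex_eqI)
        (simp_all only: complex.sel integral_Re[OF i, symmetric] integral_Im[OF i, symmetric], simp_all add: Re_exp Im_exp)
  qed
  let ?z = "(CLINT x|M. iexp (U x + V x)) - (CLINT x|M. iexp (U x)) * (CLINT x|M. iexp (V x))"
  have "(CLINT x|M. iexp (U x + V x)) = Complex (expectation (\<lambda>x. cos (U x + V x))) (expectation (\<lambda>x. sin (U x + V x)))"
    using iexp[of "\<lambda>x. U x + V x"] by simp
  moreover have "expectation (\<lambda>x. cos (U x + V x)) = expectation (\<lambda>x. cos (U x) * cos (V x)) - expectation (\<lambda>x. sin (U x) * sin (V x))"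
    unfolding cos_add by (rule Bochner_Integration.integral_diff) (use int2 in auto)
  moreover have "expectation (\<lambda>x. sin (U x + V x)) = expectation (\<lambda>x. sin (U x) * cos (V x)) + expectation (\<lambda>x. cos (U x) * sin (V x))"
    unfolding sin_add by (rule Bochner_Integration.integral_add) (use int2 in auto)
  ultimately have "Re ?z = cv M (\<lambda>x. cos (U x)) (\<lambda>x. cos (V x)) - cv M (\<lambda>x. sin (U x)) (\<lambda>x. sin (V x))"
    "Im ?z = cv M (\<lambda>x. sin (U x)) (\<lambda>x. cos (V x)) + cv M (\<lambda>x. cos (U x)) (\<lambda>x. sin (V x))"
    using iexp[of U] iexp[of V] by (simp_all add: cv_def algebra_simps)
  then have "\<bar>Re ?z\<bar> \<le> 8 * \<beta>" "\<bar>Im ?z\<bar> \<le> 8 * \<beta>"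
    using c[of cos cos] c[of sin sin] c[of sin cos] c[of cos sin] by auto
  then show ?thesis using cmod_le[of ?z] by linarith
qed

section \<open>Truncation and moments of order 2 + \<nu>\<close>

definition trunc :: "real \<Rightarrow> real \<Rightarrow> real" where
  "trunc K y = max (- K) (min K y)"

lemma trunc_borel [measurable]: "trunc K \<in> borel_measurable borel"
  unfolding trunc_def by measurable

lemma continuous_trunc: "continuous_on UNIV (trunc K)"
  unfolding trunc_def by (intro continuous_intros)

lemma trunc_bound: "K \<ge> 0 \<Longrightarrow> \<bar>trunc K y\<bar> \<le> K"
  unfolding trunc_def by auto

lemma trunc_le: "K \<ge> 0 \<Longrightarrow> \<bar>trunc K y\<bar> \<le> \<bar>y\<bar>"
  unfolding trunc_def by auto

text \<open>The left side vanishes unless |y| > K. Then w = max(|y|, |z|) exceeds K, the product is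
  at most w^2, and the factor (w/K)^\<nu> >= 1 produces the higher moment. With z = 1 the same bound
  serves for means.\<close>

lemma trunc_error_product:
  assumes K: "K \<ge> 1" and \<nu>: "\<nu> > 0"
  shows "\<bar>y - trunc K y\<bar> * \<bar>z\<bar> \<le> K powr (- \<nu>) * (\<bar>y\<bar> powr (2 + \<nu>) + \<bar>z\<bar> powr (2 + \<nu>))"
proof (cases "\<bar>y\<bar> \<le> K")
  case True
  then have "y = trunc K y" by (auto simp: trunc_def)
  then show ?thesis by simp
next
  case False
  define w where "w = max \<bar>y\<bar> \<bar>z\<bar>"
  have "\<bar>y - trunc K y\<bar> \<le> \<bar>y\<bar>" using K by (auto simp: trunc_def)
  then have "\<bar>y - trunc K y\<bar> * \<bar>z\<bar> \<le> w * w"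
    unfolding w_def by (intro mult_mono) auto
  also have "\<dots> = w powr 2" using False K by (simp add: w_def powr_numeral power2_eq_square)
  also have "\<dots> \<le> w powr 2 * (w / K) powr \<nu>"
  proof -
    have "1 \<le> w / K" using False K by (simp add: w_def)
    then have "1 \<le> (w / K) powr \<nu>" using \<nu> ge_one_powr_ge_zero[of "w / K" \<nu>] by simp
    then show ?thesis by (simp add: mult_le_cancel_left1)
  qed
  also have "\<dots> = K powr (- \<nu>) * w powr (2 + \<nu>)"
  proof -
    have "w \<ge> 0" by (simp add: w_def)
    then have "(w / K) powr \<nu> = w powr \<nu> / K powr \<nu>" by (simp add: powr_divide)
    then show ?thesis by (simp add: powr_add powr_minus divide_inverse)
  qed
  also have "w powr (2 + \<nu>) \<le> \<bar>y\<bar> powr (2 + \<nu>) + \<bar>z\<bar> powr (2 + \<nu>)"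
    by (auto simp: w_def max_def)
  finally show ?thesis by (simp add: mult_left_mono)
qed

text \<open>The bound concerns the moment itself, not its p-th root. Integrability is part of it
  because a Bochner integral that fails to exist is 0 by convention.\<close>

definition mom :: "'a measure \<Rightarrow> real \<Rightarrow> real \<Rightarrow> ('a \<Rightarrow> real) \<Rightarrow> bool" where
  "mom M p C f \<longleftrightarrow> f \<in> borel_measurable M \<and> integrable M (\<lambda>x. \<bar>f x\<bar> powr p) \<and> (\<integral>x. \<bar>f x\<bar> powr p \<partial>M) \<le> C"

lemma mom_measurable [measurable_dest]: "mom M p C f \<Longrightarrow> f \<in> borel_measurable M"
  by (simp add: mom_def)

lemma powr_le_one_plus:
  assumes "0 \<le> q" "q \<le> p" shows "\<bar>y\<bar> powr q \<le> 1 + \<bar>y::real\<bar> powr p"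
proof (cases "\<bar>y\<bar> \<le> 1")
  case True
  then have "\<bar>y\<bar> powr q \<le> 1" using assms powr_le_one_le powr_mono2[of q "\<bar>y\<bar>" 1] by auto
  then show ?thesis by (simp add: add_increasing2)
next
  case False
  then have "\<bar>y\<bar> powr q \<le> \<bar>y\<bar> powr p" using assms by (intro powr_mono) auto
  then show ?thesis by linarith
qed

lemma (in prob_space) mom_lower:
  assumes "mom M p C f" "0 \<le> q" "q \<le> p"
  shows "mom M q (1 + C) f"
proof -
  have [measurable]: "f \<in> borel_measurable M" using assms by (simp add: mom_def)
  have i: "integrable M (\<lambda>x. 1 + \<bar>f x\<bar> powr p)" using assms(1) by (simp add: mom_def)
  have i2: "integrable M (\<lambda>x. \<bar>f x\<bar> powr q)"
    by (rule Bochner_Integration.integrable_bound[OF i]) (use powr_le_one_plus[OF assms(2,3)] in \<open>auto intro!: AE_I2 order_trans[OF _ abs_ge_self]\<close>)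
  have "expectation (\<lambda>x. \<bar>f x\<bar> powr q) \<le> expectation (\<lambda>x. 1 + \<bar>f x\<bar> powr p)"
    by (intro integral_mono i i2 powr_le_one_plus assms)
  with assms(1) i2 show ?thesis by (simp add: mom_def prob_space)
qed

lemma (in prob_space) mom_abs:
  assumes "mom M p C f" "p \<ge> 1"
  shows "integrable M f" "expectation (\<lambda>x. \<bar>f x\<bar>) \<le> 1 + C" "\<bar>expectation f\<bar> \<le> 1 + C"
proof -
  have "mom M 1 (1 + C) f" using mom_lower[OF assms(1), of 1] assms(2) by simp
  then have m: "f \<in> borel_measurable M" "integrable M (\<lambda>x. \<bar>f x\<bar>)" "expectation (\<lambda>x. \<bar>f x\<bar>) \<le> 1 + C"
    by (auto simp: mom_def)
  show "integrable M f" using m by (simp add: integrable_abs_iff)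
  show "expectation (\<lambda>x. \<bar>f x\<bar>) \<le> 1 + C" by fact
  then show "\<bar>expectation f\<bar> \<le> 1 + C" using integral_abs_bound[of M f] by linarith
qed

lemma (in prob_space) mom_prod:
  assumes "mom M p C f" "mom M p C g" "p \<ge> 2"
  shows "integrable M (\<lambda>x. f x * g x)" "expectation (\<lambda>x. \<bar>f x * g x\<bar>) \<le> 1 + C"
proof -
  have "mom M 2 (1 + C) f" "mom M 2 (1 + C) g" using mom_lower[of p C _ 2] assms by auto
  then have m [measurable]: "f \<in> borel_measurable M" "g \<in> borel_measurable M" and i: "integrable M (\<lambda>x. (f x)\<^sup>2)" "integrable M (\<lambda>x. (g x)\<^sup>2)"
    and e: "expectation (\<lambda>x. (f x)\<^sup>2) \<le> 1 + C" "expectation (\<lambda>x. (g x)\<^sup>2) \<le> 1 + C"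
    by (auto simp: mom_def powr_numeral)
  have b: "\<bar>y * z\<bar> \<le> (y\<^sup>2 + z\<^sup>2) / 2" for y z :: real
    using sum_squares_bound[of "\<bar>y\<bar>" "\<bar>z\<bar>"] by (simp add: abs_mult)
  have b': "\<bar>f x * g x\<bar> \<le> \<bar>(f x)\<^sup>2 + (g x)\<^sup>2\<bar> / 2" for x using b[of "f x" "g x"] by simp
  show i2: "integrable M (\<lambda>x. f x * g x)"
    by (rule Bochner_Integration.integrable_bound[of M "\<lambda>x. ((f x)\<^sup>2 + (g x)\<^sup>2) / 2"]) (use i b' in auto)
  have "expectation (\<lambda>x. \<bar>f x * g x\<bar>) \<le> expectation (\<lambda>x. ((f x)\<^sup>2 + (g x)\<^sup>2) / 2)"
    using i i2 b by (intro integral_mono) auto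
  then show "expectation (\<lambda>x. \<bar>f x * g x\<bar>) \<le> 1 + C" using i e by simp
qed

lemma (in prob_space) mom_trunc:
  assumes "mom M p C f" "p \<ge> 0" "K \<ge> 0"
  shows "mom M p C (\<lambda>x. trunc K (f x))"
proof -
  have [measurable]: "f \<in> borel_measurable M" using assms by (simp add: mom_def)
  have i: "integrable M (\<lambda>x. \<bar>f x\<bar> powr p)" using assms(1) by (simp add: mom_def)
  have le: "\<bar>trunc K (f x)\<bar> powr p \<le> \<bar>f x\<bar> powr p" for x
    using trunc_le[OF assms(3)] assms(2) by (intro powr_mono2) auto
  have i2: "integrable M (\<lambda>x. \<bar>trunc K (f x)\<bar> powr p)"
    by (rule Bochner_Integration.integrable_bound[OF i]) (use le in auto)
  show ?thesis using integral_mono[OF i2 i le] assms(1) i2 by (auto simp: mom_def)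
qed

text \<open>The error is uniform over all pairs with the given moment bound, which permits
  exchanging truncation and limits. Products contribute 4 C, means 2 (1 + C)^2; the stated constant
  dominates their sum.\<close>

lemma (in prob_space) cv_trunc:
  assumes f: "mom M (2 + \<nu>) C f" and g: "mom M (2 + \<nu>) C g" and \<nu>: "\<nu> > 0" and K: "K \<ge> 1"
  shows "\<bar>cv M f g - cv M (\<lambda>x. trunc K (f x)) (\<lambda>x. trunc K (g x))\<bar> \<le> (6 * C + 4) * (1 + C) * K powr (- \<nu>)"
proof -
  define tf tg where "tf x = trunc K (f x)" and "tg x = trunc K (g x)" for x
  have tf: "mom M (2 + \<nu>) C tf" "mom M (2 + \<nu>) C tg"
    using mom_trunc[OF f, of K] mom_trunc[OF g, of K] \<nu> K by (auto simp: tf_def[abs_def] tg_def[abs_def])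
  have [measurable]: "f \<in> borel_measurable M" "g \<in> borel_measurable M" using f g by (auto simp: mom_def)
  have p: "2 + \<nu> \<ge> 1" "2 + \<nu> \<ge> 2" using \<nu> by auto
  note i = mom_abs(1)[OF f p(1)] mom_abs(1)[OF g p(1)] mom_abs(1)[OF tf(1) p(1)] mom_abs(1)[OF tf(2) p(1)]
    mom_prod(1)[OF f g p(2)] mom_prod(1)[OF tf p(2)]
  have ip: "integrable M (\<lambda>x. \<bar>f x\<bar> powr (2 + \<nu>))" "integrable M (\<lambda>x. \<bar>g x\<bar> powr (2 + \<nu>))"
    and ep: "expectation (\<lambda>x. \<bar>f x\<bar> powr (2 + \<nu>)) \<le> C" "expectation (\<lambda>x. \<bar>g x\<bar> powr (2 + \<nu>)) \<le> C"
    using f g by (auto simp: mom_def)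
  have C: "C \<ge> 0" using ep(1) Bochner_Integration.integral_nonneg[of M "\<lambda>x. \<bar>f x\<bar> powr (2 + \<nu>)"] by (smt (verit) powr_ge_zero)
  define \<kappa> where "\<kappa> = K powr (- \<nu>)"
  have \<kappa>: "\<kappa> > 0" using K by (simp add: \<kappa>_def)
  have "\<bar>f x * g x - tf x * tg x\<bar> \<le> 2 * \<kappa> * (\<bar>f x\<bar> powr (2 + \<nu>) + \<bar>g x\<bar> powr (2 + \<nu>))" for x
  proof -
    have "f x * g x - tf x * tg x = (f x - tf x) * g x + (g x - tg x) * tf x" by algebra
    also have "\<bar>\<dots>\<bar> \<le> \<bar>f x - tf x\<bar> * \<bar>g x\<bar> + \<bar>g x - tg x\<bar> * \<bar>f x\<bar>"
      using trunc_le[of K "f x"] K by (intro order_trans[OF abs_triangle_ineq]) (auto simp: abs_mult tf_def intro!: mult_left_mono)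
    also have "\<dots> \<le> 2 * \<kappa> * (\<bar>f x\<bar> powr (2 + \<nu>) + \<bar>g x\<bar> powr (2 + \<nu>))"
      using trunc_error_product[OF K \<nu>, of "f x" "g x"] trunc_error_product[OF K \<nu>, of "g x" "f x"]
      by (simp add: tf_def tg_def \<kappa>_def algebra_simps)
    finally show ?thesis .
  qed
  then have "expectation (\<lambda>x. \<bar>f x * g x - tf x * tg x\<bar>) \<le> expectation (\<lambda>x. 2 * \<kappa> * (\<bar>f x\<bar> powr (2 + \<nu>) + \<bar>g x\<bar> powr (2 + \<nu>)))"
    using i ip by (intro integral_mono) auto
  also have "\<dots> = 2 * \<kappa> * (expectation (\<lambda>x. \<bar>f x\<bar> powr (2 + \<nu>)) + expectation (\<lambda>x. \<bar>g x\<bar> powr (2 + \<nu>)))"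
    using ip by simp
  also have "\<dots> \<le> 2 * \<kappa> * (C + C)"
    using ep \<kappa> by (intro mult_left_mono add_mono) auto
  finally have 1: "\<bar>expectation (\<lambda>x. f x * g x) - expectation (\<lambda>x. tf x * tg x)\<bar> \<le> 4 * C * \<kappa>"
    using integral_abs_bound[of M "\<lambda>x. f x * g x - tf x * tg x"] i by (simp add: mult_ac)
  have d: "\<bar>expectation u - expectation (\<lambda>x. trunc K (u x))\<bar> \<le> (1 + C) * \<kappa>" if u: "mom M (2 + \<nu>) C u" for u
  proof -
    have iu: "integrable M u" "integrable M (\<lambda>x. trunc K (u x))"
      using mom_abs(1)[OF u p(1)] mom_abs(1)[OF mom_trunc[OF u] p(1), of K] \<nu> K by auto
    have "\<bar>u x - trunc K (u x)\<bar> \<le> \<kappa> * (\<bar>u x\<bar> powr (2 + \<nu>) + 1)" for x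
      using trunc_error_product[OF K \<nu>, of "u x" 1] by (simp add: \<kappa>_def)
    then have "expectation (\<lambda>x. \<bar>u x - trunc K (u x)\<bar>) \<le> expectation (\<lambda>x. \<kappa> * (\<bar>u x\<bar> powr (2 + \<nu>) + 1))"
      using iu u by (intro integral_mono) (auto simp: mom_def)
    also have "\<dots> = \<kappa> * (expectation (\<lambda>x. \<bar>u x\<bar> powr (2 + \<nu>)) + 1)"
      using u by (simp add: mom_def prob_space)
    also have "\<dots> \<le> \<kappa> * (C + 1)"
      using u \<kappa> by (intro mult_left_mono) (auto simp: mom_def)
    finally show ?thesis
      using integral_abs_bound[of M "\<lambda>x. u x - trunc K (u x)"] iu by (simp add: mult.commute add.commute)
  qed
  have 2: "\<bar>expectation f * expectation g - expectation tf * expectation tg\<bar> \<le> 2 * ((1 + C) * \<kappa> * (1 + C))"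
  proof -
    have "expectation f * expectation g - expectation tf * expectation tg =
      (expectation f - expectation tf) * expectation g + (expectation g - expectation tg) * expectation tf" by algebra
    also have "\<bar>\<dots>\<bar> \<le> (1 + C) * \<kappa> * (1 + C) + (1 + C) * \<kappa> * (1 + C)"
      using d[OF f] d[OF g] mom_abs(3)[OF g p(1)] mom_abs(3)[OF tf(1) p(1)] C \<kappa>
      by (intro order_trans[OF abs_triangle_ineq] add_mono) (auto simp: abs_mult tf_def[abs_def] tg_def[abs_def] intro!: mult_mono)
    finally show ?thesis by linarith
  qed
  have "4 * C * \<kappa> + 2 * ((1 + C) * \<kappa> * (1 + C)) \<le> (6 * C + 4) * (1 + C) * \<kappa>"
  proof -
    have "4 * C + 2 * (1 + C) * (1 + C) \<le> (6 * C + 4) * (1 + C)"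
      using C mult_nonneg_nonneg[OF C C] by (simp add: algebra_simps)
    from mult_right_mono[OF this less_imp_le[OF \<kappa>]] show ?thesis by (simp add: algebra_simps)
  qed
  then show ?thesis using 1 2 unfolding cv_def tf_def[symmetric] tg_def[symmetric] \<kappa>_def[symmetric] by linarith
qed

lemma (in prob_space) covariance_eq_cv:
  assumes "integrable M f" "integrable M g" "integrable M (\<lambda>x. f x * g x)"
  shows "covariance M f g = cv M f g"
proof -
  have "(f x - expectation f) * (g x - expectation g) =
    f x * g x - expectation g * f x - expectation f * g x + expectation f * expectation g" for x by algebra
  then show ?thesis
    using assms unfolding covariance_def cv_def by (simp add: prob_space)
qed

section \<open>Weak convergence to a normal law\<close>

text \<open>The functions whose integrals are determined by characteristic functions, in real form.
  The product-to-sum formulas make them an algebra.\<close>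

inductive trig_poly :: "('a::euclidean_space \<Rightarrow> real) \<Rightarrow> bool" where
  cos: "trig_poly (\<lambda>x. c * cos (l \<bullet> x))"
| sin: "trig_poly (\<lambda>x. c * sin (l \<bullet> x))"
| add: "trig_poly f \<Longrightarrow> trig_poly g \<Longrightarrow> trig_poly (\<lambda>x. f x + g x)"

lemma trig_poly_sum:
  assumes "finite I" "\<And>i. i \<in> I \<Longrightarrow> trig_poly (f i)"
  shows "trig_poly (\<lambda>x. \<Sum>i\<in>I. f i x)"
  using assms
proof (induction I rule: finite_induct)
  case empty
  then show ?case using trig_poly.cos[of 0 0] by simp
qed (auto intro: trig_poly.add)

lemma trig_poly_cong: "trig_poly f \<Longrightarrow> (\<And>x. f x = g x) \<Longrightarrow> trig_poly g"
  by (subst (asm) ext[of f g]) auto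

lemma trig_poly_mult:
  assumes "trig_poly f" "trig_poly g"
  shows "trig_poly (\<lambda>x. f x * g x)"
  using assms(1)
proof induction
  case (cos c l)
  show ?case using assms(2)
  proof induction
    case (cos c' l')
    show ?case
      by (rule trig_poly_cong[OF trig_poly.add[OF trig_poly.cos[of "c * c' / 2" "l - l'"] trig_poly.cos[of "c * c' / 2" "l + l'"]]])
        (simp add: inner_simps cos_diff cos_add field_simps)
  next
    case (sin c' l')
    show ?case
      by (rule trig_poly_cong[OF trig_poly.add[OF trig_poly.sin[of "c * c' / 2" "l + l'"] trig_poly.sin[of "- (c * c' / 2)" "l - l'"]]])
        (simp add: inner_simps sin_diff sin_add field_simps)
  next
    case (add f g)
    from trig_poly.add[OF add.IH] show ?case by (rule trig_poly_cong) (simp add: algebra_simps)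
  qed
next
  case (sin c l)
  show ?case using assms(2)
  proof induction
    case (cos c' l')
    show ?case
      by (rule trig_poly_cong[OF trig_poly.add[OF trig_poly.sin[of "c * c' / 2" "l + l'"] trig_poly.sin[of "c * c' / 2" "l - l'"]]])
        (simp add: inner_simps sin_diff sin_add field_simps)
  next
    case (sin c' l')
    show ?case
      by (rule trig_poly_cong[OF trig_poly.add[OF trig_poly.cos[of "c * c' / 2" "l - l'"] trig_poly.cos[of "- (c * c' / 2)" "l + l'"]]])
        (simp add: inner_simps cos_diff cos_add field_simps)
  next
    case (add f g)
    from trig_poly.add[OF add.IH] show ?case by (rule trig_poly_cong) (simp add: algebra_simps)
  qed
next
  case (add f g)
  from trig_poly.add[OF add.IH] show ?case by (rule trig_poly_cong) (simp add: algebra_simps)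
qed

text \<open>Induction over the polynomial, by closure under sums and products. This links
  Stone-Weierstrass on a cube with characteristic functions.\<close>

lemma trig_poly_compose:
  assumes "real_polynomial_function p"
  shows "trig_poly (\<lambda>x::'a::euclidean_space. p (\<Sum>i\<in>Basis. sin (c * (x \<bullet> i)) *\<^sub>R i))"
  using assms
proof induction
  case (linear f)
  interpret bounded_linear f by fact
  have "trig_poly (\<lambda>x::'a. \<Sum>i\<in>Basis. f i * sin ((c *\<^sub>R i) \<bullet> x))"
    by (intro trig_poly_sum trig_poly.sin) auto
  then show ?case
    by (rule trig_poly_cong) (simp add: sum scaleR inner_commute mult.commute)
next
  case (const k)
  then show ?case using trig_poly.cos[of k 0] by simp
qed (auto intro: trig_poly.add trig_poly_mult)

lemma trig_poly_continuous: "trig_poly f \<Longrightarrow> continuous_on UNIV f"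
  by (induction rule: trig_poly.induct) (auto intro!: continuous_intros)

lemma trig_poly_bounded: "trig_poly f \<Longrightarrow> \<exists>B. \<forall>x. \<bar>f x\<bar> \<le> B"
proof (induction rule: trig_poly.induct)
  case (cos c l)
  show ?case by (intro exI[of _ "\<bar>c\<bar>"]) (auto simp: abs_mult intro!: mult_left_le)
next
  case (sin c l)
  show ?case by (intro exI[of _ "\<bar>c\<bar>"]) (auto simp: abs_mult intro!: mult_left_le)
next
  case (add f g)
  then obtain B B' where "\<forall>x. \<bar>f x\<bar> \<le> B" "\<forall>x. \<bar>g x\<bar> \<le> B'" by blast
  then have "\<bar>f x + g x\<bar> \<le> B + B'" for x
    by (meson abs_triangle_ineq add_mono order_trans)
  then show ?case by blast
qed

lemma abs_sin_minus_le: "\<bar>sin x - x\<bar> \<le> x\<^sup>2 / 2" for x :: real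
proof -
  have "cmod (iexp x - (\<Sum>k\<le>1. (\<i> * x)^k / fact k)) \<le> \<bar>x\<bar>^2 / 2"
    using iexp_approx1[of x 1] by (simp add: numeral_2_eq_2)
  moreover have "Im (iexp x - (\<Sum>k\<le>1. (\<i> * x)^k / fact k)) = sin x - x"
    by (simp add: Im_exp)
  ultimately show ?thesis
    using abs_Im_le_cmod[of "iexp x - (\<Sum>k\<le>1. (\<i> * x)^k / fact k)"] by simp
qed

text \<open>Levy's continuity theorem for tight sequences. On a large ball x is close to S x, the
  vector of all sin(c x_i) / c with small c. As a function of the sines, f(S x) is approximated by a
  polynomial, and uniformly on the whole space because the sines stay in a cube. The resulting
  trigonometric polynomial thus stays bounded off the ball, where tightness controls the
  loss.\<close>

lemma weak_conv_law_trig: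
  fixes \<mu> :: "nat \<Rightarrow> 'a::euclidean_space measure"
  assumes \<mu>: "\<And>n. prob_space (\<mu> n)" "\<And>n. sets (\<mu> n) = sets borel"
    and \<nu>: "prob_space \<nu>" "sets \<nu> = sets borel"
    and tight: "\<And>e. e > 0 \<Longrightarrow> \<exists>K. \<forall>n. measure (\<mu> n) {x. norm x > K} \<le> e"
    and cos: "\<And>l. (\<lambda>n. \<integral>x. cos (l \<bullet> x) \<partial>\<mu> n) \<longlonglongrightarrow> (\<integral>x. cos (l \<bullet> x) \<partial>\<nu>)"
    and sin: "\<And>l. (\<lambda>n. \<integral>x. sin (l \<bullet> x) \<partial>\<mu> n) \<longlonglongrightarrow> (\<integral>x. sin (l \<bullet> x) \<partial>\<nu>)"
  shows "weak_conv_law \<mu> \<nu> sequentially"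
  unfolding weak_conv_law_def
proof (intro allI impI)
  fix f :: "'a \<Rightarrow> real" assume f: "continuous_on UNIV f \<and> bounded (range f)"
  then obtain B0 where B0: "\<And>x. \<bar>f x\<bar> \<le> B0" by (auto simp: bounded_iff)
  define B where "B = \<bar>B0\<bar> + 1"
  have B: "\<bar>f x\<bar> \<le> B" "B > 0" for x using B0[of x] by (auto simp: B_def)
  have int: "integrable N g" if "prob_space N" "sets N = sets borel" "continuous_on UNIV g" "\<And>x. \<bar>g x\<bar> \<le> D"
    for N and g :: "'a \<Rightarrow> real" and D
  proof -
    interpret prob_space N by fact
    have "g \<in> borel_measurable N"
      using that(2,3) borel_measurable_continuous_onI measurable_cong_sets by blast
    then show ?thesis using that(4) by (intro integrable_const_bound[where B=D]) auto
  qed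
  have trig_conv: "(\<lambda>n. \<integral>x. g x \<partial>\<mu> n) \<longlonglongrightarrow> (\<integral>x. g x \<partial>\<nu>)" if "trig_poly g" for g
    using that
  proof induction
    case (cos c l)
    show ?case using tendsto_mult_left[OF assms(6)] by simp
  next
    case (sin c l)
    show ?case using tendsto_mult_left[OF assms(7)] by simp
  next
    case (add f g)
    obtain D E where "\<forall>x. \<bar>f x\<bar> \<le> D" "\<forall>x. \<bar>g x\<bar> \<le> E"
      using trig_poly_bounded add.hyps by metis
    then have i: "integrable (\<mu> n) f" "integrable (\<mu> n) g" "integrable \<nu> f" "integrable \<nu> g" for n
      using int[OF \<mu>] int[OF \<nu>] trig_poly_continuous add.hyps by metis+
    show ?case using tendsto_add[OF add.IH] i by simp
  qed
  show "(\<lambda>n. \<integral>x. f x \<partial>\<mu> n) \<longlonglongrightarrow> (\<integral>x. f x \<partial>\<nu>)"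
  proof (rule tendstoI)
    fix e0 :: real assume e0: "e0 > 0"
    \<comment> \<open>Two approximations at (2 + 2 B) e each and one limit error e make (5 + 4 B) e
      in total.\<close>
    define e where "e = e0 / (6 + 4 * B)"
    have e: "e > 0" "(5 + 4 * B) * e < e0" using e0 B by (auto simp: e_def field_simps)
    obtain K1 where K1: "\<And>n. measure (\<mu> n) {x. norm x > K1} \<le> e" using tight[OF e(1)] by blast
    obtain K2 where K2: "measure \<nu> {x. norm x > K2} \<le> e"
    proof -
      interpret prob_space \<nu> by (rule \<nu>)
      have "(\<lambda>k. measure \<nu> {x::'a. norm x > real k}) \<longlonglongrightarrow> measure \<nu> (\<Inter>k. {x::'a. norm x > real k})"
        by (rule finite_Lim_measure_decseq) (auto simp: \<nu>(2) decseq_def)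
      moreover have "(\<Inter>k. {x::'a. norm x > real k}) = {}"
      proof -
        have "\<exists>k. \<not> norm x > real k" for x :: 'a
          using reals_Archimedean2[of "norm x"] by (auto simp: not_less intro: less_imp_le)
        then show ?thesis by blast
      qed
      ultimately have "\<forall>\<^sub>F k in sequentially. measure \<nu> {x::'a. norm x > real k} < e"
        using e(1) by (intro order_tendstoD(2)) auto
      then show ?thesis using that by (auto simp: eventually_sequentially intro: less_imp_le)
    qed
    define K where "K = max 1 (max K1 K2)"
    have K: "K \<ge> 1" "K1 \<le> K" "K2 \<le> K" by (auto simp: K_def)
    have tail: "measure N {x. norm x > K} \<le> e" if "N = \<nu> \<or> N = \<mu> n" for N n
    proof (rule order_trans)
      show "measure N {x. norm x > K} \<le> measure N {x. norm x > (if N = \<nu> then K2 else K1)}"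
      proof -
        interpret prob_space N using that \<mu> \<nu> by auto
        show ?thesis by (rule finite_measure_mono) (use K that \<mu>(2) \<nu>(2) in \<open>auto split: if_splits\<close>)
      qed
    qed (use K1 K2 that in auto)
    have "uniformly_continuous_on (cball 0 (K + 1)) f"
      by (intro compact_uniformly_continuous) (use f continuous_on_subset in auto)
    then obtain d where d: "d > 0" "\<And>x y. x \<in> cball 0 (K+1) \<Longrightarrow> y \<in> cball 0 (K+1) \<Longrightarrow> dist y x < d \<Longrightarrow> dist (f y) (f x) < e"
      unfolding uniformly_continuous_on_def using e(1) by metis
    \<comment> \<open>On the ball each coordinate of \<open>S x - x\<close> is at most c K^2 / 2;
      this \<open>c\<close> makes the sum over all coordinates min(d, 1) / 2.\<close>
    define c where "c = min d 1 / (real DIM('a) * K\<^sup>2)"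
    have c: "c > 0" using d K by (auto simp: c_def)
    define S where "S x = (1/c) *\<^sub>R (\<Sum>i\<in>Basis. sin (c * (x \<bullet> i)) *\<^sub>R i)" for x :: 'a
    have S: "norm (S x - x) < min d 1" if "norm x \<le> K" for x
    proof -
      have "\<bar>(S x - x) \<bullet> i\<bar> \<le> c * K\<^sup>2 / 2" if i: "i \<in> Basis" for i
      proof -
        have "(S x - x) \<bullet> i = (sin (c * (x \<bullet> i)) - c * (x \<bullet> i)) / c"
          using i c by (simp add: S_def inner_simps diff_divide_distrib)
        then have "\<bar>(S x - x) \<bullet> i\<bar> \<le> ((c * (x \<bullet> i))\<^sup>2 / 2) / c"
          using divide_right_mono[OF abs_sin_minus_le[of "c * (x \<bullet> i)"], of c] c by (simp add: abs_divide)
        also have "\<dots> = c * (x \<bullet> i)\<^sup>2 / 2" using c by (simp add: power2_eq_square)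
        also have "(x \<bullet> i)\<^sup>2 \<le> K\<^sup>2"
          using Basis_le_norm[OF i, of x] \<open>norm x \<le> K\<close> by (simp add: abs_le_square_iff[symmetric])
        finally show ?thesis using c by simp
      qed
      then have "norm (S x - x) \<le> (\<Sum>i\<in>(Basis::'a set). c * K\<^sup>2 / 2)"
        by (intro order_trans[OF norm_le_l1] sum_mono)
      also have "\<dots> = min d 1 / 2" using K by (simp add: c_def)
      also have "\<dots> < min d 1" using d by auto
      finally show ?thesis .
    qed
    obtain p where p: "real_polynomial_function p" "\<And>y. y \<in> cbox (-One) One \<Longrightarrow> \<bar>f ((1/c) *\<^sub>R y) - p y\<bar> < e"
    proof (rule Stone_Weierstrass_real_polynomial_function[of "cbox (-One) (One::'a)" "\<lambda>y. f ((1/c) *\<^sub>R y)" e])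
      show "continuous_on (cbox (-One) One) (\<lambda>y. f ((1/c) *\<^sub>R y))"
        by (rule continuous_on_compose2[of UNIV f]) (use f in \<open>auto intro!: continuous_intros\<close>)
    qed (use e in auto)
    define T where "T x = p (\<Sum>i\<in>Basis. sin (c * (x \<bullet> i)) *\<^sub>R i)" for x :: 'a
    have T: "trig_poly T" unfolding T_def[abs_def] by (rule trig_poly_compose) fact
    have fT: "\<bar>f x - T x\<bar> \<le> 2 * e + 2 * B * indicator {x. norm x > K} x" for x
    proof -
      have "(\<Sum>i\<in>Basis. sin (c * (x \<bullet> i)) *\<^sub>R i) \<in> cbox (-One) One"
        by (auto simp: mem_box inner_simps)
      from p(2)[OF this] have 1: "\<bar>f (S x) - T x\<bar> < e" by (simp add: S_def T_def)
      show ?thesis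
      proof (cases "norm x > K")
        case True
        then show ?thesis using 1 B(1)[of x] B(1)[of "S x"] e(1) by (simp add: abs_le_iff abs_less_iff)
      next
        case False
        then have "norm (S x - x) < min d 1" by (intro S) simp
        then have "norm (S x) \<le> K + 1" "dist (S x) x < d" using False norm_triangle_ineq2[of "S x" x] by (auto simp: dist_norm)
        then have "dist (f (S x)) (f x) < e" using False by (intro d(2)) auto
        then show ?thesis using 1 False by (simp add: dist_real_def abs_less_iff abs_le_iff)
      qed
    qed
    obtain D where D: "\<And>x. \<bar>T x\<bar> \<le> D" using trig_poly_bounded[OF T] by blast
    have close: "\<bar>(\<integral>x. f x \<partial>N) - (\<integral>x. T x \<partial>N)\<bar> \<le> (2 + 2 * B) * e" if N: "N = \<nu> \<or> N = \<mu> n" for N n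
    proof -
      have Np: "prob_space N" "sets N = sets borel" using N \<mu> \<nu> by auto
      interpret prob_space N by (rule Np)
      have fi: "integrable N f" "integrable N T"
        using int[OF Np] f B(1) D trig_poly_continuous[OF T] by blast+
      have tm: "{x. norm x > K} \<in> sets N" unfolding Np(2) by measurable
      have ii: "integrable N (\<lambda>x. 2 * e + 2 * B * indicator {x. norm x > K} x)"
        by (intro Bochner_Integration.integrable_add integrable_mult_right integrable_real_indicator tm) (auto simp: emeasure_eq_measure)
      have "(\<integral>x. \<bar>f x - T x\<bar> \<partial>N) \<le> (\<integral>x. 2 * e + 2 * B * indicator {x. norm x > K} x \<partial>N)"
        using fi ii by (intro integral_mono fT) auto
      also have "\<dots> = 2 * e + 2 * B * measure N {x. norm x > K}"
      proof -
        have i3: "integrable N (\<lambda>x. indicat_real {x. norm x > K} x)"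
          by (intro integrable_real_indicator tm) (auto simp: emeasure_eq_measure)
        have "{x. norm x > K} \<inter> space N = {x. norm x > K}"
          using sets.sets_into_space[OF tm] by blast
        then show ?thesis using i3 by (simp add: prob_space)
      qed
      also have "\<dots> \<le> 2 * e + 2 * B * e" using tail[OF N] B(2) by simp
      finally show ?thesis
        using integral_abs_bound[of N "\<lambda>x. f x - T x"] fi by (simp add: algebra_simps)
    qed
    have "\<forall>\<^sub>F n in sequentially. dist (\<integral>x. T x \<partial>\<mu> n) (\<integral>x. T x \<partial>\<nu>) < e"
      using trig_conv[OF T] e(1) by (rule tendstoD)
    then show "\<forall>\<^sub>F n in sequentially. dist (\<integral>x. f x \<partial>\<mu> n) (\<integral>x. f x \<partial>\<nu>) < e0"
    proof eventually_elim
      case (elim n)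
      have "\<bar>(\<integral>x. f x \<partial>\<mu> n) - (\<integral>x. f x \<partial>\<nu>)\<bar> < (2 + 2 * B) * e + e + (2 + 2 * B) * e"
        using elim close[of "\<mu> n" n, OF disjI2[OF refl]] close[of \<nu> n, OF disjI1[OF refl]] unfolding dist_real_def by linarith
      also have "\<dots> = (5 + 4 * B) * e" by (simp add: algebra_simps)
      finally show ?case using e(2) by (simp add: dist_real_def)
    qed
  qed
qed

section \<open>Quadratic forms and the multivariate normal law\<close>

definition qform :: "real^'q^'q \<Rightarrow> ('q \<Rightarrow> real) \<Rightarrow> real" where
  "qform S v = (\<Sum>i\<in>UNIV. \<Sum>j\<in>UNIV. v i * v j * S $ i $ j)"

text \<open>Serves both cases of the elimination step: for a zero diagonal entry the form is affine
  in t, so its slope must vanish; for a positive one the best t completes the square.\<close>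

lemma qform_add_unit:
  fixes S :: "real^'q^'q"
  assumes "\<And>i j. S $ i $ j = S $ j $ i"
  shows "qform S (\<lambda>i. v i + (if i = k then t else 0)) =
    qform S v + 2 * t * (\<Sum>i\<in>UNIV. v i * S $ i $ k) + t\<^sup>2 * S $ k $ k"
proof -
  have "qform S (\<lambda>i. v i + (if i = k then t else 0)) =
    (\<Sum>i\<in>UNIV. \<Sum>j\<in>UNIV. v i * v j * S $ i $ j + (if j = k then v i * t * S $ i $ k else 0) +
      (if i = k then t * v j * S $ k $ j else 0) + (if i = k then if j = k then t * t * S $ k $ k else 0 else 0))"
    unfolding qform_def by (intro sum.cong refl) (simp add: algebra_simps)
  also have "\<dots> = qform S v + (\<Sum>i\<in>UNIV. v i * t * S $ i $ k) + (\<Sum>j\<in>UNIV. t * v j * S $ k $ j) + t * t * S $ k $ k"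
  proof -
    have "(\<Sum>i\<in>UNIV. \<Sum>j\<in>UNIV. if i = k then g j else 0) = (\<Sum>j\<in>UNIV. g j)" for g :: "'q \<Rightarrow> real"
      by (subst sum.swap) simp
    moreover have "(\<Sum>i\<in>UNIV. \<Sum>j\<in>UNIV. if j = k then g i else 0) = (\<Sum>j\<in>UNIV. g j)" for g :: "'q \<Rightarrow> real"
      by simp
    ultimately show ?thesis
      unfolding qform_def by (simp only: sum.distrib) simp
  qed
  also have "(\<Sum>j\<in>UNIV. t * v j * S $ k $ j) = (\<Sum>i\<in>UNIV. v i * t * S $ i $ k)"
    by (intro sum.cong refl) (simp add: assms[of k] mult_ac)
  also have "\<dots> = t * (\<Sum>i\<in>UNIV. v i * S $ i $ k)"
    by (simp add: sum_distrib_left mult_ac)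
  finally show ?thesis by (simp add: power2_eq_square algebra_simps)
qed

text \<open>Cholesky elimination: one column of the root is split off for each index in \<open>J\<close>.\<close>

lemma psd_root_aux:
  fixes S :: "real^'q^'q" and J :: "'q set"
  assumes "finite J" "\<And>i j. S $ i $ j = S $ j $ i" "\<And>v. qform S v \<ge> 0" "\<And>i j. i \<notin> J \<Longrightarrow> S $ i $ j = 0"
  shows "\<exists>A :: real^'q^'q. A ** transpose A = S \<and> (\<forall>i j. j \<notin> J \<longrightarrow> A $ i $ j = 0)"
  using assms
proof (induction J arbitrary: S rule: finite_induct)
  case empty
  have "S = 0" using empty by (simp add: vec_eq_iff)
  then show ?case by (intro exI[of _ 0]) simp
next
  case (insert k J)
  note sym = insert.prems(1) and psd = insert.prems(2) and supp = insert.prems(3)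
  have unit: "qform S (\<lambda>j. (if j = i then 1 else 0) + (if j = k then t else 0)) = S $ i $ i + 2 * t * S $ i $ k + t\<^sup>2 * S $ k $ k" for i t
  proof -
    have "qform S (\<lambda>j. if j = i then 1 else 0) = S $ i $ i"
      using qform_add_unit[OF sym, of "\<lambda>_. 0" i 1] by (simp add: qform_def)
    moreover have "(\<Sum>j\<in>UNIV. (if j = i then 1 else 0) * S $ j $ k) = S $ i $ k"
      by (simp add: if_distrib[of "\<lambda>x. x * _"] sum.If_cases)
    ultimately show ?thesis using qform_add_unit[OF sym, of "\<lambda>j. if j = i then 1 else 0" k t] by simp
  qed
  show ?case
  proof (cases "S $ k $ k = 0")
    case True
    have z: "S $ i $ k = 0" for i
    proof (rule ccontr)
      assume n: "S $ i $ k \<noteq> 0"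
      show False
        \<comment> \<open>With this t the form equals
          \<open>S $ i $ i - (S $ i $ i + 1) = - 1\<close>.\<close>
        using psd[of "\<lambda>j. (if j = i then 1 else 0) + (if j = k then - (S $ i $ i + 1) / (2 * S $ i $ k) else 0)"] n True
        unfolding unit by (simp add: field_simps)
    qed
    have "\<exists>A :: real^'q^'q. A ** transpose A = S \<and> (\<forall>i j. j \<notin> J \<longrightarrow> A $ i $ j = 0)"
    proof (rule insert.IH[OF sym psd])
      show "S $ i $ j = 0" if "i \<notin> J" for i j
        using supp[of i j] z[of j] sym[of k j] that by (cases "i = k") auto
    qed
    then show ?thesis by blast
  next
    case False
    have "S $ k $ k \<ge> 0" using psd[of "\<lambda>j. if j = k then 1 else 0"] qform_add_unit[OF sym, of "\<lambda>_. 0" k 1]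
      by (simp add: qform_def)
    then have pos: "S $ k $ k > 0" using False by simp
    \<comment> \<open>The Schur complement of the diagonal entry at \<open>k\<close>: its row and
      column \<open>k\<close> vanish, so its support shrinks to \<open>J\<close>.\<close>
    define S' :: "real^'q^'q" where "S' = (\<chi> i j. S $ i $ j - S $ i $ k * S $ j $ k / S $ k $ k)"
    have "\<exists>A :: real^'q^'q. A ** transpose A = S' \<and> (\<forall>i j. j \<notin> J \<longrightarrow> A $ i $ j = 0)"
    proof (rule insert.IH)
      show "S' $ i $ j = S' $ j $ i" for i j using sym[of i j] by (simp add: S'_def mult.commute)
      show "S' $ i $ j = 0" if "i \<notin> J" for i j
        using supp[of i] that pos sym[of k j] by (cases "i = k") (auto simp: S'_def)
      show "qform S' v \<ge> 0" for v
      proof -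
        define s where "s = (\<Sum>i\<in>UNIV. v i * S $ i $ k)"
        have "qform S' v = qform S v - (\<Sum>i\<in>UNIV. \<Sum>j\<in>UNIV. (v i * S $ i $ k) * (v j * S $ j $ k)) / S $ k $ k"
          unfolding qform_def S'_def by (simp add: sum_subtractf sum_divide_distrib algebra_simps)
        also have "(\<Sum>i\<in>UNIV. \<Sum>j\<in>UNIV. (v i * S $ i $ k) * (v j * S $ j $ k)) = s\<^sup>2"
          by (simp add: s_def sum_product power2_eq_square)
        \<comment> \<open>The shift - s / S_kk minimises the quadratic in t, so the value of the
          Schur complement is a value of the original form.\<close>
        also have "qform S v - s\<^sup>2 / S $ k $ k = qform S (\<lambda>i. v i + (if i = k then - s / S $ k $ k else 0))"
          unfolding qform_add_unit[OF sym] s_def[symmetric] using pos by (simp add: power2_eq_square field_simps)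
        finally show ?thesis using psd by simp
      qed
    qed
    then obtain A :: "real^'q^'q" where A: "A ** transpose A = S'" "\<And>i j. j \<notin> J \<Longrightarrow> A $ i $ j = 0" by blast
    define R :: "real^'q^'q" where "R = (\<chi> i j. A $ i $ j + (if j = k then S $ i $ k / sqrt (S $ k $ k) else 0))"
    have "R ** transpose R = S"
    proof -
      have "(R ** transpose R) $ i $ j = S $ i $ j" for i j
      proof -
        have "(R ** transpose R) $ i $ j = (\<Sum>l\<in>UNIV. R $ i $ l * R $ j $ l)"
          by (simp add: matrix_matrix_mult_def transpose_def)
        also have "\<dots> = (\<Sum>l\<in>UNIV. A $ i $ l * A $ j $ l + (if l = k then S $ i $ k * S $ j $ k / S $ k $ k else 0))"
        proof (intro sum.cong refl)
          fix l
          show "R $ i $ l * R $ j $ l = A $ i $ l * A $ j $ l + (if l = k then S $ i $ k * S $ j $ k / S $ k $ k else 0)"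
            using A(2)[of k] insert.hyps(2) pos by (auto simp: R_def)
        qed
        also have "\<dots> = (A ** transpose A) $ i $ j + S $ i $ k * S $ j $ k / S $ k $ k"
          by (simp add: sum.distrib matrix_matrix_mult_def transpose_def)
        finally show ?thesis by (simp add: A(1) S'_def)
      qed
      then show ?thesis by (simp add: vec_eq_iff)
    qed
    moreover have "\<forall>i j. j \<notin> insert k J \<longrightarrow> R $ i $ j = 0" using A(2) by (auto simp: R_def)
    ultimately show ?thesis by blast
  qed
qed

lemma psd_root:
  fixes S :: "real^'q^'q"
  assumes "\<And>i j. S $ i $ j = S $ j $ i" "\<And>v. qform S v \<ge> 0"
  shows "\<exists>A :: real^'q^'q. A ** transpose A = S"
  using psd_root_aux[of UNIV S] assms by auto

lemma borel_measurable_vecI: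
  fixes f :: "'a \<Rightarrow> real^'n"
  assumes "\<And>j. (\<lambda>x. f x $ j) \<in> borel_measurable M"
  shows "f \<in> borel_measurable M"
  using assms by (subst borel_measurable_euclidean_space) (auto simp: Basis_vec_def inner_axis)

lemma mv_normal_measurable [measurable]:
  "(\<lambda>w. m + A *v (\<chi> i. w i)) \<in> borel_measurable (Pi\<^sub>M (UNIV :: 'q::finite set) (\<lambda>_. std_normal_distribution))"
  for m :: "real^'q" and A :: "real^'q^'q"
proof (rule borel_measurable_vecI)
  show "(\<lambda>w. (m + A *v (\<chi> i. w i)) $ j) \<in> borel_measurable (Pi\<^sub>M (UNIV :: 'q set) (\<lambda>_. std_normal_distribution))" for j
    unfolding matrix_vector_mult_def by (simp, measurable)
qed

lemma prob_space_mv_normal: "prob_space (mv_normal m S)" and sets_mv_normal: "sets (mv_normal m S) = sets borel"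
proof -
  interpret product_prob_space "\<lambda>_::'a. std_normal_distribution" UNIV
    by (rule product_prob_spaceI, rule real_distribution.axioms(1)[OF real_dist_normal_dist])
  show "prob_space (mv_normal m S)" unfolding mv_normal_def Let_def
    by (rule prob_space_distr) (rule mv_normal_measurable)
  show "sets (mv_normal m S) = sets borel" unfolding mv_normal_def Let_def by simp
qed

text \<open>The root chosen inside \<open>mv_normal\<close> exists by \<open>psd_root\<close>. Under
  the product measure the exponential splits over the coordinates of w into one-dimensional normal
  characteristic functions, whose exponents add up to |A^T l|^2 = l^T S l.\<close>

lemma mv_normal_char:
  fixes S :: "real^'q^'q"
  assumes sym: "\<And>i j. S $ i $ j = S $ j $ i" and psd: "\<And>v. qform S v \<ge> 0"
  shows "(CLINT x|mv_normal 0 S. iexp (l \<bullet> x)) = of_real (exp (- qform S (\<lambda>i. l $ i) / 2))"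
proof -
  define A :: "real^'q^'q" where "A = (SOME A. A ** transpose A = S)"
  have A: "A ** transpose A = S" unfolding A_def using psd_root[OF sym psd] by (rule someI_ex)
  let ?N = "Pi\<^sub>M (UNIV :: 'q set) (\<lambda>_. std_normal_distribution)"
  define u where "u j = (\<Sum>i\<in>UNIV. l $ i * A $ i $ j)" for j
  interpret product_prob_space "\<lambda>_::'q. std_normal_distribution" UNIV
    by (rule product_prob_spaceI, rule real_distribution.axioms(1)[OF real_dist_normal_dist])
  have "(CLINT x|mv_normal 0 S. iexp (l \<bullet> x)) = (CLINT w|?N. iexp (l \<bullet> (0 + A *v (\<chi> i. w i))))"
    unfolding mv_normal_def Let_def A_def[symmetric] by (rule integral_distr[OF mv_normal_measurable]) auto
  also have "\<dots> = (CLINT w|?N. (\<Prod>j\<in>UNIV. iexp (u j * w j)))"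
  proof (intro Bochner_Integration.integral_cong refl)
    fix w :: "'q \<Rightarrow> real"
    have "l \<bullet> (0 + A *v (\<chi> i. w i)) = (\<Sum>i\<in>UNIV. \<Sum>j\<in>UNIV. l $ i * A $ i $ j * w j)"
      by (simp add: inner_vec_def matrix_vector_mult_def sum_distrib_left mult.assoc)
    also have "\<dots> = (\<Sum>j\<in>UNIV. u j * w j)"
      unfolding u_def sum_distrib_right by (rule sum.swap)
    finally show "iexp (l \<bullet> (0 + A *v (\<chi> i. w i))) = (\<Prod>j\<in>UNIV. iexp (u j * w j))"
      by (simp add: exp_sum sum_distrib_left)
  qed
  also have "\<dots> = (\<Prod>j\<in>UNIV. CLINT y|std_normal_distribution. iexp (u j * y))"
  proof (rule product_integral_prod)
    show "integrable std_normal_distribution (\<lambda>y. iexp (u j * y))" for j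
      by (rule prob_space.integrable_iexp[OF real_distribution.axioms(1)[OF real_dist_normal_dist]]) auto
  qed simp
  also have "\<dots> = (\<Prod>j\<in>UNIV. of_real (exp (- ((u j)\<^sup>2) / 2)))"
    using char_std_normal_distribution by (simp add: char_def fun_eq_iff)
  also have "\<dots> = of_real (exp (- (\<Sum>j\<in>UNIV. (u j)\<^sup>2) / 2))"
    by (simp add: exp_sum[symmetric] sum_negf sum_divide_distrib of_real_prod[symmetric] del: of_real_prod)
  also have "(\<Sum>j\<in>UNIV. (u j)\<^sup>2) = qform S (\<lambda>i. l $ i)"
  proof -
    have "(\<Sum>j\<in>UNIV. (u j)\<^sup>2) = (\<Sum>j\<in>UNIV. \<Sum>i\<in>UNIV. \<Sum>i'\<in>UNIV. l $ i * l $ i' * (A $ i $ j * A $ i' $ j))"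
      by (simp add: u_def power2_eq_square sum_product mult_ac)
    also have "\<dots> = (\<Sum>i\<in>UNIV. \<Sum>j\<in>UNIV. \<Sum>i'\<in>UNIV. l $ i * l $ i' * (A $ i $ j * A $ i' $ j))"
      by (rule sum.swap)
    also have "\<dots> = (\<Sum>i\<in>UNIV. \<Sum>i'\<in>UNIV. \<Sum>j\<in>UNIV. l $ i * l $ i' * (A $ i $ j * A $ i' $ j))"
      by (intro sum.cong refl sum.swap)
    also have "\<dots> = (\<Sum>i\<in>UNIV. \<Sum>i'\<in>UNIV. l $ i * l $ i' * (A ** transpose A) $ i $ i')"
      by (simp add: matrix_matrix_mult_def transpose_def sum_distrib_left)
    finally show ?thesis by (simp add: A qform_def)
  qed
  finally show ?thesis .
qed

section \<open>A central limit theorem for weakly dependent arrays\<close>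

text \<open>Interpolates between the cubic bound near 0 and the quadratic bound away from 0, so that
  moments of order 2 + \<delta> suffice for the expansion.\<close>

lemma iexp_approx_powr:
  assumes "0 < \<delta>" "\<delta> \<le> 1"
  shows "cmod (iexp x - (1 + \<i> * x - x\<^sup>2 / 2)) \<le> \<bar>x\<bar> powr (2 + \<delta>)"
proof -
  have eq: "(\<Sum>k\<le>2. (\<i> * x)^k / fact k) = 1 + \<i> * x - x\<^sup>2 / 2"
    by (simp add: numeral_2_eq_2 power2_eq_square algebra_simps)
  show ?thesis
  proof (cases "\<bar>x\<bar> \<le> 1")
    case True
    have "cmod (iexp x - (1 + \<i> * x - x\<^sup>2 / 2)) \<le> \<bar>x\<bar> ^ 3 / 6"
      using iexp_approx1[of x 2] unfolding eq by (simp add: eval_nat_numeral)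
    also have "\<dots> \<le> \<bar>x\<bar> ^ 3" by simp
    also have "\<dots> = \<bar>x\<bar> powr 3" by (cases "x = 0") (simp_all add: powr_numeral)
    also have "\<dots> \<le> \<bar>x\<bar> powr (2 + \<delta>)" using True assms by (intro powr_mono') auto
    finally show ?thesis .
  next
    case False
    have "cmod (iexp x - (1 + \<i> * x - x\<^sup>2 / 2)) \<le> \<bar>x\<bar> ^ 2"
      using iexp_approx2[of x 2] unfolding eq by (simp add: eval_nat_numeral)
    also have "\<dots> = \<bar>x\<bar> powr 2" using False by (simp add: powr_numeral)
    also have "\<dots> \<le> \<bar>x\<bar> powr (2 + \<delta>)" using False assms by (intro powr_mono) auto
    finally show ?thesis .
  qed
qed

lemma exp_minus_approx:
  fixes y :: real assumes "y \<ge> 0"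
  shows "\<bar>exp (- y) - (1 - y)\<bar> \<le> y\<^sup>2"
proof -
  have "1 \<le> (1 - y + y\<^sup>2) * (1 + y)"
    using assms by (simp add: algebra_simps power2_eq_square)
  moreover have "1 + y \<le> exp y" by (rule exp_ge_add_one_self)
  moreover have "0 \<le> 1 - y + y\<^sup>2"
    using zero_le_power2[of "y - 1/2"] by (simp add: power2_eq_square algebra_simps)
  ultimately have "1 \<le> (1 - y + y\<^sup>2) * exp y"
    by (meson mult_left_mono order_trans)
  then have "exp (- y) \<le> 1 - y + y\<^sup>2"
    by (simp add: exp_minus field_simps)
  moreover have "1 - y \<le> exp (- y)" using exp_ge_add_one_self[of "- y"] by simp
  ultimately show ?thesis by (simp add: abs_le_iff)
qed

text \<open>Estimates every summand by the largest one. The crude constant does no harm, because the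
  number of summands stays fixed in the limit wherever the bound is used.\<close>

lemma abs_sum_powr_le:
  fixes x :: "'i \<Rightarrow> real"
  assumes "finite I" "q \<ge> 0"
  shows "\<bar>\<Sum>i\<in>I. x i\<bar> powr q \<le> real (card I) powr q * (\<Sum>i\<in>I. \<bar>x i\<bar> powr q)"
proof (cases "I = {}")
  case False
  define y where "y = Max ((\<lambda>i. \<bar>x i\<bar>) ` I)"
  have "y \<in> (\<lambda>i. \<bar>x i\<bar>) ` I" unfolding y_def using assms False by (intro Max_in) auto
  then obtain k where k: "k \<in> I" "y = \<bar>x k\<bar>" by auto
  have le: "\<bar>x i\<bar> \<le> y" if "i \<in> I" for i
    unfolding y_def using assms that by (intro Max_ge) auto
  have "\<bar>\<Sum>i\<in>I. x i\<bar> \<le> (\<Sum>i\<in>I. y)"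
    using le by (intro order_trans[OF sum_abs] sum_mono)
  then have "\<bar>\<Sum>i\<in>I. x i\<bar> powr q \<le> (real (card I) * y) powr q"
    using assms by (intro powr_mono2) auto
  also have "\<dots> = real (card I) powr q * y powr q" using k by (simp add: powr_mult)
  also have "y powr q \<le> (\<Sum>i\<in>I. \<bar>x i\<bar> powr q)"
    unfolding k(2) by (rule member_le_sum) (use k assms in auto)
  finally show ?thesis by (simp add: mult_left_mono)
qed (use assms in simp)

lemma (in prob_space) mom_sum:
  assumes I: "finite I" and x: "\<And>i. i \<in> I \<Longrightarrow> mom M q C (x i)" and q: "q \<ge> 0"
  shows "mom M q (real (card I) powr q * (real (card I) * C)) (\<lambda>\<omega>. \<Sum>i\<in>I. x i \<omega>)"
proof -
  have m: "x i \<in> borel_measurable M" "integrable M (\<lambda>\<omega>. \<bar>x i \<omega>\<bar> powr q)" "expectation (\<lambda>\<omega>. \<bar>x i \<omega>\<bar> powr q) \<le> C" if "i \<in> I" for i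
    using x[OF that] by (auto simp: mom_def)
  have S: "(\<lambda>\<omega>. \<Sum>i\<in>I. x i \<omega>) \<in> borel_measurable M" using m(1) by (rule borel_measurable_sum)
  then have S': "(\<lambda>\<omega>. \<bar>\<Sum>i\<in>I. x i \<omega>\<bar> powr q) \<in> borel_measurable M" by measurable
  have i: "integrable M (\<lambda>\<omega>. real (card I) powr q * (\<Sum>i\<in>I. \<bar>x i \<omega>\<bar> powr q))"
    using m(2) by (intro integrable_mult_right Bochner_Integration.integrable_sum)
  have i2: "integrable M (\<lambda>\<omega>. \<bar>\<Sum>i\<in>I. x i \<omega>\<bar> powr q)"
    by (rule Bochner_Integration.integrable_bound[OF i S'])
      (use abs_sum_powr_le[OF I q] in \<open>auto simp: sum_nonneg\<close>)
  have "expectation (\<lambda>\<omega>. \<bar>\<Sum>i\<in>I. x i \<omega>\<bar> powr q) \<le> expectation (\<lambda>\<omega>. real (card I) powr q * (\<Sum>i\<in>I. \<bar>x i \<omega>\<bar> powr q))"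
    by (intro integral_mono i i2 abs_sum_powr_le I q)
  also have "\<dots> = real (card I) powr q * (\<Sum>i\<in>I. expectation (\<lambda>\<omega>. \<bar>x i \<omega>\<bar> powr q))"
    using m(2) by simp
  also have "\<dots> \<le> real (card I) powr q * (real (card I) * C)"
    using m(3) by (intro mult_left_mono sum_bounded_above) auto
  finally show ?thesis using S i2 by (simp add: mom_def)
qed

lemma (in prob_space) iexp_expectation_le_1:
  "cmod (CLINT x|M. iexp (U x)) \<le> 1"
proof -
  have "cmod (CLINT x|M. iexp (U x)) \<le> expectation (\<lambda>x. cmod (iexp (U x)))"
    by (rule integral_norm_bound)
  also have "\<dots> = 1" by (simp add: prob_space)
  finally show ?thesis .
qed

text \<open>A row has O(m) neighbouring pairs and O(m^2) distant ones. After division by m it is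
  enough that neighbouring covariances vanish, whereas distant ones must be o(1/m). The decoupling
  error is paid once per group, hence it is o(1/m) as well.\<close>

locale weakly_dependent_array = prob_space M for M :: "'a measure" +
  fixes T :: "nat \<Rightarrow> nat \<Rightarrow> 'a \<Rightarrow> real" and m :: "nat \<Rightarrow> nat" and \<delta> C s2 :: real and v e f \<beta> :: "nat \<Rightarrow> real"
  assumes m: "filterlim m at_top sequentially"
    and \<delta>: "0 < \<delta>" "\<delta> \<le> 1"
    and mom: "\<And>n i. i < m n \<Longrightarrow> mom M (2 + \<delta>) C (T n i)"
    and mean: "\<And>n i. i < m n \<Longrightarrow> expectation (T n i) = 0"
    and nonneg: "s2 \<ge> 0" "\<And>n. v n \<ge> 0" "\<And>n. e n \<ge> 0" "\<And>n. f n \<ge> 0" "\<And>n. \<beta> n \<ge> 0"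
    and var: "\<And>n i. i < m n \<Longrightarrow> \<bar>expectation (\<lambda>x. T n i x * T n i x) - s2\<bar> \<le> v n"
    and adj: "\<And>n i. Suc i < m n \<Longrightarrow> \<bar>expectation (\<lambda>x. T n i x * T n (Suc i) x)\<bar> \<le> e n"
    and far: "\<And>n i j. i + 2 \<le> j \<Longrightarrow> j < m n \<Longrightarrow> \<bar>expectation (\<lambda>x. T n i x * T n j x)\<bar> \<le> f n"
    and decouple: "\<And>n I J t. I \<subseteq> {..<m n} \<Longrightarrow> J \<subseteq> {..<m n} \<Longrightarrow> (\<And>i j. i \<in> I \<Longrightarrow> j \<in> J \<Longrightarrow> i + 2 \<le> j) \<Longrightarrow>
      cmod ((CLINT x|M. iexp (t * (\<Sum>i\<in>I. T n i x) + t * (\<Sum>j\<in>J. T n j x))) -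
        (CLINT x|M. iexp (t * (\<Sum>i\<in>I. T n i x))) * (CLINT x|M. iexp (t * (\<Sum>j\<in>J. T n j x)))) \<le> \<beta> n"
    and lim: "v \<longlonglongrightarrow> 0" "e \<longlonglongrightarrow> 0" "(\<lambda>n. real (m n) * f n) \<longlonglongrightarrow> 0" "(\<lambda>n. real (m n) * \<beta> n) \<longlonglongrightarrow> 0"
begin

lemma T_measurable: "i < m n \<Longrightarrow> T n i \<in> borel_measurable M"
  using mom[of i n] by (simp add: mom_def)

lemma sum_measurable: "D \<subseteq> {..<m n} \<Longrightarrow> (\<lambda>x. \<Sum>i\<in>D. T n i x) \<in> borel_measurable M"
  by (intro borel_measurable_sum T_measurable) auto

lemma T_prod_integrable: "i < m n \<Longrightarrow> j < m n \<Longrightarrow> integrable M (\<lambda>x. T n i x * T n j x)"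
  using mom_prod(1)[OF mom mom, of i n j] \<delta> by simp

lemma C_nonneg: assumes "m n > 0" shows "C \<ge> 0"
proof -
  have "0 \<le> expectation (\<lambda>x. \<bar>T n 0 x\<bar> powr (2 + \<delta>))" by (rule Bochner_Integration.integral_nonneg) simp
  also have "\<dots> \<le> C" using mom[OF assms] by (simp add: mom_def)
  finally show ?thesis .
qed

text \<open>Expanding the square yields s2 up to v on the diagonal, at most two neighbours per index
  with e each, and f for all remaining pairs.\<close>

lemma sum_square:
  assumes D: "D \<subseteq> {..<m n}"
  shows "integrable M (\<lambda>x. (\<Sum>i\<in>D. T n i x)\<^sup>2)"
    and "\<bar>expectation (\<lambda>x. (\<Sum>i\<in>D. T n i x)\<^sup>2) - real (card D) * s2\<bar> \<le> real (card D) * (v n + 2 * e n + real (card D) * f n)"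
proof -
  have fin: "finite D" using D finite_subset by blast
  have eq: "(\<Sum>i\<in>D. T n i x)\<^sup>2 = (\<Sum>i\<in>D. \<Sum>j\<in>D. T n i x * T n j x)" for x
    by (simp add: power2_eq_square sum_product)
  have int: "integrable M (\<lambda>x. T n i x * T n j x)" if "i \<in> D" "j \<in> D" for i j
    using T_prod_integrable that D by auto
  show "integrable M (\<lambda>x. (\<Sum>i\<in>D. T n i x)\<^sup>2)"
    unfolding eq by (intro Bochner_Integration.integrable_sum int)
  have E: "expectation (\<lambda>x. (\<Sum>i\<in>D. T n i x)\<^sup>2) = (\<Sum>i\<in>D. \<Sum>j\<in>D. expectation (\<lambda>x. T n i x * T n j x))"
    unfolding eq using int by (simp add: Bochner_Integration.integral_sum Bochner_Integration.integrable_sum)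
  have bound: "\<bar>expectation (\<lambda>x. T n i x * T n j x) - (if j = i then s2 else 0)\<bar> \<le>
     (if j = i then v n else 0) + (if j = Suc i then e n else 0) + (if Suc j = i then e n else 0) + f n"
    if "i \<in> D" "j \<in> D" for i j
  proof -
    have ij: "i < m n" "j < m n" using that D by auto
    consider "j = i" | "j = Suc i" | "i = Suc j" | "i + 2 \<le> j" | "j + 2 \<le> i" by linarith
    then show ?thesis
    proof cases
      case 1 then show ?thesis using var[OF ij(1)] nonneg(4)[of n] by simp
    next
      case 2 then show ?thesis using adj[of i n] ij nonneg(4)[of n] by simp
    next
      case 3 then show ?thesis using adj[of j n] ij nonneg(4)[of n] by (simp add: mult.commute)
    next
      case 4 then show ?thesis using far[OF 4 ij(2)] by simp
    next
      case 5 then show ?thesis using far[OF 5 ij(1)] by (simp add: mult.commute)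
    qed
  qed
  have "expectation (\<lambda>x. (\<Sum>i\<in>D. T n i x)\<^sup>2) - real (card D) * s2 =
    (\<Sum>i\<in>D. \<Sum>j\<in>D. expectation (\<lambda>x. T n i x * T n j x) - (if j = i then s2 else 0))"
    unfolding E using fin by (simp add: sum_subtractf)
  also have "\<bar>\<dots>\<bar> \<le> (\<Sum>i\<in>D. \<Sum>j\<in>D. (if j = i then v n else 0) + (if j = Suc i then e n else 0) + (if Suc j = i then e n else 0) + f n)"
    by (intro order_trans[OF sum_abs] sum_mono) (use bound in auto)
  also have "\<dots> \<le> (\<Sum>i\<in>D. v n + e n + e n + real (card D) * f n)"
  proof (rule sum_mono)
    fix i assume i: "i \<in> D"
    have "(\<Sum>j\<in>D. if j = Suc i then e n else 0) \<le> e n" using fin nonneg(3)[of n] by simp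
    moreover have "(\<Sum>j\<in>D. if Suc j = i then e n else 0) \<le> e n"
    proof -
      have "(\<Sum>j\<in>D. if Suc j = i then e n else 0) \<le> (\<Sum>j\<in>D. if j = i - 1 then e n else 0)"
        using nonneg(3)[of n] by (intro sum_mono) auto
      also have "\<dots> \<le> e n" using fin nonneg(3)[of n] by simp
      finally show ?thesis .
    qed
    ultimately show "(\<Sum>j\<in>D. (if j = i then v n else 0) + (if j = Suc i then e n else 0) + (if Suc j = i then e n else 0) + f n) \<le>
      v n + e n + e n + real (card D) * f n"
      using i fin by (simp add: sum.distrib)
  qed
  also have "\<dots> = real (card D) * (v n + 2 * e n + real (card D) * f n)" by simp
  finally show "\<bar>expectation (\<lambda>x. (\<Sum>i\<in>D. T n i x)\<^sup>2) - real (card D) * s2\<bar> \<le> real (card D) * (v n + 2 * e n + real (card D) * f n)" .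
qed

text \<open>Nothing separates neighbouring indices, so the last index of each run of \<open>p\<close> is discarded; the
  loss is a fraction \<open>1/p\<close> of the variance, and \<open>p \<rightarrow> \<infinity>\<close> after \<open>n\<close>.\<close>

definition group :: "nat \<Rightarrow> nat \<Rightarrow> nat set" where
  "group p g = {g * p..<g * p + (p - 1)}"

lemma group_subset: "g < m n div p \<Longrightarrow> group p g \<subseteq> {..<m n}"
proof -
  assume "g < m n div p"
  then have "Suc g * p \<le> m n" by (meson Suc_leI div_times_less_eq_dividend mult_le_mono1 order_trans)
  then show ?thesis by (auto simp: group_def)
qed

lemma group_separated:
  assumes "g < h" "i \<in> group p g" "j \<in> group p h" shows "i + 2 \<le> j"
proof -
  have "Suc g * p \<le> h * p" using assms(1) by (intro mult_le_mono1) simp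
  then show ?thesis using assms(2,3) by (auto simp: group_def)
qed

lemma group_sum:
  "(\<Sum>i\<in>(\<Union>g<q. group p g). T n i x) = (\<Sum>g<q. \<Sum>i\<in>group p g. T n i x)"
proof (rule sum.UNION_disjoint)
  show "\<forall>i\<in>{..<q}. \<forall>j\<in>{..<q}. i \<noteq> j \<longrightarrow> group p i \<inter> group p j = {}"
    using group_separated by (metis Int_emptyI add_2_eq_Suc' linorder_neqE_nat not_less_eq_eq le_SucI order_refl)
qed (auto simp: group_def)

text \<open>Groups are peeled off from the right at the price of one \<beta> each; earlier errors do
  not grow, as characteristic functions have modulus at most 1.\<close>

lemma group_decouple:
  assumes "q \<le> m n div p"
  shows "cmod ((CLINT x|M. iexp (t * (\<Sum>i\<in>(\<Union>g<q. group p g). T n i x))) -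
    (\<Prod>g<q. CLINT x|M. iexp (t * (\<Sum>i\<in>group p g. T n i x)))) \<le> real q * \<beta> n"
  using assms
proof (induction q)
  case 0
  then show ?case by (simp add: prob_space)
next
  case (Suc q)
  let ?K = "\<Union>g<q. group p g"
  let ?E = "\<lambda>D. CLINT x|M. iexp (t * (\<Sum>i\<in>D. T n i x))"
  have 1: "cmod ((CLINT x|M. iexp (t * (\<Sum>i\<in>?K. T n i x) + t * (\<Sum>i\<in>group p q. T n i x))) - ?E ?K * ?E (group p q)) \<le> \<beta> n"
  proof (rule decouple)
    show "?K \<subseteq> {..<m n}"
    proof (rule UN_least)
      fix g assume "g \<in> {..<q}"
      then show "group p g \<subseteq> {..<m n}" using Suc.prems by (intro group_subset) simp
    qed
    show "group p q \<subseteq> {..<m n}" using group_subset Suc.prems by simp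
    show "i + 2 \<le> j" if "i \<in> ?K" "j \<in> group p q" for i j using that group_separated by blast
  qed
  have eq: "t * (\<Sum>i\<in>(\<Union>g<Suc q. group p g). T n i x) = t * (\<Sum>i\<in>?K. T n i x) + t * (\<Sum>i\<in>group p q. T n i x)" for x
    by (simp only: group_sum sum.lessThan_Suc distrib_left)
  have "cmod (?E ?K * ?E (group p q) - (\<Prod>g<q. ?E (group p g)) * ?E (group p q)) \<le> real q * \<beta> n * 1"
    unfolding left_diff_distrib[symmetric] norm_mult using Suc.prems nonneg(5)[of n]
    by (intro mult_mono Suc.IH iexp_expectation_le_1) auto
  with 1 have "cmod ((CLINT x|M. iexp (t * (\<Sum>i\<in>?K. T n i x) + t * (\<Sum>i\<in>group p q. T n i x))) - (\<Prod>g<q. ?E (group p g)) * ?E (group p q)) \<le> \<beta> n + real q * \<beta> n"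
    using norm_diff_triangle_le by fastforce
  then show ?case unfolding eq prod.lessThan_Suc by (simp add: algebra_simps)
qed

text \<open>One index for each complete run, and fewer than p from the incomplete run at the
  end.\<close>

lemma discarded_card:
  assumes "p \<ge> 1"
  shows "card ({..<m n} - (\<Union>g<m n div p. group p g)) \<le> m n div p + p"
proof -
  let ?w = "m n div p"
  have "{..<m n} - (\<Union>g<?w. group p g) \<subseteq> (\<lambda>g. g * p + (p - 1)) ` {..<?w} \<union> {?w * p..<m n}"
  proof
    fix i assume i: "i \<in> {..<m n} - (\<Union>g<?w. group p g)"
    show "i \<in> (\<lambda>g. g * p + (p - 1)) ` {..<?w} \<union> {?w * p..<m n}"
    proof (cases "i div p < ?w")
      case True
      then have "i \<notin> group p (i div p)" using i by blast
      moreover have "i = i div p * p + i mod p" "i mod p < p" using assms by auto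
      moreover have "i div p * p \<le> i" by simp
      ultimately have "i = i div p * p + (p - 1)" unfolding group_def atLeastLessThan_iff by linarith
      then show ?thesis using True by blast
    next
      case False
      then have "?w * p \<le> i" by (metis div_times_less_eq_dividend mult_le_mono1 not_less order_trans)
      then show ?thesis using i by auto
    qed
  qed
  then have "card ({..<m n} - (\<Union>g<?w. group p g)) \<le> card ((\<lambda>g. g * p + (p - 1)) ` {..<?w} \<union> {?w * p..<m n})"
    by (intro card_mono) auto
  also have "\<dots> \<le> card ((\<lambda>g. g * p + (p - 1)) ` {..<?w}) + card {?w * p..<m n}"
    by (rule card_Un_le)
  also have "\<dots> \<le> ?w + p"
  proof (rule add_mono)
    show "card ((\<lambda>g. g * p + (p - 1)) ` {..<?w}) \<le> ?w" using card_image_le[of "{..<?w}"] by fastforce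
    have "m n - ?w * p = m n mod p" by (simp add: modulo_nat_def)
    then show "card {?w * p..<m n} \<le> p" using assms by (simp add: less_imp_le)
  qed
  finally show ?thesis .
qed

text \<open>From |exp(i y) - 1| <= |y| <= t + y^2 / t only the second moment of the discarded sum
  enters, and \<open>sum_square\<close> bounds it in proportion to the number of discarded
  indices.\<close>

lemma discard_error:
  assumes "p \<ge> 1" "t > 0" "m n > 0" "D = {..<m n} - (\<Union>g<m n div p. group p g)"
  shows "cmod ((CLINT x|M. iexp (\<theta> * (\<Sum>i<m n. T n i x) / sqrt (m n))) -
    (CLINT x|M. iexp (\<theta> / sqrt (m n) * (\<Sum>i\<in>(\<Union>g<m n div p. group p g). T n i x)))) \<le>
    t + \<theta>\<^sup>2 / t * ((real (m n div p) + p) / m n * (s2 + v n + 2 * e n + real (m n) * f n))"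
proof -
  let ?K = "\<Union>g<m n div p. group p g"
  have K: "?K \<subseteq> {..<m n}"
    by (rule UN_least) (simp add: group_subset)
  have D: "D \<subseteq> {..<m n}" using assms by auto
  define u where "u = \<theta> / sqrt (m n)"
  have u2: "u\<^sup>2 = \<theta>\<^sup>2 / m n" by (simp add: u_def power_divide)
  define S where "S B x = (\<Sum>i\<in>B. T n i x)" for B x
  have [measurable]: "S B \<in> borel_measurable M" if "B \<subseteq> {..<m n}" for B
    unfolding S_def[abs_def] by (rule sum_measurable) fact
  have split: "S {..<m n} x = S ?K x + S D x" for x
    unfolding S_def assms(4) using sum.subset_diff[OF K, of "\<lambda>i. T n i x"] by simp
  have int: "integrable M (\<lambda>x. iexp (u * S B x))" if "B \<subseteq> {..<m n}" for B
    by (rule integrable_iexp) (use that in measurable)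
  have sq: "integrable M (\<lambda>x. (S D x)\<^sup>2)" using sum_square(1)[OF D] by (simp add: S_def)
  have pt: "cmod (iexp (u * S {..<m n} x) - iexp (u * S ?K x)) \<le> t + u\<^sup>2 / t * (S D x)\<^sup>2" for x
  proof -
    have "iexp (u * S {..<m n} x) - iexp (u * S ?K x) = iexp (u * S ?K x) * (iexp (u * S D x) - 1)"
      unfolding split by (simp add: exp_add[symmetric] algebra_simps)
    also have "cmod \<dots> \<le> \<bar>u * S D x\<bar>"
      using iexp_approx1[of "u * S D x" 0] by (simp add: norm_mult)
    also have "\<dots> \<le> t + (u * S D x)\<^sup>2 / t"
    proof (cases "\<bar>u * S D x\<bar> \<le> t")
      case True then show ?thesis using assms(2) by (simp add: add_increasing2)
    next
      case False
      then have "\<bar>u * S D x\<bar> * t \<le> \<bar>u * S D x\<bar> * \<bar>u * S D x\<bar>" by (intro mult_left_mono) auto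
      then have "\<bar>u * S D x\<bar> \<le> (u * S D x)\<^sup>2 / t" using assms(2) by (simp add: power2_eq_square le_divide_eq abs_mult)
      then show ?thesis using assms(2) by simp
    qed
    finally show ?thesis by (simp add: power_mult_distrib)
  qed
  have "cmod ((CLINT x|M. iexp (u * S {..<m n} x)) - (CLINT x|M. iexp (u * S ?K x))) =
    cmod (CLINT x|M. iexp (u * S {..<m n} x) - iexp (u * S ?K x))"
    using int K by simp
  also have "\<dots> \<le> expectation (\<lambda>x. cmod (iexp (u * S {..<m n} x) - iexp (u * S ?K x)))"
    by (rule integral_norm_bound)
  also have "\<dots> \<le> expectation (\<lambda>x. t + u\<^sup>2 / t * (S D x)\<^sup>2)"
    using int K sq by (intro integral_mono pt) auto
  also have "\<dots> = t + u\<^sup>2 / t * expectation (\<lambda>x. (S D x)\<^sup>2)"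
    using sq by (simp add: prob_space)
  also have "\<dots> \<le> t + u\<^sup>2 / t * ((real (m n div p) + p) * (s2 + v n + 2 * e n + real (m n) * f n))"
  proof (intro add_left_mono mult_left_mono)
    have cD: "real (card D) \<le> real (m n div p) + p"
      using discarded_card[OF assms(1), of n] unfolding assms(4) by linarith
    have cD2: "card D \<le> m n" using card_mono[OF _ D] by simp
    have "expectation (\<lambda>x. (S D x)\<^sup>2) \<le> real (card D) * (s2 + v n + 2 * e n + real (card D) * f n)"
      using sum_square(2)[OF D] by (simp add: S_def algebra_simps abs_le_iff)
    also have "\<dots> \<le> (real (m n div p) + p) * (s2 + v n + 2 * e n + real (m n) * f n)"
      using cD cD2 nonneg(1) nonneg(2-4)[of n] by (intro mult_mono add_mono mult_right_mono) auto
    finally show "expectation (\<lambda>x. (S D x)\<^sup>2) \<le> (real (m n div p) + p) * (s2 + v n + 2 * e n + real (m n) * f n)" .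
  qed (use assms in auto)
  also have "t + u\<^sup>2 / t * ((real (m n div p) + p) * (s2 + v n + 2 * e n + real (m n) * f n)) =
    t + \<theta>\<^sup>2 / t * ((real (m n div p) + p) / m n * (s2 + v n + 2 * e n + real (m n) * f n))"
    unfolding u2 by (simp add: mult_ac)
  finally show ?thesis unfolding S_def u_def times_divide_eq_left .
qed

text \<open>Second-order expansion for one group. Every error carries a factor 1 / m, so the sum
  over at most m groups is no larger than the bracket, which tends to 0 for fixed p.\<close>

lemma group_char:
  assumes p: "p \<ge> 1" and n: "m n > 0" and g: "g < m n div p" and c: "c = \<theta>\<^sup>2 * real (p - 1) * s2 / 2"
  shows "cmod ((CLINT x|M. iexp (\<theta> / sqrt (m n) * (\<Sum>i\<in>group p g. T n i x))) - of_real (exp (- c / m n))) \<le>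
    (\<bar>\<theta>\<bar> powr (2 + \<delta>) * (real p powr (2 + \<delta>) * (real p * C)) * real (m n) powr (- \<delta> / 2) +
      \<theta>\<^sup>2 / 2 * (real p * (v n + 2 * e n + real p * f n)) + c\<^sup>2 / m n) / m n"
proof -
  define B where "B x = (\<Sum>i\<in>group p g. T n i x)" for x
  define u where "u = \<theta> / sqrt (m n)"
  have u2: "u\<^sup>2 = \<theta>\<^sup>2 / m n" by (simp add: u_def power_divide)
  note sub = group_subset[OF g]
  have card: "card (group p g) = p - 1" by (simp add: group_def)
  have Bm [measurable]: "B \<in> borel_measurable M" unfolding B_def[abs_def] by (rule sum_measurable[OF sub])
  have BI: "integrable M (\<lambda>x. iexp (u * B x))" by (rule integrable_iexp) measurable
  have T1: "integrable M (T n i)" if "i < m n" for i using mom_abs(1)[OF mom[OF that]] \<delta> by simp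
  have B1: "integrable M B" "expectation B = 0"
  proof -
    show "integrable M B" unfolding B_def[abs_def] using T1 sub by (intro Bochner_Integration.integrable_sum) auto
    show "expectation B = 0" unfolding B_def using T1 sub mean
      by (subst Bochner_Integration.integral_sum) (auto intro!: sum.neutral)
  qed
  have B2: "integrable M (\<lambda>x. (B x)\<^sup>2)" using sum_square(1)[OF sub] by (simp add: B_def)
  have "\<bar>expectation (\<lambda>x. (B x)\<^sup>2) - real (p - 1) * s2\<bar> \<le> real (p - 1) * (v n + 2 * e n + real (p - 1) * f n)"
    using sum_square(2)[OF sub] by (simp add: B_def card)
  also have "\<dots> \<le> real p * (v n + 2 * e n + real p * f n)"
    using nonneg(2-4)[of n] by (intro mult_mono add_mono mult_right_mono add_nonneg_nonneg mult_nonneg_nonneg) auto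
  finally have B2E: "\<bar>expectation (\<lambda>x. (B x)\<^sup>2) - real (p - 1) * s2\<bar> \<le> real p * (v n + 2 * e n + real p * f n)" .
  have Bp: "mom M (2 + \<delta>) (real p powr (2 + \<delta>) * (real p * C)) B"
  proof -
    have "mom M (2 + \<delta>) (real (p - 1) powr (2 + \<delta>) * (real (p - 1) * C)) B"
      unfolding B_def[abs_def] card[symmetric]
    proof (rule mom_sum)
      show "mom M (2 + \<delta>) C (T n i)" if "i \<in> group p g" for i using that sub by (intro mom) auto
    qed (use \<delta> in \<open>auto simp: group_def\<close>)
    moreover have "real (p - 1) powr (2 + \<delta>) * (real (p - 1) * C) \<le> real p powr (2 + \<delta>) * (real p * C)"
      using C_nonneg[OF n] \<delta> by (intro mult_mono powr_mono2) auto
    ultimately show ?thesis by (auto simp: mom_def)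
  qed
  have Bpi: "integrable M (\<lambda>x. \<bar>B x\<bar> powr (2 + \<delta>))" and BpE: "expectation (\<lambda>x. \<bar>B x\<bar> powr (2 + \<delta>)) \<le> real p powr (2 + \<delta>) * (real p * C)"
    using Bp by (auto simp: mom_def)
  have 1: "cmod ((CLINT x|M. iexp (u * B x)) - of_real (1 - u\<^sup>2 * expectation (\<lambda>x. (B x)\<^sup>2) / 2)) \<le>
    \<bar>u\<bar> powr (2 + \<delta>) * (real p powr (2 + \<delta>) * (real p * C))"
  proof -
    have i2: "integrable M (\<lambda>x. 1 + \<i> * complex_of_real (u * B x) - complex_of_real ((u * B x)\<^sup>2) / 2)"
    proof -
      have "integrable M (\<lambda>x. complex_of_real (u * B x))" using B1 by (intro integrable_of_real integrable_mult_right)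
      moreover have "integrable M (\<lambda>x. complex_of_real ((u * B x)\<^sup>2))"
        unfolding power_mult_distrib using B2 by (intro integrable_of_real integrable_mult_right)
      ultimately show ?thesis by (intro Bochner_Integration.integrable_diff Bochner_Integration.integrable_add integrable_mult_right integrable_divide) auto
    qed
    have "(CLINT x|M. 1 + \<i> * complex_of_real (u * B x) - complex_of_real ((u * B x)\<^sup>2) / 2) = of_real (1 - u\<^sup>2 * expectation (\<lambda>x. (B x)\<^sup>2) / 2)"
    proof -
      have a: "integrable M (\<lambda>x. complex_of_real (u * B x))" using B1 by (intro integrable_of_real integrable_mult_right)
      have b: "integrable M (\<lambda>x. complex_of_real ((u * B x)\<^sup>2))"
        unfolding power_mult_distrib using B2 by (intro integrable_of_real integrable_mult_right)
      have "(CLINT x|M. 1 + \<i> * complex_of_real (u * B x) - complex_of_real ((u * B x)\<^sup>2) / 2) =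
        (CLINT x|M. 1) + \<i> * (CLINT x|M. complex_of_real (u * B x)) - (CLINT x|M. complex_of_real ((u * B x)\<^sup>2)) / 2"
        using a b by (subst Bochner_Integration.integral_diff, auto simp del: of_real_mult of_real_power)
      also have "(CLINT x|M. complex_of_real (u * B x)) = of_real (u * expectation B)"
        by (subst integral_complex_of_real) (use B1 in simp)
      also have "(CLINT x|M. complex_of_real ((u * B x)\<^sup>2)) = of_real (u\<^sup>2 * expectation (\<lambda>x. (B x)\<^sup>2))"
        by (subst integral_complex_of_real) (use B2 in \<open>simp add: power_mult_distrib\<close>)
      finally show ?thesis using B1 by (simp add: prob_space)
    qed
    then have "(CLINT x|M. iexp (u * B x)) - of_real (1 - u\<^sup>2 * expectation (\<lambda>x. (B x)\<^sup>2) / 2) =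
      (CLINT x|M. iexp (u * B x) - (1 + \<i> * complex_of_real (u * B x) - complex_of_real ((u * B x)\<^sup>2) / 2))"
      using BI i2 by simp
    also have "cmod \<dots> \<le> expectation (\<lambda>x. cmod (iexp (u * B x) - (1 + \<i> * complex_of_real (u * B x) - complex_of_real ((u * B x)\<^sup>2) / 2)))"
      by (rule integral_norm_bound)
    also have "\<dots> \<le> expectation (\<lambda>x. \<bar>u\<bar> powr (2 + \<delta>) * \<bar>B x\<bar> powr (2 + \<delta>))"
    proof (intro integral_mono)
      show "cmod (iexp (u * B x) - (1 + \<i> * complex_of_real (u * B x) - complex_of_real ((u * B x)\<^sup>2) / 2)) \<le> \<bar>u\<bar> powr (2 + \<delta>) * \<bar>B x\<bar> powr (2 + \<delta>)" for x
        using iexp_approx_powr[OF \<delta>, of "u * B x"] by (simp add: abs_mult powr_mult)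
    qed (use BI i2 Bpi in auto)
    also have "\<dots> = \<bar>u\<bar> powr (2 + \<delta>) * expectation (\<lambda>x. \<bar>B x\<bar> powr (2 + \<delta>))" by simp
    also have "\<dots> \<le> \<bar>u\<bar> powr (2 + \<delta>) * (real p powr (2 + \<delta>) * (real p * C))"
      by (intro mult_left_mono BpE) auto
    finally show ?thesis .
  qed
  \<comment> \<open>The power of m is -1 - \<delta>/2; the part beyond -1 is the gain from having
    more than two moments.\<close>
  have u_powr: "\<bar>u\<bar> powr (2 + \<delta>) = \<bar>\<theta>\<bar> powr (2 + \<delta>) * real (m n) powr (- \<delta> / 2) / m n"
  proof -
    have "sqrt (m n) powr (2 + \<delta>) = real (m n) powr ((2 + \<delta>) / 2)"
      using n by (simp add: powr_half_sqrt[symmetric] powr_powr)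
    also have "\<dots> = m n * real (m n) powr (\<delta> / 2)"
      using n by (simp add: add_divide_distrib powr_add)
    finally show ?thesis
    proof -
      assume s: "sqrt (m n) powr (2 + \<delta>) = m n * real (m n) powr (\<delta> / 2)"
      have i: "real (m n) powr (- \<delta> / 2) = 1 / real (m n) powr (\<delta> / 2)"
        using powr_minus_divide[of "real (m n)" "\<delta> / 2"] by simp
      show ?thesis
        unfolding i u_def abs_divide powr_divide by (simp add: s)
    qed
  qed
  have 2: "\<bar>(1 - u\<^sup>2 * expectation (\<lambda>x. (B x)\<^sup>2) / 2) - (1 - c / m n)\<bar> \<le> \<theta>\<^sup>2 / 2 * (real p * (v n + 2 * e n + real p * f n)) / m n"
  proof -
    have "(1 - u\<^sup>2 * expectation (\<lambda>x. (B x)\<^sup>2) / 2) - (1 - c / m n) = - (\<theta>\<^sup>2 / 2 * (expectation (\<lambda>x. (B x)\<^sup>2) - real (p - 1) * s2) / m n)"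
    proof -
      have "(1 - a / k * E / 2) - (1 - a * q * s / 2 / k) = - (a / 2 * (E - q * s) / k)" for a k E q s :: real
        by (cases "k = 0") (simp_all add: field_simps)
      from this[of "\<theta>\<^sup>2" "real (m n)"] show ?thesis unfolding u2 c .
    qed
    then have "\<bar>(1 - u\<^sup>2 * expectation (\<lambda>x. (B x)\<^sup>2) / 2) - (1 - c / m n)\<bar> = \<theta>\<^sup>2 / 2 * \<bar>expectation (\<lambda>x. (B x)\<^sup>2) - real (p - 1) * s2\<bar> / m n"
      by (simp only: abs_minus_cancel abs_mult abs_divide) simp
    also have "\<dots> \<le> \<theta>\<^sup>2 / 2 * (real p * (v n + 2 * e n + real p * f n)) / m n"
      by (intro divide_right_mono mult_left_mono B2E) auto
    finally show ?thesis .
  qed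
  have "c \<ge> 0" using nonneg(1) by (simp add: c)
  then have 3: "\<bar>(1 - c / m n) - exp (- c / m n)\<bar> \<le> c\<^sup>2 / m n / m n"
    using exp_minus_approx[of "c / m n"] by (simp add: power_divide power2_eq_square abs_minus_commute)
  have 4: "cmod (complex_of_real (1 - u\<^sup>2 * expectation (\<lambda>x. (B x)\<^sup>2) / 2) - of_real (exp (- c / m n))) \<le>
     \<theta>\<^sup>2 / 2 * (real p * (v n + 2 * e n + real p * f n)) / m n + c\<^sup>2 / m n / m n"
    using 2 3 unfolding of_real_diff[symmetric] norm_of_real by linarith
  have "cmod ((CLINT x|M. iexp (u * B x)) - of_real (exp (- c / m n))) \<le>
    \<bar>u\<bar> powr (2 + \<delta>) * (real p powr (2 + \<delta>) * (real p * C)) +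
    (\<theta>\<^sup>2 / 2 * (real p * (v n + 2 * e n + real p * f n)) / m n + c\<^sup>2 / m n / m n)"
    using norm_triangle_le[OF add_mono[OF 1 4]] by simp
  also have "\<bar>u\<bar> powr (2 + \<delta>) * (real p powr (2 + \<delta>) * (real p * C)) +
    (\<theta>\<^sup>2 / 2 * (real p * (v n + 2 * e n + real p * f n)) / m n + c\<^sup>2 / m n / m n) =
    (\<bar>\<theta>\<bar> powr (2 + \<delta>) * (real p powr (2 + \<delta>) * (real p * C)) * real (m n) powr (- \<delta> / 2) +
      \<theta>\<^sup>2 / 2 * (real p * (v n + 2 * e n + real p * f n)) + c\<^sup>2 / m n) / m n"
    unfolding u_powr add_divide_distrib times_divide_eq_left by (simp only: mult_ac add_ac)
  finally show ?thesis unfolding u_def B_def .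
qed

theorem char_convergence:
  "(\<lambda>n. CLINT x|M. iexp (\<theta> * (\<Sum>i<m n. T n i x) / sqrt (m n))) \<longlonglongrightarrow> of_real (exp (- (\<theta>\<^sup>2 * s2 / 2)))"
proof (rule tendstoI)
  fix \<epsilon> :: real assume \<epsilon>: "\<epsilon> > 0"
  \<comment> \<open>Budget: 2 t for the discarded indices, less than t for decoupling and expansion
    together, 2 t for the exponent.\<close>
  define t where "t = \<epsilon> / 5"
  have t: "t > 0" using \<epsilon> by (simp add: t_def)
  have "(\<lambda>p. \<theta>\<^sup>2 / t * (2 / real p * (s2 + 1))) \<longlonglongrightarrow> \<theta>\<^sup>2 / t * (0 * (s2 + 1))"
    by (intro tendsto_intros lim_const_over_n)
  then have "(\<lambda>p. \<theta>\<^sup>2 / t * (2 / real p * (s2 + 1))) \<longlonglongrightarrow> 0" by simp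
  then have ev1: "\<forall>\<^sub>F p in sequentially. \<theta>\<^sup>2 / t * (2 / real p * (s2 + 1)) < t"
    using t by (rule order_tendstoD)
  have "(\<lambda>p. exp (- (\<theta>\<^sup>2 * (real p - 1) * s2 / 2 / real p))) \<longlonglongrightarrow> exp (- (\<theta>\<^sup>2 * s2 / 2))"
  proof (rule Lim_transform_eventually)
    have "(\<lambda>p. exp (- (\<theta>\<^sup>2 * s2 / 2 * (1 - 1 / real p)))) \<longlonglongrightarrow> exp (- (\<theta>\<^sup>2 * s2 / 2 * (1 - 0)))"
      by (intro tendsto_intros lim_const_over_n)
    then show "(\<lambda>p. exp (- (\<theta>\<^sup>2 * s2 / 2 * (1 - 1 / real p)))) \<longlonglongrightarrow> exp (- (\<theta>\<^sup>2 * s2 / 2))" by simp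
    show "\<forall>\<^sub>F p in sequentially. exp (- (\<theta>\<^sup>2 * s2 / 2 * (1 - 1 / real p))) = exp (- (\<theta>\<^sup>2 * (real p - 1) * s2 / 2 / real p))"
      using eventually_gt_at_top[of 0] by eventually_elim (simp add: field_simps)
  qed
  then have ev2: "\<forall>\<^sub>F p in sequentially. dist (exp (- (\<theta>\<^sup>2 * (real p - 1) * s2 / 2 / real p))) (exp (- (\<theta>\<^sup>2 * s2 / 2))) < t"
    using t by (rule tendstoD)
  \<comment> \<open>\<open>p\<close> is fixed before \<open>n\<close> grows. It makes the discarded
    share 2/p of the variance small and brings (p - 1)/p close to 1.\<close>
  obtain p :: nat where p: "p \<ge> 1" "\<theta>\<^sup>2 / t * (2 / real p * (s2 + 1)) < t"
    "dist (exp (- (\<theta>\<^sup>2 * (real p - 1) * s2 / 2 / real p))) (exp (- (\<theta>\<^sup>2 * s2 / 2))) < t"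
    using eventually_happens'[OF sequentially_bot eventually_conj[OF eventually_conj[OF ev1 ev2] eventually_ge_at_top[of 1]]] by auto
  define c where "c = \<theta>\<^sup>2 * real (p - 1) * s2 / 2"
  have c0: "c \<ge> 0" using nonneg(1) by (simp add: c_def)
  define \<eta> where "\<eta> n = \<bar>\<theta>\<bar> powr (2 + \<delta>) * (real p powr (2 + \<delta>) * (real p * C)) * real (m n) powr (- \<delta> / 2) +
      \<theta>\<^sup>2 / 2 * (real p * (v n + 2 * e n + real p * f n)) + c\<^sup>2 / m n" for n
  have mr: "filterlim (\<lambda>n. real (m n)) at_top sequentially"
    using filterlim_compose[OF filterlim_real_sequentially m] .
  have f0: "f \<longlonglongrightarrow> 0"
  proof (rule tendsto_sandwich[OF _ _ tendsto_const lim(3)])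
    show "\<forall>\<^sub>F n in sequentially. f n \<le> real (m n) * f n"
      using filterlim_at_top[THEN iffD1, OF mr, rule_format, of 1]
    proof eventually_elim
      case (elim n)
      from mult_right_mono[OF this nonneg(4)[of n]] show ?case by simp
    qed
  qed (use nonneg(4) in auto)
  have "\<eta> \<longlonglongrightarrow> \<bar>\<theta>\<bar> powr (2 + \<delta>) * (real p powr (2 + \<delta>) * (real p * C)) * 0 +
      \<theta>\<^sup>2 / 2 * (real p * (0 + 2 * 0 + real p * 0)) + 0"
    unfolding \<eta>_def
    by (intro tendsto_intros lim f0 tendsto_neg_powr mr real_tendsto_divide_at_top[OF tendsto_const mr]) (use \<delta> in auto)
  then have \<eta>0: "\<eta> \<longlonglongrightarrow> 0" by simp
  have wm: "(\<lambda>n. real (m n div p) / real (m n)) \<longlonglongrightarrow> 1 / real p"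
  proof (rule tendsto_sandwich)
    show "\<forall>\<^sub>F n in sequentially. 1 / real p - 1 / real (m n) \<le> real (m n div p) / real (m n)"
      using filterlim_at_top[THEN iffD1, OF mr, rule_format, of 1]
    proof eventually_elim
      case (elim n)
      have "real (m n) = real (m n div p) * real p + real (m n mod p)"
        by (metis div_mult_mod_eq of_nat_add of_nat_mult)
      moreover have "real (m n mod p) \<le> real p" using p(1) by (simp add: less_imp_le)
      ultimately have "real (m n) / real p - 1 \<le> real (m n div p)" using p(1) by (simp add: divide_le_eq algebra_simps)
      then have "(real (m n) / real p - 1) / real (m n) \<le> real (m n div p) / real (m n)"
        by (rule divide_right_mono) simp
      then show ?case using elim by (simp add: diff_divide_distrib)
    qed
    show "\<forall>\<^sub>F n in sequentially. real (m n div p) / real (m n) \<le> 1 / real p"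
      using filterlim_at_top[THEN iffD1, OF mr, rule_format, of 1]
    proof eventually_elim
      case (elim n)
      have "real (m n div p) * real p \<le> real (m n)"
        by (metis div_times_less_eq_dividend of_nat_le_iff of_nat_mult)
      then show ?case using elim p(1) by (simp add: field_simps)
    qed
    show "(\<lambda>n. 1 / real p - 1 / real (m n)) \<longlonglongrightarrow> 1 / real p"
      using tendsto_diff[OF tendsto_const real_tendsto_divide_at_top[OF tendsto_const mr], of "1 / real p" 1] by simp
  qed simp
  have "(\<lambda>n. exp (- c * (real (m n div p) / real (m n)))) \<longlonglongrightarrow> exp (- c * (1 / real p))"
    by (intro tendsto_intros wm)
  then have ev3: "\<forall>\<^sub>F n in sequentially. dist (exp (- c * (real (m n div p) / real (m n)))) (exp (- c * (1 / real p))) < t"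
    using t by (rule tendstoD)
  have "(\<lambda>n. \<eta> n + real (m n) * \<beta> n) \<longlonglongrightarrow> 0" using tendsto_add[OF \<eta>0 lim(4)] by simp
  then have ev4: "\<forall>\<^sub>F n in sequentially. \<eta> n + real (m n) * \<beta> n < t" using t by (rule order_tendstoD)
  have "(\<lambda>n. v n + 2 * e n + real (m n) * f n) \<longlonglongrightarrow> 0 + 2 * 0 + 0" by (intro tendsto_intros lim)
  then have ev5: "\<forall>\<^sub>F n in sequentially. v n + 2 * e n + real (m n) * f n < 1" by (intro order_tendstoD) auto
  \<comment> \<open>Once m >= p^2, the incomplete run has length at most m/p, so at most 2 m / p
    indices are discarded.\<close>
  have "\<forall>\<^sub>F n in sequentially. m n \<ge> p * p"
    using filterlim_at_top[THEN iffD1, OF m] by blast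
  with ev3 ev4 ev5
  show "\<forall>\<^sub>F n in sequentially. dist (CLINT x|M. iexp (\<theta> * (\<Sum>i<m n. T n i x) / sqrt (m n))) (of_real (exp (- (\<theta>\<^sup>2 * s2 / 2)))) < \<epsilon>"
  proof eventually_elim
    case (elim n)
    have mpos: "m n > 0" using elim(4) p(1) by (cases "m n") auto
    let ?w = "m n div p"
    let ?K = "\<Union>g<?w. group p g"
    let ?E = "\<lambda>D. CLINT x|M. iexp (\<theta> / sqrt (m n) * (\<Sum>i\<in>D. T n i x))"
    have 1: "cmod ((CLINT x|M. iexp (\<theta> * (\<Sum>i<m n. T n i x) / sqrt (m n))) - ?E ?K) \<le> 2 * t"
    proof -
      have "real ?w + p \<le> 2 * real (m n) / p"
      proof -
        have "real ?w * real p \<le> real (m n)" by (metis div_times_less_eq_dividend of_nat_le_iff of_nat_mult)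
        moreover have "real p * real p \<le> real (m n)" using elim(4) by (metis of_nat_le_iff of_nat_mult)
        ultimately show ?thesis using p(1) by (simp add: field_simps)
      qed
      then have "(real ?w + p) / m n \<le> 2 / p" using mpos p(1) by (simp add: field_simps)
      then have "(real ?w + p) / m n * (s2 + v n + 2 * e n + real (m n) * f n) \<le> 2 / p * (s2 + 1)"
        using elim(3) nonneg(1) nonneg(2-4)[of n] by (intro mult_mono) auto
      then have "\<theta>\<^sup>2 / t * ((real ?w + p) / m n * (s2 + v n + 2 * e n + real (m n) * f n)) \<le> \<theta>\<^sup>2 / t * (2 / p * (s2 + 1))"
        using t by (intro mult_left_mono) auto
      with discard_error[OF p(1) t mpos refl, of \<theta>] p(2) show ?thesis by linarith
    qed
    have 2: "cmod (?E ?K - (\<Prod>g<?w. ?E (group p g))) \<le> real (m n) * \<beta> n"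
    proof -
      have "real ?w * \<beta> n \<le> real (m n) * \<beta> n" using nonneg(5)[of n] by (intro mult_right_mono) auto
      with group_decouple[of ?w n p "\<theta> / sqrt (m n)"] show ?thesis by simp
    qed
    have 3: "cmod ((\<Prod>g<?w. ?E (group p g)) - (\<Prod>g<?w. complex_of_real (exp (- c / m n)))) \<le> \<eta> n"
    proof -
      have \<eta>n: "\<eta> n \<ge> 0"
        unfolding \<eta>_def using nonneg(2-4)[of n] C_nonneg[OF mpos] by (intro add_nonneg_nonneg mult_nonneg_nonneg) auto
      have "cmod ((\<Prod>g<?w. ?E (group p g)) - (\<Prod>g<?w. complex_of_real (exp (- c / m n)))) \<le> (\<Sum>g<?w. cmod (?E (group p g) - complex_of_real (exp (- c / m n))))"
      proof (rule norm_prod_diff)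
        show "cmod (?E (group p g)) \<le> 1" for g by (rule iexp_expectation_le_1)
        show "cmod (complex_of_real (exp (- c / m n))) \<le> 1" using c0 by simp
      qed
      also have "\<dots> \<le> (\<Sum>g<?w. \<eta> n / m n)"
        using group_char[OF p(1) mpos _ c_def] by (intro sum_mono) (simp add: \<eta>_def)
      also have "\<dots> = real ?w / m n * \<eta> n" by simp
      also have "\<dots> \<le> 1 * \<eta> n" using \<eta>n mpos by (intro mult_right_mono) auto
      finally show ?thesis by simp
    qed
    have 4: "(\<Prod>g<?w. complex_of_real (exp (- c / m n))) = of_real (exp (- c * (real ?w / m n)))"
      by (simp add: exp_of_nat_mult[symmetric] mult.commute flip: of_real_power)
    have c': "exp (- c * (1 / real p)) = exp (- (\<theta>\<^sup>2 * (real p - 1) * s2 / 2 / real p))"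
      using p(1) by (simp add: c_def of_nat_diff)
    have 5: "cmod (of_real (exp (- c * (real ?w / m n))) - of_real (exp (- (\<theta>\<^sup>2 * s2 / 2)))) \<le> 2 * t"
      using elim(1) p(3) unfolding c' of_real_diff[symmetric] norm_of_real dist_real_def by linarith
    have "cmod ((CLINT x|M. iexp (\<theta> * (\<Sum>i<m n. T n i x) / sqrt (m n))) - of_real (exp (- (\<theta>\<^sup>2 * s2 / 2)))) \<le>
      2 * t + real (m n) * \<beta> n + \<eta> n + 2 * t"
      by (rule norm_diff_triangle_le[OF norm_diff_triangle_le[OF norm_diff_triangle_le[OF 1 2] 3[unfolded 4]] 5])
    also have "\<dots> < \<epsilon>" using elim(2) t by (simp add: t_def)
    finally show ?case by (simp add: dist_norm)
  qed
qed

end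

section \<open>Stationary processes\<close>

lemma atMost_pred_vec: "{z::real^'d. z \<le> x} \<in> sets borel"
  using borel_closed[OF closed_eucl_atMost[of x]] by (simp add: atMost_def)

locale stationary_process = prob_space M for M :: "'a measure" +
  fixes X :: "int \<Rightarrow> 'a \<Rightarrow> real^'d"
  assumes stationary: "strictly_stationary M X"
begin

lemma X_measurable [measurable]: "X t \<in> borel_measurable M"
  using stationary by (simp add: strictly_stationary_def)

definition path :: "int set \<Rightarrow> int \<Rightarrow> 'a \<Rightarrow> int \<Rightarrow> real^'d" where
  "path J u \<omega> = (\<lambda>t\<in>J. X (t + u) \<omega>)"

lemma path_measurable [measurable]: "path J u \<in> measurable M (Pi\<^sub>M J (\<lambda>_. borel))"
  unfolding path_def[abs_def] by measurable

lemma path_distr: "finite J \<Longrightarrow> distr M (Pi\<^sub>M J (\<lambda>_. borel)) (path J u) = distr M (Pi\<^sub>M J (\<lambda>_. borel)) (path J 0)"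
  using stationary unfolding strictly_stationary_def path_def[abs_def] by simp

lemma path_prob:
  assumes "finite J" and "S \<in> sets (Pi\<^sub>M J (\<lambda>_. borel))"
  shows "prob {\<omega>\<in>space M. path J u \<omega> \<in> S} = prob {\<omega>\<in>space M. path J 0 \<omega> \<in> S}"
proof -
  have "prob {\<omega>\<in>space M. path J v \<omega> \<in> S} = measure (distr M (Pi\<^sub>M J (\<lambda>_. borel)) (path J v)) S" for v
    using measure_distr[OF path_measurable assms(2), of v] by (simp add: vimage_def Int_def conj_commute)
  then show ?thesis by (simp only: path_distr[OF assms(1), of u])
qed

text \<open>The \<sigma>-algebra generated by the \<open>X t\<close> with t in \<open>J\<close>, for
  any set \<open>J\<close>: nothing refers to the past. It is a measure only in order to express
  measurability.\<close>

definition past_algebra :: "int set \<Rightarrow> 'a measure" where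
  "past_algebra J = vimage_algebra (space M) (path J 0) (Pi\<^sub>M J (\<lambda>_. borel))"

lemma space_past_algebra [simp]: "space (past_algebra J) = space M"
  by (simp add: past_algebra_def)

lemma past_algebra_subset: "sets (past_algebra J) \<subseteq> events"
proof -
  have "path J 0 \<in> space M \<rightarrow> space (Pi\<^sub>M J (\<lambda>_. borel :: (real^'d) measure))"
    using measurable_space[OF path_measurable] by auto
  then show ?thesis
    unfolding past_algebra_def by (subst sets_vimage_algebra2) (auto intro: measurable_sets[OF path_measurable])
qed

lemma past_algebra_sets:
  "sets (past_algebra J) = {{\<omega>\<in>space M. path J 0 \<omega> \<in> S} |S. S \<in> sets (Pi\<^sub>M J (\<lambda>_. borel))}"
proof -
  have "path J 0 \<in> space M \<rightarrow> space (Pi\<^sub>M J (\<lambda>_. borel :: (real^'d) measure))"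
    using measurable_space[OF path_measurable] by auto
  moreover have "path J 0 -` S \<inter> space M = {\<omega>\<in>space M. path J 0 \<omega> \<in> S}" for S by auto
  ultimately show ?thesis
    unfolding past_algebra_def by (simp add: sets_vimage_algebra2)
qed

lemma path_past_measurable: "path J 0 \<in> measurable (past_algebra J) (Pi\<^sub>M J (\<lambda>_. borel))"
  unfolding past_algebra_def by (rule measurable_vimage_algebra1) (use measurable_space[OF path_measurable] in auto)

lemma past_measurable:
  assumes "\<Phi> \<in> measurable (Pi\<^sub>M J (\<lambda>_. borel)) N"
  shows "(\<lambda>\<omega>. \<Phi> (path J 0 \<omega>)) \<in> measurable (past_algebra J) N"
  using measurable_compose[OF path_past_measurable assms] .

lemma gen_events_path:
  assumes "\<And>t. t \<in> J \<Longrightarrow> t + u \<in> T" "S \<in> sets (Pi\<^sub>M J (\<lambda>_. borel))"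
  shows "{\<omega>\<in>space M. path J u \<omega> \<in> S} \<in> gen_events M X T"
proof -
  define N where "N = sigma (space M) (\<Union>t\<in>T. (\<lambda>S. X t -` S \<inter> space M) ` sets borel)"
  have sp: "space N = space M" unfolding N_def by (rule space_measure_of) auto
  have st: "sets N = gen_events M X T" unfolding N_def gen_events_def by (rule sets_measure_of) auto
  have [measurable]: "X (t + u) \<in> borel_measurable N" if "t \<in> J" for t
  proof (rule measurableI)
    fix A :: "(real^'d) set" assume "A \<in> sets borel"
    then show "X (t + u) -` A \<inter> space N \<in> sets N"
      unfolding st gen_events_def sp using assms(1)[OF that] by (intro sigma_sets.Basic) auto
  qed auto
  have "path J u \<in> measurable N (Pi\<^sub>M J (\<lambda>_. borel))"
    unfolding path_def[abs_def] by (rule measurable_restrict) simp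
  from measurable_sets[OF this assms(2)] show ?thesis
    by (simp add: sp st vimage_def Int_def conj_commute)
qed

text \<open>A supremum of reals dominates its members only over a bounded set; here 1 is a
  bound.\<close>

lemma alpha_mix_upper:
  assumes "A \<in> gen_events M X {..0}" "B \<in> gen_events M X {int p..}"
  shows "\<bar>prob (A \<inter> B) - prob A * prob B\<bar> \<le> alpha_mix M X p"
proof -
  have "bdd_above ((\<lambda>(A, B). \<bar>prob (A \<inter> B) - prob A * prob B\<bar>) ` (gen_events M X {..0} \<times> gen_events M X {int p..}))"
  proof (rule bdd_aboveI[of _ 1])
    fix z assume "z \<in> (\<lambda>(A, B). \<bar>prob (A \<inter> B) - prob A * prob B\<bar>) ` (gen_events M X {..0} \<times> gen_events M X {int p..})"
    then obtain A B where z: "z = \<bar>prob (A \<inter> B) - prob A * prob B\<bar>" by auto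
    have "0 \<le> prob A * prob B" "prob A * prob B \<le> 1" "0 \<le> prob (A \<inter> B)" "prob (A \<inter> B) \<le> 1"
      by (auto intro: mult_le_one)
    then show "z \<le> 1" unfolding z abs_le_iff by linarith
  qed
  from cSUP_upper[OF _ this, of "(A, B)"] show ?thesis
    unfolding alpha_mix_def using assms by simp
qed

lemma alpha_mix_nonneg: "alpha_mix M X p \<ge> 0"
proof -
  have "{} \<in> gen_events M X T" for T unfolding gen_events_def by (rule sigma_sets.Empty)
  from alpha_mix_upper[OF this this, of p] show ?thesis by simp
qed

text \<open>The mixing coefficient splits time at 0, and stationarity moves the split to
  \<open>c\<close>. Stationarity is a statement about finite-dimensional laws, hence the finite
  index sets.\<close>

lemma alpha_bound_past:
  assumes J: "finite J1" "finite J2" "J1 \<subseteq> {..c}" "J2 \<subseteq> {c + int p..}"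
  shows "alpha_bound M (past_algebra J1) (past_algebra J2) (alpha_mix M X p)"
proof -
  have "\<bar>prob (A \<inter> B) - prob A * prob B\<bar> \<le> alpha_mix M X p"
    if ABs: "A \<in> sets (past_algebra J1)" "B \<in> sets (past_algebra J2)" for A B
  proof -
    obtain S1 where S1: "S1 \<in> sets (Pi\<^sub>M J1 (\<lambda>_. borel))" and A: "A = {\<omega>\<in>space M. path J1 0 \<omega> \<in> S1}"
      using ABs(1) unfolding past_algebra_sets by auto
    obtain S2 where S2: "S2 \<in> sets (Pi\<^sub>M J2 (\<lambda>_. borel))" and B: "B = {\<omega>\<in>space M. path J2 0 \<omega> \<in> S2}"
      using ABs(2) unfolding past_algebra_sets by auto
    let ?J = "J1 \<union> J2"
    \<comment> \<open>Both events are written as one event on the path over the union, so that a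
      single shift carries the joint probability along.\<close>
    define S where "S = {y\<in>space (Pi\<^sub>M ?J (\<lambda>_. borel)). restrict y J1 \<in> S1 \<and> restrict y J2 \<in> S2}"
    have S: "S \<in> sets (Pi\<^sub>M ?J (\<lambda>_. borel))"
    proof -
      have "(\<lambda>y. restrict y J1) \<in> measurable (Pi\<^sub>M ?J (\<lambda>_. borel)) (Pi\<^sub>M J1 (\<lambda>_. borel :: (real^'d) measure))"
        "(\<lambda>y. restrict y J2) \<in> measurable (Pi\<^sub>M ?J (\<lambda>_. borel)) (Pi\<^sub>M J2 (\<lambda>_. borel :: (real^'d) measure))"
        by (auto intro: measurable_restrict_subset)
      then show ?thesis unfolding S_def using S1 S2 by measurable
    qed
    have r: "restrict (path ?J u \<omega>) J1 = path J1 u \<omega>" "restrict (path ?J u \<omega>) J2 = path J2 u \<omega>" for u \<omega>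
      by (auto simp: path_def restrict_def)
    have AB: "{\<omega>\<in>space M. path ?J u \<omega> \<in> S} = {\<omega>\<in>space M. path J1 u \<omega> \<in> S1} \<inter> {\<omega>\<in>space M. path J2 u \<omega> \<in> S2}" for u
      using measurable_space[OF path_measurable[of ?J u]] by (auto simp: S_def r)
    let ?A = "{\<omega>\<in>space M. path J1 (- c) \<omega> \<in> S1}" and ?B = "{\<omega>\<in>space M. path J2 (- c) \<omega> \<in> S2}"
    have "prob (A \<inter> B) = prob (?A \<inter> ?B)"
      using path_prob[OF _ S, of "- c"] J unfolding AB A B by simp
    moreover have "prob A = prob ?A" "prob B = prob ?B"
      using path_prob[OF J(1) S1, of "- c"] path_prob[OF J(2) S2, of "- c"] by (simp_all add: A B)
    moreover have "?A \<in> gen_events M X {..0}" "?B \<in> gen_events M X {int p..}"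
      using J(3,4) S1 S2 by (auto intro!: gen_events_path)
    ultimately show ?thesis using alpha_mix_upper[of ?A ?B p] by simp
  qed
  then show ?thesis
    unfolding alpha_bound_def using past_algebra_subset by auto
qed

section \<open>Joint non-exceedance probabilities on two sets of positions\<close>

definition Q :: "int set \<Rightarrow> int set \<Rightarrow> real^'d \<Rightarrow> real^'d \<Rightarrow> real" where
  "Q A B u v = prob {\<omega>\<in>space M. (\<forall>t\<in>A. X t \<omega> \<le> u) \<and> (\<forall>t\<in>B. X t \<omega> \<le> v)}"

lemma Q_set_eq:
  "A \<subseteq> J \<Longrightarrow> B \<subseteq> J \<Longrightarrow> {\<omega>\<in>space M. (\<forall>t\<in>A. X (t + c) \<omega> \<le> u) \<and> (\<forall>t\<in>B. X (t + c) \<omega> \<le> v)} =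
    {\<omega>\<in>space M. path J c \<omega> \<in> {y\<in>space (Pi\<^sub>M J (\<lambda>_. borel)). (\<forall>t\<in>A. y t \<le> u) \<and> (\<forall>t\<in>B. y t \<le> v)}}"
  using measurable_space[OF path_measurable[of J c]] by (auto simp: path_def subset_iff)

lemma Q_path_set:
  assumes "finite A" "finite B" "A \<subseteq> J" "B \<subseteq> J"
  shows "{y\<in>space (Pi\<^sub>M J (\<lambda>_. borel)). (\<forall>t\<in>A. y t \<le> u) \<and> (\<forall>t\<in>B. y t \<le> v)} \<in> sets (Pi\<^sub>M J (\<lambda>_. borel :: (real^'d) measure))"
proof -
  have *: "{y\<in>space (Pi\<^sub>M J (\<lambda>_. borel :: (real^'d) measure)). y t \<le> u} \<in> sets (Pi\<^sub>M J (\<lambda>_. borel))" if "t \<in> J" for t u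
    using measurable_sets[OF measurable_component_singleton[OF that] atMost_pred_vec[of u]]
    by (simp add: vimage_def Int_def conj_commute)
  show ?thesis
    using assms by (intro sets.sets_Collect_conj sets.sets_Collect_finite_All' sets.sets_Collect_finite_All *) auto
qed

lemma Q_sets:
  assumes "finite A" "finite B"
  shows "{\<omega>\<in>space M. (\<forall>t\<in>A. X t \<omega> \<le> u) \<and> (\<forall>t\<in>B. X t \<omega> \<le> v)} \<in> events"
proof -
  have "path (A \<union> B) 0 -` {y\<in>space (Pi\<^sub>M (A \<union> B) (\<lambda>_. borel)). (\<forall>t\<in>A. y t \<le> u) \<and> (\<forall>t\<in>B. y t \<le> v)} \<inter> space M \<in> events"
    by (intro measurable_sets[OF path_measurable] Q_path_set assms) auto
  also have "path (A \<union> B) 0 -` {y\<in>space (Pi\<^sub>M (A \<union> B) (\<lambda>_. borel)). (\<forall>t\<in>A. y t \<le> u) \<and> (\<forall>t\<in>B. y t \<le> v)} \<inter> space M =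
    {\<omega>\<in>space M. (\<forall>t\<in>A. X t \<omega> \<le> u) \<and> (\<forall>t\<in>B. X t \<omega> \<le> v)}"
    using Q_set_eq[of A "A \<union> B" B 0 u v] by auto
  finally show ?thesis .
qed

lemma Q_bounds: "0 \<le> Q A B u v" "Q A B u v \<le> 1"
  by (auto simp: Q_def)

lemma Q_empty [simp]: "Q {} {} u v = 1"
  by (simp add: Q_def prob_space)

lemma Q_swap: "Q A B u v = Q B A v u"
  by (simp add: Q_def conj_commute)

lemma Q_right_empty: "Q A {} u v = Q A {} u w"
  by (simp add: Q_def)

lemma Q_shift:
  assumes "finite A" "finite B"
  shows "Q ((\<lambda>t. t + c) ` A) ((\<lambda>t. t + c) ` B) u v = Q A B u v"
proof -
  let ?J = "A \<union> B"
  have "prob {\<omega>\<in>space M. path ?J c \<omega> \<in> {y\<in>space (Pi\<^sub>M ?J (\<lambda>_. borel)). (\<forall>t\<in>A. y t \<le> u) \<and> (\<forall>t\<in>B. y t \<le> v)}} =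
    prob {\<omega>\<in>space M. path ?J 0 \<omega> \<in> {y\<in>space (Pi\<^sub>M ?J (\<lambda>_. borel)). (\<forall>t\<in>A. y t \<le> u) \<and> (\<forall>t\<in>B. y t \<le> v)}}"
    using assms by (intro path_prob Q_path_set) auto
  then show ?thesis
    using Q_set_eq[of A ?J B c u v] Q_set_eq[of A ?J B 0 u v] by (simp add: Q_def)
qed

lemma Q_mono:
  assumes "finite A'" "finite B'" "A' \<subseteq> A" "B' \<subseteq> B" "finite A" "finite B"
  shows "Q A B u v \<le> Q A' B' u v"
  unfolding Q_def using assms by (intro finite_measure_mono Q_sets) auto

lemma Q_mix:
  assumes fin: "finite A1" "finite B1" "finite A2" "finite B2"
    and c: "A1 \<union> B1 \<subseteq> {..c}" "A2 \<union> B2 \<subseteq> {c + int p..}"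
  shows "\<bar>Q (A1 \<union> A2) (B1 \<union> B2) u v - Q A1 B1 u v * Q A2 B2 u v\<bar> \<le> alpha_mix M X p"
proof -
  let ?E = "\<lambda>A B. {\<omega>\<in>space M. (\<forall>t\<in>A. X t \<omega> \<le> u) \<and> (\<forall>t\<in>B. X t \<omega> \<le> v)}"
  have E: "?E A B \<in> sets (past_algebra (A \<union> B))" if "finite A" "finite B" for A B
  proof -
    have "path (A \<union> B) 0 -` {y\<in>space (Pi\<^sub>M (A \<union> B) (\<lambda>_. borel)). (\<forall>t\<in>A. y t \<le> u) \<and> (\<forall>t\<in>B. y t \<le> v)} \<inter> space (past_algebra (A \<union> B)) \<in> sets (past_algebra (A \<union> B))"
      by (intro measurable_sets[OF path_past_measurable] Q_path_set that) auto
    also have "path (A \<union> B) 0 -` {y\<in>space (Pi\<^sub>M (A \<union> B) (\<lambda>_. borel)). (\<forall>t\<in>A. y t \<le> u) \<and> (\<forall>t\<in>B. y t \<le> v)} \<inter> space (past_algebra (A \<union> B)) = ?E A B"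
      using Q_set_eq[of A "A \<union> B" B 0 u v] by auto
    finally show ?thesis .
  qed
  have "alpha_bound M (past_algebra (A1 \<union> B1)) (past_algebra (A2 \<union> B2)) (alpha_mix M X p)"
    by (rule alpha_bound_past) (use fin c in auto)
  with E[OF fin(1,2)] E[OF fin(3,4)]
  have "\<bar>prob (?E A1 B1 \<inter> ?E A2 B2) - prob (?E A1 B1) * prob (?E A2 B2)\<bar> \<le> alpha_mix M X p"
    unfolding alpha_bound_def by blast
  moreover have "?E A1 B1 \<inter> ?E A2 B2 = ?E (A1 \<union> A2) (B1 \<union> B2)" by auto
  ultimately show ?thesis by (simp add: Q_def)
qed

definition K :: "nat \<Rightarrow> real^'d \<Rightarrow> real" where
  "K c u = Q {1..int c} {} u u"

lemma Q_interval: "Q {s + 1..s + int c} {} u v = K c u" "Q {} {s + 1..s + int c} v u = K c u"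
proof -
  have img: "(\<lambda>t. t + s) ` {1..int c} = {s + 1..s + int c}"
    unfolding image_add_atLeastAtMost' by (simp add: add.commute)
  have "Q {s + 1..s + int c} {} u v = Q {s + 1..s + int c} {} u u" by (rule Q_right_empty)
  also have "\<dots> = Q ((\<lambda>t. t + s) ` {1..int c}) ((\<lambda>t. t + s) ` {}) u u" by (simp only: img image_empty)
  also have "\<dots> = K c u" unfolding K_def by (rule Q_shift) auto
  finally show "Q {s + 1..s + int c} {} u v = K c u" .
  then show "Q {} {s + 1..s + int c} v u = K c u"
    by (simp add: Q_swap[of "{}"])
qed

lemma K_bounds: "0 \<le> K c u" "K c u \<le> 1"
  by (auto simp: K_def Q_bounds)

lemma K_antimono: "c \<le> c' \<Longrightarrow> K c' u \<le> K c u"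
  unfolding K_def by (rule Q_mono) auto

text \<open>A union bound: the two events differ only if a level is exceeded at one of the added
  positions.\<close>

lemma Q_remove:
  assumes "finite A" "finite B" "finite A'" "finite B'"
  shows "Q A B u v - Q (A \<union> A') (B \<union> B') u v \<le> (1 - Q A' {} u v) + (1 - Q {} B' u v)"
proof -
  let ?E = "\<lambda>A B. {\<omega>\<in>space M. (\<forall>t\<in>A. X t \<omega> \<le> u) \<and> (\<forall>t\<in>B. X t \<omega> \<le> v)}"
  note [measurable] = Q_sets
  have "?E A B \<subseteq> ?E (A \<union> A') (B \<union> B') \<union> (space M - ?E A' {}) \<union> (space M - ?E {} B')" by auto
  then have "prob (?E A B) \<le> prob (?E (A \<union> A') (B \<union> B') \<union> (space M - ?E A' {}) \<union> (space M - ?E {} B'))"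
    using assms by (intro finite_measure_mono sets.Un sets.Diff Q_sets) auto
  also have "\<dots> \<le> prob (?E (A \<union> A') (B \<union> B')) + prob (space M - ?E A' {}) + prob (space M - ?E {} B')"
    using assms by (intro order_trans[OF measure_Un_le] add_right_mono measure_Un_le) (auto intro!: sets.Un sets.Diff Q_sets)
  also have "prob (space M - ?E A' {}) = 1 - prob (?E A' {})"
    using assms by (intro prob_compl Q_sets) auto
  also have "prob (space M - ?E {} B') = 1 - prob (?E {} B')"
    using assms by (intro prob_compl Q_sets) auto
  finally show ?thesis by (simp add: Q_def)
qed

text \<open>Positions in the gap \<open>{c - l<..c}\<close> are dropped before the mixing bound is applied, at a cost
  of at most the exceedance probability over a stretch of length \<open>l\<close>.\<close>

lemma Q_cut:
  assumes fin: "finite A" "finite B"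
  shows "\<bar>Q A B u v - Q (A \<inter> {..c}) (B \<inter> {..c}) u v * Q (A \<inter> {c<..}) (B \<inter> {c<..}) u v\<bar> \<le>
    alpha_mix M X l + 2 * ((1 - K l u) + (1 - K l v))"
proof -
  define g where "g = (1 - K l u) + (1 - K l v)"
  define d where "d = c - int l"
  define A1 B1 where "A1 = A \<inter> {..d}" and "B1 = B \<inter> {..d}"
  define A2 B2 where "A2 = A \<inter> {c<..}" and "B2 = B \<inter> {c<..}"
  define Ag Bg where "Ag = A \<inter> {d<..c}" and "Bg = B \<inter> {d<..c}"
  have f: "finite A1" "finite B1" "finite A2" "finite B2" "finite Ag" "finite Bg"
    using fin by (auto simp: A1_def B1_def A2_def B2_def Ag_def Bg_def)
  \<comment> \<open>The bound \<open>g\<close> is paid twice, for restoring the gap in the whole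
    event and for restoring it in the left factor; this is the factor 2 in the claim.\<close>
  have gap: "(1 - Q Ag {} u v) + (1 - Q {} Bg u v) \<le> g"
  proof -
    have "Q {d + 1..d + int l} {} u v \<le> Q Ag {} u v" "Q {} {d + 1..d + int l} u v \<le> Q {} Bg u v"
      by (rule Q_mono; use f in \<open>auto simp: Ag_def Bg_def d_def\<close>)+
    then show ?thesis unfolding Q_interval g_def by simp
  qed
  have U: "(A1 \<union> A2) \<union> Ag = A" "(B1 \<union> B2) \<union> Bg = B" "A1 \<union> Ag = A \<inter> {..c}" "B1 \<union> Bg = B \<inter> {..c}"
    by (auto simp: A1_def B1_def A2_def B2_def Ag_def Bg_def d_def)
  have 1: "0 \<le> Q (A1 \<union> A2) (B1 \<union> B2) u v - Q A B u v" "Q (A1 \<union> A2) (B1 \<union> B2) u v - Q A B u v \<le> g"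
    using Q_remove[of "A1 \<union> A2" "B1 \<union> B2" Ag Bg u v] gap f Q_mono[of "A1 \<union> A2" "B1 \<union> B2" A B u v] fin
    unfolding U by (auto simp: A1_def B1_def A2_def B2_def)
  have 2: "0 \<le> Q A1 B1 u v - Q (A \<inter> {..c}) (B \<inter> {..c}) u v" "Q A1 B1 u v - Q (A \<inter> {..c}) (B \<inter> {..c}) u v \<le> g"
  proof -
    have "A1 \<subseteq> A \<inter> {..c}" "B1 \<subseteq> B \<inter> {..c}" by (auto simp: A1_def B1_def d_def)
    then show "0 \<le> Q A1 B1 u v - Q (A \<inter> {..c}) (B \<inter> {..c}) u v"
      using Q_mono[of A1 B1 "A \<inter> {..c}" "B \<inter> {..c}" u v] f fin by simp
    show "Q A1 B1 u v - Q (A \<inter> {..c}) (B \<inter> {..c}) u v \<le> g"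
      using Q_remove[of A1 B1 Ag Bg u v] gap f unfolding U by simp
  qed
  have 3: "\<bar>Q (A1 \<union> A2) (B1 \<union> B2) u v - Q A1 B1 u v * Q A2 B2 u v\<bar> \<le> alpha_mix M X l"
    by (rule Q_mix[where c=d]) (use f in \<open>auto simp: A1_def B1_def A2_def B2_def d_def\<close>)
  have "\<bar>Q A1 B1 u v * Q A2 B2 u v - Q (A \<inter> {..c}) (B \<inter> {..c}) u v * Q A2 B2 u v\<bar> \<le> g * 1"
    unfolding left_diff_distrib[symmetric] abs_mult using 2 Q_bounds[of A2 B2 u v] by (intro mult_mono) auto
  with 1 3 show ?thesis unfolding A2_def[symmetric] B2_def[symmetric] g_def[symmetric] by linarith
qed

end

section \<open>Max-domain of attraction\<close>

lemma cmax_measurable: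
  fixes f :: "'i \<Rightarrow> 'a \<Rightarrow> real^'d"
  assumes "finite S" and f: "\<And>t. t \<in> S \<Longrightarrow> f t \<in> borel_measurable N"
  shows "(\<lambda>\<omega>. cmax (\<lambda>t. f t \<omega>) S) \<in> borel_measurable N"
proof (rule borel_measurable_vecI)
  fix j
  have "(\<lambda>\<omega>. f t \<omega> $ j) \<in> borel_measurable N" if "t \<in> S" for t
    using measurable_compose[OF f[OF that] borel_measurable_nth] .
  then have "(\<lambda>\<omega>. Max ((\<lambda>t. f t \<omega> $ j) ` S)) \<in> borel_measurable N"
    using assms(1) by (intro borel_measurable_Max) auto
  then show "(\<lambda>\<omega>. cmax (\<lambda>t. f t \<omega>) S $ j) \<in> borel_measurable N"
    by (simp add: cmax_def)
qed

lemma rescale_measurable [measurable]: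
  fixes a b :: "real^'d"
  shows "rescale a b \<in> borel_measurable borel"
proof (rule borel_measurable_vecI)
  fix j
  have "(\<lambda>x :: real^'d. (x $ j - b $ j) / a $ j) \<in> borel_measurable borel"
    by (intro borel_measurable_divide borel_measurable_diff borel_measurable_nth) auto
  then show "(\<lambda>x. rescale a b x $ j) \<in> borel_measurable borel"
    by (simp add: rescale_def)
qed

definition level :: "real^'d \<Rightarrow> real^'d \<Rightarrow> real^'d \<Rightarrow> real^'d" where
  "level a b y = (\<chi> j. a $ j * y $ j + b $ j)"

lemma cmax_le_iff:
  assumes "finite S" "S \<noteq> {}"
  shows "cmax x S \<le> y \<longleftrightarrow> (\<forall>t\<in>S. x t \<le> y)"
  using assms by (auto simp: cmax_def less_eq_vec_def)

lemma rescale_le_iff: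
  assumes "\<And>j. a $ j > 0"
  shows "rescale a b x \<le> y \<longleftrightarrow> x \<le> level a b y"
  using assms by (simp add: rescale_def level_def less_eq_vec_def field_simps)

lemma level_inf:
  assumes "\<And>j. a $ j > 0"
  shows "z \<le> level a b (inf x y) \<longleftrightarrow> z \<le> level a b x \<and> z \<le> level a b y"
  unfolding rescale_le_iff[OF assms, symmetric] by simp

text \<open>For negative g both branches merge into one formula with \<open>max 0\<close>,
  continuous because the exponent -1/g is positive. The excluded points are points where the
  function is 0.\<close>

lemma isCont_gev:
  assumes "g \<le> 0 \<or> 1 + g * c > 0"
  shows "isCont (gev g) c"
proof -
  consider "g = 0" | "g < 0" | "g > 0" "1 + g * c > 0" using assms by linarith
  then show ?thesis
  proof cases
    case 1
    have "gev g = (\<lambda>x. exp (- exp (- x)))" using 1 by (simp add: gev_def fun_eq_iff)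
    then show ?thesis by (auto intro!: continuous_intros)
  next
    case 2
    have eq: "gev g = (\<lambda>x. exp (- ((max 0 (1 + g * x)) powr (- 1 / g))))"
      using 2 by (auto simp: gev_def fun_eq_iff max_def)
    have "((\<lambda>x. (max 0 (1 + g * x)) powr (- 1 / g)) \<longlongrightarrow> (max 0 (1 + g * c)) powr (- 1 / g)) (at c)"
    proof (rule tendsto_powr')
      have "0 < - 1 / g" using 2 by (simp add: zero_less_divide_iff)
      then show "max 0 (1 + g * c) \<noteq> 0 \<or> 0 < - 1 / g \<and> (\<forall>\<^sub>F x in at c. 0 \<le> max 0 (1 + g * x))" by simp
    qed (intro tendsto_intros)+
    then show ?thesis unfolding eq isCont_def by (rule tendsto_exp[OF tendsto_minus])
  next
    case 3
    have "((\<lambda>x. 1 + g * x) \<longlongrightarrow> 1 + g * c) (at c)" by (intro tendsto_intros)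
    then have "\<forall>\<^sub>F x in at c. 1 + g * x > 0" using 3(2) by (rule order_tendstoD)
    then have ev: "\<forall>\<^sub>F x in at c. exp (- ((1 + g * x) powr (- 1 / g))) = gev g x"
      by eventually_elim (use 3 in \<open>simp add: gev_def\<close>)
    have "((\<lambda>x. exp (- ((1 + g * x) powr (- 1 / g)))) \<longlongrightarrow> exp (- ((1 + g * c) powr (- 1 / g)))) (at c)"
      using 3 by (intro tendsto_intros) auto
    with ev have "(gev g \<longlongrightarrow> exp (- ((1 + g * c) powr (- 1 / g)))) (at c)"
      by (rule Lim_transform_eventually[rotated])
    then show ?thesis unfolding isCont_def using 3 by (simp add: gev_def)
  qed
qed

text \<open>Where \<open>isCont_gev\<close> does not apply the distribution function is 0, which
  leaves no room for an atom either.\<close>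

lemma gev_no_atoms:
  assumes "real_distribution N" and cdf: "\<And>x. cdf N x = gev g x"
  shows "measure N {c} = 0"
proof -
  interpret real_distribution N by fact
  have cg: "cdf N = gev g" using cdf by auto
  show ?thesis
  proof (cases "g \<le> 0 \<or> 1 + g * c > 0")
    case True
    then show ?thesis using isCont_gev isCont_cdf[of c] cg by simp
  next
    case False
    then have "cdf N c = 0" by (simp add: cdf gev_def)
    moreover have "measure N {c} \<le> cdf N c" unfolding cdf_def by (rule finite_measure_mono) auto
    ultimately show ?thesis using measure_nonneg[of N "{c}"] by linarith
  qed
qed

text \<open>Block lengths \<open>R\<close> and gap lengths \<open>L\<close> run along an arbitrary
  index sequence, so that the results apply to every subsequence of sample sizes. Mixing enters
  through \<alpha>(L) -> 0; rates come in with the number of blocks.\<close>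

locale mda_process = stationary_process M X for M :: "'a measure" and X :: "int \<Rightarrow> 'a \<Rightarrow> real^'d" +
  fixes a b :: "nat \<Rightarrow> real^'d" and \<gamma> :: "real^'d" and P :: "(real^'d) measure" and R L :: "nat \<Rightarrow> nat"
  assumes mda: "cond_MDA M X a b \<gamma> P"
    and R_pos: "\<And>i. R i \<ge> 1" and R_top: "filterlim R at_top sequentially"
    and L_top: "filterlim L at_top sequentially" and LR: "(\<lambda>i. real (L i) / real (R i)) \<longlonglongrightarrow> 0"
    and alpha_L: "(\<lambda>i. alpha_mix M X (L i)) \<longlonglongrightarrow> 0"
begin

abbreviation lvl :: "nat \<Rightarrow> real^'d \<Rightarrow> real^'d" where "lvl c y \<equiv> level (a c) (b c) y"
abbreviation u :: "nat \<Rightarrow> real^'d \<Rightarrow> real^'d" where "u i x \<equiv> level (a (R i)) (b (R i)) x"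

lemma a_pos: "c \<ge> 1 \<Longrightarrow> a c $ j > 0"
  using mda by (auto simp: cond_MDA_def)

lemma prob_P: "prob_space P" and sets_P [measurable_cong]: "sets P = sets borel"
  using mda by (auto simp: cond_MDA_def extreme_value_def)

lemma space_P [simp]: "space P = UNIV"
  using sets_eq_imp_space_eq[OF sets_P] by simp

abbreviation G :: "real^'d \<Rightarrow> real" where "G \<equiv> mcdf P"

lemma G_bounds: "0 \<le> G x" "G x \<le> 1"
  using prob_space.prob_le_1[OF prob_P] by (auto simp: mcdf_def)

lemma atMost_P: "{..x} \<in> sets P"
  using borel_closed[OF closed_eucl_atMost[of x]] by (simp add: sets_P)

lemma marginal_null: "measure P {z. z $ j = c} = 0"
proof -
  interpret P: prob_space P by (rule prob_P)
  have [measurable]: "(\<lambda>z :: real^'d. z $ j) \<in> borel_measurable P"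
    using borel_measurable_nth[of j] measurable_cong_sets[OF sets_P refl] by blast
  have "real_distribution (distr P borel (\<lambda>z. z $ j))" by (rule P.real_distribution_distr) measurable
  then have "measure (distr P borel (\<lambda>z. z $ j)) {c} = 0"
    using mda by (intro gev_no_atoms[where g="\<gamma> $ j"]) (auto simp: cond_MDA_def)
  then show ?thesis by (subst (asm) measure_distr) (auto simp: vimage_def)
qed

definition e1 :: "real^'d" where "e1 = (\<chi> j. 1)"

lemma e1_nth [simp]: "e1 $ j = 1"
  by (simp add: e1_def)

lemma e1_mono: "s \<le> t \<Longrightarrow> x + s *\<^sub>R e1 \<le> x + t *\<^sub>R e1" "s \<le> t \<Longrightarrow> x - t *\<^sub>R e1 \<le> x - s *\<^sub>R e1"
  by (auto simp: less_eq_vec_def)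

lemma G_right: "(\<lambda>n. G (x + (1 / real (Suc n)) *\<^sub>R e1)) \<longlonglongrightarrow> G x"
proof -
  interpret P: prob_space P by (rule prob_P)
  have "(\<lambda>n. measure P {..x + (1 / real (Suc n)) *\<^sub>R e1}) \<longlonglongrightarrow> measure P (\<Inter>n. {..x + (1 / real (Suc n)) *\<^sub>R e1})"
  proof (rule P.finite_Lim_measure_decseq)
    show "decseq (\<lambda>n. {..x + (1 / real (Suc n)) *\<^sub>R e1})"
      unfolding decseq_def by (intro allI impI atMost_subset_iff[THEN iffD2] e1_mono frac_le) auto
  qed (use atMost_P in auto)
  also have "(\<Inter>n. {..x + (1 / real (Suc n)) *\<^sub>R e1}) = {..x}"
  proof (intro set_eqI iffI)
    fix z assume z: "z \<in> (\<Inter>n. {..x + (1 / real (Suc n)) *\<^sub>R e1})"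
    have "z $ j \<le> x $ j" for j
    proof (rule LIMSEQ_le_const)
      have "(\<lambda>n. x $ j + 1 / real (Suc n)) \<longlonglongrightarrow> x $ j + 0"
        by (intro tendsto_intros LIMSEQ_Suc[OF lim_1_over_n])
      then show "(\<lambda>n. x $ j + 1 / real (Suc n)) \<longlonglongrightarrow> x $ j" by simp
      show "\<exists>N. \<forall>n\<ge>N. z $ j \<le> x $ j + 1 / real (Suc n)"
        using z by (auto simp: less_eq_vec_def)
    qed
    then show "z \<in> {..x}" by (simp add: less_eq_vec_def)
  qed (auto simp: less_eq_vec_def intro: add_increasing2)
  finally show ?thesis by (simp add: mcdf_def)
qed

text \<open>The approximating orthants exhaust the open orthant below x. It differs from the closed
  one by the hyperplanes z_j = x_j, which are null because GEV margins have no atoms.\<close>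

lemma G_left: "(\<lambda>n. G (x - (1 / real (Suc n)) *\<^sub>R e1)) \<longlonglongrightarrow> G x"
proof -
  interpret P: prob_space P by (rule prob_P)
  have "(\<lambda>n. measure P {..x - (1 / real (Suc n)) *\<^sub>R e1}) \<longlonglongrightarrow> measure P (\<Union>n. {..x - (1 / real (Suc n)) *\<^sub>R e1})"
  proof (rule P.finite_Lim_measure_incseq)
    show "incseq (\<lambda>n. {..x - (1 / real (Suc n)) *\<^sub>R e1})"
      unfolding incseq_def by (intro allI impI atMost_subset_iff[THEN iffD2] e1_mono frac_le) auto
  qed (use atMost_P in auto)
  also have "(\<Union>n. {..x - (1 / real (Suc n)) *\<^sub>R e1}) = {z. \<forall>j. z $ j < x $ j}"
  proof (intro set_eqI iffI)
    fix z assume z: "z \<in> {z. \<forall>j. z $ j < x $ j}"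
    define d where "d = Min (range (\<lambda>j. x $ j - z $ j))"
    have d: "d > 0" using z unfolding d_def by (subst Min_gr_iff) auto
    then obtain n where n: "inverse (real (Suc n)) < d" using reals_Archimedean by blast
    have "d \<le> x $ j - z $ j" for j unfolding d_def by (rule Min_le) auto
    then have "z $ j \<le> x $ j - 1 / real (Suc n)" for j using n by (smt (verit) inverse_eq_divide)
    then show "z \<in> (\<Union>n. {..x - (1 / real (Suc n)) *\<^sub>R e1})" by (auto simp: less_eq_vec_def)
  next
    fix z assume "z \<in> (\<Union>n. {..x - (1 / real (Suc n)) *\<^sub>R e1})"
    then obtain n where n: "\<And>j. z $ j \<le> x $ j - 1 / real (Suc n)" by (auto simp: less_eq_vec_def)
    have "1 / real (Suc n) > 0" by simp
    then show "z \<in> {z. \<forall>j. z $ j < x $ j}" using n by (simp, smt (verit))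
  qed
  also have "measure P {z. \<forall>j. z $ j < x $ j} = measure P {..x}"
  proof (rule P.finite_measure_eq_AE)
    have "AE z in P. z $ j \<noteq> x $ j" for j
    proof (rule AE_I)
      have m: "{z :: real^'d. z $ j = x $ j} \<in> sets borel" by measurable
      show "emeasure P {z. z $ j = x $ j} = 0" using marginal_null[of j "x $ j"] by (simp add: P.emeasure_eq_measure)
      show "{z. z $ j = x $ j} \<in> sets P" using m by (simp add: sets_P)
    qed auto
    then have "AE z in P. \<forall>j. z $ j \<noteq> x $ j" by (simp add: AE_all_countable)
    then show "AE z in P. (z \<in> {z. \<forall>j. z $ j < x $ j}) = (z \<in> {..x})"
      by eventually_elim (auto simp: less_eq_vec_def less_le)
    show "{z. \<forall>j. z $ j < x $ j} \<in> sets P" unfolding sets_P by measurable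
  qed (rule atMost_P)
  finally show ?thesis by (simp add: mcdf_def)
qed

section \<open>Distribution functions of block maxima at moving levels\<close>

definition ramp :: "real \<Rightarrow> real^'d \<Rightarrow> real^'d \<Rightarrow> real" where
  "ramp d x z = max 0 (1 - (\<Sum>j\<in>UNIV. max 0 (z $ j - x $ j)) / d)"

lemma ramp_bounds:
  assumes "d > 0"
  shows "0 \<le> ramp d x z" "ramp d x z \<le> 1" "z \<le> x \<Longrightarrow> ramp d x z = 1" "\<not> z \<le> x + d *\<^sub>R e1 \<Longrightarrow> ramp d x z = 0"
proof -
  have "0 \<le> (\<Sum>j\<in>UNIV. max 0 (z $ j - x $ j)) / d" using assms by (simp add: sum_nonneg)
  then show "0 \<le> ramp d x z" "ramp d x z \<le> 1" by (auto simp: ramp_def)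
  show "ramp d x z = 1" if "z \<le> x"
  proof -
    have "(\<Sum>j\<in>UNIV. max 0 (z $ j - x $ j)) = 0"
      using that by (intro sum.neutral) (auto simp: less_eq_vec_def)
    then show ?thesis by (simp add: ramp_def)
  qed
  show "ramp d x z = 0" if nle: "\<not> z \<le> x + d *\<^sub>R e1"
  proof -
    obtain j where "z $ j > x $ j + d" using nle by (auto simp: less_eq_vec_def not_le)
    then have "d < max 0 (z $ j - x $ j)" by simp
    also have "\<dots> \<le> (\<Sum>j\<in>UNIV. max 0 (z $ j - x $ j))" by (rule member_le_sum) auto
    finally show ?thesis using assms by (simp add: ramp_def)
  qed
qed

lemma ramp_continuous: "continuous_on UNIV (ramp d x)"
  unfolding ramp_def[abs_def] divide_inverse by (intro continuous_intros)

lemma ramp_integral: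
  assumes N: "prob_space N" "sets N = sets borel" and d: "d > 0"
  shows "measure N {..x} \<le> (\<integral>z. ramp d x z \<partial>N)" "(\<integral>z. ramp d x z \<partial>N) \<le> measure N {..x + d *\<^sub>R e1}"
proof -
  interpret N: prob_space N by fact
  have sp: "space N = UNIV" using sets_eq_imp_space_eq[OF N(2)] by simp
  have "ramp d x \<in> borel_measurable N"
    using borel_measurable_continuous_onI[OF ramp_continuous] measurable_cong_sets[OF N(2) refl] by blast
  then have i: "integrable N (ramp d x)"
    by (intro N.integrable_const_bound[where B=1]) (use ramp_bounds[OF d] in auto)
  have A: "{..y} \<in> sets N" for y :: "real^'d" using borel_closed[OF closed_eucl_atMost[of y]] by (simp add: N(2))
  have ii: "integrable N (indicat_real {..y})" for y :: "real^'d"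
    using A by (intro integrable_real_indicator) (auto simp: N.emeasure_eq_measure)
  have "(\<integral>z. indicat_real {..x} z \<partial>N) \<le> (\<integral>z. ramp d x z \<partial>N)"
    by (intro integral_mono i ii) (use ramp_bounds[OF d] in \<open>auto simp: indicator_def\<close>)
  then show "measure N {..x} \<le> (\<integral>z. ramp d x z \<partial>N)" by (simp add: sp)
  have "(\<integral>z. ramp d x z \<partial>N) \<le> (\<integral>z. indicat_real {..x + d *\<^sub>R e1} z \<partial>N)"
    by (intro integral_mono i ii) (use ramp_bounds[OF d] in \<open>auto simp: indicator_def\<close>)
  then show "(\<integral>z. ramp d x z \<partial>N) \<le> measure N {..x + d *\<^sub>R e1}" by (simp add: sp)
qed

lemma block_Z_measurable: "(\<lambda>\<omega>. block_Z a b c (\<lambda>t. X t \<omega>)) \<in> borel_measurable M"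
  unfolding block_Z_def by (rule measurable_compose[OF cmax_measurable rescale_measurable]) auto

definition block_law :: "nat \<Rightarrow> (real^'d) measure" where
  "block_law c = distr M borel (\<lambda>\<omega>. block_Z a b c (\<lambda>t. X t \<omega>))"

lemma block_law_prob: "prob_space (block_law c)" "sets (block_law c) = sets borel"
  unfolding block_law_def by (auto intro: prob_space_distr block_Z_measurable)

lemma block_law_atMost:
  assumes "c \<ge> 1"
  shows "measure (block_law c) {..y} = K c (lvl c y)"
proof -
  have "measure (block_law c) {..y} = prob {\<omega>\<in>space M. block_Z a b c (\<lambda>t. X t \<omega>) \<le> y}"
    unfolding block_law_def using borel_closed[OF closed_eucl_atMost[of y]]
    by (subst measure_distr[OF block_Z_measurable]) (auto simp: vimage_def Int_def conj_commute)
  then show ?thesis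
    using assms a_pos[OF assms] unfolding K_def Q_def block_Z_def
    by (simp add: rescale_le_iff cmax_le_iff)
qed

text \<open>Continuity of \<open>G\<close> upgrades weak convergence to convergence at every point,
  even at moving ones: the distribution function is caught between the integrals of two
  ramps.\<close>

lemma block_conv:
  assumes c: "filterlim c at_top sequentially" and y: "\<And>j. (\<lambda>i. y i $ j) \<longlonglongrightarrow> x $ j"
  shows "(\<lambda>i. measure (block_law (c i)) {..y i}) \<longlonglongrightarrow> G x"
proof (rule tendstoI)
  fix e :: real assume e: "e > 0"
  have weak: "(\<lambda>i. \<integral>z. ramp d w z \<partial>block_law (c i)) \<longlonglongrightarrow> (\<integral>z. ramp d w z \<partial>P)" if d: "d > 0" for d w
  proof -
    have "continuous_on UNIV (ramp d w) \<and> bounded (range (ramp d w))"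
      using ramp_continuous ramp_bounds(1,2)[OF d] by (auto simp: bounded_iff intro!: exI[of _ 1])
    then have "(\<lambda>i. \<integral>z. ramp d w z \<partial>block_law i) \<longlonglongrightarrow> (\<integral>z. ramp d w z \<partial>P)"
      using mda unfolding cond_MDA_def weak_conv_law_def block_law_def by blast
    then show ?thesis using c by (rule filterlim_compose)
  qed
  have "\<forall>\<^sub>F n in sequentially. dist (G (x + (1 / real (Suc n)) *\<^sub>R e1)) (G x) < e / 2 \<and> dist (G (x - (1 / real (Suc n)) *\<^sub>R e1)) (G x) < e / 2"
    using e by (intro eventually_conj tendstoD[OF G_right] tendstoD[OF G_left]) auto
  then obtain n where n: "dist (G (x + (1 / real (Suc n)) *\<^sub>R e1)) (G x) < e / 2" "dist (G (x - (1 / real (Suc n)) *\<^sub>R e1)) (G x) < e / 2"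
    by (auto simp: eventually_sequentially)
  \<comment> \<open>The moving point uses up one \<open>d\<close> and the ramp another, so both
    comparisons stay within 2 d = 1/(n + 1) of x.\<close>
  define d where "d = 1 / real (Suc n) / 2"
  have d: "d > 0" "2 * d = 1 / real (Suc n)" by (simp_all add: d_def del: of_nat_Suc)
  have "\<forall>\<^sub>F i in sequentially. \<forall>j\<in>UNIV. dist (y i $ j) (x $ j) < d"
    using d by (intro eventually_ball_finite ballI tendstoD[OF y]) auto
  moreover have "\<forall>\<^sub>F i in sequentially. dist (\<integral>z. ramp d (x + d *\<^sub>R e1) z \<partial>block_law (c i)) (\<integral>z. ramp d (x + d *\<^sub>R e1) z \<partial>P) < e / 2"
    using e by (intro tendstoD[OF weak[OF d(1)]]) auto
  moreover have "\<forall>\<^sub>F i in sequentially. dist (\<integral>z. ramp d (x - (2 * d) *\<^sub>R e1) z \<partial>block_law (c i)) (\<integral>z. ramp d (x - (2 * d) *\<^sub>R e1) z \<partial>P) < e / 2"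
    using e by (intro tendstoD[OF weak[OF d(1)]]) auto
  ultimately show "\<forall>\<^sub>F i in sequentially. dist (measure (block_law (c i)) {..y i}) (G x) < e"
  proof eventually_elim
    case (elim i)
    interpret N: prob_space "block_law (c i)" by (rule block_law_prob)
    have A: "{..y} \<in> sets (block_law (c i))" for y :: "real^'d"
      using borel_closed[OF closed_eucl_atMost[of y]] by (simp add: block_law_prob)
    have y1: "y i \<le> x + d *\<^sub>R e1" and y2: "(x - (2 * d) *\<^sub>R e1) + d *\<^sub>R e1 \<le> y i"
      using elim(1) by (auto simp: less_eq_vec_def dist_real_def abs_less_iff less_imp_le intro: less_imp_le) (smt (verit))+
    have "measure (block_law (c i)) {..y i} \<le> measure (block_law (c i)) {..x + d *\<^sub>R e1}"
      by (rule N.finite_measure_mono) (use y1 A in auto)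
    also have "\<dots> \<le> (\<integral>z. ramp d (x + d *\<^sub>R e1) z \<partial>block_law (c i))"
      by (rule ramp_integral[OF block_law_prob d(1)])
    also have "\<dots> < (\<integral>z. ramp d (x + d *\<^sub>R e1) z \<partial>P) + e / 2" using elim(2) unfolding dist_real_def abs_less_iff by linarith
    also have "(\<integral>z. ramp d (x + d *\<^sub>R e1) z \<partial>P) \<le> measure P {..(x + d *\<^sub>R e1) + d *\<^sub>R e1}"
      by (rule ramp_integral[OF prob_P sets_P d(1)])
    also have "(x + d *\<^sub>R e1) + d *\<^sub>R e1 = x + (1 / real (Suc n)) *\<^sub>R e1"
      unfolding d(2)[symmetric] by (simp add: scaleR_2[symmetric] add.assoc flip: scaleR_left_distrib)
    finally have 1: "measure (block_law (c i)) {..y i} < G x + e"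
      using n(1) unfolding mcdf_def dist_real_def abs_less_iff by linarith
    have "measure P {..x - (2 * d) *\<^sub>R e1} \<le> (\<integral>z. ramp d (x - (2 * d) *\<^sub>R e1) z \<partial>P)"
      by (rule ramp_integral[OF prob_P sets_P d(1)])
    also have "\<dots> < (\<integral>z. ramp d (x - (2 * d) *\<^sub>R e1) z \<partial>block_law (c i)) + e / 2"
      using elim(3) unfolding dist_real_def abs_less_iff by linarith
    also have "(\<integral>z. ramp d (x - (2 * d) *\<^sub>R e1) z \<partial>block_law (c i)) \<le> measure (block_law (c i)) {..(x - (2 * d) *\<^sub>R e1) + d *\<^sub>R e1}"
      by (rule ramp_integral[OF block_law_prob d(1)])
    also have "\<dots> \<le> measure (block_law (c i)) {..y i}"
      by (rule N.finite_measure_mono) (use y2 A in auto)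
    finally have "G x - e < measure (block_law (c i)) {..y i}"
      using n(2) unfolding d(2) mcdf_def dist_real_def abs_less_iff by linarith
    with 1 show ?case by (simp add: dist_real_def abs_less_iff)
  qed
qed

section \<open>Max-stability of the limit law\<close>

definition shift :: "real \<Rightarrow> 'd \<Rightarrow> real" where
  "shift s j = (if \<gamma> $ j = 0 then ln s else (s powr (\<gamma> $ j) - 1) / \<gamma> $ j)"

text \<open>Inverse of the map with components s^\<gamma> z + \<open>shift\<close>. It is the
  limiting position of the point x when levels standardised for length r are standardised for length
  r s instead.\<close>

definition Tinv :: "real \<Rightarrow> real^'d \<Rightarrow> real^'d" where
  "Tinv s x = (\<chi> j. (x $ j - shift s j) / s powr (\<gamma> $ j))"

definition Gs :: "real \<Rightarrow> real^'d \<Rightarrow> real" where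
  "Gs s x = G (Tinv s x)"

lemma R_real_top: "filterlim (\<lambda>i. real (R i)) at_top sequentially"
  by (rule filterlim_compose[OF filterlim_real_sequentially R_top])

lemma floor_top: "s > 0 \<Longrightarrow> filterlim (\<lambda>i. nat \<lfloor>real (R i) * s\<rfloor>) at_top sequentially"
  by (rule filterlim_compose[OF filterlim_nat_sequentially])
     (rule filterlim_compose[OF filterlim_floor_sequentially filterlim_at_top_mult_tendsto_pos[OF tendsto_const _ R_real_top, of s]])

text \<open>The level for \<open>R\<close> is rewritten as a level for floor(R s). Its standardised
  argument \<open>y\<close> converges by the regular variation of \<open>a\<close> and
  \<open>b\<close>, and \<open>block_conv\<close> admits such moving arguments.\<close>

lemma K_scale:
  assumes s: "s > 0"
  shows "(\<lambda>i. K (nat \<lfloor>real (R i) * s\<rfloor>) (u i x)) \<longlonglongrightarrow> Gs s x"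
proof -
  define c where "c i = nat \<lfloor>real (R i) * s\<rfloor>" for i
  have c: "filterlim c at_top sequentially" unfolding c_def by (rule floor_top[OF s])
  define y where "y i = (\<chi> j. (x $ j - (b (c i) $ j - b (R i) $ j) / a (R i) $ j) / (a (c i) $ j / a (R i) $ j))" for i
  have "(\<lambda>i. y i $ j) \<longlonglongrightarrow> Tinv s x $ j" for j
  proof -
    have 1: "(\<lambda>r. a (nat \<lfloor>real r * s\<rfloor>) $ j / a r $ j) \<longlonglongrightarrow> s powr (\<gamma> $ j)"
      and 2: "(\<lambda>r. (b (nat \<lfloor>real r * s\<rfloor>) $ j - b r $ j) / a r $ j) \<longlonglongrightarrow> shift s j"
      using mda s unfolding cond_MDA_def shift_def by blast+
    show ?thesis unfolding y_def Tinv_def c_def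
      using filterlim_compose[OF 1 R_top] filterlim_compose[OF 2 R_top] s
      by (simp only: vec_lambda_beta) (intro tendsto_divide tendsto_diff tendsto_const, auto)
  qed
  then have "(\<lambda>i. measure (block_law (c i)) {..y i}) \<longlonglongrightarrow> Gs s x"
    unfolding Gs_def by (rule block_conv[OF c])
  moreover have "\<forall>\<^sub>F i in sequentially. measure (block_law (c i)) {..y i} = K (c i) (u i x)"
    using filterlim_at_top[THEN iffD1, OF c, rule_format, of 1]
  proof eventually_elim
    case (elim i)
    have "lvl (c i) (y i) = u i x"
      unfolding vec_eq_iff
    proof
      fix j
      show "lvl (c i) (y i) $ j = u i x $ j"
        using a_pos[OF elim, of j] a_pos[OF R_pos, of i j] by (simp add: level_def y_def field_simps)
    qed
    then show ?case using block_law_atMost[OF elim, of "y i"] by simp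
  qed
  ultimately show ?thesis unfolding c_def by (rule Lim_transform_eventually)
qed

end

text \<open>Cauchy's functional equation under monotonicity. If the value at 1 is 0, some multiple
  of s exceeds 1, so a power of the value at s is 0. Otherwise the values at multiples of s lie
  between integer powers of the value at 1, and - ln of the value at s agrees with s times that at 1
  up to O(1/n).\<close>

lemma decreasing_multiplicative_powr:
  fixes \<phi> :: "real \<Rightarrow> real"
  assumes bounds: "\<And>s. s > 0 \<Longrightarrow> 0 \<le> \<phi> s" "\<And>s. s > 0 \<Longrightarrow> \<phi> s \<le> 1"
    and mult: "\<And>s t. s > 0 \<Longrightarrow> t > 0 \<Longrightarrow> \<phi> (s + t) = \<phi> s * \<phi> t"
    and anti: "\<And>s t. 0 < s \<Longrightarrow> s \<le> t \<Longrightarrow> \<phi> t \<le> \<phi> s"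
    and s: "s > 0"
  shows "\<phi> s = \<phi> 1 powr s"
proof -
  have pow: "\<phi> (real (Suc n) * t) = \<phi> t ^ Suc n" if "t > 0" for n t
  proof (induction n)
    case (Suc n)
    have "\<phi> (real (Suc (Suc n)) * t) = \<phi> (t + real (Suc n) * t)" by (simp add: algebra_simps)
    also have "\<dots> = \<phi> t * \<phi> (real (Suc n) * t)" using that by (intro mult) auto
    finally show ?case using Suc by simp
  qed simp
  show ?thesis
  proof (cases "\<phi> 1 = 0")
    case True
    obtain n :: nat where n: "1 / s < real n" using reals_Archimedean2 by blast
    have "1 \<le> real (Suc n) * s" using n s by (simp add: field_simps)
    then have "\<phi> s ^ Suc n \<le> 0" using anti[of 1 "real (Suc n) * s"] pow[OF s, of n] True by simp
    moreover have "\<phi> s ^ Suc n \<ge> 0" using bounds(1)[OF s] by simp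
    ultimately have "\<phi> s ^ Suc n = 0" by linarith
    then show ?thesis using True by auto
  next
    case False
    then have p1: "\<phi> 1 > 0" using bounds(1)[of 1] by simp
    define l where "l = - ln (\<phi> 1)"
    have l: "l \<ge> 0" "\<phi> 1 = exp (- l)" using p1 bounds(2)[of 1] by (auto simp: l_def)
    have pow1: "\<phi> t \<ge> exp (- l * (t + 1))" if t: "t > 0" for t
    proof -
      define p where "p = nat \<lfloor>t\<rfloor>"
      have p: "real p \<le> t" "t \<le> real (Suc p)" using t unfolding p_def by linarith+
      have "exp (- l * (t + 1)) \<le> exp (- l * real (Suc p))"
        using mult_left_mono[OF _ l(1), of "real (Suc p)" "t + 1"] p by simp
      also have "\<dots> = \<phi> (real (Suc p) * 1)" unfolding pow[OF zero_less_one] l(2)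
        by (simp only: exp_of_nat_mult[symmetric] mult.commute)
      also have "\<dots> \<le> \<phi> t" using t p by (intro anti) auto
      finally show ?thesis .
    qed
    have pow2: "\<phi> t \<le> exp (- l * (t - 1))" if t: "t > 0" for t
    proof (cases "t < 1")
      case True
      then have "0 \<le> - l * (t - 1)" using l(1) by (simp add: mult_nonneg_nonpos)
      then have "1 \<le> exp (- l * (t - 1))" by simp
      then show ?thesis using bounds(2)[OF t] by linarith
    next
      case False
      define p where "p = nat \<lfloor>t\<rfloor> - 1"
      have p: "real (Suc p) \<le> t" "t \<le> real (Suc p) + 1" using False unfolding p_def by linarith+
      have "\<phi> t \<le> \<phi> (real (Suc p) * 1)" using p by (intro anti) auto
      also have "\<dots> = exp (- l * real (Suc p))" unfolding pow[OF zero_less_one] l(2)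
        by (simp only: exp_of_nat_mult[symmetric] mult.commute)
      also have "\<dots> \<le> exp (- l * (t - 1))"
        using mult_left_mono[OF _ l(1), of "t - 1" "real (Suc p)"] p by simp
      finally show ?thesis .
    qed
    have ps: "\<phi> s > 0" using pow1[OF s] by (smt (verit) exp_gt_zero)
    define k where "k = - ln (\<phi> s)"
    have k: "\<phi> s = exp (- k)" using ps by (simp add: k_def)
    have "\<bar>k - l * s\<bar> * real (Suc n) \<le> l" for n
    proof -
      have t: "real (Suc n) * s > 0" using s by simp
      have e: "\<phi> (real (Suc n) * s) = exp (- k * real (Suc n))"
        unfolding pow[OF s] k by (simp only: exp_of_nat_mult[symmetric] mult.commute)
      have "- l * (real (Suc n) * s + 1) \<le> - k * real (Suc n)" "- k * real (Suc n) \<le> - l * (real (Suc n) * s - 1)"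
        using pow1[OF t] pow2[OF t] unfolding e by simp_all
      then have "\<bar>k * real (Suc n) - l * s * real (Suc n)\<bar> \<le> l"
        unfolding abs_le_iff by (simp add: algebra_simps)
      then show ?thesis by (simp add: left_diff_distrib[symmetric] abs_mult del: of_nat_Suc)
    qed
    then have le: "\<bar>k - l * s\<bar> \<le> l / real (Suc n)" for n by (simp add: pos_le_divide_eq del: of_nat_Suc)
    have "\<bar>k - l * s\<bar> \<le> 0"
    proof (rule LIMSEQ_le_const)
      show "(\<lambda>n. l / real (Suc n)) \<longlonglongrightarrow> 0" by (rule LIMSEQ_Suc[OF lim_const_over_n])
      show "\<exists>N. \<forall>n\<ge>N. \<bar>k - l * s\<bar> \<le> l / real (Suc n)" using le by blast
    qed
    then have "k = l * s" by simp
    then show ?thesis using p1 unfolding k by (simp add: powr_def l_def)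
  qed
qed

text \<open>Lower orthants are stable under intersection and generate the Borel sets.\<close>

lemma cdf_unique:
  fixes M N :: "'a::ordered_euclidean_space measure"
  assumes "prob_space M" "prob_space N" "sets M = sets borel" "sets N = sets borel"
    and eq: "\<And>z. measure M {..z} = measure N {..z}"
  shows "M = N"
proof (rule measure_eqI_generator_eq[where E="range (\<lambda>a::'a. {..a})" and A="\<lambda>n. {..real n *\<^sub>R One}" and \<Omega>=UNIV])
  interpret M: prob_space M by fact
  interpret N: prob_space N by fact
  show "Int_stable (range (\<lambda>a::'a. {..a}))"
  proof (rule Int_stableI)
    fix S T assume "S \<in> range (\<lambda>a::'a. {..a})" "T \<in> range (\<lambda>a::'a. {..a})"
    then obtain x y where "S = {..x}" "T = {..y}" by auto
    then have "S \<inter> T = {..inf x y}" by auto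
    then show "S \<inter> T \<in> range (\<lambda>a::'a. {..a})" by blast
  qed
  show "emeasure M S = emeasure N S" if "S \<in> range (\<lambda>a::'a. {..a})" for S
    using that eq by (auto simp: M.emeasure_eq_measure N.emeasure_eq_measure)
  show "sets M = sigma_sets UNIV (range (\<lambda>a::'a. {..a}))" "sets N = sigma_sets UNIV (range (\<lambda>a::'a. {..a}))"
    unfolding assms(3,4) by (subst borel_eq_atMost, simp add: sets_measure_of)+
  show "(\<Union>n. {..real n *\<^sub>R One}) = (UNIV :: 'a set)"
  proof (intro set_eqI iffI UNIV_I)
    fix x :: 'a
    obtain n where n: "norm x \<le> real n" using real_arch_simple by blast
    have "x \<bullet> i \<le> real n" if "i \<in> Basis" for i
      using Basis_le_norm[OF that, of x] n by linarith
    then have "x \<in> {..real n *\<^sub>R One}" by (auto simp: eucl_le[where 'a='a] inner_simps)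
    then show "x \<in> (\<Union>n. {..real n *\<^sub>R One})" by blast
  qed
  show "emeasure M {..real n *\<^sub>R One} \<noteq> \<infinity>" for n by (simp add: M.emeasure_eq_measure)
qed auto

context mda_process
begin

lemma Gs_1: "Gs 1 x = G x"
proof -
  have "Tinv 1 x = x" by (simp add: vec_eq_iff Tinv_def shift_def)
  then show ?thesis by (simp add: Gs_def)
qed

lemma Gs_bounds: "0 \<le> Gs s x" "Gs s x \<le> 1"
  by (auto simp: Gs_def G_bounds)

lemma Gs_antimono:
  assumes "0 < s" "s \<le> t" shows "Gs t x \<le> Gs s x"
proof (rule LIMSEQ_le[OF K_scale K_scale])
  show "\<exists>N. \<forall>i\<ge>N. K (nat \<lfloor>real (R i) * t\<rfloor>) (u i x) \<le> K (nat \<lfloor>real (R i) * s\<rfloor>) (u i x)"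
    using assms by (intro exI allI impI K_antimono nat_mono floor_mono mult_left_mono) auto
qed (use assms in auto)

text \<open>\<open>N\<close> stretches of length \<open>l\<close>, separated by gaps of length
  \<open>l\<close>, fit into 2 N l positions; each one costs a mixing coefficient.\<close>

lemma K_blocks: "K (2 * N * l) w \<le> K l w ^ N + real N * alpha_mix M X l"
proof (induction N)
  case (Suc N)
  define c where "c = int (2 * N * l)"
  have "K (2 * Suc N * l) w \<le> Q ({1..c} \<union> {c + int l + 1..c + int l + int l}) ({} \<union> {}) w w"
    unfolding K_def c_def by (rule Q_mono) auto
  also have "\<dots> \<le> Q {1..c} {} w w * Q {c + int l + 1..c + int l + int l} {} w w + alpha_mix M X l"
  proof -
    have "\<bar>Q ({1..c} \<union> {c + int l + 1..c + int l + int l}) ({} \<union> {}) w w - Q {1..c} {} w w * Q {c + int l + 1..c + int l + int l} {} w w\<bar> \<le> alpha_mix M X l"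
      by (rule Q_mix[where c=c]) auto
    then show ?thesis by linarith
  qed
  also have "\<dots> = K (2 * N * l) w * K l w + alpha_mix M X l"
    using Q_interval(1)[of "c + int l" l w w] by (simp add: K_def c_def)
  also have "\<dots> \<le> (K l w ^ N + real N * alpha_mix M X l) * K l w + alpha_mix M X l"
    using Suc K_bounds by (intro add_right_mono mult_right_mono) auto
  also have "\<dots> \<le> K l w ^ Suc N + real (Suc N) * alpha_mix M X l"
  proof -
    have "real N * alpha_mix M X l * K l w \<le> real N * alpha_mix M X l * 1"
      using K_bounds alpha_mix_nonneg by (intro mult_left_mono) auto
    then show ?thesis by (simp add: algebra_simps)
  qed
  finally show ?case .
qed (simp add: K_bounds)

text \<open>If a stretch of length \<open>L\<close> had non-exceedance probability at most q < 1,
  then \<open>N\<close> separated copies inside floor(R s) positions would push the non-exceedance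
  probability below q^N plus a vanishing term, which contradicts a positive limit. As L = o(R),
  there is room for any fixed \<open>N\<close>.\<close>

lemma gap_negligible_Gs:
  assumes s: "s > 0" and pos: "Gs s x > 0"
  shows "(\<lambda>i. K (L i) (u i x)) \<longlonglongrightarrow> 1"
proof (rule order_tendstoI)
  fix y :: real assume "y > 1"
  then show "\<forall>\<^sub>F i in sequentially. K (L i) (u i x) < y"
    using order_le_less_trans[OF K_bounds(2)] by (intro always_eventually) auto
next
  fix y :: real assume y: "y < 1"
  \<comment> \<open>\<open>y\<close> may be nonpositive; the maximum makes the base of the power
    positive.\<close>
  define q where "q = max y (1/2)"
  have q: "0 < q" "q < 1" "y \<le> q" using y by (auto simp: q_def)
  define g where "g = Gs s x"
  have g: "g > 0" using pos by (simp add: g_def)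
  obtain N where N: "q ^ N < g / 2" using real_arch_pow_inv[of "g / 2" q] g q by auto
  have "\<forall>\<^sub>F i in sequentially. g * 3/4 < K (nat \<lfloor>real (R i) * s\<rfloor>) (u i x)"
    using g by (intro order_tendstoD(1)[OF K_scale[OF s]]) (simp add: g_def)
  moreover have "\<forall>\<^sub>F i in sequentially. real N * alpha_mix M X (L i) < g / 4"
    using tendsto_mult_left[OF alpha_L, of "real N"] g by (intro order_tendstoD(2)) auto
  moreover have "\<forall>\<^sub>F i in sequentially. real (2 * N) * (real (L i) / real (R i)) < s"
    using tendsto_mult_left[OF LR, of "real (2 * N)"] s by (intro order_tendstoD(2)) auto
  ultimately show "\<forall>\<^sub>F i in sequentially. y < K (L i) (u i x)"
  proof eventually_elim
    case (elim i)
    have "real (2 * N * L i) \<le> real (R i) * s"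
      using elim(3) R_pos[of i] by (simp add: field_simps)
    then have "2 * N * L i \<le> nat \<lfloor>real (R i) * s\<rfloor>" by (rule le_nat_floor)
    then have "K (nat \<lfloor>real (R i) * s\<rfloor>) (u i x) \<le> K (2 * N * L i) (u i x)" by (rule K_antimono)
    also have "\<dots> \<le> K (L i) (u i x) ^ N + real N * alpha_mix M X (L i)" by (rule K_blocks)
    finally have "q ^ N < K (L i) (u i x) ^ N" using elim(1,2) N by linarith
    then have "q < K (L i) (u i x)" by (rule power_less_imp_less_base[OF _ K_bounds(1)])
    then show ?case using q by simp
  qed
qed

text \<open>The stretch for s + t is cut at s. The gap costs nothing in the limit if some
  \<open>Gs r x\<close> is positive; otherwise both sides are 0. Rounding may add one position,
  whose exceedance probability is at most that of the gap, hence 5 instead of 4 in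
  \<open>bound\<close>.\<close>

lemma Gs_mult:
  assumes s: "s > 0" and t: "t > 0"
  shows "Gs (s + t) x = Gs s x * Gs t x"
proof (cases "\<exists>r>0. Gs r x > 0")
  case False
  then have "Gs r x = 0" if "r > 0" for r using that Gs_bounds(1)[of r x] by force
  then show ?thesis using s t by simp
next
  case True
  then have gap: "(\<lambda>i. K (L i) (u i x)) \<longlonglongrightarrow> 1" using gap_negligible_Gs by blast
  define c1 c2 c where "c1 i = nat \<lfloor>real (R i) * s\<rfloor>" and "c2 i = nat \<lfloor>real (R i) * t\<rfloor>"
    and "c i = nat \<lfloor>real (R i) * (s + t)\<rfloor>" for i
  have bound: "\<bar>K (c i) (u i x) - K (c1 i) (u i x) * K (c2 i) (u i x)\<bar> \<le> alpha_mix M X (L i) + 5 * (1 - K (L i) (u i x))"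
    if "L i \<ge> 1" for i
  proof -
    let ?u = "u i x"
    have "\<bar>Q {1..int (c1 i + c2 i)} {} ?u ?u -
      Q ({1..int (c1 i + c2 i)} \<inter> {..int (c1 i)}) ({} \<inter> {..int (c1 i)}) ?u ?u *
      Q ({1..int (c1 i + c2 i)} \<inter> {int (c1 i)<..}) ({} \<inter> {int (c1 i)<..}) ?u ?u\<bar> \<le>
      alpha_mix M X (L i) + 2 * ((1 - K (L i) ?u) + (1 - K (L i) ?u))"
      by (rule Q_cut) auto
    moreover have "{1..int (c1 i + c2 i)} \<inter> {..int (c1 i)} = {1..int (c1 i)}"
      "{1..int (c1 i + c2 i)} \<inter> {int (c1 i)<..} = {int (c1 i) + 1..int (c1 i) + int (c2 i)}" by auto
    ultimately have 1: "\<bar>K (c1 i + c2 i) ?u - K (c1 i) ?u * K (c2 i) ?u\<bar> \<le> alpha_mix M X (L i) + 4 * (1 - K (L i) ?u)"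
      using Q_interval(1)[of "int (c1 i)" "c2 i" ?u ?u] by (simp add: K_def)
    have nn: "0 \<le> real (R i) * s" "0 \<le> real (R i) * t" using s t by auto
    have cc: "c1 i + c2 i \<le> c i" "c i \<le> c1 i + c2 i + 1"
      using nn unfolding c1_def c2_def c_def distrib_left by linarith+
    have "K (c1 i + c2 i) ?u - K (c1 i + c2 i + 1) ?u \<le> 1 - K 1 ?u"
    proof -
      have "{1..int (c1 i + c2 i)} \<union> {int (c1 i + c2 i) + 1..int (c1 i + c2 i) + int 1} = {1..int (c1 i + c2 i + 1)}" by auto
      then show ?thesis
        using Q_remove[of "{1..int (c1 i + c2 i)}" "{}" "{int (c1 i + c2 i) + 1..int (c1 i + c2 i) + int 1}" "{}" ?u ?u]
        unfolding Q_interval by (simp add: K_def)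
    qed
    also have "\<dots> \<le> 1 - K (L i) ?u" using K_antimono[OF that, of ?u] by simp
    finally have "\<bar>K (c i) ?u - K (c1 i + c2 i) ?u\<bar> \<le> 1 - K (L i) ?u"
      using K_antimono[OF cc(1), of ?u] K_antimono[OF cc(2), of ?u] by linarith
    have gen: "\<bar>p - q\<bar> \<le> A + 4 * B \<Longrightarrow> \<bar>r - p\<bar> \<le> B \<Longrightarrow> \<bar>r - q\<bar> \<le> A + 5 * B" for p q r A B :: real
      by linarith
    show ?thesis by (rule gen[OF 1]) fact
  qed
  have "(\<lambda>i. K (c i) (u i x) - K (c1 i) (u i x) * K (c2 i) (u i x)) \<longlonglongrightarrow> 0"
  proof (rule Lim_null_comparison)
    show "\<forall>\<^sub>F i in sequentially. norm (K (c i) (u i x) - K (c1 i) (u i x) * K (c2 i) (u i x)) \<le> alpha_mix M X (L i) + 5 * (1 - K (L i) (u i x))"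
      using filterlim_at_top[THEN iffD1, OF L_top, rule_format, of 1]     proof eventually_elim
      case (elim i)
      then show ?case unfolding real_norm_def by (rule bound)
    qed
    have "(\<lambda>i. alpha_mix M X (L i) + 5 * (1 - K (L i) (u i x))) \<longlonglongrightarrow> 0 + 5 * (1 - 1)"
      by (intro tendsto_intros alpha_L gap)
    then show "(\<lambda>i. alpha_mix M X (L i) + 5 * (1 - K (L i) (u i x))) \<longlonglongrightarrow> 0" by simp
  qed
  moreover have "(\<lambda>i. K (c i) (u i x) - K (c1 i) (u i x) * K (c2 i) (u i x)) \<longlonglongrightarrow> Gs (s + t) x - Gs s x * Gs t x"
    unfolding c_def c1_def c2_def using s t by (intro tendsto_intros K_scale) auto
  ultimately show ?thesis using LIMSEQ_unique by fastforce
qed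

text \<open>Monotone, bounded and multiplicative in s, hence a power. This is the max-stability of
  \<open>G\<close>.\<close>

lemma Gs_powr:
  assumes s: "s > 0" shows "Gs s x = G x powr s"
  unfolding Gs_1[symmetric]
proof (rule decreasing_multiplicative_powr[of "\<lambda>s. Gs s x", OF _ _ _ _ s])
  show "Gs (s + t) x = Gs s x * Gs t x" if "s > 0" "t > 0" for s t using that by (rule Gs_mult)
  show "Gs t x \<le> Gs s x" if "0 < s" "s \<le> t" for s t using that by (rule Gs_antimono)
qed (rule Gs_bounds)+

lemma gap_negligible:
  assumes "G x > 0" shows "(\<lambda>i. K (L i) (u i x)) \<longlonglongrightarrow> 1"
  by (rule gap_negligible_Gs[OF zero_less_one]) (simp only: Gs_1 assms)

text \<open>\<open>c\<close> is eventually caught between floor(R (s - d)) and floor(R (s + d)), and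
  powers are continuous in the exponent, with base 0 treated separately.\<close>

lemma K_limit:
  assumes c: "(\<lambda>i. real (c i) / real (R i)) \<longlonglongrightarrow> s" and s: "s > 0"
  shows "(\<lambda>i. K (c i) (u i x)) \<longlonglongrightarrow> G x powr s"
proof (rule tendstoI)
  fix e :: real assume e: "e > 0"
  have "isCont (\<lambda>t. G x powr t) s"
  proof (cases "G x = 0")
    case False
    have "isCont (\<lambda>t. exp (t * ln (G x))) s" by (intro continuous_intros)
    then show ?thesis using False by (simp add: powr_def)
  qed simp
  then have "\<forall>\<^sub>F t in nhds s. dist (G x powr t) (G x powr s) < e / 2"
    using e unfolding isCont_def tendsto_at_iff_tendsto_nhds by (intro tendstoD) auto
  then obtain d0 where d0: "d0 > 0" "\<And>t. dist t s < d0 \<Longrightarrow> dist (G x powr t) (G x powr s) < e / 2"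
    unfolding eventually_nhds_metric by blast
  define d where "d = min d0 s / 2"
  have d: "d > 0" "d < s" "dist (s + d) s < d0" "dist (s - d) s < d0" using d0 s by (auto simp: d_def dist_real_def min_def)
  have "\<forall>\<^sub>F i in sequentially. dist (real (c i) / real (R i)) s < d" using c d(1) by (rule tendstoD)
  moreover have "\<forall>\<^sub>F i in sequentially. dist (K (nat \<lfloor>real (R i) * (s + d)\<rfloor>) (u i x)) (Gs (s + d) x) < e / 2"
    using e d s by (intro tendstoD[OF K_scale]) auto
  moreover have "\<forall>\<^sub>F i in sequentially. dist (K (nat \<lfloor>real (R i) * (s - d)\<rfloor>) (u i x)) (Gs (s - d) x) < e / 2"
    using e d s by (intro tendstoD[OF K_scale]) auto
  ultimately show "\<forall>\<^sub>F i in sequentially. dist (K (c i) (u i x)) (G x powr s) < e"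
  proof eventually_elim
    case (elim i)
    have Rp: "real (R i) > 0" using R_pos[of i] by simp
    have "real (c i) / real (R i) < s + d" "s - d < real (c i) / real (R i)"
      using elim(1) unfolding dist_real_def abs_less_iff by linarith+
    then have b: "real (c i) \<le> real (R i) * (s + d)" "real (R i) * (s - d) \<le> real (c i)"
      using Rp by (simp_all add: field_simps)
    have "c i \<le> nat \<lfloor>real (R i) * (s + d)\<rfloor>" using b(1) by (rule le_nat_floor)
    then have 1: "K (nat \<lfloor>real (R i) * (s + d)\<rfloor>) (u i x) \<le> K (c i) (u i x)" by (rule K_antimono)
    have "nat \<lfloor>real (R i) * (s - d)\<rfloor> \<le> c i" using b(2) by linarith
    then have 2: "K (c i) (u i x) \<le> K (nat \<lfloor>real (R i) * (s - d)\<rfloor>) (u i x)" by (rule K_antimono)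
    have "Gs (s + d) x = G x powr (s + d)" "Gs (s - d) x = G x powr (s - d)"
      using d s by (auto intro!: Gs_powr)
    then show ?case
      using 1 2 elim(2,3) d0(2)[OF d(3)] d0(2)[OF d(4)] unfolding dist_real_def abs_less_iff by linarith
  qed
qed

section \<open>The limit law of overlapping maxima\<close>

text \<open>The law with distribution function G^s, obtained as an affine image of \<open>P\<close>
  by max-stability rather than from a general existence theorem.\<close>

definition V :: "real \<Rightarrow> (real^'d) measure" where
  "V s = distr P borel (\<lambda>z. \<chi> j. s powr (\<gamma> $ j) * z $ j + shift s j)"

lemma affine_measurable: "(\<lambda>z. \<chi> j. s powr (\<gamma> $ j) * z $ j + shift s j) \<in> borel_measurable P"
proof (rule borel_measurable_vecI)
  fix j
  have "(\<lambda>z::real^'d. s powr (\<gamma> $ j) * z $ j + shift s j) \<in> borel_measurable borel" by measurable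
  then show "(\<lambda>z. (\<chi> j. s powr (\<gamma> $ j) * z $ j + shift s j) $ j) \<in> borel_measurable P"
    using measurable_cong_sets[OF sets_P refl] by auto
qed

lemma V_prob: "prob_space (V s)" "sets (V s) = sets borel"
  unfolding V_def using prob_P affine_measurable by (auto intro: prob_space.prob_space_distr)

lemma V_cdf: "s > 0 \<Longrightarrow> measure (V s) {..x} = G x powr s"
proof -
  assume s: "s > 0"
  have "measure (V s) {..x} = measure P {z. (\<chi> j. s powr (\<gamma> $ j) * z $ j + shift s j) \<le> x}"
    unfolding V_def using borel_closed[OF closed_eucl_atMost[of x]]
    by (subst measure_distr[OF affine_measurable]) (auto simp: vimage_def)
  also have "{z. (\<chi> j. s powr (\<gamma> $ j) * z $ j + shift s j) \<le> x} = {..Tinv s x}"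
    using s by (auto simp: less_eq_vec_def Tinv_def field_simps)
  finally show ?thesis using Gs_powr[OF s, of x] by (simp add: Gs_def mcdf_def)
qed

definition is_G_xi :: "real \<Rightarrow> ((real^'d) \<times> (real^'d)) measure \<Rightarrow> bool" where
  "is_G_xi \<xi> C \<longleftrightarrow> prob_space C \<and> sets C = sets borel \<and>
     (\<forall>x y. measure C ({..x} \<times> {..y}) = G x powr \<xi> * G y powr \<xi> * G (inf x y) powr (1 - \<xi>))"

lemma atMost_pair: "{..x} \<times> {..y} = {..(x, y)}" for x y :: "real^'d"
  by (auto simp: less_eq_prod_def)

lemma is_G_xi_unique: "is_G_xi \<xi> C \<Longrightarrow> is_G_xi \<xi> C' \<Longrightarrow> C = C'"
proof (rule cdf_unique)
  assume "is_G_xi \<xi> C" "is_G_xi \<xi> C'"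
  then show "measure C {..z} = measure C' {..z}" for z
    unfolding is_G_xi_def atMost_pair by (cases z) simp
qed (auto simp: is_G_xi_def)

lemma measurable_sup_vec: "(\<lambda>p. sup (fst p) (snd p)) \<in> measurable (borel \<Otimes>\<^sub>M borel) (borel :: (real^'d) measure)"
proof (rule borel_measurable_vecI)
  fix j
  have "(\<lambda>p :: (real^'d) \<times> (real^'d). max (fst p $ j) (snd p $ j)) \<in> borel_measurable (borel \<Otimes>\<^sub>M borel)"
  proof (rule borel_measurable_max)
    show "(\<lambda>p :: (real^'d) \<times> (real^'d). fst p $ j) \<in> borel_measurable (borel \<Otimes>\<^sub>M borel)"
      by (rule measurable_compose[OF measurable_fst borel_measurable_nth])
    show "(\<lambda>p :: (real^'d) \<times> (real^'d). snd p $ j) \<in> borel_measurable (borel \<Otimes>\<^sub>M borel)"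
      by (rule measurable_compose[OF measurable_snd borel_measurable_nth])
  qed
  then show "(\<lambda>p :: (real^'d) \<times> (real^'d). sup (fst p) (snd p) $ j) \<in> borel_measurable (borel \<Otimes>\<^sub>M borel)"
    by (simp add: sup_vec_def sup_max)
qed

text \<open>With independent \<open>V\<^sub>1, V\<^sub>2, V\<^sub>3\<close> of distribution functions \<open>G\<^sup>\<xi>\<close>, \<open>G\<^sup>1\<^sup>-\<^sup>\<xi>\<close>, \<open>G\<^sup>\<xi>\<close>, the pair
  \<open>(max(V\<^sub>1, V\<^sub>2), max(V\<^sub>2, V\<^sub>3))\<close> has the required law.\<close>

lemma is_G_xi_exists:
  assumes \<xi>: "0 < \<xi>" "\<xi> < 1"
  shows "\<exists>C. is_G_xi \<xi> C"
proof -
  let ?W = "V (1 - \<xi>) \<Otimes>\<^sub>M V \<xi>"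
  let ?N = "V \<xi> \<Otimes>\<^sub>M ?W"
  interpret V1: prob_space "V \<xi>" by (rule V_prob)
  interpret V2: prob_space "V (1 - \<xi>)" by (rule V_prob)
  interpret W: pair_prob_space "V (1 - \<xi>)" "V \<xi>" ..
  interpret N: pair_prob_space "V \<xi>" ?W ..
  define F where "F p = (sup (fst p) (fst (snd p)), sup (fst (snd p)) (snd (snd p)))" for p :: "(real^'d) \<times> (real^'d) \<times> (real^'d)"
  have sN: "sets ?N = sets (borel \<Otimes>\<^sub>M (borel \<Otimes>\<^sub>M borel))"
    by (intro sets_pair_measure_cong V_prob)
  have Fm: "F \<in> borel_measurable ?N"
  proof -
    have "(\<lambda>p. sup (fst p) (fst (snd p))) \<in> measurable (borel \<Otimes>\<^sub>M (borel \<Otimes>\<^sub>M borel)) (borel :: (real^'d) measure)"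
      using measurable_compose[OF _ measurable_sup_vec, of "\<lambda>p. (fst p, fst (snd p))" "borel \<Otimes>\<^sub>M (borel \<Otimes>\<^sub>M borel)"] by simp
    moreover have "(\<lambda>p. sup (fst (snd p)) (snd (snd p))) \<in> measurable (borel \<Otimes>\<^sub>M (borel \<Otimes>\<^sub>M borel)) (borel :: (real^'d) measure)"
      using measurable_compose[OF _ measurable_sup_vec, of "\<lambda>p. (fst (snd p), snd (snd p))" "borel \<Otimes>\<^sub>M (borel \<Otimes>\<^sub>M borel)"] by simp
    ultimately have "F \<in> measurable (borel \<Otimes>\<^sub>M (borel \<Otimes>\<^sub>M borel)) (borel \<Otimes>\<^sub>M borel)"
      unfolding F_def[abs_def] by (intro measurable_Pair)
    then have "F \<in> measurable (borel \<Otimes>\<^sub>M (borel \<Otimes>\<^sub>M borel)) borel" by (simp only: borel_prod)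
    then show ?thesis by (subst measurable_cong_sets[OF sN refl])
  qed
  have sp: "space (V s) = UNIV" for s using sets_eq_imp_space_eq[OF V_prob(2)] by simp
  have at: "{..x} \<in> sets (V s)" for x :: "real^'d" and s
    using borel_closed[OF closed_eucl_atMost[of x]] by (simp add: V_prob)
  let ?Q = "distr ?N borel F"
  have "measure ?Q ({..x} \<times> {..y}) = G x powr \<xi> * G y powr \<xi> * G (inf x y) powr (1 - \<xi>)" for x y
  proof -
    have "{..x} \<times> {..y} \<in> sets borel" unfolding atMost_pair by (rule borel_closed[OF closed_eucl_atMost])
    then have "measure ?Q ({..x} \<times> {..y}) = measure ?N (F -` ({..x} \<times> {..y}) \<inter> space ?N)"
      by (rule measure_distr[OF Fm])
    \<comment> \<open>The event is a product set: the first variable below x, the second below both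
      bounds, the third below y.\<close>
    also have "F -` ({..x} \<times> {..y}) \<inter> space ?N = {..x} \<times> ({..inf x y} \<times> {..y})"
      by (auto simp: F_def space_pair_measure sp)
    also have "measure ?N \<dots> = measure (V \<xi>) {..x} * measure ?W ({..inf x y} \<times> {..y})"
      using at by (simp add: measure_def W.P.emeasure_pair_measure_Times enn2real_mult)
    also have "measure ?W ({..inf x y} \<times> {..y}) = measure (V (1 - \<xi>)) {..inf x y} * measure (V \<xi>) {..y}"
      using at by (simp add: measure_def V1.emeasure_pair_measure_Times enn2real_mult)
    finally show ?thesis using \<xi> by (simp add: V_cdf mult_ac)
  qed
  then have "is_G_xi \<xi> ?Q"
    unfolding is_G_xi_def using N.P.prob_space_distr[OF Fm] by auto
  then show ?thesis by blast
qed

text \<open>Existence and uniqueness give meaning to the \<open>THE\<close> in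
  \<open>G_xi_law\<close>; on this range \<open>min \<xi> 1\<close> is \<xi>.\<close>

lemma G_xi_law_is_G_xi:
  assumes \<xi>: "0 < \<xi>" "\<xi> < 1"
  shows "is_G_xi \<xi> (G_xi_law P \<xi>)"
proof -
  have "\<exists>!C. is_G_xi \<xi> C" using is_G_xi_exists[OF \<xi>] is_G_xi_unique by blast
  then have "is_G_xi \<xi> (THE C. is_G_xi \<xi> C)" by (rule theI')
  then show ?thesis using \<xi> unfolding G_xi_law_def is_G_xi_def by (simp add: min_def)
qed

section \<open>Couplings of the limit law with itself\<close>

definition coupling :: "((real^'d) \<times> (real^'d)) measure \<Rightarrow> bool" where
  "coupling C \<longleftrightarrow> prob_space C \<and> sets C = sets borel \<and> distr C borel fst = P \<and> distr C borel snd = P"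

lemma atMost_e1_exhaust: "(\<Union>n. {..real n *\<^sub>R e1}) = UNIV"
proof (intro set_eqI iffI UNIV_I)
  fix x :: "real^'d"
  obtain n where n: "norm x \<le> real n" using real_arch_simple by blast
  have "x $ i \<le> real n" for i using component_le_norm_cart[of x i] n by linarith
  then have "x \<in> {..real n *\<^sub>R e1}" by (auto simp: less_eq_vec_def)
  then show "x \<in> (\<Union>n. {..real n *\<^sub>R e1})" by blast
qed

lemma atMost_e1_incseq: "incseq (\<lambda>n. {..real n *\<^sub>R e1})"
proof (rule incseq_SucI)
  fix n :: nat
  show "{..real n *\<^sub>R e1} \<le> {..real (Suc n) *\<^sub>R e1}"
    using e1_mono(1)[of "real n" "real (Suc n)" 0] by simp
qed

lemma G_large: "(\<lambda>n. G (real n *\<^sub>R e1)) \<longlonglongrightarrow> 1"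
proof -
  interpret P: prob_space P by (rule prob_P)
  have "(\<lambda>n. measure P {..real n *\<^sub>R e1}) \<longlonglongrightarrow> measure P (\<Union>n. {..real n *\<^sub>R e1})"
    by (rule P.finite_Lim_measure_incseq[OF _ atMost_e1_incseq]) (use atMost_P in auto)
  then show ?thesis using P.prob_space by (simp add: mcdf_def atMost_e1_exhaust)
qed

lemma fst_borel [measurable]: "fst \<in> borel_measurable (borel :: ((real^'d) \<times> (real^'d)) measure)"
  and snd_borel [measurable]: "snd \<in> borel_measurable (borel :: ((real^'d) \<times> (real^'d)) measure)"
  unfolding borel_prod[symmetric] by measurable

text \<open>A margin is recovered by sending the bound on the other coordinate to infinity along the
  diagonal.\<close>

lemma couplingI:
  assumes C: "prob_space C" "sets C = sets borel"
    and fst: "\<And>x. (\<lambda>n. measure C ({..x} \<times> {..real n *\<^sub>R e1})) \<longlonglongrightarrow> G x"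
    and snd: "\<And>x. (\<lambda>n. measure C ({..real n *\<^sub>R e1} \<times> {..x})) \<longlonglongrightarrow> G x"
  shows "coupling C"
proof -
  interpret C: prob_space C by fact
  have sp: "space C = UNIV" using sets_eq_imp_space_eq[OF C(2)] by simp
  have m [measurable]: "fst \<in> borel_measurable C" "snd \<in> borel_measurable C"
    using fst_borel snd_borel measurable_cong_sets[OF C(2) refl] by blast+
  have at: "{..x} \<times> {..y} \<in> sets C" for x y unfolding atMost_pair C(2) by (rule borel_closed[OF closed_eucl_atMost])
  note U = atMost_e1_exhaust and inc = atMost_e1_incseq
  have "measure (distr C borel fst) {..x} = measure P {..x}" for x
  proof -
    have "(\<lambda>n. measure C ({..x} \<times> {..real n *\<^sub>R e1})) \<longlonglongrightarrow> measure C (\<Union>n. {..x} \<times> {..real n *\<^sub>R e1})"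
    proof (rule C.finite_Lim_measure_incseq)
      show "incseq (\<lambda>n. {..x} \<times> {..real n *\<^sub>R e1})"
        by (rule incseq_SucI, rule Sigma_mono, simp, rule incseq_SucD[OF inc])
    qed (use at in blast)
    also have "(\<Union>n. {..x} \<times> {..real n *\<^sub>R e1}) = {..x} \<times> (\<Union>n. {..real n *\<^sub>R e1})" by blast
    finally have "measure C ({..x} \<times> UNIV) = G x" using LIMSEQ_unique[OF fst] unfolding U by metis
    moreover have "fst -` {..x} \<inter> space C = {..x} \<times> UNIV" by (auto simp: sp)
    ultimately show ?thesis
      using measure_distr[OF m(1) borel_closed[OF closed_eucl_atMost[of x]]] by (simp add: mcdf_def)
  qed
  then have 1: "distr C borel fst = P"
    by (rule cdf_unique[OF C.prob_space_distr[OF m(1)] prob_P sets_distr sets_P])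
  have "measure (distr C borel snd) {..x} = measure P {..x}" for x
  proof -
    have "(\<lambda>n. measure C ({..real n *\<^sub>R e1} \<times> {..x})) \<longlonglongrightarrow> measure C (\<Union>n. {..real n *\<^sub>R e1} \<times> {..x})"
    proof (rule C.finite_Lim_measure_incseq)
      show "incseq (\<lambda>n. {..real n *\<^sub>R e1} \<times> {..x})"
        by (rule incseq_SucI, rule Sigma_mono, rule incseq_SucD[OF inc], simp)
    qed (use at in blast)
    also have "(\<Union>n. {..real n *\<^sub>R e1} \<times> {..x}) = (\<Union>n. {..real n *\<^sub>R e1}) \<times> {..x}" by blast
    finally have "measure C (UNIV \<times> {..x}) = G x" using LIMSEQ_unique[OF snd] unfolding U by metis
    moreover have "snd -` {..x} \<inter> space C = UNIV \<times> {..x}" by (auto simp: sp)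
    ultimately show ?thesis
      using measure_distr[OF m(2) borel_closed[OF closed_eucl_atMost[of x]]] by (simp add: mcdf_def)
  qed
  then have 2: "distr C borel snd = P"
    by (rule cdf_unique[OF C.prob_space_distr[OF m(2)] prob_P sets_distr sets_P])
  show ?thesis unfolding coupling_def using C 1 2 by blast
qed

lemma inf_large: "\<forall>\<^sub>F n in sequentially. inf x (real n *\<^sub>R e1) = x"
proof -
  obtain n0 where n0: "norm x \<le> real n0" using real_arch_simple by blast
  have "inf x (real n *\<^sub>R e1) = x" if "n \<ge> n0" for n
  proof (rule inf_absorb1)
    have "x $ i \<le> real n" for i using component_le_norm_cart[of x i] n0 that by (smt (verit) of_nat_le_iff)
    then show "x \<le> real n *\<^sub>R e1" by (simp add: less_eq_vec_def)
  qed
  then show ?thesis using eventually_sequentially by blast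
qed

lemma is_G_xi_coupling:
  assumes \<xi>: "0 < \<xi>" "\<xi> < 1" and C: "is_G_xi \<xi> C"
  shows "coupling C"
proof (rule couplingI)
  fix x
  \<comment> \<open>This includes \<open>G x = 0\<close>, where \<open>powr\<close> makes both sides
    0.\<close>
  have GG: "G x powr \<xi> * 1 powr \<xi> * G x powr (1 - \<xi>) = G x"
    using G_bounds(1)[of x] by (simp add: powr_add[symmetric])
  have lim: "(\<lambda>n. G x powr \<xi> * G (real n *\<^sub>R e1) powr \<xi> * G (inf x (real n *\<^sub>R e1)) powr (1 - \<xi>)) \<longlonglongrightarrow> G x"
  proof (rule Lim_transform_eventually)
    have "(\<lambda>n. G x powr \<xi> * G (real n *\<^sub>R e1) powr \<xi> * G x powr (1 - \<xi>)) \<longlonglongrightarrow> G x powr \<xi> * 1 powr \<xi> * G x powr (1 - \<xi>)"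
      by (intro tendsto_mult tendsto_const tendsto_powr G_large) auto
    then show "(\<lambda>n. G x powr \<xi> * G (real n *\<^sub>R e1) powr \<xi> * G x powr (1 - \<xi>)) \<longlonglongrightarrow> G x" unfolding GG .
    show "\<forall>\<^sub>F n in sequentially. G x powr \<xi> * G (real n *\<^sub>R e1) powr \<xi> * G x powr (1 - \<xi>) =
      G x powr \<xi> * G (real n *\<^sub>R e1) powr \<xi> * G (inf x (real n *\<^sub>R e1)) powr (1 - \<xi>)"
      using inf_large[of x] by eventually_elim simp
  qed
  show "(\<lambda>n. measure C ({..x} \<times> {..real n *\<^sub>R e1})) \<longlonglongrightarrow> G x"
    using lim C by (simp add: is_G_xi_def)
  show "(\<lambda>n. measure C ({..real n *\<^sub>R e1} \<times> {..x})) \<longlonglongrightarrow> G x"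
    using lim C by (simp add: is_G_xi_def inf_commute mult_ac)
qed (use C in \<open>auto simp: is_G_xi_def\<close>)

lemma product_coupling: "coupling (P \<Otimes>\<^sub>M P)" "measure (P \<Otimes>\<^sub>M P) ({..x} \<times> {..y}) = G x * G y"
proof -
  interpret P: prob_space P by (rule prob_P)
  interpret PP: pair_prob_space P P ..
  show m: "measure (P \<Otimes>\<^sub>M P) ({..x} \<times> {..y}) = G x * G y" for x y
    using atMost_P by (simp add: measure_def mcdf_def P.emeasure_pair_measure_Times enn2real_mult)
  show "coupling (P \<Otimes>\<^sub>M P)"
  proof (rule couplingI)
    show "sets (P \<Otimes>\<^sub>M P) = sets borel"
      unfolding borel_prod[symmetric] by (intro sets_pair_measure_cong sets_P)
    show "(\<lambda>n. measure (P \<Otimes>\<^sub>M P) ({..x} \<times> {..real n *\<^sub>R e1})) \<longlonglongrightarrow> G x" for x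
      unfolding m using tendsto_mult_left[OF G_large, of "G x"] by simp
    show "(\<lambda>n. measure (P \<Otimes>\<^sub>M P) ({..real n *\<^sub>R e1} \<times> {..x})) \<longlonglongrightarrow> G x" for x
      unfolding m using tendsto_mult_right[OF G_large, of "G x"] by simp
  qed (rule PP.P.prob_space_axioms)
qed

text \<open>The defining distribution function is symmetric in its two arguments. This is the source
  of the equal contributions of opposite lags on the circle.\<close>

lemma is_G_xi_swap:
  assumes C: "is_G_xi \<xi> C"
  shows "distr C borel (\<lambda>p. (snd p, fst p)) = C"
proof (rule is_G_xi_unique[OF _ C])
  have m: "(\<lambda>p. (snd p, fst p)) \<in> borel_measurable C"
  proof -
    have "(\<lambda>p. (snd p, fst p)) \<in> measurable (borel \<Otimes>\<^sub>M borel) (borel \<Otimes>\<^sub>M (borel :: (real^'d) measure) :: ((real^'d) \<times> (real^'d)) measure)"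
      by measurable
    then have "(\<lambda>p. (snd p, fst p)) \<in> measurable (borel :: ((real^'d) \<times> (real^'d)) measure) (borel :: ((real^'d) \<times> (real^'d)) measure)"
      by (simp only: borel_prod)
    moreover have "sets C = sets borel" using C by (simp add: is_G_xi_def)
    ultimately show ?thesis by (subst measurable_cong_sets[OF _ refl])
  qed
  have "measure (distr C borel (\<lambda>p. (snd p, fst p))) ({..x} \<times> {..y}) = measure C ({..y} \<times> {..x})" for x y
  proof -
    have s: "{..x} \<times> {..y} \<in> sets borel" unfolding atMost_pair by (rule borel_closed[OF closed_eucl_atMost])
    have "space C = UNIV" using C sets_eq_imp_space_eq[of C borel] by (simp add: is_G_xi_def)
    then have "(\<lambda>p. (snd p, fst p)) -` ({..x} \<times> {..y}) \<inter> space C = {..y} \<times> {..x}" by auto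
    then show ?thesis unfolding measure_distr[OF m s] by (rule arg_cong)
  qed
  then show "is_G_xi \<xi> (distr C borel (\<lambda>p. (snd p, fst p)))"
    using C m prob_space.prob_space_distr[OF _ m] by (auto simp: is_G_xi_def inf_commute mult_ac)
qed

end

section \<open>Windows on a circle\<close>

text \<open>Reduction modulo \<open>N\<close> to the representatives 1, ..., \<open>N\<close>, which
  match the numbering of positions in a block.\<close>

definition wrap :: "int \<Rightarrow> int \<Rightarrow> int" where
  "wrap N p = (p - 1) mod N + 1"

lemma wrap_id: "1 \<le> p \<Longrightarrow> p \<le> N \<Longrightarrow> wrap N p = p"
  by (simp add: wrap_def)

lemma wrap_over: "N < p \<Longrightarrow> p \<le> 2 * N \<Longrightarrow> wrap N p = p - N"
proof -
  assume p: "N < p" "p \<le> 2 * N"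
  have "(p - 1) mod N = (p - 1 - N) mod N"
    using mod_add_self2[of "p - 1 - N" N] by simp
  also have "\<dots> = p - 1 - N" using p by (intro mod_pos_pos_trivial) auto
  finally show ?thesis by (simp add: wrap_def)
qed

lemma wrap_cong: "p mod N = q mod N \<Longrightarrow> wrap N (p + c) = wrap N (q + c)"
proof -
  assume "p mod N = q mod N"
  then have "(p + (c - 1)) mod N = (q + (c - 1)) mod N" by (rule mod_add_cong) simp
  then show ?thesis by (simp add: wrap_def algebra_simps)
qed

text \<open>Block \<open>{1..N}\<close> seen as a circle, turned by \<open>\<rho>\<close>.\<close>

definition rot :: "int \<Rightarrow> int \<Rightarrow> int set \<Rightarrow> int set" where
  "rot N \<rho> A = (\<lambda>p. wrap N (p + \<rho>)) ` A"

definition win :: "int \<Rightarrow> int \<Rightarrow> int \<Rightarrow> int set" where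
  "win N r s = wrap N ` {s..s + r - 1}"

text \<open>Turning by \<rho> sends the last \<rho> positions to the front and moves the others
  ahead by \<rho>. The cut after position \<rho> therefore separates two translates of pieces of
  \<open>A\<close>.\<close>

lemma rot_split:
  assumes A: "A \<subseteq> {1..N}" and \<rho>: "0 \<le> \<rho>" "\<rho> < N"
  shows "rot N \<rho> A \<inter> {..\<rho>} = (\<lambda>p. p + (\<rho> - N)) ` (A \<inter> {N - \<rho><..})"
    and "rot N \<rho> A \<inter> {\<rho><..} = (\<lambda>p. p + \<rho>) ` (A \<inter> {..N - \<rho>})"
    and "rot N \<rho> A \<subseteq> {1..N}"
proof -
  have w: "wrap N (p + \<rho>) = (if p \<le> N - \<rho> then p + \<rho> else p + (\<rho> - N))" if "p \<in> A" for p
    using A \<rho> that wrap_id[of "p + \<rho>" N] wrap_over[of N "p + \<rho>"] by (auto simp: subset_iff)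
  have r: "rot N \<rho> A = (\<lambda>p. if p \<le> N - \<rho> then p + \<rho> else p + (\<rho> - N)) ` A"
    unfolding rot_def using w by (rule image_cong[OF refl])
  show "rot N \<rho> A \<inter> {..\<rho>} = (\<lambda>p. p + (\<rho> - N)) ` (A \<inter> {N - \<rho><..})"
    unfolding r using A \<rho> by (force simp: image_iff subset_iff)
  show "rot N \<rho> A \<inter> {\<rho><..} = (\<lambda>p. p + \<rho>) ` (A \<inter> {..N - \<rho>})"
    unfolding r using A \<rho> by (force simp: image_iff subset_iff)
  show "rot N \<rho> A \<subseteq> {1..N}"
    unfolding r using A \<rho> by (force simp: subset_iff)
qed

lemma win_rot: "win N r s = rot N (s - 1) {1..r}"
proof -
  have E: "{s..s + r - 1} = (\<lambda>p. p + (s - 1)) ` {1..r}" unfolding image_add_atLeastAtMost' by (simp add: add.commute)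
  show ?thesis unfolding win_def rot_def E image_image by (rule refl)
qed

text \<open>Only the lag matters: the windows at s and t are one rotation of the windows starting at
  1 and at d + 1.\<close>

lemma win_rot_shifted:
  assumes "d = (t - s) mod N"
  shows "win N r t = rot N (s - 1) {d + 1..d + r}"
proof -
  have E: "{d + 1..d + r} = (\<lambda>p. p + d) ` {1..r}" unfolding image_add_atLeastAtMost' by (simp add: add.commute)
  have "rot N (s - 1) {d + 1..d + r} = (\<lambda>p. wrap N ((d + s) + (p - 1))) ` {1..r}"
    unfolding rot_def E image_image by (intro image_cong refl arg_cong[where f="wrap N"]) simp
  also have "\<dots> = (\<lambda>p. wrap N (t + (p - 1))) ` {1..r}"
  proof (intro image_cong refl wrap_cong)
    show "(d + s) mod N = t mod N" unfolding assms by (simp add: mod_add_left_eq)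
  qed
  also have "\<dots> = win N r t"
    unfolding win_rot rot_def by (intro image_cong refl arg_cong[where f="wrap N"]) simp
  finally show ?thesis ..
qed

lemma win_subset: "N > 0 \<Longrightarrow> win N r s \<subseteq> {1..N}"
proof
  fix q assume N: "N > 0" and "q \<in> win N r s"
  then obtain p where "q = (p - 1) mod N + 1" by (auto simp: win_def wrap_def)
  then show "q \<in> {1..N}" using pos_mod_bound[OF N, of "p - 1"] pos_mod_sign[OF N, of "p - 1"] by simp
qed

lemma finite_win [simp]: "finite (win N r s)"
  by (simp add: win_def)

text \<open>A wrapped window consists of two pieces, one of which has at least half of its length,
  rounded down. This rescues the levels at which \<open>G\<close> vanishes.\<close>

lemma win_large_interval:
  assumes s: "1 \<le> s" "s \<le> N" and r: "1 \<le> r" "r \<le> N"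
  shows "\<exists>c. {c + 1..c + r div 2} \<subseteq> win N r s"
proof (cases "s + r div 2 - 1 \<le> N")
  case True
  have "p \<in> win N r s" if "p \<in> {s - 1 + 1..s - 1 + r div 2}" for p
  proof -
    have "wrap N p = p" "p \<in> {s..s + r - 1}" using that True s r by (auto intro: wrap_id)
    then show ?thesis unfolding win_def by (metis image_eqI)
  qed
  then show ?thesis by blast
next
  case False
  have "p \<in> win N r s" if "p \<in> {0 + 1..0 + r div 2}" for p
  proof -
    have b: "N < p + N" "p + N \<le> 2 * N" using that r by auto
    have "wrap N (p + N) = p" using wrap_over[OF b] by simp
    moreover have "p + N \<in> {s..s + r - 1}" using that False s r by auto
    ultimately show ?thesis unfolding win_def by (metis image_eqI)
  qed
  then show ?thesis by blast
qed

context mda_process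
begin

text \<open>Up to the mixing error, both sides factorise over the same two pieces of the circle, only in a
  different order.\<close>

lemma Q_rotate:
  assumes A: "A \<subseteq> {1..N}" and B: "B \<subseteq> {1..N}" and \<rho>: "0 \<le> \<rho>" "\<rho> < N"
  shows "\<bar>Q A B w v - Q (rot N \<rho> A) (rot N \<rho> B) w v\<bar> \<le> 2 * alpha_mix M X l + 4 * ((1 - K l w) + (1 - K l v))"
proof -
  have fin: "finite A" "finite B" using A B finite_subset by blast+
  have finr: "finite (rot N \<rho> A)" "finite (rot N \<rho> B)" using fin by (auto simp: rot_def)
  let ?c = "N - \<rho>"
  have 1: "\<bar>Q A B w v - Q (A \<inter> {..?c}) (B \<inter> {..?c}) w v * Q (A \<inter> {?c<..}) (B \<inter> {?c<..}) w v\<bar> \<le>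
    alpha_mix M X l + 2 * ((1 - K l w) + (1 - K l v))" by (rule Q_cut[OF fin])
  have 2: "\<bar>Q (rot N \<rho> A) (rot N \<rho> B) w v - Q (A \<inter> {?c<..}) (B \<inter> {?c<..}) w v * Q (A \<inter> {..?c}) (B \<inter> {..?c}) w v\<bar> \<le>
    alpha_mix M X l + 2 * ((1 - K l w) + (1 - K l v))"
    using Q_cut[OF finr, of w v \<rho> l] unfolding rot_split(1,2)[OF A \<rho>] rot_split(1,2)[OF B \<rho>]
    using fin by (simp add: Q_shift)
  from 1 2 show ?thesis by (simp add: mult.commute)
qed

section \<open>Limits for pairs of windows\<close>

definition gerr :: "nat \<Rightarrow> real^'d \<Rightarrow> real^'d \<Rightarrow> real" where
  "gerr i x y = alpha_mix M X (L i) + 2 * ((1 - K (L i) (u i x)) + (1 - K (L i) (u i y)))"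

lemma gerr_limit: "G x > 0 \<Longrightarrow> G y > 0 \<Longrightarrow> (\<lambda>i. gerr i x y) \<longlonglongrightarrow> 0"
proof -
  assume "G x > 0" "G y > 0"
  then have "(\<lambda>i. gerr i x y) \<longlonglongrightarrow> 0 + 2 * ((1 - 1) + (1 - 1))"
    unfolding gerr_def by (intro tendsto_intros alpha_L gap_negligible)
  then show ?thesis by simp
qed

lemma K_inf: "Q {s + 1..s + int c} {s + 1..s + int c} (u i x) (u i y) = K c (u i (inf x y))"
proof -
  have "Q {s + 1..s + int c} {s + 1..s + int c} (u i x) (u i y) = Q {s + 1..s + int c} {} (u i (inf x y)) (u i (inf x y))"
    unfolding Q_def using level_inf[OF a_pos[OF R_pos[of i]], of _ "b (R i)" x y]
    by (intro arg_cong[where f=prob]) auto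
  then show ?thesis by (simp add: Q_interval)
qed

text \<open>Cuts after d and after R leave stretches of lengths d, R - d and d; on the middle one
  both bounds apply, that is, their infimum.\<close>

lemma overlap_base:
  assumes "d \<le> R i"
  shows "\<bar>Q {1..int (R i)} {int d + 1..int d + int (R i)} (u i x) (u i y) - K d (u i x) * (K (R i - d) (u i (inf x y)) * K d (u i y))\<bar> \<le> 2 * gerr i x y"
proof -
  let ?A = "{1..int (R i)}" and ?B = "{int d + 1..int d + int (R i)}"
  have 1: "\<bar>Q ?A ?B (u i x) (u i y) - Q (?A \<inter> {..int d}) (?B \<inter> {..int d}) (u i x) (u i y) * Q (?A \<inter> {int d<..}) (?B \<inter> {int d<..}) (u i x) (u i y)\<bar> \<le> gerr i x y"
    unfolding gerr_def by (rule Q_cut) auto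
  have s1: "?A \<inter> {..int d} = {0 + 1..0 + int d}" "?B \<inter> {..int d} = {}" "?A \<inter> {int d<..} = {int d + 1..int (R i)}" "?B \<inter> {int d<..} = ?B"
    using assms by auto
  let ?A' = "{int d + 1..int (R i)}"
  have 2: "\<bar>Q ?A' ?B (u i x) (u i y) - Q (?A' \<inter> {..int (R i)}) (?B \<inter> {..int (R i)}) (u i x) (u i y) * Q (?A' \<inter> {int (R i)<..}) (?B \<inter> {int (R i)<..}) (u i x) (u i y)\<bar> \<le> gerr i x y"
    unfolding gerr_def by (rule Q_cut) auto
  have s2: "?A' \<inter> {..int (R i)} = {int d + 1..int d + int (R i - d)}" "?B \<inter> {..int (R i)} = {int d + 1..int d + int (R i - d)}"
    "?A' \<inter> {int (R i)<..} = {}" "?B \<inter> {int (R i)<..} = {int (R i) + 1..int (R i) + int d}"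
    using assms by auto
  have 3: "\<bar>Q ?A' ?B (u i x) (u i y) - K (R i - d) (u i (inf x y)) * K d (u i y)\<bar> \<le> gerr i x y"
    using 2 unfolding s2 K_inf Q_interval .
  have 4: "\<bar>Q ?A ?B (u i x) (u i y) - K d (u i x) * Q ?A' ?B (u i x) (u i y)\<bar> \<le> gerr i x y"
    using 1 unfolding s1 Q_interval .
  have "\<bar>K d (u i x) * Q ?A' ?B (u i x) (u i y) - K d (u i x) * (K (R i - d) (u i (inf x y)) * K d (u i y))\<bar> \<le> 1 * gerr i x y"
    unfolding right_diff_distrib[symmetric] abs_mult using 3 K_bounds by (intro mult_mono) auto
  with 4 show ?thesis by linarith
qed

lemma disjoint_base:
  assumes "R i \<le> d"
  shows "\<bar>Q {1..int (R i)} {int d + 1..int d + int (R i)} (u i x) (u i y) - K (R i) (u i x) * K (R i) (u i y)\<bar> \<le> gerr i x y"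
proof -
  let ?A = "{1..int (R i)}" and ?B = "{int d + 1..int d + int (R i)}"
  have 1: "\<bar>Q ?A ?B (u i x) (u i y) - Q (?A \<inter> {..int (R i)}) (?B \<inter> {..int (R i)}) (u i x) (u i y) * Q (?A \<inter> {int (R i)<..}) (?B \<inter> {int (R i)<..}) (u i x) (u i y)\<bar> \<le> gerr i x y"
    unfolding gerr_def by (rule Q_cut) auto
  have s: "?A \<inter> {..int (R i)} = {0 + 1..0 + int (R i)}" "?B \<inter> {..int (R i)} = {}" "?A \<inter> {int (R i)<..} = {}" "?B \<inter> {int (R i)<..} = ?B"
    using assms by auto
  show ?thesis using 1 unfolding s Q_interval .
qed

lemma K_R_limit: "(\<lambda>i. K (R i) (u i x)) \<longlonglongrightarrow> G x"
proof -
  have "(\<lambda>i. real (R i) / real (R i)) = (\<lambda>i. 1)" using R_pos by (auto simp: fun_eq_iff Suc_le_eq)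
  then show ?thesis using K_limit[of R 1 x] G_bounds(1)[of x] by simp
qed

text \<open>Gaps cannot be neglected at such levels. But the window contains an interval of half its
  length, whose non-exceedance probability tends to G^(1/2) = 0.\<close>

lemma win_null:
  assumes s: "\<And>i. 1 \<le> s i \<and> s i \<le> N i" and N: "\<And>i. int (R i) \<le> N i" and G: "G x = 0"
    and f: "\<And>i. 0 \<le> f i \<and> f i \<le> Q (win (N i) (int (R i)) (s i)) {} (u i x) (u i x)"
  shows "f \<longlonglongrightarrow> 0"
proof (rule tendsto_sandwich[OF _ _ tendsto_const])
  have lim: "(\<lambda>i. real (R i div 2) / real (R i)) \<longlonglongrightarrow> 1 / 2"
  proof (rule tendsto_sandwich)
    show "\<forall>\<^sub>F i in sequentially. 1 / 2 - 1 / real (R i) \<le> real (R i div 2) / real (R i)"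
    proof (rule always_eventually, rule allI)
      fix i
      have "real (R i) / 2 - 1 \<le> real (R i div 2)" by linarith
      from divide_right_mono[OF this, of "real (R i)"] show "1 / 2 - 1 / real (R i) \<le> real (R i div 2) / real (R i)"
        using R_pos[of i] by (simp add: diff_divide_distrib)
    qed
    show "\<forall>\<^sub>F i in sequentially. real (R i div 2) / real (R i) \<le> 1 / 2"
    proof (rule always_eventually, rule allI)
      fix i
      have "real (R i div 2) \<le> real (R i) / 2" by linarith
      from divide_right_mono[OF this, of "real (R i)"] show "real (R i div 2) / real (R i) \<le> 1 / 2"
        using R_pos[of i] by simp
    qed
    show "(\<lambda>i. 1 / 2 - 1 / real (R i)) \<longlonglongrightarrow> 1 / 2"
      using tendsto_diff[OF tendsto_const real_tendsto_divide_at_top[OF tendsto_const R_real_top], of "1/2" 1] by simp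
  qed simp
  have "(\<lambda>i. K (R i div 2) (u i x)) \<longlonglongrightarrow> G x powr (1/2)" by (rule K_limit[OF lim]) simp
  then show "(\<lambda>i. K (R i div 2) (u i x)) \<longlonglongrightarrow> 0" using G by simp
  show "\<forall>\<^sub>F i in sequentially. 0 \<le> f i" using f by simp
  show "\<forall>\<^sub>F i in sequentially. f i \<le> K (R i div 2) (u i x)"
  proof (rule always_eventually, rule allI)
    fix i
    obtain c where c: "{c + 1..c + int (R i) div 2} \<subseteq> win (N i) (int (R i)) (s i)"
      using win_large_interval[of "s i" "N i" "int (R i)"] s[of i] N[of i] R_pos[of i] by auto
    have "Q (win (N i) (int (R i)) (s i)) {} (u i x) (u i x) \<le> Q {c + 1..c + int (R i div 2)} {} (u i x) (u i x)"
      using c by (intro Q_mono) (auto simp: zdiv_int)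
    then show "f i \<le> K (R i div 2) (u i x)" using f[of i] unfolding Q_interval by linarith
  qed
qed

lemma squeeze_limit:
  assumes "(\<lambda>i. p i) \<longlonglongrightarrow> (l::real)" "(\<lambda>i. e i) \<longlonglongrightarrow> 0" "\<And>i. \<bar>f i - p i\<bar> \<le> c * e i"
  shows "f \<longlonglongrightarrow> l"
proof -
  have "(\<lambda>i. f i - p i) \<longlonglongrightarrow> 0"
    by (rule Lim_null_comparison[of _ "\<lambda>i. c * e i"]) (use assms(3) tendsto_mult_left[OF assms(2), of c] in auto)
  from tendsto_add[OF this assms(1)] show ?thesis by simp
qed

text \<open>The circle is turned until the first window starts at 1;
  \<open>int d + int (R i) \<le> N\<close> keeps the second one from wrapping in that
  position.\<close>

lemma win_rotate:
  assumes s: "1 \<le> s" "s \<le> N" and d: "int d = (t - s) mod N" "int d + int (R i) \<le> N"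
  shows "\<bar>Q (win N (int (R i)) s) (win N (int (R i)) t) (u i x) (u i y) -
    Q {1..int (R i)} {int d + 1..int d + int (R i)} (u i x) (u i y)\<bar> \<le> 2 * gerr i x y"
proof -
  have "\<bar>Q {1..int (R i)} {int d + 1..int d + int (R i)} (u i x) (u i y) -
    Q (rot N (s - 1) {1..int (R i)}) (rot N (s - 1) {int d + 1..int d + int (R i)}) (u i x) (u i y)\<bar> \<le>
    2 * alpha_mix M X (L i) + 4 * ((1 - K (L i) (u i x)) + (1 - K (L i) (u i y)))"
    using s d R_pos[of i] by (intro Q_rotate) auto
  then show ?thesis unfolding win_rot[symmetric] win_rot_shifted[OF d(1), symmetric] gerr_def
    by (simp add: abs_minus_commute)
qed

lemma win_single_limit:
  assumes s: "\<And>i. 1 \<le> s i \<and> s i \<le> N i" and N: "\<And>i. int (R i) \<le> N i"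
  shows "(\<lambda>i. Q (win (N i) (int (R i)) (s i)) {} (u i x) (u i x)) \<longlonglongrightarrow> G x"
proof (cases "G x = 0")
  case True
  then show ?thesis using win_null[OF s N True, of "\<lambda>i. Q (win (N i) (int (R i)) (s i)) {} (u i x) (u i x)"] Q_bounds by simp
next
  case False
  then have G: "G x > 0" using G_bounds(1)[of x] by simp
  show ?thesis
  proof (rule squeeze_limit[OF K_R_limit gerr_limit[OF G G], where c=2])
    fix i
    have "\<bar>Q {1..int (R i)} {} (u i x) (u i x) - Q (rot (N i) (s i - 1) {1..int (R i)}) (rot (N i) (s i - 1) {}) (u i x) (u i x)\<bar> \<le>
      2 * alpha_mix M X (L i) + 4 * ((1 - K (L i) (u i x)) + (1 - K (L i) (u i x)))"
      using s[of i] N[of i] by (intro Q_rotate) auto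
    then show "\<bar>Q (win (N i) (int (R i)) (s i)) {} (u i x) (u i x) - K (R i) (u i x)\<bar> \<le> 2 * gerr i x x"
      unfolding win_rot K_def gerr_def by (simp add: rot_def abs_minus_commute)
  qed
qed

text \<open>Rotation and the two cuts cost 2 \<open>gerr\<close> each. If \<open>G\<close> vanishes
  at x or y, the claimed limit is 0 and a single window already forces it.\<close>

lemma win_overlap_limit:
  assumes s: "\<And>i. 1 \<le> s i \<and> s i \<le> N i" and t: "\<And>i. 1 \<le> t i \<and> t i \<le> N i" and N: "\<And>i. 2 * int (R i) \<le> N i"
    and d: "\<And>i. int (d i) = (t i - s i) mod N i" "\<And>i. d i \<le> R i"
    and \<xi>: "(\<lambda>i. real (d i) / real (R i)) \<longlonglongrightarrow> \<xi>" "0 < \<xi>" "\<xi> < 1"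
  shows "(\<lambda>i. Q (win (N i) (int (R i)) (s i)) (win (N i) (int (R i)) (t i)) (u i x) (u i y)) \<longlonglongrightarrow>
    G x powr \<xi> * G y powr \<xi> * G (inf x y) powr (1 - \<xi>)"
proof -
  have N1: "int (R i) \<le> N i" for i using N[of i] by linarith
  consider "G x = 0" | "G y = 0" | "G x > 0" "G y > 0" using G_bounds(1)[of x] G_bounds(1)[of y] by linarith
  then show ?thesis
  proof cases
    case 1
    have "Q (win (N i) (int (R i)) (s i)) (win (N i) (int (R i)) (t i)) (u i x) (u i y) \<le> Q (win (N i) (int (R i)) (s i)) {} (u i x) (u i x)" for i
      using Q_mono[of "win (N i) (int (R i)) (s i)" "{}" "win (N i) (int (R i)) (s i)" "win (N i) (int (R i)) (t i)" "u i x" "u i y"]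
      by (simp add: Q_right_empty[of _ "u i x" "u i y" "u i x"])
    then show ?thesis using win_null[OF s N1 1, of "\<lambda>i. Q (win (N i) (int (R i)) (s i)) (win (N i) (int (R i)) (t i)) (u i x) (u i y)"] Q_bounds 1 \<xi> by simp
  next
    case 2
    have "Q (win (N i) (int (R i)) (s i)) (win (N i) (int (R i)) (t i)) (u i x) (u i y) \<le> Q (win (N i) (int (R i)) (t i)) {} (u i y) (u i y)" for i
      using Q_mono[of "{}" "win (N i) (int (R i)) (t i)" "win (N i) (int (R i)) (s i)" "win (N i) (int (R i)) (t i)" "u i x" "u i y"]
      by (simp add: Q_swap[of "{}"] Q_right_empty[of _ "u i y" "u i x" "u i y"])
    then show ?thesis using win_null[OF t N1 2, of "\<lambda>i. Q (win (N i) (int (R i)) (s i)) (win (N i) (int (R i)) (t i)) (u i x) (u i y)"] Q_bounds 2 \<xi> by simp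
  next
    case 3
    have lim: "(\<lambda>i. K (d i) (u i x) * (K (R i - d i) (u i (inf x y)) * K (d i) (u i y))) \<longlonglongrightarrow>
      G x powr \<xi> * (G (inf x y) powr (1 - \<xi>) * G y powr \<xi>)"
    proof (intro tendsto_mult K_limit \<xi>)
      have "(\<lambda>i. 1 - real (d i) / real (R i)) \<longlonglongrightarrow> 1 - \<xi>" by (intro tendsto_intros \<xi>)
      moreover have "1 - real (d i) / real (R i) = real (R i - d i) / real (R i)" for i
        using d(2)[of i] R_pos[of i] by (simp add: of_nat_diff diff_divide_distrib)
      ultimately show "(\<lambda>i. real (R i - d i) / real (R i)) \<longlonglongrightarrow> 1 - \<xi>" by simp
    qed (use \<xi> in auto)
    have "(\<lambda>i. Q (win (N i) (int (R i)) (s i)) (win (N i) (int (R i)) (t i)) (u i x) (u i y)) \<longlonglongrightarrow>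
      G x powr \<xi> * (G (inf x y) powr (1 - \<xi>) * G y powr \<xi>)"
    proof (rule squeeze_limit[OF lim gerr_limit[OF 3], where c=4])
      fix i
      have "int (d i) + int (R i) \<le> N i" using d(2)[of i] N[of i] by linarith
      then show "\<bar>Q (win (N i) (int (R i)) (s i)) (win (N i) (int (R i)) (t i)) (u i x) (u i y) -
        K (d i) (u i x) * (K (R i - d i) (u i (inf x y)) * K (d i) (u i y))\<bar> \<le> 4 * gerr i x y"
        using win_rotate[of "s i" "N i" "d i" "t i" i x y] overlap_base[OF d(2), of i x y] s[of i] d(1)[of i] by simp
    qed
    then show ?thesis by (simp add: mult_ac)
  qed
qed

text \<open>Disposes of the points where \<open>G\<close> vanishes, once for all product limits;
  \<open>f\<close> stands for a joint probability, bounded by that of either window.\<close>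

lemma pair_product_limit:
  assumes s: "\<And>i. 1 \<le> s i \<and> s i \<le> N i" and t: "\<And>i. 1 \<le> t i \<and> t i \<le> N i" and N: "\<And>i. int (R i) \<le> N i"
    and le: "\<And>i x y. f i x y \<le> Q (win (N i) (int (R i)) (s i)) {} (u i x) (u i x)"
      "\<And>i x y. f i x y \<le> Q (win (N i) (int (R i)) (t i)) {} (u i y) (u i y)" "\<And>i x y. 0 \<le> f i x y"
    and pos: "\<And>x y. G x > 0 \<Longrightarrow> G y > 0 \<Longrightarrow> (\<lambda>i. f i x y) \<longlonglongrightarrow> G x * G y"
  shows "(\<lambda>i. f i x y) \<longlonglongrightarrow> G x * G y"
proof -
  consider "G x = 0" | "G y = 0" | "G x > 0" "G y > 0" using G_bounds(1)[of x] G_bounds(1)[of y] by linarith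
  then show ?thesis
  proof cases
    case 1
    then show ?thesis using win_null[OF s N 1, of "\<lambda>i. f i x y"] le by simp
  next
    case 2
    then show ?thesis using win_null[OF t N 2, of "\<lambda>i. f i x y"] le by simp
  qed (rule pos)
qed

lemma win_pair_le:
  "Q (win N r s) (win N' r' t) w v \<le> Q (win N r s) {} w w" "Q (win N r s) (win N' r' t) w v \<le> Q (win N' r' t) {} v v"
  using Q_mono[of "win N r s" "{}" "win N r s" "win N' r' t" w v] Q_mono[of "{}" "win N' r' t" "win N r s" "win N' r' t" w v]
  by (simp_all add: Q_swap[of "{}"] Q_right_empty[of _ w v w] Q_right_empty[of _ v w v])

lemma win_disjoint_limit:
  assumes s: "\<And>i. 1 \<le> s i \<and> s i \<le> N i" and t: "\<And>i. 1 \<le> t i \<and> t i \<le> N i"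
    and d: "\<And>i. int (d i) = (t i - s i) mod N i" "\<And>i. R i \<le> d i" "\<And>i. int (d i) + int (R i) \<le> N i"
  shows "(\<lambda>i. Q (win (N i) (int (R i)) (s i)) (win (N i) (int (R i)) (t i)) (u i x) (u i y)) \<longlonglongrightarrow> G x * G y"
proof (rule pair_product_limit[OF s t])
  show "int (R i) \<le> N i" for i using d(3)[of i] by linarith
next
  fix x y assume G: "G x > 0" "G y > 0"
  show "(\<lambda>i. Q (win (N i) (int (R i)) (s i)) (win (N i) (int (R i)) (t i)) (u i x) (u i y)) \<longlonglongrightarrow> G x * G y"
  proof (rule squeeze_limit[OF tendsto_mult[OF K_R_limit K_R_limit] gerr_limit[OF G], where c=3])
    fix i
    show "\<bar>Q (win (N i) (int (R i)) (s i)) (win (N i) (int (R i)) (t i)) (u i x) (u i y) - K (R i) (u i x) * K (R i) (u i y)\<bar> \<le> 3 * gerr i x y"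
      using win_rotate[of "s i" "N i" "d i" "t i" i x y] disjoint_base[OF d(2), of i x y] s[of i] d(1,3)[of i] by simp
  qed
qed (rule win_pair_le Q_bounds)+

lemma win_adjacent_limit:
  assumes s: "\<And>i. 1 \<le> s i \<and> s i \<le> N i" and t: "\<And>i. 1 \<le> t i \<and> t i \<le> N i" and N: "\<And>i. int (R i) \<le> N i"
  shows "(\<lambda>i. Q (win (N i) (int (R i)) (s i)) ((\<lambda>p. p + N i) ` win (N i) (int (R i)) (t i)) (u i x) (u i y)) \<longlonglongrightarrow> G x * G y"
proof (rule pair_product_limit[OF s t N])
  fix i x y
  have Np: "N i > 0" using s[of i] by linarith
  let ?A = "win (N i) (int (R i)) (s i)" and ?B = "win (N i) (int (R i)) (t i)"
  have A: "?A \<subseteq> {1..N i}" "?B \<subseteq> {1..N i}" using win_subset[OF Np] by auto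
  show "Q ?A ((\<lambda>p. p + N i) ` ?B) (u i x) (u i y) \<le> Q ?A {} (u i x) (u i x)"
    using Q_mono[of ?A "{}" ?A "(\<lambda>p. p + N i) ` ?B" "u i x" "u i y"] by (simp add: Q_right_empty[of _ "u i x" "u i y" "u i x"])
  show "Q ?A ((\<lambda>p. p + N i) ` ?B) (u i x) (u i y) \<le> Q ?B {} (u i y) (u i y)"
    using Q_mono[of "{}" "(\<lambda>p. p + N i) ` ?B" ?A "(\<lambda>p. p + N i) ` ?B" "u i x" "u i y"] Q_shift[of "{}" ?B "N i" "u i x" "u i y"]
    by (simp add: Q_swap[of "{}"] Q_right_empty[of _ "u i y" "u i x" "u i y"])
  show "0 \<le> Q ?A ((\<lambda>p. p + N i) ` ?B) (u i x) (u i y)" by (rule Q_bounds)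
next
  fix x y assume G: "G x > 0" "G y > 0"
  show "(\<lambda>i. Q (win (N i) (int (R i)) (s i)) ((\<lambda>p. p + N i) ` win (N i) (int (R i)) (t i)) (u i x) (u i y)) \<longlonglongrightarrow> G x * G y"
  proof (rule squeeze_limit[OF tendsto_mult[OF win_single_limit[OF s N] win_single_limit[OF t N]] gerr_limit[OF G], where c=1])
    fix i
    have Np: "N i > 0" using s[of i] by linarith
    let ?A = "win (N i) (int (R i)) (s i)" and ?B = "win (N i) (int (R i)) (t i)"
    let ?B' = "(\<lambda>p. p + N i) ` ?B"
    have A: "?A \<subseteq> {1..N i}" "?B \<subseteq> {1..N i}" using win_subset[OF Np] by auto
    \<comment> \<open>A cut at the block boundary \<open>N i\<close> separates the two windows
      completely.\<close>
    have "\<bar>Q ?A ?B' (u i x) (u i y) - Q (?A \<inter> {..N i}) (?B' \<inter> {..N i}) (u i x) (u i y) * Q (?A \<inter> {N i<..}) (?B' \<inter> {N i<..}) (u i x) (u i y)\<bar> \<le> gerr i x y"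
      unfolding gerr_def by (rule Q_cut) auto
    moreover have "?A \<inter> {..N i} = ?A" "?A \<inter> {N i<..} = {}" using A(1) by auto
    moreover have "?B' \<inter> {..N i} = {}" "?B' \<inter> {N i<..} = ?B'" using A(2) by (auto simp: subset_iff)
    moreover have "Q {} ?B' (u i x) (u i y) = Q ?B {} (u i y) (u i y)"
      using Q_shift[of "{}" ?B "N i" "u i x" "u i y"] by (simp add: Q_swap[of "{}"] Q_right_empty[of _ "u i y" "u i x" "u i y"])
    ultimately show "\<bar>Q ?A ?B' (u i x) (u i y) - Q ?A {} (u i x) (u i x) * Q ?B {} (u i y) (u i y)\<bar> \<le> 1 * gerr i x y"
      by (simp add: Q_right_empty[of _ "u i x" "u i y" "u i x"])
  qed
qed

section \<open>From joint distribution functions to covariances\<close>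

lemma mom_fst: "coupling C \<Longrightarrow> mom P p c g \<Longrightarrow> mom C p c (\<lambda>z. g (fst z))"
  and mom_snd: "coupling C \<Longrightarrow> mom P p c g \<Longrightarrow> mom C p c (\<lambda>z. g (snd z))"
proof -
  have main: "mom C p c (\<lambda>z. g (f z))" if C: "sets C = sets borel" and P: "distr C borel f = P" and f: "f \<in> borel_measurable C" and g: "mom P p c g" for f
  proof -
    have gm: "g \<in> borel_measurable borel" and i: "integrable P (\<lambda>x. \<bar>g x\<bar> powr p)" and e: "(\<integral>x. \<bar>g x\<bar> powr p \<partial>P) \<le> c"
      using g measurable_cong_sets[OF sets_P refl] by (auto simp: mom_def)
    have gm2: "(\<lambda>x. \<bar>g x\<bar> powr p) \<in> borel_measurable borel" using gm by measurable
    show ?thesis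
      unfolding mom_def
      using measurable_compose[OF f gm] i e unfolding P[symmetric] integrable_distr_eq[OF f gm2] integral_distr[OF f gm2] by blast
  qed
  assume C: "coupling C" and g: "mom P p c g"
  have s: "sets C = sets borel" using C by (simp add: coupling_def)
  have m: "fst \<in> borel_measurable C" "snd \<in> borel_measurable C"
    using fst_borel snd_borel measurable_cong_sets[OF s refl] by blast+
  show "mom C p c (\<lambda>z. g (fst z))" "mom C p c (\<lambda>z. g (snd z))"
    using main[OF s _ m(1) g] main[OF s _ m(2) g] C by (auto simp: coupling_def)
qed

text \<open>For truncated functions this is weak convergence with almost everywhere continuous
  integrands. The truncation error is uniform in \<open>i\<close> and is the same under the limit
  coupling, because both margins of the latter are \<open>P\<close>.\<close>

lemma cv_convergence:
  fixes Y1 Y2 :: "nat \<Rightarrow> 'a \<Rightarrow> real^'d" and g1 g2 :: "real^'d \<Rightarrow> real"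
  assumes C: "coupling C" and Y: "\<And>i. Y1 i \<in> borel_measurable M" "\<And>i. Y2 i \<in> borel_measurable M"
    and conv: "\<And>x y. (\<lambda>i. prob {\<omega>\<in>space M. Y1 i \<omega> \<le> x \<and> Y2 i \<omega> \<le> y}) \<longlonglongrightarrow> measure C ({..x} \<times> {..y})"
    and g: "g1 \<in> borel_measurable borel" "g2 \<in> borel_measurable borel" "AE z in P. isCont g1 z" "AE z in P. isCont g2 z"
    and mom: "\<And>i. mom M (2 + \<nu>) c (\<lambda>\<omega>. g1 (Y1 i \<omega>))" "\<And>i. mom M (2 + \<nu>) c (\<lambda>\<omega>. g2 (Y2 i \<omega>))"
      "mom P (2 + \<nu>) c g1" "mom P (2 + \<nu>) c g2" and \<nu>: "\<nu> > 0"
  shows "(\<lambda>i. cv M (\<lambda>\<omega>. g1 (Y1 i \<omega>)) (\<lambda>\<omega>. g2 (Y2 i \<omega>))) \<longlonglongrightarrow> cv C (\<lambda>z. g1 (fst z)) (\<lambda>z. g2 (snd z))"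
proof -
  have Cp: "prob_space C" and Cs: "sets C = sets borel" and Cf: "distr C borel fst = P" "distr C borel snd = P"
    using C by (auto simp: coupling_def)
  interpret C: prob_space C by fact
  have m: "fst \<in> borel_measurable C" "snd \<in> borel_measurable C"
    using fst_borel snd_borel measurable_cong_sets[OF Cs refl] by blast+
  \<comment> \<open>Since both margins are \<open>P\<close>, the discontinuities of each factor are
    null under \<open>C\<close>, however singular \<open>C\<close> may be.\<close>
  have ae: "AE z in C. isCont g1 (fst z)" "AE z in C. isCont g2 (snd z)"
    using AE_distrD[OF m(1), of "isCont g1"] AE_distrD[OF m(2), of "isCont g2"] g(3,4) unfolding Cf by auto
  define Y where "Y i \<omega> = (Y1 i \<omega>, Y2 i \<omega>)" for i \<omega>
  have Ym: "Y i \<in> borel_measurable M" for i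
    unfolding Y_def[abs_def] borel_prod[symmetric] using Y by measurable
  define \<mu> where "\<mu> i = distr M borel (Y i)" for i
  have \<mu>: "prob_space (\<mu> i)" "sets (\<mu> i) = sets borel" for i
    unfolding \<mu>_def using Ym by (auto intro: prob_space_distr)
  have cdf: "(\<lambda>i. measure (\<mu> i) {..z}) \<longlonglongrightarrow> measure C {..z}" for z
  proof -
    obtain x y where z: "z = (x, y)" by (cases z)
    have "measure (\<mu> i) {..z} = prob {\<omega>\<in>space M. Y1 i \<omega> \<le> x \<and> Y2 i \<omega> \<le> y}" for i
    proof -
      have "Y i -` {..z} \<inter> space M = {\<omega>\<in>space M. Y1 i \<omega> \<le> x \<and> Y2 i \<omega> \<le> y}"
        by (auto simp: z Y_def less_eq_prod_def)
      then show ?thesis unfolding \<mu>_def using measure_distr[OF Ym borel_closed[OF closed_eucl_atMost[of z]], of i] by simp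
    qed
    then show ?thesis using conv[of x y] unfolding z atMost_pair[symmetric] by simp
  qed
  have main: "(\<lambda>i. expectation (\<lambda>\<omega>. f (Y i \<omega>))) \<longlonglongrightarrow> (\<integral>z. f z \<partial>C)"
    if f: "f \<in> borel_measurable borel" "\<And>z. \<bar>f z\<bar> \<le> D" "AE z in C. isCont f z" for f :: "(real^'d) \<times> (real^'d) \<Rightarrow> real" and D
  proof -
    have "(\<lambda>i. \<integral>z. f z \<partial>\<mu> i) \<longlonglongrightarrow> (\<integral>z. f z \<partial>C)"
      by (rule cdf_convergence_ae_continuous[OF \<mu> Cp Cs cdf f])
    moreover have "(\<integral>z. f z \<partial>\<mu> i) = expectation (\<lambda>\<omega>. f (Y i \<omega>))" for i
      unfolding \<mu>_def by (rule integral_distr[OF Ym f(1)])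
    ultimately show ?thesis by simp
  qed
  have trunc_cont: "isCont (\<lambda>z. trunc K (h z)) z" if "isCont h z" for h :: "(real^'d) \<times> (real^'d) \<Rightarrow> real" and z K
    using continuous_trunc that by (intro isCont_o2[OF that]) (auto simp: continuous_on_eq_continuous_at)
  have cont1: "isCont (\<lambda>z. g1 (fst z)) z" if "isCont g1 (fst z)" for z :: "(real^'d) \<times> (real^'d)"
    using that by (intro isCont_o2[where g=g1 and f=fst]) (auto intro: continuous_intros)
  have cont2: "isCont (\<lambda>z. g2 (snd z)) z" if "isCont g2 (snd z)" for z :: "(real^'d) \<times> (real^'d)"
    using that by (intro isCont_o2[where g=g2 and f=snd]) (auto intro: continuous_intros)
  have tm: "(\<lambda>z::(real^'d) \<times> (real^'d). trunc K (g1 (fst z))) \<in> borel_measurable borel"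
    "(\<lambda>z::(real^'d) \<times> (real^'d). trunc K (g2 (snd z))) \<in> borel_measurable borel" for K
    using measurable_compose[OF measurable_compose[OF fst_borel g(1)] trunc_borel]
      measurable_compose[OF measurable_compose[OF snd_borel g(2)] trunc_borel] by this+
  have tlim: "(\<lambda>i. cv M (\<lambda>\<omega>. trunc K (g1 (Y1 i \<omega>))) (\<lambda>\<omega>. trunc K (g2 (Y2 i \<omega>)))) \<longlonglongrightarrow>
    cv C (\<lambda>z. trunc K (g1 (fst z))) (\<lambda>z. trunc K (g2 (snd z)))" if K: "K \<ge> 1" for K
  proof -
    have b: "\<bar>trunc K y\<bar> \<le> K" for y using trunc_bound K by simp
    have "(\<lambda>i. expectation (\<lambda>\<omega>. (\<lambda>z. trunc K (g1 (fst z)) * trunc K (g2 (snd z))) (Y i \<omega>))) \<longlonglongrightarrow> (\<integral>z. trunc K (g1 (fst z)) * trunc K (g2 (snd z)) \<partial>C)"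
    proof (rule main)
      show "(\<lambda>z. trunc K (g1 (fst z)) * trunc K (g2 (snd z))) \<in> borel_measurable borel" using tm by measurable
      show "\<bar>trunc K (g1 (fst z)) * trunc K (g2 (snd z))\<bar> \<le> K * K" for z
        unfolding abs_mult using b K by (intro mult_mono) auto
      show "AE z in C. isCont (\<lambda>z. trunc K (g1 (fst z)) * trunc K (g2 (snd z))) z"
        using ae by eventually_elim (intro isCont_mult trunc_cont cont1 cont2)
    qed
    moreover have "(\<lambda>i. expectation (\<lambda>\<omega>. (\<lambda>z. trunc K (g1 (fst z))) (Y i \<omega>))) \<longlonglongrightarrow> (\<integral>z. trunc K (g1 (fst z)) \<partial>C)"
    proof (rule main[OF tm(1) b])
      show "AE z in C. isCont (\<lambda>z. trunc K (g1 (fst z))) z"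
        using ae(1) by eventually_elim (intro trunc_cont cont1)
    qed
    moreover have "(\<lambda>i. expectation (\<lambda>\<omega>. (\<lambda>z. trunc K (g2 (snd z))) (Y i \<omega>))) \<longlonglongrightarrow> (\<integral>z. trunc K (g2 (snd z)) \<partial>C)"
    proof (rule main[OF tm(2) b])
      show "AE z in C. isCont (\<lambda>z. trunc K (g2 (snd z))) z"
        using ae(2) by eventually_elim (intro trunc_cont cont2)
    qed
    ultimately show ?thesis unfolding cv_def Y_def fst_conv snd_conv by (intro tendsto_diff tendsto_mult)
  qed
  define D where "D = (6 * c + 4) * (1 + c)"
  show ?thesis
  proof (rule tendstoI)
    fix e :: real assume e: "e > 0"
    have "(\<lambda>n. D * real n powr (- \<nu>)) \<longlonglongrightarrow> D * 0"
      using \<nu> by (intro tendsto_mult tendsto_const tendsto_neg_powr filterlim_real_sequentially) auto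
    then have "\<forall>\<^sub>F n in sequentially. D * real n powr (- \<nu>) < e / 3"
      using e by (intro order_tendstoD) auto
    then have "\<forall>\<^sub>F n in sequentially. D * real n powr (- \<nu>) < e / 3 \<and> n \<ge> 1"
      by (intro eventually_conj eventually_ge_at_top)
    then obtain n where n: "D * real n powr (- \<nu>) < e / 3" "real n \<ge> 1"
      by (auto simp: eventually_sequentially)
    have 1: "\<bar>cv M (\<lambda>\<omega>. g1 (Y1 i \<omega>)) (\<lambda>\<omega>. g2 (Y2 i \<omega>)) - cv M (\<lambda>\<omega>. trunc n (g1 (Y1 i \<omega>))) (\<lambda>\<omega>. trunc n (g2 (Y2 i \<omega>)))\<bar> < e / 3" for i
      using cv_trunc[OF mom(1,2) \<nu> n(2), of i i] n(1) unfolding D_def by linarith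
    have 2: "\<bar>cv C (\<lambda>z. g1 (fst z)) (\<lambda>z. g2 (snd z)) - cv C (\<lambda>z. trunc n (g1 (fst z))) (\<lambda>z. trunc n (g2 (snd z)))\<bar> < e / 3"
      using C.cv_trunc[OF mom_fst[OF C mom(3)] mom_snd[OF C mom(4)] \<nu> n(2)] n(1) unfolding D_def by linarith
    have "\<forall>\<^sub>F i in sequentially. dist (cv M (\<lambda>\<omega>. trunc n (g1 (Y1 i \<omega>))) (\<lambda>\<omega>. trunc n (g2 (Y2 i \<omega>))))
      (cv C (\<lambda>z. trunc n (g1 (fst z))) (\<lambda>z. trunc n (g2 (snd z)))) < e / 3"
      using e by (intro tendstoD[OF tlim[OF n(2)]]) auto
    then show "\<forall>\<^sub>F i in sequentially. dist (cv M (\<lambda>\<omega>. g1 (Y1 i \<omega>)) (\<lambda>\<omega>. g2 (Y2 i \<omega>))) (cv C (\<lambda>z. g1 (fst z)) (\<lambda>z. g2 (snd z))) < e"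
    proof eventually_elim
      case (elim i)
      then show ?case using 1[of i] 2 unfolding dist_real_def by linarith
    qed
  qed
qed

text \<open>A Fatou argument: the p-th power capped at n is bounded and almost everywhere
  continuous, so its limit integral inherits the bound, and monotone convergence removes the
  cap.\<close>

lemma mom_limit:
  fixes g :: "real^'d \<Rightarrow> real"
  assumes g: "g \<in> borel_measurable borel" "AE z in P. isCont g z" and p: "p > 0"
    and mom: "\<And>i. mom M p c (\<lambda>\<omega>. g (block_Z a b (R i) (\<lambda>t. X t \<omega>)))"
  shows "mom P p c g"
proof -
  interpret P: prob_space P by (rule prob_P)
  have gP [measurable]: "g \<in> borel_measurable P" using g(1) measurable_cong_sets[OF sets_P refl] by blast
  have c: "c \<ge> 0"
  proof -
    have "0 \<le> expectation (\<lambda>\<omega>. \<bar>g (block_Z a b (R 0) (\<lambda>t. X t \<omega>))\<bar> powr p)" by (rule Bochner_Integration.integral_nonneg) simp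
    also have "\<dots> \<le> c" using mom[of 0] by (simp add: mom_def)
    finally show ?thesis .
  qed
  have le: "(\<integral>z. min (\<bar>g z\<bar> powr p) (real n) \<partial>P) \<le> c" for n
  proof (rule LIMSEQ_le_const2)
    let ?f = "\<lambda>z. min (\<bar>g z\<bar> powr p) (real n)"
    have fm: "?f \<in> borel_measurable borel" using g(1) by measurable
    show "(\<lambda>i. \<integral>z. ?f z \<partial>block_law (R i)) \<longlonglongrightarrow> (\<integral>z. ?f z \<partial>P)"
    proof (rule cdf_convergence_ae_continuous[OF block_law_prob prob_P sets_P _ fm, where K="real n"])
      show "(\<lambda>i. measure (block_law (R i)) {..z}) \<longlonglongrightarrow> measure P {..z}" for z
        using block_conv[OF R_top, of "\<lambda>_. z" z] by (simp add: mcdf_def)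
      show "AE z in P. isCont ?f z"
        using g(2)
      proof eventually_elim
        case (elim z)
        then show ?case unfolding isCont_def
          by (intro tendsto_min tendsto_const tendsto_powr' tendsto_rabs) (use p in auto)
      qed
    qed auto
    have "(\<integral>z. ?f z \<partial>block_law (R i)) \<le> c" for i
    proof -
      have "(\<integral>z. ?f z \<partial>block_law (R i)) = expectation (\<lambda>\<omega>. ?f (block_Z a b (R i) (\<lambda>t. X t \<omega>)))"
        unfolding block_law_def by (rule integral_distr[OF block_Z_measurable fm])
      also have "\<dots> \<le> expectation (\<lambda>\<omega>. \<bar>g (block_Z a b (R i) (\<lambda>t. X t \<omega>))\<bar> powr p)"
      proof (rule integral_mono)
        show "integrable M (\<lambda>\<omega>. ?f (block_Z a b (R i) (\<lambda>t. X t \<omega>)))"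
          using measurable_compose[OF block_Z_measurable fm] by (intro integrable_const_bound[where B="real n"]) auto
      qed (use mom[of i] in \<open>auto simp: mom_def\<close>)
      also have "\<dots> \<le> c" using mom[of i] by (simp add: mom_def)
      finally show ?thesis .
    qed
    then show "\<exists>N. \<forall>i\<ge>N. (\<integral>z. ?f z \<partial>block_law (R i)) \<le> c" by blast
  qed
  have nn: "(\<integral>\<^sup>+z. ennreal (\<bar>g z\<bar> powr p) \<partial>P) \<le> ennreal c"
  proof -
    have "(\<integral>\<^sup>+z. ennreal (\<bar>g z\<bar> powr p) \<partial>P) = (\<integral>\<^sup>+z. (SUP n. ennreal (min (\<bar>g z\<bar> powr p) (real n))) \<partial>P)"
    proof (intro nn_integral_cong)
      fix z
      obtain n where n: "\<bar>g z\<bar> powr p \<le> real n" using real_arch_simple by blast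
      show "ennreal (\<bar>g z\<bar> powr p) = (SUP n. ennreal (min (\<bar>g z\<bar> powr p) (real n)))"
      proof (rule antisym)
        show "ennreal (\<bar>g z\<bar> powr p) \<le> (SUP n. ennreal (min (\<bar>g z\<bar> powr p) (real n)))"
          by (rule SUP_upper2[of n]) (use n in \<open>auto simp: min_absorb1\<close>)
        show "(SUP n. ennreal (min (\<bar>g z\<bar> powr p) (real n))) \<le> ennreal (\<bar>g z\<bar> powr p)"
          by (rule SUP_least) (auto intro: ennreal_leI)
      qed
    qed
    also have "\<dots> = (SUP n. \<integral>\<^sup>+z. ennreal (min (\<bar>g z\<bar> powr p) (real n)) \<partial>P)"
    proof (rule nn_integral_monotone_convergence_SUP)
      show "incseq (\<lambda>n z. ennreal (min (\<bar>g z\<bar> powr p) (real n)))"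
        by (rule incseq_SucI) (auto simp: le_fun_def intro!: ennreal_leI)
    qed measurable
    also have "\<dots> \<le> ennreal c"
    proof (rule SUP_least)
      fix n :: nat
      have "integrable P (\<lambda>z. min (\<bar>g z\<bar> powr p) (real n))"
        by (intro P.integrable_const_bound[where B="real n"]) auto
      then have "(\<integral>\<^sup>+z. ennreal (min (\<bar>g z\<bar> powr p) (real n)) \<partial>P) = ennreal (\<integral>z. min (\<bar>g z\<bar> powr p) (real n) \<partial>P)"
        by (intro nn_integral_eq_integral) auto
      then show "(\<integral>\<^sup>+z. ennreal (min (\<bar>g z\<bar> powr p) (real n)) \<partial>P) \<le> ennreal c" using le[of n] by (simp add: ennreal_leI)
    qed
    finally show ?thesis .
  qed
  have i: "integrable P (\<lambda>z. \<bar>g z\<bar> powr p)"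
  proof (rule integrableI_bounded)
    show "(\<integral>\<^sup>+z. ennreal (norm (\<bar>g z\<bar> powr p)) \<partial>P) < \<infinity>"
      using order_le_less_trans[OF nn] by simp
  qed measurable
  have "ennreal (\<integral>z. \<bar>g z\<bar> powr p \<partial>P) \<le> ennreal c"
    using nn nn_integral_eq_integral[OF i] by simp
  then show ?thesis using i gP c by (simp add: mom_def)
qed

end

section \<open>Averages and Riemann sums\<close>

text \<open>Taking a worst point for each \<open>i\<close> turns convergence along all selections
  into uniform convergence.\<close>

lemma uniform_choice:
  fixes \<phi> :: "nat \<Rightarrow> 's \<Rightarrow> real"
  assumes S: "\<And>i. finite (S i)" "\<And>i. S i \<noteq> {}"
    and lim: "\<And>s. (\<And>i. s i \<in> S i) \<Longrightarrow> (\<lambda>i. \<phi> i (s i)) \<longlonglongrightarrow> l"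
  obtains \<epsilon> where "\<epsilon> \<longlonglongrightarrow> 0" "\<And>i s. s \<in> S i \<Longrightarrow> \<bar>\<phi> i s - l\<bar> \<le> \<epsilon> i" "\<And>i. 0 \<le> \<epsilon> i"
proof -
  define \<epsilon> where "\<epsilon> i = Max ((\<lambda>s. \<bar>\<phi> i s - l\<bar>) ` S i)" for i
  have "\<exists>s\<in>S i. \<epsilon> i = \<bar>\<phi> i s - l\<bar>" for i
  proof -
    have "\<epsilon> i \<in> (\<lambda>s. \<bar>\<phi> i s - l\<bar>) ` S i" unfolding \<epsilon>_def using S by (intro Max_in) auto
    then show ?thesis by auto
  qed
  then obtain s where s: "\<And>i. s i \<in> S i" "\<And>i. \<epsilon> i = \<bar>\<phi> i (s i) - l\<bar>" by metis
  have "\<epsilon> \<longlonglongrightarrow> 0"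
  proof -
    have "(\<lambda>i. \<bar>\<phi> i (s i) - l\<bar>) \<longlonglongrightarrow> \<bar>l - l\<bar>" by (intro tendsto_intros lim s)
    moreover have "\<epsilon> = (\<lambda>i. \<bar>\<phi> i (s i) - l\<bar>)" using s(2) by (rule ext)
    ultimately show ?thesis by simp
  qed
  moreover have "\<bar>\<phi> i t - l\<bar> \<le> \<epsilon> i" if "t \<in> S i" for i t
    unfolding \<epsilon>_def using S that by (intro Max_ge) auto
  moreover have "0 \<le> \<epsilon> i" for i using s(2)[of i] by simp
  ultimately show ?thesis using that by blast
qed

lemma average_error:
  fixes f :: "'s \<Rightarrow> real"
  assumes "finite S" "S \<noteq> {}" "\<And>s. s \<in> S \<Longrightarrow> \<bar>f s - l\<bar> \<le> e"
  shows "\<bar>(\<Sum>s\<in>S. f s) / real (card S) - l\<bar> \<le> e"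
proof -
  have c: "real (card S) > 0" using assms by (simp add: card_gt_0_iff)
  have "(\<Sum>s\<in>S. f s) / real (card S) - l = (\<Sum>s\<in>S. f s - l) / real (card S)"
    using c by (simp add: sum_subtractf diff_divide_distrib)
  also have "\<bar>\<dots>\<bar> \<le> (\<Sum>s\<in>S. e) / real (card S)"
    unfolding abs_divide abs_of_nat by (intro divide_right_mono order_trans[OF sum_abs] sum_mono assms) auto
  finally show ?thesis using c by simp
qed

lemma floor_sum_integral:
  fixes f :: "nat \<Rightarrow> real"
  assumes r: "r \<ge> 1"
  shows "integrable lborel (\<lambda>v. indicator {0..<1} v * f (nat \<lfloor>real r * v\<rfloor>))"
    and "(\<integral>v. indicator {0..<1} v * f (nat \<lfloor>real r * v\<rfloor>) \<partial>lborel) = (\<Sum>d<r. f d) / real r"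
proof -
  define J where "J d = {real d / real r..<(real d + 1) / real r}" for d :: nat
  have rp: "real r > 0" using r by simp
  have J: "v \<in> J d \<longleftrightarrow> v \<ge> 0 \<and> nat \<lfloor>real r * v\<rfloor> = d" for v d
  proof -
    have "v \<in> J d \<longleftrightarrow> real d \<le> real r * v \<and> real r * v < real d + 1"
      using rp by (auto simp: J_def field_simps)
    also have "\<dots> \<longleftrightarrow> \<lfloor>real r * v\<rfloor> = int d" by (simp add: floor_eq_iff)
    also have "\<dots> \<longleftrightarrow> v \<ge> 0 \<and> nat \<lfloor>real r * v\<rfloor> = d"
    proof
      assume a: "\<lfloor>real r * v\<rfloor> = int d"
      then have "0 \<le> real r * v" by linarith
      then show "v \<ge> 0 \<and> nat \<lfloor>real r * v\<rfloor> = d" using a rp by (simp add: zero_le_mult_iff)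
    next
      assume "v \<ge> 0 \<and> nat \<lfloor>real r * v\<rfloor> = d"
      then have "0 \<le> real r * v" "nat \<lfloor>real r * v\<rfloor> = d" using rp by auto
      then show "\<lfloor>real r * v\<rfloor> = int d" by (metis int_nat_eq zero_le_floor)
    qed
    finally show ?thesis .
  qed
  have eq: "indicator {0..<1} v * f (nat \<lfloor>real r * v\<rfloor>) = (\<Sum>d<r. f d * indicator (J d) v)" for v
  proof (cases "v \<in> {0..<1}")
    case True
    have "0 \<le> real r * v" "real r * v < real r" using True rp by (auto simp: mult_less_cancel_left2)
    then have lt: "nat \<lfloor>real r * v\<rfloor> < r" by linarith
    have "(\<Sum>d<r. f d * indicator (J d) v) = (\<Sum>d<r. if d = nat \<lfloor>real r * v\<rfloor> then f d else 0)"
      using True by (intro sum.cong) (auto simp: J indicator_def)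
    then show ?thesis using True lt by simp
  next
    case False
    have "v \<notin> J d" if "d < r" for d
    proof
      assume "v \<in> J d"
      then have v: "v \<ge> 0" "\<lfloor>real r * v\<rfloor> < int r" using that rp by (auto simp: J)
      then have "real r * v < real r" by linarith
      then have "v < 1" using rp by simp
      with v False show False by simp
    qed
    then show ?thesis using False by simp
  qed
  have fin: "emeasure lborel (J d) \<noteq> \<infinity>" for d unfolding J_def using rp by (simp add: divide_right_mono)
  have int: "integrable lborel (\<lambda>v. f d * indicator (J d) v)" for d
    using fin[of d] by (intro integrable_mult_right integrable_real_indicator) (auto simp: J_def less_top[symmetric])
  have ms: "measure lborel (J d) = 1 / real r" for d
    unfolding J_def using rp by (simp add: divide_right_mono add_divide_distrib)
  show "integrable lborel (\<lambda>v. indicator {0..<1} v * f (nat \<lfloor>real r * v\<rfloor>))"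
    unfolding eq by (intro Bochner_Integration.integrable_sum int)
  show "(\<integral>v. indicator {0..<1} v * f (nat \<lfloor>real r * v\<rfloor>) \<partial>lborel) = (\<Sum>d<r. f d) / real r"
  proof -
    have I: "(\<integral>v. f d * indicator (J d) v \<partial>lborel) = f d / real r" for d using ms[of d] by simp
    show ?thesis
      unfolding eq sum_divide_distrib by (subst Bochner_Integration.integral_sum[OF int]) (simp only: I)
  qed
qed

text \<open>The Riemann sum is the integral of a step function, so dominated convergence applies.
  The limit is measurable on the open interval as a pointwise limit of these step functions.\<close>

lemma riemann_limit:
  fixes c :: "nat \<Rightarrow> nat \<Rightarrow> real" and r :: "nat \<Rightarrow> nat"
  assumes r: "\<And>i. r i \<ge> 1" and D: "\<And>i d. d < r i \<Longrightarrow> \<bar>c i d\<bar> \<le> D"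
    and lim: "\<And>\<xi>. 0 < \<xi> \<Longrightarrow> \<xi> < 1 \<Longrightarrow> (\<lambda>i. c i (nat \<lfloor>real (r i) * \<xi>\<rfloor>)) \<longlonglongrightarrow> \<Gamma> \<xi>"
  shows "(\<lambda>i. (\<Sum>d<r i. c i d) / real (r i)) \<longlonglongrightarrow> (LBINT \<xi>:{0..1}. \<Gamma> \<xi>)"
proof -
  define F where "F i v = indicator {0..<1} v * c i (nat \<lfloor>real (r i) * v\<rfloor>)" for i and v :: real
  define G where "G v = indicator {0<..<1} v * \<Gamma> v" for v :: real
  have D0: "D \<ge> 0" using D[of 0 0] r[of 0] by linarith
  have Fm: "F i \<in> borel_measurable borel" for i
    using borel_measurable_integrable[OF floor_sum_integral(1)[OF r[of i], where f="c i"]] by (simp add: F_def[abs_def])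
  have ind: "(\<lambda>i. indicator {0<..<1} v * F i v) \<longlonglongrightarrow> G v" for v
  proof (cases "v \<in> {0<..<1}")
    case True
    then show ?thesis using lim[of v] by (simp add: G_def F_def)
  qed (simp add: G_def)
  have Gm [measurable]: "G \<in> borel_measurable borel"
  proof (rule borel_measurable_LIMSEQ_metric)
    show "(\<lambda>v. indicator {0<..<1} v * F i v) \<in> borel_measurable borel" for i using Fm[of i] by measurable
  qed (rule ind)
  have ae0: "AE v in lborel. v \<noteq> (0::real)" "AE v in lborel. v \<noteq> (1::real)" by (rule AE_lborel_singleton)+
  have "(\<lambda>i. \<integral>v. F i v \<partial>lborel) \<longlonglongrightarrow> (\<integral>v. G v \<partial>lborel)"
  proof (rule integral_dominated_convergence[where w="\<lambda>v. D * indicator {0..<1} v"])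
    show "G \<in> borel_measurable lborel" using Gm by simp
    show "F i \<in> borel_measurable lborel" for i using Fm by simp
    show "integrable lborel (\<lambda>v::real. D * indicator {0..<1} v)"
      by (intro integrable_mult_right integrable_real_indicator) auto
    show "AE v in lborel. (\<lambda>i. F i v) \<longlonglongrightarrow> G v"
      using ae0
    proof eventually_elim
      case (elim v)
      show ?case
      proof (cases "v \<in> {0<..<1}")
        case True
        then show ?thesis using ind[of v] by simp
      next
        case False
        then have "v \<notin> {0..<1}" using elim by auto
        then show ?thesis using False by (simp add: F_def G_def)
      qed
    qed
    show "AE v in lborel. norm (F i v) \<le> D * indicator {0..<1} v" for i
    proof (rule AE_I2)
      fix v :: real
      show "norm (F i v) \<le> D * indicator {0..<1} v"
      proof (cases "v \<in> {0..<1}")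
        case True
        then have "0 \<le> real (r i) * v" "real (r i) * v < real (r i)" using r[of i] by (auto simp: mult_less_cancel_left2)
        then have "nat \<lfloor>real (r i) * v\<rfloor> < r i" by linarith
        then show ?thesis using D True by (simp add: F_def)
      qed (simp add: F_def)
    qed
  qed
  moreover have "(\<integral>v. F i v \<partial>lborel) = (\<Sum>d<r i. c i d) / real (r i)" for i
    unfolding F_def by (rule floor_sum_integral(2)[OF r])
  moreover have "(\<integral>v. G v \<partial>lborel) = (LBINT \<xi>:{0..1}. \<Gamma> \<xi>)"
  proof -
    have eq: "AE v in lborel. G v = indicator {0..1} v * \<Gamma> v"
      using ae0 by eventually_elim (auto simp: G_def indicator_def)
    \<comment> \<open>Nothing is known about \<open>\<Gamma>\<close> at 0 and 1; as single points
      they neither spoil measurability nor change the integral.\<close>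
    have split: "(\<lambda>v. indicator {0..1} v * \<Gamma> v) = (\<lambda>v. G v + indicator {0} v * \<Gamma> 0 + indicator {1} v * \<Gamma> 1)"
      by (auto simp: G_def fun_eq_iff indicator_def)
    have "(\<lambda>v. G v + indicator {0} v * \<Gamma> 0 + indicator {1} v * \<Gamma> 1) \<in> borel_measurable lborel"
      by measurable
    then have "(\<lambda>v. indicator {0..1} v * \<Gamma> v) \<in> borel_measurable lborel"
      by (subst split)
    then show ?thesis unfolding set_lebesgue_integral_def real_scaleR_def
      by (intro integral_cong_AE eq) simp_all
  qed
  ultimately show ?thesis by simp
qed

section \<open>Bilinearity of covariances and moments of averages\<close>

lemma cv_commute: "cv M f g = cv M g f"
  by (simp add: cv_def mult.commute)

lemma cv_sum:
  assumes fin: "finite I" "finite J"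
    and int: "\<And>i. i \<in> I \<Longrightarrow> integrable M (f i)" "\<And>j. j \<in> J \<Longrightarrow> integrable M (g j)"
      "\<And>i j. i \<in> I \<Longrightarrow> j \<in> J \<Longrightarrow> integrable M (\<lambda>x. f i x * g j x)"
  shows "cv M (\<lambda>x. \<Sum>i\<in>I. f i x) (\<lambda>x. \<Sum>j\<in>J. g j x) = (\<Sum>i\<in>I. \<Sum>j\<in>J. cv M (f i) (g j))"
proof -
  have "(\<integral>x. (\<Sum>i\<in>I. f i x) * (\<Sum>j\<in>J. g j x) \<partial>M) = (\<Sum>i\<in>I. \<Sum>j\<in>J. \<integral>x. f i x * g j x \<partial>M)"
    unfolding sum_product using int(3)
    by (subst Bochner_Integration.integral_sum, intro Bochner_Integration.integrable_sum, simp)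
      (intro sum.cong refl Bochner_Integration.integral_sum, simp)
  moreover have "(\<integral>x. (\<Sum>i\<in>I. f i x) \<partial>M) = (\<Sum>i\<in>I. \<integral>x. f i x \<partial>M)" "(\<integral>x. (\<Sum>j\<in>J. g j x) \<partial>M) = (\<Sum>j\<in>J. \<integral>x. g j x \<partial>M)"
    using int(1,2) by (auto intro: Bochner_Integration.integral_sum)
  ultimately show ?thesis by (simp add: cv_def sum_product sum_subtractf)
qed

lemma cv_scale: "cv M (\<lambda>x. c * f x) (\<lambda>x. d * g x) = c * d * cv M f g"
proof -
  have "(\<integral>x. c * f x * (d * g x) \<partial>M) = c * d * (\<integral>x. f x * g x \<partial>M)"
    by (simp add: mult_ac flip: integral_mult_right_zero)
  then show ?thesis by (simp add: cv_def algebra_simps)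
qed

lemma (in prob_space) cv_center:
  assumes "integrable M f" "integrable M g" "integrable M (\<lambda>x. f x * g x)"
  shows "cv M (\<lambda>x. f x - a) (\<lambda>x. g x - b) = cv M f g"
proof -
  have "(f x - a) * (g x - b) = f x * g x - b * f x - a * g x + a * b" for x by algebra
  then show ?thesis using assms by (simp add: cv_def prob_space algebra_simps)
qed

lemma (in prob_space) cv_mom_bound:
  assumes "mom M p C f" "mom M p C g" "p \<ge> 2"
  shows "\<bar>cv M f g\<bar> \<le> (1 + C) + (1 + C) * (1 + C)"
proof -
  have "\<bar>expectation (\<lambda>x. f x * g x)\<bar> \<le> 1 + C"
    using integral_abs_bound[of M "\<lambda>x. f x * g x"] mom_prod(2)[OF assms] by linarith
  moreover have "\<bar>expectation f * expectation g\<bar> \<le> (1 + C) * (1 + C)"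
    unfolding abs_mult using mom_abs(3)[OF assms(1)] mom_abs(3)[OF assms(2)] assms(3)
    by (intro mult_mono) (auto intro: order_trans[OF abs_ge_zero])
  ultimately show ?thesis unfolding cv_def by linarith
qed

lemma mom_scale:
  assumes "mom M p C f" "p \<ge> 0"
  shows "mom M p (\<bar>a\<bar> powr p * C) (\<lambda>x. a * f x)"
  using assms by (auto simp: mom_def abs_mult powr_mult intro!: mult_left_mono)

lemma mom_mono: "mom M p C f \<Longrightarrow> C \<le> D \<Longrightarrow> mom M p D f"
  by (auto simp: mom_def)

lemma (in prob_space) mom_dominated:
  assumes "mom M p C f" "g \<in> borel_measurable M" "\<And>x. x \<in> space M \<Longrightarrow> \<bar>g x\<bar> \<le> \<bar>f x\<bar>" "p \<ge> 0"
  shows "mom M p C g"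
proof -
  have [measurable]: "f \<in> borel_measurable M" "g \<in> borel_measurable M" using assms by (auto simp: mom_def)
  have i: "integrable M (\<lambda>x. \<bar>f x\<bar> powr p)" using assms(1) by (simp add: mom_def)
  have le: "\<bar>g x\<bar> powr p \<le> \<bar>f x\<bar> powr p" if "x \<in> space M" for x
    using assms(3)[OF that] assms(4) by (intro powr_mono2) auto
  have i2: "integrable M (\<lambda>x. \<bar>g x\<bar> powr p)"
    by (rule Bochner_Integration.integrable_bound[OF i]) (use le in auto)
  have "expectation (\<lambda>x. \<bar>g x\<bar> powr p) \<le> expectation (\<lambda>x. \<bar>f x\<bar> powr p)"
    by (rule integral_mono[OF i2 i le])
  then show ?thesis using assms(1) i2 by (simp add: mom_def)
qed

text \<open>Jensen's inequality, applied to |x| + 1 in order to stay at positive arguments; |x| + 1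
  <= 2 max(|x|, 1) accounts for the factor 2^p and the summand 1. The constant is free of the number
  of summands, which grows with the block.\<close>

lemma average_powr_le:
  fixes x :: "'s \<Rightarrow> real"
  assumes S: "finite S" "S \<noteq> {}" and p: "p \<ge> 1"
  shows "\<bar>(\<Sum>s\<in>S. x s) / real (card S)\<bar> powr p \<le> 2 powr p * ((\<Sum>s\<in>S. \<bar>x s\<bar> powr p) / real (card S) + 1)"
proof -
  have c: "real (card S) > 0" using S by (simp add: card_gt_0_iff)
  define y where "y s = \<bar>x s\<bar> + 1" for s
  have "\<bar>(\<Sum>s\<in>S. x s) / real (card S)\<bar> \<le> (\<Sum>s\<in>S. y s) / real (card S)"
    unfolding abs_divide abs_of_nat y_def
    by (intro divide_right_mono order_trans[OF sum_abs] sum_mono) auto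
  also have "\<dots> = (\<Sum>s\<in>S. (1 / real (card S)) *\<^sub>R y s)" by (simp add: sum_divide_distrib)
  finally have "\<bar>(\<Sum>s\<in>S. x s) / real (card S)\<bar> powr p \<le> (\<Sum>s\<in>S. (1 / real (card S)) *\<^sub>R y s) powr p"
    using p by (intro powr_mono2) auto
  also have "\<dots> \<le> (\<Sum>s\<in>S. (1 / real (card S)) * (y s powr p))"
    using convex_on_sum[OF S powr_convex[OF p], of "\<lambda>_. 1 / real (card S)" y] c S by (simp add: y_def add_nonneg_pos)
  also have "\<dots> \<le> (\<Sum>s\<in>S. (1 / real (card S)) * (2 powr p * (\<bar>x s\<bar> powr p + 1)))"
  proof (intro sum_mono mult_left_mono)
    fix s
    have "y s powr p \<le> (2 * max \<bar>x s\<bar> 1) powr p" using p by (intro powr_mono2) (auto simp: y_def)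
    also have "\<dots> = 2 powr p * max \<bar>x s\<bar> 1 powr p" by (simp add: powr_mult)
    also have "max \<bar>x s\<bar> 1 powr p \<le> \<bar>x s\<bar> powr p + 1" by (auto simp: max_def)
    finally show "y s powr p \<le> 2 powr p * (\<bar>x s\<bar> powr p + 1)" by (simp add: mult_left_mono)
  qed (use c in auto)
  also have "\<dots> = 2 powr p * ((\<Sum>s\<in>S. \<bar>x s\<bar> powr p) / real (card S) + 1)"
    using c by (simp add: sum.distrib sum_distrib_left[symmetric] distrib_left sum_divide_distrib[symmetric] sum_distrib_right[symmetric] field_simps)
  finally show ?thesis .
qed

lemma (in prob_space) mom_average:
  assumes S: "finite S" "S \<noteq> {}" and p: "p \<ge> 1" and m: "\<And>s. s \<in> S \<Longrightarrow> mom M p C (f s)"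
  shows "mom M p (2 powr p * (C + 1)) (\<lambda>x. (\<Sum>s\<in>S. f s x) / real (card S))"
proof -
  have c: "real (card S) > 0" using S by (simp add: card_gt_0_iff)
  have f: "f s \<in> borel_measurable M" "integrable M (\<lambda>x. \<bar>f s x\<bar> powr p)" "expectation (\<lambda>x. \<bar>f s x\<bar> powr p) \<le> C" if "s \<in> S" for s
    using m[OF that] by (auto simp: mom_def)
  have A: "(\<lambda>x. (\<Sum>s\<in>S. f s x) / real (card S)) \<in> borel_measurable M"
    using f(1) by (intro borel_measurable_divide borel_measurable_sum) auto
  then have A': "(\<lambda>x. \<bar>(\<Sum>s\<in>S. f s x) / real (card S)\<bar> powr p) \<in> borel_measurable M" by measurable
  have i0: "integrable M (\<lambda>x. (\<Sum>s\<in>S. \<bar>f s x\<bar> powr p))" using f(2) by (intro Bochner_Integration.integrable_sum)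
  have i: "integrable M (\<lambda>x. 2 powr p * ((\<Sum>s\<in>S. \<bar>f s x\<bar> powr p) / real (card S) + 1))"
    using i0 by (intro integrable_mult_right Bochner_Integration.integrable_add integrable_divide) auto
  have i2: "integrable M (\<lambda>x. \<bar>(\<Sum>s\<in>S. f s x) / real (card S)\<bar> powr p)"
    by (rule Bochner_Integration.integrable_bound[OF i A'])
      (use average_powr_le[OF S p] in \<open>auto intro!: AE_I2 order_trans[OF _ abs_ge_self]\<close>)
  have "expectation (\<lambda>x. \<bar>(\<Sum>s\<in>S. f s x) / real (card S)\<bar> powr p) \<le> expectation (\<lambda>x. 2 powr p * ((\<Sum>s\<in>S. \<bar>f s x\<bar> powr p) / real (card S) + 1))"
    by (intro integral_mono i i2 average_powr_le S p)
  also have "\<dots> = 2 powr p * ((\<Sum>s\<in>S. expectation (\<lambda>x. \<bar>f s x\<bar> powr p)) / real (card S) + 1)"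
    using i0 f(2) by (simp add: prob_space)
  also have "\<dots> \<le> 2 powr p * (C + 1)"
  proof (intro mult_left_mono add_right_mono)
    have "(\<Sum>s\<in>S. expectation (\<lambda>x. \<bar>f s x\<bar> powr p)) \<le> real (card S) * C" using f(3) by (intro sum_bounded_above)
    then show "(\<Sum>s\<in>S. expectation (\<lambda>x. \<bar>f s x\<bar> powr p)) / real (card S) \<le> C" using c by (simp add: divide_le_eq mult.commute)
  qed auto
  finally show ?thesis using A i2 by (simp add: mom_def)
qed

lemma (in prob_space) mom_centered:
  assumes m: "mom M p C f" and p: "p \<ge> 1"
  shows "mom M p (2 powr p * (2 * (C + (1 + C) powr p))) (\<lambda>x. f x - expectation f)"
proof -
  \<comment> \<open>The centred variable is the sum over \<open>bool\<close> of \<open>f\<close> and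
    the constant minus its mean, so that \<open>mom_sum\<close> applies.\<close>
  define F where "F j = (if j then f else (\<lambda>_. - expectation f))" for j :: bool
  have C: "C \<ge> 0"
  proof -
    have "0 \<le> expectation (\<lambda>x. \<bar>f x\<bar> powr p)" by (rule Bochner_Integration.integral_nonneg) simp
    also have "\<dots> \<le> C" using m by (simp add: mom_def)
    finally show ?thesis .
  qed
  have "mom M p (C + (1 + C) powr p) (F j)" for j
  proof (cases j)
    case True
    then show ?thesis using mom_mono[OF m, of "C + (1 + C) powr p"] by (simp add: F_def)
  next
    case False
    have "\<bar>expectation f\<bar> powr p \<le> (1 + C) powr p" using mom_abs(3)[OF m p] p by (intro powr_mono2) auto
    then show ?thesis using False C by (simp add: F_def mom_def prob_space)
  qed
  then have "mom M p (real (card (UNIV :: bool set)) powr p * (real (card (UNIV :: bool set)) * (C + (1 + C) powr p))) (\<lambda>x. \<Sum>j\<in>UNIV. F j x)"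
    using p by (intro mom_sum) auto
  then show ?thesis by (simp add: F_def UNIV_bool)
qed

section \<open>Circular block maxima\<close>

definition split_set :: "nat \<Rightarrow> nat \<Rightarrow> nat \<Rightarrow> int set" where
  "split_set k r t = {1..int t} \<union> {int ((k - 1) * r + t + 1)..int (k * r)}"

lemma split_Z_eq: "split_Z a b k r t x = rescale (a r) (b r) (cmax x (split_set k r t))"
  by (simp add: split_Z_def split_set_def)

lemma split_set_full: "k \<ge> 1 \<Longrightarrow> split_set k r r = {1..int r}"
  by (cases k) (auto simp: split_set_def algebra_simps)

lemma win_split_inner:
  assumes "1 \<le> j" "j + r - 1 \<le> k * r" "k \<ge> 1"
  shows "win (int (k * r)) (int r) (int j) = (\<lambda>p. p + (int j - 1)) ` split_set k r r"
proof -
  have "win (int (k * r)) (int r) (int j) = (\<lambda>p. p) ` {int j..int j + int r - 1}"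
  proof -
    have "int j + int r - 1 \<le> int (k * r)" using assms(1,2) by linarith
    then show ?thesis
      unfolding win_def using assms(1) by (intro image_cong refl wrap_id) (auto simp del: of_nat_mult)
  qed
  also have "\<dots> = (\<lambda>p. p + (int j - 1)) ` {1..int r}"
    unfolding image_add_atLeastAtMost' by (simp add: add.commute)
  finally show ?thesis unfolding split_set_full[OF assms(3)] .
qed

text \<open>This window runs up to k r + t, so its last t entries wrap to the positions 1, ..., t.
  The result is the set of positions in the moment condition.\<close>

lemma win_split_outer:
  assumes t: "1 \<le> t" "t \<le> r" and k: "k \<ge> 2"
  shows "win (int (k * r)) (int r) (int ((k - 1) * r + t + 1)) = split_set k r t"
proof -
  let ?N = "int (k * r)" and ?s = "int ((k - 1) * r + t + 1)"
  have N: "?N = int ((k - 1) * r) + int r" "int r \<le> int ((k - 1) * r)"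
  proof -
    obtain k' where "k = k' + 2" using k nat_le_iff_add by (metis add.commute)
    then show "?N = int ((k - 1) * r) + int r" "int r \<le> int ((k - 1) * r)" by (simp_all add: algebra_simps)
  qed
  have "{?s..?s + int r - 1} = {?s..?N} \<union> {?N + 1..?N + int t}"
    using t N by (auto simp del: of_nat_mult)
  then have "win ?N (int r) ?s = wrap ?N ` {?s..?N} \<union> wrap ?N ` {?N + 1..?N + int t}"
    by (simp add: win_def image_Un)
  also have "wrap ?N ` {?s..?N} = (\<lambda>p. p) ` {?s..?N}"
    using t by (intro image_cong refl wrap_id) (auto simp del: of_nat_mult)
  also have "wrap ?N ` {?N + 1..?N + int t} = (\<lambda>p. p - ?N) ` {?N + 1..?N + int t}"
    using t N by (intro image_cong refl wrap_over) (auto simp del: of_nat_mult)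
  also have "\<dots> = {1..int t}"
    using image_add_atLeastAtMost'[of "- ?N" "?N + 1" "?N + int t"] by (simp del: of_nat_mult)
  finally show ?thesis by (auto simp: split_set_def)
qed

lemma cmax_shift: "cmax x ((\<lambda>p. p + c) ` S) = cmax (\<lambda>t. x (t + c)) S"
  by (simp add: cmax_def image_image)

lemma cmax_cong: "(\<And>t. t \<in> S \<Longrightarrow> x t = y t) \<Longrightarrow> cmax x S = cmax y S"
  by (simp add: cmax_def cong: image_cong)

lemma mom_distr:
  assumes Y: "Y \<in> borel_measurable M" and g: "g \<in> borel_measurable borel"
  shows "mom M p C (\<lambda>\<omega>. g (Y \<omega>)) \<longleftrightarrow> mom (distr M borel Y) p C g"
proof -
  have gp: "(\<lambda>x. \<bar>g x\<bar> powr p) \<in> borel_measurable borel" using g by measurable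
  show ?thesis
    unfolding mom_def integrable_distr_eq[OF Y gp] integral_distr[OF Y gp]
    using measurable_compose[OF Y g] g by simp
qed

lemma wrap_diff:
  assumes "0 \<le> d" "d < N"
  shows "(wrap N (s + d) - s) mod N = d"
proof -
  have "(wrap N (s + d) - s) mod N = ((s + d - 1) mod N + (1 - s)) mod N" by (simp add: wrap_def algebra_simps)
  also have "\<dots> = (s + d - 1 + (1 - s)) mod N" by (rule mod_add_left_eq)
  also have "\<dots> = d" using assms by simp
  finally show ?thesis .
qed

lemma wrap_range: "N > 0 \<Longrightarrow> 1 \<le> wrap N p \<and> wrap N p \<le> N"
  using pos_mod_bound[of N "p - 1"] pos_mod_sign[of N "p - 1"] unfolding wrap_def by linarith

lemma wrap_nat: "1 \<le> l \<Longrightarrow> l \<le> 2 * n \<Longrightarrow> wrap (int n) (int l) = int (if l \<le> n then l else l - n)"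
  using wrap_id[of "int l" "int n"] wrap_over[of "int n" "int l"] by (auto simp: of_nat_diff)

lemma wrap_back:
  assumes "1 \<le> t" "t \<le> N"
  shows "wrap N (s + (t - s) mod N) = t"
proof -
  have "wrap N (s + (t - s) mod N) = ((t - s) mod N + (s - 1)) mod N + 1" by (simp add: wrap_def algebra_simps)
  also have "((t - s) mod N + (s - 1)) mod N = (t - s + (s - 1)) mod N" by (rule mod_add_left_eq)
  also have "\<dots> = t - 1" using assms by simp
  finally show ?thesis by simp
qed

definition oplus :: "nat \<Rightarrow> nat \<Rightarrow> nat \<Rightarrow> nat" where
  "oplus N s d = nat (wrap (int N) (int s + int d))"

lemma oplus_int: "N > 0 \<Longrightarrow> int (oplus N s d) = wrap (int N) (int s + int d)"
  using wrap_range[of "int N" "int s + int d"] by (simp add: oplus_def)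

lemma oplus_range: "N > 0 \<Longrightarrow> oplus N s d \<in> {1..N}"
  using wrap_range[of "int N" "int s + int d"] by (auto simp: oplus_def)

lemma oplus_diff: "d < N \<Longrightarrow> (int (oplus N s d) - int s) mod int N = int d"
  using wrap_diff[of "int d" "int N" "int s"] by (simp add: oplus_int)

text \<open>Seen from the position N - d steps ahead of \<open>s\<close>, \<open>s\<close> itself is
  d steps ahead: a large lag is a small one with the windows exchanged.\<close>

lemma oplus_diff_back:
  assumes "1 \<le> d" "d < N"
  shows "(int s - int (oplus N s (N - d))) mod int N = int d"
proof -
  have 1: "(int (oplus N s (N - d)) - int s) mod int N = int (N - d)" using assms by (intro oplus_diff) auto
  have "(int s - int (oplus N s (N - d))) mod int N = (- (int (oplus N s (N - d)) - int s)) mod int N" by simp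
  also have "\<dots> = (- ((int (oplus N s (N - d)) - int s) mod int N)) mod int N" by (rule mod_minus_eq[symmetric])
  also have "\<dots> = (int d - int N) mod int N" unfolding 1 using assms by (simp add: of_nat_diff)
  also have "\<dots> = int d" using assms by (subst minus_mod_self2) simp
  finally show ?thesis .
qed

lemma sum_oplus: "N > 0 \<Longrightarrow> (\<Sum>t\<in>{1..N}. f t) = (\<Sum>d<N. f (oplus N s d))"
proof (rule sum.reindex_bij_witness[of _ "\<lambda>d. oplus N s d" "\<lambda>t. nat ((int t - int s) mod int N)"])
  assume N: "N > 0"
  fix t assume t: "t \<in> {1..N}"
  have "wrap (int N) (int s + (int t - int s) mod int N) = int t" using t by (intro wrap_back) auto
  then show "oplus N s (nat ((int t - int s) mod int N)) = t" using N by (simp add: oplus_def)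
  then show "f (oplus N s (nat ((int t - int s) mod int N))) = f t" by simp
  show "nat ((int t - int s) mod int N) \<in> {..<N}" using N by (simp add: nat_less_iff)
next
  assume N: "N > 0"
  fix d assume d: "d \<in> {..<N}"
  show "oplus N s d \<in> {1..N}" by (rule oplus_range[OF N])
  show "nat ((int (oplus N s d) - int s) mod int N) = d" using d by (simp add: oplus_diff)
qed

text \<open>\<open>m\<close> counts the circular blocks, so that k m = n / r is the quantity in
  which the mixing rate is stated. The lower bound on \<nu> is what truncation for distant blocks
  requires.\<close>

locale circular_process = mda_process M X a b \<gamma> P R L
  for M :: "'a measure" and X :: "int \<Rightarrow> 'a \<Rightarrow> real^'d" and a b \<gamma> P R L +
  fixes k :: nat and m :: "nat \<Rightarrow> nat" and om \<nu> :: real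
  assumes k: "k \<ge> 2" and m_pos: "\<And>i. m i \<ge> 1" and m_top: "filterlim m at_top sequentially"
    and om: "om > 0" and \<nu>: "\<nu> > 2 / om"
    and mix_R: "(\<lambda>i. real (k * m i) powr (1 + om) * alpha_mix M X (R i)) \<longlonglongrightarrow> 0"
begin

abbreviation N :: "nat \<Rightarrow> nat" where "N i \<equiv> k * R i"

lemma \<nu>_pos: "\<nu> > 0"
  using om \<nu> by (meson divide_pos_pos less_trans zero_less_numeral)

lemma N_pos: "N i > 0"
  using k R_pos[of i] by simp

lemma N_ge: "2 * R i \<le> N i"
  using k by simp

lemma N_ge_int: "2 * int (R i) \<le> int (N i)"
  using N_ge[of i] by linarith

lemma R_le_N_int: "int (R i) \<le> int (N i)"
  using N_ge_int[of i] by linarith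

text \<open>The positions entering one circular maximum, with blocks \<open>q\<close> counted from 0
  and windows \<open>j\<close> from 1.\<close>

definition cpos :: "nat \<Rightarrow> nat \<Rightarrow> nat \<Rightarrow> int set" where
  "cpos i q j = (\<lambda>p. p + int (q * N i)) ` win (int (N i)) (int (R i)) (int j)"

definition Zc :: "nat \<Rightarrow> nat \<Rightarrow> nat \<Rightarrow> 'a \<Rightarrow> real^'d" where
  "Zc i q j \<omega> = rescale (a (R i)) (b (R i)) (cmax (\<lambda>t. X t \<omega>) (cpos i q j))"

lemma cpos_finite [simp]: "finite (cpos i q j)" "cpos i q j \<noteq> {}"
  using R_pos[of i] by (auto simp: cpos_def win_def)

lemma cpos_subset: "cpos i q j \<subseteq> {int (q * N i) + 1..int (Suc q * N i)}"
  using win_subset[of "int (N i)" "int (R i)" "int j"] N_pos[of i] unfolding cpos_def by (auto simp: subset_iff algebra_simps)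

lemma circ_Z_Zc:
  assumes j: "1 \<le> j" "j \<le> N i"
  shows "circ_Z a b k (R i) (\<lambda>t. X t \<omega>) (q * N i + j) = Zc i q j \<omega>"
proof -
  have d: "(q * N i + j - 1) div N i = q" "(q * N i + j - 1) mod N i = j - 1"
  proof -
    have "q * N i + j - 1 = j - 1 + q * N i" using j by simp
    moreover have "j - 1 < N i" using j by simp
    ultimately show "(q * N i + j - 1) div N i = q" "(q * N i + j - 1) mod N i = j - 1"
      using div_mult_self1[of "N i" "j - 1" q] mod_mult_self1[of "j - 1" q "N i"] N_pos[of i] by (simp_all only: div_less mod_less)
  qed
  \<comment> \<open>\<open>circ_max\<close> counts blocks from 1, hence
    \<open>q + 1\<close>.\<close>
  have "cmax (circ_entry k (R i) (\<lambda>t. X t \<omega>) (q + 1)) {j..j + R i - 1} = cmax (\<lambda>t. X t \<omega>) (cpos i q j)"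
  proof -
    have e: "circ_entry k (R i) (\<lambda>t. X t \<omega>) (q + 1) l = X (wrap (int (N i)) (int l) + int (q * N i)) \<omega>" if l: "l \<in> {j..j + R i - 1}" for l
    proof -
      have "l \<le> j + R i - 1" using l by simp
      then have "l \<le> 2 * N i" using j N_ge[of i] by linarith
      then have "wrap (int (N i)) (int l) = int (if l \<le> N i then l else l - N i)"
        using l j by (intro wrap_nat) auto
      then show ?thesis by (simp add: circ_entry_def add.commute)
    qed
    have i: "int ` {j..j + R i - 1} = {int j..int j + int (R i) - 1}"
      using R_pos[of i] by (simp add: image_int_atLeastAtMost of_nat_diff)
    have "cmax (circ_entry k (R i) (\<lambda>t. X t \<omega>) (q + 1)) {j..j + R i - 1} = cmax (\<lambda>l. X (wrap (int (N i)) (int l) + int (q * N i)) \<omega>) {j..j + R i - 1}"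
      using e by (rule cmax_cong)
    also have "\<dots> = cmax (\<lambda>t. X t \<omega>) ((\<lambda>l. wrap (int (N i)) (int l) + int (q * N i)) ` {j..j + R i - 1})"
      by (simp add: cmax_def image_image)
    also have "(\<lambda>l. wrap (int (N i)) (int l) + int (q * N i)) ` {j..j + R i - 1} = cpos i q j"
      unfolding cpos_def win_def i[symmetric] image_image ..
    finally show ?thesis .
  qed
  then show ?thesis using j d by (simp add: circ_Z_def circ_max_def Let_def Zc_def)
qed

lemma X_cmax_measurable: "finite S \<Longrightarrow> (\<lambda>\<omega>. cmax (\<lambda>t. X t \<omega>) S) \<in> borel_measurable M"
  by (rule cmax_measurable) auto

lemma Zc_measurable [measurable]: "Zc i q j \<in> borel_measurable M"
  unfolding Zc_def[abs_def] by (rule measurable_compose[OF X_cmax_measurable rescale_measurable]) simp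

lemma cmax_law:
  assumes S: "finite S"
  shows "distr M borel (\<lambda>\<omega>. cmax (\<lambda>t. X t \<omega>) ((\<lambda>p. p + c) ` S)) = distr M borel (\<lambda>\<omega>. cmax (\<lambda>t. X t \<omega>) S)"
proof -
  have m: "(\<lambda>y. cmax y S) \<in> borel_measurable (Pi\<^sub>M S (\<lambda>_. borel))"
    using cmax_measurable[OF S, of "\<lambda>t y. y t" "Pi\<^sub>M S (\<lambda>_. borel)"] by simp
  have e: "cmax (\<lambda>t. X t \<omega>) ((\<lambda>p. p + d) ` S) = cmax (path S d \<omega>) S" for d \<omega>
    unfolding cmax_shift by (rule cmax_cong) (simp add: path_def)
  have D: "distr M borel (\<lambda>\<omega>. cmax (path S d \<omega>) S) = distr (distr M (Pi\<^sub>M S (\<lambda>_. borel)) (path S d)) borel (\<lambda>y. cmax y S)" for d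
    by (subst distr_distr[OF m path_measurable]) (simp add: comp_def)
  have "distr M borel (\<lambda>\<omega>. cmax (path S c \<omega>) S) = distr M borel (\<lambda>\<omega>. cmax (path S 0 \<omega>) S)"
    unfolding D path_distr[OF S, of c] by (rule refl)
  then show ?thesis using e[of _ c] e[of _ 0] by simp
qed

lemma Zc_law:
  assumes "cpos i q j = (\<lambda>p. p + c) ` split_set k (R i) t"
  shows "distr M borel (Zc i q j) = distr M borel (\<lambda>\<omega>. split_Z a b k (R i) t (\<lambda>u. X u \<omega>))"
proof -
  have fin: "finite (split_set k (R i) t)" by (simp add: split_set_def)
  have "distr M borel (\<lambda>\<omega>. rescale (a (R i)) (b (R i)) (cmax (\<lambda>t. X t \<omega>) S)) =
    distr (distr M borel (\<lambda>\<omega>. cmax (\<lambda>t. X t \<omega>) S)) borel (rescale (a (R i)) (b (R i)))" if "finite S" for S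
    by (subst distr_distr[OF rescale_measurable X_cmax_measurable[OF that]]) (simp add: comp_def)
  from this[of "cpos i q j"] this[OF fin] cmax_law[OF fin, of c] show ?thesis
    unfolding split_Z_eq Zc_def[abs_def] assms by (simp add: fin)
qed

lemma cpos_inner:
  assumes "1 \<le> j" "j + R i - 1 \<le> N i"
  shows "cpos i q j = (\<lambda>p. p + (int j - 1 + int (q * N i))) ` split_set k (R i) (R i)"
  using win_split_inner[OF assms] k unfolding cpos_def by (simp add: image_image add.assoc)

lemma cpos_outer:
  assumes "1 \<le> t" "t \<le> R i"
  shows "cpos i q ((k - 1) * R i + t + 1) = (\<lambda>p. p + int (q * N i)) ` split_set k (R i) t"
  using win_split_outer[OF assms k] unfolding cpos_def by simp

text \<open>A window that does not wrap is a translate of a full block, the case t = R; the others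
  are those of \<open>win_split_outer\<close>. So a moment bound over t in {1..R} covers every
  window.\<close>

lemma cpos_split:
  assumes j: "1 \<le> j" "j \<le> N i"
  obtains c t where "t \<in> {1..R i}" "cpos i q j = (\<lambda>p. p + c) ` split_set k (R i) t"
proof (cases "j + R i - 1 \<le> N i")
  case True
  then show ?thesis using that[of "R i"] cpos_inner[OF j(1) True] R_pos[of i] by auto
next
  case False
  define t where "t = j + R i - 1 - N i"
  have "N i = (k - 1) * R i + R i" using k by (cases k) auto
  then have t: "1 \<le> t" "t \<le> R i" "j = (k - 1) * R i + t + 1" using False j by (auto simp: t_def)
  show ?thesis using that[of t] cpos_outer[OF t(1,2)] t by auto
qed

text \<open>What the scalar theory asks of an integrand, with one moment bound \<open>c\<close> for
  all \<open>i\<close> and \<open>t\<close>. The linear forms of \<open>h\<close> will satisfy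
  it.\<close>

definition adm :: "real \<Rightarrow> (real^'d \<Rightarrow> real) \<Rightarrow> bool" where
  "adm c g \<longleftrightarrow> g \<in> borel_measurable borel \<and> (AE z in P. isCont g z) \<and>
     (\<forall>i. \<forall>t\<in>{1..R i}. mom M (2 + \<nu>) c (\<lambda>\<omega>. g (split_Z a b k (R i) t (\<lambda>u. X u \<omega>))))"

lemma split_Z_measurable: "(\<lambda>\<omega>. split_Z a b k (R i) t (\<lambda>u. X u \<omega>)) \<in> borel_measurable M"
  unfolding split_Z_eq by (rule measurable_compose[OF X_cmax_measurable rescale_measurable]) (simp add: split_set_def)

lemma adm_Zc:
  assumes g: "adm c g" and j: "1 \<le> j" "j \<le> N i"
  shows "mom M (2 + \<nu>) c (\<lambda>\<omega>. g (Zc i q j \<omega>))"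
proof -
  obtain d t where t: "t \<in> {1..R i}" "cpos i q j = (\<lambda>p. p + d) ` split_set k (R i) t" by (rule cpos_split[OF j])
  have gm: "g \<in> borel_measurable borel" using g by (simp add: adm_def)
  have "mom M (2 + \<nu>) c (\<lambda>\<omega>. g (split_Z a b k (R i) t (\<lambda>u. X u \<omega>)))" using g t(1) by (simp add: adm_def)
  then show ?thesis
    unfolding mom_distr[OF Zc_measurable gm] mom_distr[OF split_Z_measurable gm] Zc_law[OF t(2)] .
qed

lemma block_Z_split: "block_Z a b (R i) x = split_Z a b k (R i) (R i) x"
  using k by (simp add: block_Z_def split_Z_eq split_set_full)

lemma adm_P: "adm c g \<Longrightarrow> mom P (2 + \<nu>) c g"
proof (rule mom_limit)
  assume g: "adm c g"
  show "g \<in> borel_measurable borel" "AE z in P. isCont g z" using g by (auto simp: adm_def)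
  show "0 < 2 + \<nu>" using \<nu>_pos by simp
  show "mom M (2 + \<nu>) c (\<lambda>\<omega>. g (block_Z a b (R i) (\<lambda>t. X t \<omega>)))" for i
    unfolding block_Z_split using g R_pos[of i] by (simp add: adm_def)
qed

lemma Zc_pair_prob:
  "prob {\<omega>\<in>space M. Zc i q s \<omega> \<le> x \<and> Zc i q' t \<omega> \<le> y} = Q (cpos i q s) (cpos i q' t) (u i x) (u i y)"
  unfolding Q_def Zc_def rescale_le_iff[OF a_pos[OF R_pos]] by (simp add: cmax_le_iff)

lemma Zc_pair_win:
  "Q (cpos i q s) (cpos i q t) v w = Q (win (int (N i)) (int (R i)) (int s)) (win (int (N i)) (int (R i)) (int t)) v w"
  unfolding cpos_def by (rule Q_shift) auto

section \<open>Covariances of pairs of circular maxima\<close>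

definition \<Gamma> :: "(real^'d \<Rightarrow> real) \<Rightarrow> (real^'d \<Rightarrow> real) \<Rightarrow> real \<Rightarrow> real" where
  "\<Gamma> g1 g2 \<xi> = cv (G_xi_law P \<xi>) (\<lambda>z. g1 (fst z)) (\<lambda>z. g2 (snd z))"

text \<open>The two coordinates are exchangeable under \<open>G_xi_law\<close>.\<close>

lemma \<Gamma>_sym:
  assumes g: "g1 \<in> borel_measurable borel" "g2 \<in> borel_measurable borel" and \<xi>: "0 < \<xi>" "\<xi> < 1"
  shows "\<Gamma> g2 g1 \<xi> = \<Gamma> g1 g2 \<xi>"
proof -
  let ?C = "G_xi_law P \<xi>"
  note isg = G_xi_law_is_G_xi[OF \<xi>]
  have s: "sets ?C = sets borel" using isg by (simp add: is_G_xi_def)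
  have "(\<lambda>p. (snd p, fst p)) \<in> measurable (borel :: ((real^'d) \<times> (real^'d)) measure) (borel \<Otimes>\<^sub>M borel)"
    by (intro measurable_Pair fst_borel snd_borel)
  then have sw: "(\<lambda>p. (snd p, fst p)) \<in> measurable ?C borel"
    unfolding borel_prod by (subst measurable_cong_sets[OF s refl])
  have swap: "(\<integral>z. f z \<partial>?C) = (\<integral>z. f (snd z, fst z) \<partial>?C)" if "f \<in> borel_measurable borel" for f :: "_ \<Rightarrow> real"
    using integral_distr[OF sw that] unfolding is_G_xi_swap[OF isg] .
  have m: "(\<lambda>z::(real^'d) \<times> (real^'d). g2 (fst z)) \<in> borel_measurable borel" "(\<lambda>z::(real^'d) \<times> (real^'d). g1 (snd z)) \<in> borel_measurable borel"
    by (rule measurable_compose[OF fst_borel g(2)], rule measurable_compose[OF snd_borel g(1)])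
  show ?thesis
    unfolding \<Gamma>_def cv_def using swap[OF m(1)] swap[OF m(2)] swap[OF borel_measurable_times[OF m]]
    by (simp add: mult.commute)
qed

lemma cv_product:
  assumes "adm c g1" "adm c g2"
  shows "cv (P \<Otimes>\<^sub>M P) (\<lambda>z. g1 (fst z)) (\<lambda>z. g2 (snd z)) = 0"
proof -
  interpret P: prob_space P by (rule prob_P)
  interpret PP: pair_prob_space P P ..
  note C = product_coupling(1)
  have p: "2 + \<nu> \<ge> 2" "2 + \<nu> \<ge> 1" using \<nu>_pos by auto
  have m1: "mom (P \<Otimes>\<^sub>M P) (2 + \<nu>) c (\<lambda>z. g1 (fst z))" and m2: "mom (P \<Otimes>\<^sub>M P) (2 + \<nu>) c (\<lambda>z. g2 (snd z))"
    using mom_fst[OF C adm_P[OF assms(1)]] mom_snd[OF C adm_P[OF assms(2)]] by auto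
  have "(\<integral>z. g1 (fst z) * g2 (snd z) \<partial>(P \<Otimes>\<^sub>M P)) = (\<integral>x. \<integral>y. g1 x * g2 y \<partial>P \<partial>P)"
    using PP.integral_fst'[OF PP.P.mom_prod(1)[OF m1 m2 p(1)]] by simp
  also have "\<dots> = (\<integral>x. g1 x \<partial>P) * (\<integral>y. g2 y \<partial>P)" by simp
  finally have 1: "(\<integral>z. g1 (fst z) * g2 (snd z) \<partial>(P \<Otimes>\<^sub>M P)) = (\<integral>x. g1 x \<partial>P) * (\<integral>y. g2 y \<partial>P)" .
  have 2: "(\<integral>z. g1 (fst z) \<partial>(P \<Otimes>\<^sub>M P)) = (\<integral>x. g1 x \<partial>P)"
    using PP.integral_fst'[OF PP.P.mom_abs(1)[OF m1 p(2)]] by (simp add: P.prob_space[unfolded space_P])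
  have 3: "(\<integral>z. g2 (snd z) \<partial>(P \<Otimes>\<^sub>M P)) = (\<integral>x. g2 x \<partial>P)"
    using PP.integral_fst'[OF PP.P.mom_abs(1)[OF m2 p(2)]] by (simp add: P.prob_space[unfolded space_P])
  show ?thesis unfolding cv_def 1 2 3 by simp
qed

lemma cv_Zc_limit:
  assumes g: "adm c g1" "adm c g2" and C: "coupling C"
    and s: "\<And>i. s i \<in> {1..N i}" and t: "\<And>i. t i \<in> {1..N i}"
    and lim: "\<And>x y. (\<lambda>i. Q (cpos i (q i) (s i)) (cpos i (q' i) (t i)) (u i x) (u i y)) \<longlonglongrightarrow> measure C ({..x} \<times> {..y})"
  shows "(\<lambda>i. cv M (\<lambda>\<omega>. g1 (Zc i (q i) (s i) \<omega>)) (\<lambda>\<omega>. g2 (Zc i (q' i) (t i) \<omega>))) \<longlonglongrightarrow>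
    cv C (\<lambda>z. g1 (fst z)) (\<lambda>z. g2 (snd z))"
proof (rule cv_convergence[OF C])
  show "(\<lambda>i. prob {\<omega>\<in>space M. Zc i (q i) (s i) \<omega> \<le> x \<and> Zc i (q' i) (t i) \<omega> \<le> y}) \<longlonglongrightarrow> measure C ({..x} \<times> {..y})" for x y
    unfolding Zc_pair_prob by (rule lim)
  show "mom M (2 + \<nu>) c (\<lambda>\<omega>. g1 (Zc i (q i) (s i) \<omega>))" "mom M (2 + \<nu>) c (\<lambda>\<omega>. g2 (Zc i (q' i) (t i) \<omega>))" for i
    using s[of i] t[of i] by (auto intro!: adm_Zc g)
qed (use g \<nu>_pos in \<open>auto simp: adm_def intro: adm_P[OF g(1)] adm_P[OF g(2)]\<close>)

lemma cv_overlap: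
  assumes g: "adm c g1" "adm c g2" and s: "\<And>i. s i \<in> {1..N i}" and t: "\<And>i. t i \<in> {1..N i}"
    and d: "\<And>i. int (d i) = (int (t i) - int (s i)) mod int (N i)" "\<And>i. d i \<le> R i"
    and \<xi>: "(\<lambda>i. real (d i) / real (R i)) \<longlonglongrightarrow> \<xi>" "0 < \<xi>" "\<xi> < 1"
  shows "(\<lambda>i. cv M (\<lambda>\<omega>. g1 (Zc i (q i) (s i) \<omega>)) (\<lambda>\<omega>. g2 (Zc i (q i) (t i) \<omega>))) \<longlonglongrightarrow> \<Gamma> g1 g2 \<xi>"
  unfolding \<Gamma>_def
proof (rule cv_Zc_limit[OF g is_G_xi_coupling[OF \<xi>(2,3) G_xi_law_is_G_xi[OF \<xi>(2,3)]] s t])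
  fix x y
  have "(\<lambda>i. Q (win (int (N i)) (int (R i)) (int (s i))) (win (int (N i)) (int (R i)) (int (t i))) (u i x) (u i y)) \<longlonglongrightarrow>
    G x powr \<xi> * G y powr \<xi> * G (inf x y) powr (1 - \<xi>)"
    using s t by (intro win_overlap_limit[OF _ _ N_ge_int d \<xi>]) (auto simp flip: of_nat_mult)
  then show "(\<lambda>i. Q (cpos i (q i) (s i)) (cpos i (q i) (t i)) (u i x) (u i y)) \<longlonglongrightarrow> measure (G_xi_law P \<xi>) ({..x} \<times> {..y})"
    using G_xi_law_is_G_xi[OF \<xi>(2,3)] unfolding Zc_pair_win is_G_xi_def by simp
qed

lemma cv_disjoint:
  assumes g: "adm c g1" "adm c g2" and s: "\<And>i. s i \<in> {1..N i}" and t: "\<And>i. t i \<in> {1..N i}"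
    and d: "\<And>i. int (d i) = (int (t i) - int (s i)) mod int (N i)" "\<And>i. R i \<le> d i" "\<And>i. d i + R i \<le> N i"
  shows "(\<lambda>i. cv M (\<lambda>\<omega>. g1 (Zc i (q i) (s i) \<omega>)) (\<lambda>\<omega>. g2 (Zc i (q i) (t i) \<omega>))) \<longlonglongrightarrow> 0"
  unfolding cv_product[OF g, symmetric]
proof (rule cv_Zc_limit[OF g product_coupling(1) s t])
  fix x y
  have "(\<lambda>i. Q (win (int (N i)) (int (R i)) (int (s i))) (win (int (N i)) (int (R i)) (int (t i))) (u i x) (u i y)) \<longlonglongrightarrow> G x * G y"
    using s t d(3) by (intro win_disjoint_limit[OF _ _ d(1,2)]) (auto simp flip: of_nat_mult of_nat_add)
  then show "(\<lambda>i. Q (cpos i (q i) (s i)) (cpos i (q i) (t i)) (u i x) (u i y)) \<longlonglongrightarrow> measure (P \<Otimes>\<^sub>M P) ({..x} \<times> {..y})"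
    unfolding Zc_pair_win product_coupling(2) .
qed

lemma cv_adjacent:
  assumes g: "adm c g1" "adm c g2" and s: "\<And>i. s i \<in> {1..N i}" and t: "\<And>i. t i \<in> {1..N i}"
  shows "(\<lambda>i. cv M (\<lambda>\<omega>. g1 (Zc i (q i) (s i) \<omega>)) (\<lambda>\<omega>. g2 (Zc i (Suc (q i)) (t i) \<omega>))) \<longlonglongrightarrow> 0"
  unfolding cv_product[OF g, symmetric]
proof (rule cv_Zc_limit[OF g product_coupling(1) s t])
  fix x y
  have e: "Q (cpos i q s) (cpos i (Suc q) t) v w =
    Q (win (int (N i)) (int (R i)) (int s)) ((\<lambda>p. p + int (N i)) ` win (int (N i)) (int (R i)) (int t)) v w" for i q s t v w
  proof -
    have "cpos i (Suc q) t = (\<lambda>p. p + int (q * N i)) ` ((\<lambda>p. p + int (N i)) ` win (int (N i)) (int (R i)) (int t))"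
      unfolding cpos_def image_image by (intro image_cong refl) simp
    then show ?thesis unfolding cpos_def by (simp only:) (rule Q_shift, auto)
  qed
  have "(\<lambda>i. Q (win (int (N i)) (int (R i)) (int (s i))) ((\<lambda>p. p + int (N i)) ` win (int (N i)) (int (R i)) (int (t i))) (u i x) (u i y)) \<longlonglongrightarrow> G x * G y"
    using s t by (intro win_adjacent_limit[OF _ _ R_le_N_int]) (auto simp flip: of_nat_mult)
  then show "(\<lambda>i. Q (cpos i (q i) (s i)) (cpos i (Suc (q i)) (t i)) (u i x) (u i y)) \<longlonglongrightarrow> measure (P \<Otimes>\<^sub>M P) ({..x} \<times> {..y})"
    unfolding e product_coupling(2) .
qed

end

section \<open>Covariances of block averages\<close>

text \<open>Lags below r and above N - r belong to overlapping windows, those in between to disjoint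
  ones. The last range is reflected to d < r, with 0 at d = 0 because lag 0 is already in the first
  sum.\<close>

lemma sum_three_parts:
  fixes f :: "nat \<Rightarrow> real"
  assumes "1 \<le> r" "2 * r \<le> N"
  shows "(\<Sum>d<N. f d) = (\<Sum>d<r. f d) + (\<Sum>d\<in>{r..N - r}. f d) + (\<Sum>d<r. if d = 0 then 0 else f (N - d))"
proof -
  have "{..<N} = ({..<r} \<union> {r..N - r}) \<union> {N - r<..<N}" using assms by auto
  then have "(\<Sum>d<N. f d) = (\<Sum>d\<in>({..<r} \<union> {r..N - r}) \<union> {N - r<..<N}. f d)" by simp
  also have "\<dots> = (\<Sum>d\<in>{..<r} \<union> {r..N - r}. f d) + (\<Sum>d\<in>{N - r<..<N}. f d)"
    using assms by (intro sum.union_disjoint) auto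
  also have "(\<Sum>d\<in>{..<r} \<union> {r..N - r}. f d) = (\<Sum>d<r. f d) + (\<Sum>d\<in>{r..N - r}. f d)"
    by (intro sum.union_disjoint) auto
  also have "(\<Sum>d\<in>{N - r<..<N}. f d) = (\<Sum>d\<in>{1..<r}. if d = 0 then 0 else f (N - d))"
    using assms by (intro sum.reindex_bij_witness[of _ "\<lambda>d. N - d" "\<lambda>d. N - d"]) auto
  also have "(\<Sum>d\<in>{1..<r}. if d = 0 then 0 else f (N - d)) = (\<Sum>d<r. if d = 0 then 0 else f (N - d))"
    by (intro sum.mono_neutral_left) auto
  finally show ?thesis .
qed

context circular_process
begin

definition B :: "(real^'d \<Rightarrow> real) \<Rightarrow> nat \<Rightarrow> nat \<Rightarrow> 'a \<Rightarrow> real" where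
  "B g i q \<omega> = (\<Sum>j\<in>{1..N i}. g (Zc i q j \<omega>)) / real (N i)"

definition lag_cov :: "(real^'d \<Rightarrow> real) \<Rightarrow> (real^'d \<Rightarrow> real) \<Rightarrow> nat \<Rightarrow> nat \<Rightarrow> nat \<Rightarrow> nat \<Rightarrow> nat \<Rightarrow> real" where
  "lag_cov g1 g2 i q s q' t = cv M (\<lambda>\<omega>. g1 (Zc i q s \<omega>)) (\<lambda>\<omega>. g2 (Zc i q' t \<omega>))"

lemma exponent_bounds: "2 + \<nu> \<ge> 1" "2 + \<nu> \<ge> 2" "2 + \<nu> \<ge> 0"
  using \<nu>_pos by auto

lemma cv_B:
  assumes g: "adm c g1" "adm c g2"
  shows "cv M (B g1 i q) (B g2 i q') = (\<Sum>s\<in>{1..N i}. \<Sum>t\<in>{1..N i}. lag_cov g1 g2 i q s q' t) / (real (N i) * real (N i))"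
proof -
  have m: "mom M (2 + \<nu>) c (\<lambda>\<omega>. g1 (Zc i q s \<omega>))" "mom M (2 + \<nu>) c (\<lambda>\<omega>. g2 (Zc i q' s \<omega>))" if "s \<in> {1..N i}" for s
    using that by (auto intro: adm_Zc[OF g(1)] adm_Zc[OF g(2)])
  have "cv M (\<lambda>\<omega>. \<Sum>j\<in>{1..N i}. g1 (Zc i q j \<omega>)) (\<lambda>\<omega>. \<Sum>j\<in>{1..N i}. g2 (Zc i q' j \<omega>)) = (\<Sum>s\<in>{1..N i}. \<Sum>t\<in>{1..N i}. lag_cov g1 g2 i q s q' t)"
    unfolding lag_cov_def
    by (rule cv_sum) (use m mom_abs(1)[OF _ exponent_bounds(1)] mom_prod(1)[OF _ _ exponent_bounds(2)] in blast)+
  then show ?thesis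
    unfolding B_def using cv_scale[of M "1 / real (N i)" _ "1 / real (N i)"] by simp
qed

lemma lag_cov_bound:
  assumes g: "adm c g1" "adm c g2" and s: "s \<in> {1..N i}" "t \<in> {1..N i}"
  shows "\<bar>lag_cov g1 g2 i q s q' t\<bar> \<le> (1 + c) + (1 + c) * (1 + c)"
  unfolding lag_cov_def using s by (intro cv_mom_bound[OF _ _ exponent_bounds(2)] adm_Zc g) auto

lemma floor_ratio:
  assumes "0 < \<xi>" "\<xi> < 1"
  shows "(\<lambda>i. real (nat \<lfloor>real (R i) * \<xi>\<rfloor>) / real (R i)) \<longlonglongrightarrow> \<xi>"
proof (rule tendsto_sandwich)
  show "\<forall>\<^sub>F i in sequentially. \<xi> - 1 / real (R i) \<le> real (nat \<lfloor>real (R i) * \<xi>\<rfloor>) / real (R i)"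
  proof (rule always_eventually, rule allI)
    fix i
    have "real (R i) * \<xi> - 1 \<le> real (nat \<lfloor>real (R i) * \<xi>\<rfloor>)" by linarith
    from divide_right_mono[OF this, of "real (R i)"] show "\<xi> - 1 / real (R i) \<le> real (nat \<lfloor>real (R i) * \<xi>\<rfloor>) / real (R i)"
      using R_pos[of i] by (simp add: diff_divide_distrib)
  qed
  show "\<forall>\<^sub>F i in sequentially. real (nat \<lfloor>real (R i) * \<xi>\<rfloor>) / real (R i) \<le> \<xi>"
  proof (rule always_eventually, rule allI)
    fix i
    have "0 \<le> real (R i) * \<xi>" using assms by simp
    then have "real (nat \<lfloor>real (R i) * \<xi>\<rfloor>) \<le> real (R i) * \<xi>" by linarith
    from divide_right_mono[OF this, of "real (R i)"] show "real (nat \<lfloor>real (R i) * \<xi>\<rfloor>) / real (R i) \<le> \<xi>"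
      using R_pos[of i] by simp
  qed
  show "(\<lambda>i. \<xi> - 1 / real (R i)) \<longlonglongrightarrow> \<xi>"
    using tendsto_diff[OF tendsto_const real_tendsto_divide_at_top[OF tendsto_const R_real_top], of \<xi> 1] by simp
qed simp

lemma floor_less_R: "0 < \<xi> \<Longrightarrow> \<xi> < 1 \<Longrightarrow> nat \<lfloor>real (R i) * \<xi>\<rfloor> < R i"
proof -
  assume "0 < \<xi>" "\<xi> < 1"
  then have "real (R i) * \<xi> < real (R i)" using R_pos[of i] by simp
  moreover have "0 \<le> real (R i) * \<xi>" using \<open>0 < \<xi>\<close> by simp
  ultimately show ?thesis by linarith
qed

text \<open>The double sum over windows is sorted by circular lag. Rotation leaves the law unchanged
  only approximately, so the covariances at a given lag are averaged over the starting point instead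
  of being identified.\<close>

definition lagavg :: "(real^'d \<Rightarrow> real) \<Rightarrow> (real^'d \<Rightarrow> real) \<Rightarrow> (nat \<Rightarrow> nat) \<Rightarrow> nat \<Rightarrow> nat \<Rightarrow> real" where
  "lagavg g1 g2 q i d = (\<Sum>s\<in>{1..N i}. lag_cov g1 g2 i (q i) s (q i) (oplus (N i) s d)) / real (N i)"

lemma lagavg_bound:
  assumes g: "adm c g1" "adm c g2"
  shows "\<bar>lagavg g1 g2 q i d\<bar> \<le> (1 + c) + (1 + c) * (1 + c)"
proof -
  have "\<bar>(\<Sum>s\<in>{1..N i}. lag_cov g1 g2 i (q i) s (q i) (oplus (N i) s d)) / real (card {1..N i}) - 0\<bar> \<le> (1 + c) + (1 + c) * (1 + c)"
    by (rule average_error) (use N_pos[of i] lag_cov_bound[OF g] oplus_range[OF N_pos] in auto)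
  then show ?thesis by (simp add: lagavg_def)
qed

text \<open>By \<open>uniform_choice\<close> all terms are close to the limit
  simultaneously.\<close>

lemma average_limit:
  assumes "\<And>s. (\<And>i. s i \<in> {1..N i}) \<Longrightarrow> (\<lambda>i. \<phi> i (s i)) \<longlonglongrightarrow> l"
  shows "(\<lambda>i. (\<Sum>s\<in>{1..N i}. \<phi> i s) / real (N i)) \<longlonglongrightarrow> l"
proof -
  have ne: "{1..N i} \<noteq> {}" for i using N_pos[of i] by auto
  obtain \<epsilon> where \<epsilon>: "\<epsilon> \<longlonglongrightarrow> 0" "\<And>i s. s \<in> {1..N i} \<Longrightarrow> \<bar>\<phi> i s - l\<bar> \<le> \<epsilon> i"
    by (rule uniform_choice[of "\<lambda>i. {1..N i}" \<phi> l]) (use ne assms in auto)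
  have "\<bar>(\<Sum>s\<in>{1..N i}. \<phi> i s) / real (card {1..N i}) - l\<bar> \<le> \<epsilon> i" for i
    by (rule average_error) (use ne \<epsilon>(2) in auto)
  then have "\<bar>(\<Sum>s\<in>{1..N i}. \<phi> i s) / real (N i) - l\<bar> \<le> 1 * \<epsilon> i" for i by simp
  then show ?thesis by (rule squeeze_limit[OF tendsto_const \<epsilon>(1)])
qed

lemma lagavg_limit:
  assumes g: "adm c g1" "adm c g2" and \<xi>: "0 < \<xi>" "\<xi> < 1"
  shows "(\<lambda>i. lagavg g1 g2 q i (nat \<lfloor>real (R i) * \<xi>\<rfloor>)) \<longlonglongrightarrow> \<Gamma> g1 g2 \<xi>"
  unfolding lagavg_def
proof (rule average_limit)
  fix s :: "nat \<Rightarrow> nat" assume s: "\<And>i. s i \<in> {1..N i}"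
  have dN: "nat \<lfloor>real (R i) * \<xi>\<rfloor> < N i" for i using floor_less_R[OF \<xi>, of i] R_le_N_int[of i] by linarith
  show "(\<lambda>i. lag_cov g1 g2 i (q i) (s i) (q i) (oplus (N i) (s i) (nat \<lfloor>real (R i) * \<xi>\<rfloor>))) \<longlonglongrightarrow> \<Gamma> g1 g2 \<xi>"
    unfolding lag_cov_def
    by (rule cv_overlap[OF g s oplus_range[OF N_pos] oplus_diff[OF dN, symmetric] _ floor_ratio[OF \<xi>] \<xi>])
      (use floor_less_R[OF \<xi>] in \<open>simp add: less_imp_le\<close>)
qed

text \<open>Lag N - d is lag d with the two windows exchanged, and the limit is symmetric by
  \<open>\<Gamma>_sym\<close>.\<close>

lemma lagavg_limit_back:
  assumes g: "adm c g1" "adm c g2" and \<xi>: "0 < \<xi>" "\<xi> < 1"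
  shows "(\<lambda>i. let d = nat \<lfloor>real (R i) * \<xi>\<rfloor> in if d = 0 then 0 else lagavg g1 g2 q i (N i - d)) \<longlonglongrightarrow> \<Gamma> g1 g2 \<xi>"
proof -
  \<comment> \<open>The maximum guards against d = 0, for which N - d is not a lag on the circle; it
    is inactive for large \<open>i\<close>.\<close>
  define d where "d i = max 1 (nat \<lfloor>real (R i) * \<xi>\<rfloor>)" for i
  have top: "\<forall>\<^sub>F i in sequentially. 1 \<le> nat \<lfloor>real (R i) * \<xi>\<rfloor>"
    using filterlim_at_top[THEN iffD1, OF floor_top[OF \<xi>(1)]] by blast
  have d1: "1 \<le> d i" "d i \<le> R i" "d i < N i" for i
    using floor_less_R[OF \<xi>, of i] R_pos[of i] N_ge[of i] unfolding d_def by linarith+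
  have dr: "(\<lambda>i. real (d i) / real (R i)) \<longlonglongrightarrow> \<xi>"
    by (rule Lim_transform_eventually[OF floor_ratio[OF \<xi>]]) (use top in \<open>eventually_elim, simp add: d_def max_def\<close>)
  have "(\<lambda>i. lagavg g1 g2 q i (N i - d i)) \<longlonglongrightarrow> \<Gamma> g1 g2 \<xi>"
    unfolding lagavg_def
  proof (rule average_limit)
    fix s :: "nat \<Rightarrow> nat" assume s: "\<And>i. s i \<in> {1..N i}"
    have gm: "g1 \<in> borel_measurable borel" "g2 \<in> borel_measurable borel" using g by (auto simp: adm_def)
    have "(\<lambda>i. lag_cov g2 g1 i (q i) (oplus (N i) (s i) (N i - d i)) (q i) (s i)) \<longlonglongrightarrow> \<Gamma> g2 g1 \<xi>"
      unfolding lag_cov_def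
      by (rule cv_overlap[OF g(2,1) oplus_range[OF N_pos] s oplus_diff_back[OF d1(1,3), symmetric] d1(2) dr \<xi>])
    then show "(\<lambda>i. lag_cov g1 g2 i (q i) (s i) (q i) (oplus (N i) (s i) (N i - d i))) \<longlonglongrightarrow> \<Gamma> g1 g2 \<xi>"
      unfolding \<Gamma>_sym[OF gm \<xi>] lag_cov_def by (simp add: cv_commute)
  qed
  then show ?thesis
  proof (rule Lim_transform_eventually)
    show "\<forall>\<^sub>F i in sequentially. lagavg g1 g2 q i (N i - d i) =
      (let d = nat \<lfloor>real (R i) * \<xi>\<rfloor> in if d = 0 then 0 else lagavg g1 g2 q i (N i - d))"
      using top
    proof eventually_elim
      case (elim i)
      then have "d i = nat \<lfloor>real (R i) * \<xi>\<rfloor>" "nat \<lfloor>real (R i) * \<xi>\<rfloor> \<noteq> 0" unfolding d_def by linarith+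
      then show ?case by (simp only: Let_def if_False)
    qed
  qed
qed

definition I\<Gamma> :: "(real^'d \<Rightarrow> real) \<Rightarrow> (real^'d \<Rightarrow> real) \<Rightarrow> real" where
  "I\<Gamma> g1 g2 = (LBINT \<xi>:{0..1}. \<Gamma> g1 g2 \<xi>)"

text \<open>Because k / N = 1 / R, the left side is the sum of all lag averages divided by R. Both
  overlapping ranges are Riemann sums with the same limit; the at most k R disjoint lags contribute
  no more than k times a uniformly vanishing covariance.\<close>

lemma diag_limit:
  assumes g: "adm c g1" "adm c g2"
  shows "(\<lambda>i. real k * cv M (B g1 i (q i)) (B g2 i (q i))) \<longlonglongrightarrow> 2 * I\<Gamma> g1 g2"
proof -
  let ?c = "lagavg g1 g2 q"
  let ?D = "(1 + c) + (1 + c) * (1 + c)"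
  have kR: "real k / real (N i) = 1 / real (R i)" for i using k by simp
  define c' where "c' i d = (if d = 0 then 0 else ?c i (N i - d))" for i d
  have D0: "0 \<le> ?D" using lagavg_bound[OF g, of q 0 0] by linarith
  have l1: "(\<lambda>i. (\<Sum>d<R i. ?c i d) / real (R i)) \<longlonglongrightarrow> I\<Gamma> g1 g2"
    unfolding I\<Gamma>_def
  proof (rule riemann_limit[OF R_pos])
    show "\<bar>?c i d\<bar> \<le> ?D" for i d by (rule lagavg_bound[OF g])
    show "(\<lambda>i. ?c i (nat \<lfloor>real (R i) * \<xi>\<rfloor>)) \<longlonglongrightarrow> \<Gamma> g1 g2 \<xi>" if "0 < \<xi>" "\<xi> < 1" for \<xi>
      by (rule lagavg_limit[OF g that])
  qed
  have l3: "(\<lambda>i. (\<Sum>d<R i. c' i d) / real (R i)) \<longlonglongrightarrow> I\<Gamma> g1 g2"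
    unfolding I\<Gamma>_def
  proof (rule riemann_limit[OF R_pos])
    show "\<bar>c' i d\<bar> \<le> ?D" for i d using lagavg_bound[OF g, of q i "N i - d"] D0 by (simp add: c'_def)
    show "(\<lambda>i. c' i (nat \<lfloor>real (R i) * \<xi>\<rfloor>)) \<longlonglongrightarrow> \<Gamma> g1 g2 \<xi>" if "0 < \<xi>" "\<xi> < 1" for \<xi>
      using lagavg_limit_back[OF g that, of q] by (simp add: c'_def Let_def)
  qed
  have l2: "(\<lambda>i. (\<Sum>d\<in>{R i..N i - R i}. ?c i d) / real (R i)) \<longlonglongrightarrow> 0"
  proof -
    let ?S = "\<lambda>i. {R i..N i - R i} \<times> {1..N i}"
    obtain \<epsilon> where \<epsilon>: "\<epsilon> \<longlonglongrightarrow> 0" "\<And>i p. p \<in> ?S i \<Longrightarrow> \<bar>(\<lambda>i p. lag_cov g1 g2 i (q i) (snd p) (q i) (oplus (N i) (snd p) (fst p))) i p - 0\<bar> \<le> \<epsilon> i" "\<And>i. 0 \<le> \<epsilon> i"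
    proof (rule uniform_choice[of ?S "\<lambda>i p. lag_cov g1 g2 i (q i) (snd p) (q i) (oplus (N i) (snd p) (fst p))" 0])
      show "?S i \<noteq> {}" for i
      proof -
        have "R i \<le> N i - R i" "1 \<le> N i" using N_ge[of i] N_pos[of i] by linarith+
        then have "(R i, 1) \<in> ?S i" by (simp only: mem_Sigma_iff atLeastAtMost_iff order_refl)
        then show ?thesis by blast
      qed
      fix p assume p: "\<And>i. p i \<in> ?S i"
      have s: "snd (p i) \<in> {1..N i}" and d: "R i \<le> fst (p i)" "fst (p i) + R i \<le> N i" "fst (p i) < N i" for i
      proof -
        from p[of i] have *: "fst (p i) \<in> {R i..N i - R i}" "snd (p i) \<in> {1..N i}" unfolding mem_Times_iff by blast+
        then show "snd (p i) \<in> {1..N i}" by blast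
        from *(1) have "R i \<le> fst (p i)" "fst (p i) \<le> N i - R i" unfolding atLeastAtMost_iff by blast+
        then show "R i \<le> fst (p i)" "fst (p i) + R i \<le> N i" "fst (p i) < N i"
          using N_ge[of i] R_pos[of i] by linarith+
      qed
      show "(\<lambda>i. lag_cov g1 g2 i (q i) (snd (p i)) (q i) (oplus (N i) (snd (p i)) (fst (p i)))) \<longlonglongrightarrow> 0"
        unfolding lag_cov_def
        by (rule cv_disjoint[OF g s oplus_range[OF N_pos] oplus_diff[OF d(3), symmetric] d(1,2)])
    qed auto
    have "\<bar>(\<Sum>d\<in>{R i..N i - R i}. ?c i d) / real (R i) - 0\<bar> \<le> real k * \<epsilon> i" for i
    proof -
      have cd: "\<bar>?c i d\<bar> \<le> \<epsilon> i" if "d \<in> {R i..N i - R i}" for d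
      proof -
        have "\<bar>(\<Sum>s\<in>{1..N i}. lag_cov g1 g2 i (q i) s (q i) (oplus (N i) s d)) / real (card {1..N i}) - 0\<bar> \<le> \<epsilon> i"
          by (rule average_error) (use N_pos[of i] \<epsilon>(2)[of "(d, _)" i] that in auto)
        then show ?thesis by (simp add: lagavg_def)
      qed
      have "\<bar>\<Sum>d\<in>{R i..N i - R i}. ?c i d\<bar> \<le> (\<Sum>d\<in>{R i..N i - R i}. \<epsilon> i)"
        by (intro order_trans[OF sum_abs] sum_mono cd)
      also have "\<dots> = real (card {R i..N i - R i}) * \<epsilon> i" by simp
      also have "\<dots> \<le> real (N i) * \<epsilon> i"
      proof (rule mult_right_mono[OF _ \<epsilon>(3)])
        have "card {R i..N i - R i} \<le> N i" using R_pos[of i] N_pos[of i] by simp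
        then show "real (card {R i..N i - R i}) \<le> real (N i)" by (rule of_nat_mono)
      qed
      finally have "\<bar>\<Sum>d\<in>{R i..N i - R i}. ?c i d\<bar> / real (R i) \<le> real (N i) * \<epsilon> i / real (R i)"
        by (rule divide_right_mono) simp
      also have "\<dots> = real k * \<epsilon> i" using R_pos[of i] by simp
      finally show ?thesis by (simp add: abs_divide)
    qed
    then show ?thesis by (rule squeeze_limit[OF tendsto_const \<epsilon>(1)])
  qed
  have eq: "real k * cv M (B g1 i (q i)) (B g2 i (q i)) =
    (\<Sum>d<R i. ?c i d) / real (R i) + (\<Sum>d\<in>{R i..N i - R i}. ?c i d) / real (R i) + (\<Sum>d<R i. c' i d) / real (R i)" for i
  proof -
    have "(\<Sum>s\<in>{1..N i}. \<Sum>t\<in>{1..N i}. lag_cov g1 g2 i (q i) s (q i) t) = (\<Sum>s\<in>{1..N i}. \<Sum>d<N i. lag_cov g1 g2 i (q i) s (q i) (oplus (N i) s d))"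
      by (intro sum.cong refl sum_oplus[OF N_pos])
    also have "\<dots> = (\<Sum>d<N i. real (N i) * ?c i d)"
      unfolding lagavg_def using N_pos[of i] by (subst sum.swap) simp
    also have "\<dots> = real (N i) * (\<Sum>d<N i. ?c i d)" by (simp add: sum_distrib_left)
    finally have "real k * cv M (B g1 i (q i)) (B g2 i (q i)) = real k / real (N i) * (\<Sum>d<N i. ?c i d)"
      unfolding cv_B[OF g] using N_pos[of i] by simp
    also have "\<dots> = (\<Sum>d<N i. ?c i d) / real (R i)" unfolding kR by simp
    also have "(\<Sum>d<N i. ?c i d) = (\<Sum>d<R i. ?c i d) + (\<Sum>d\<in>{R i..N i - R i}. ?c i d) + (\<Sum>d<R i. c' i d)"
      unfolding c'_def by (rule sum_three_parts[OF R_pos N_ge])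
    finally show ?thesis by (simp add: add_divide_distrib)
  qed
  have "(\<lambda>i. (\<Sum>d<R i. ?c i d) / real (R i) + (\<Sum>d\<in>{R i..N i - R i}. ?c i d) / real (R i) + (\<Sum>d<R i. c' i d) / real (R i)) \<longlonglongrightarrow> I\<Gamma> g1 g2 + 0 + I\<Gamma> g1 g2"
    by (intro tendsto_add l1 l2 l3)
  then show ?thesis unfolding eq by simp
qed

lemma double_average_le:
  assumes g: "adm c g1" "adm c g2" and "\<And>s t. s \<in> {1..N i} \<Longrightarrow> t \<in> {1..N i} \<Longrightarrow> \<bar>lag_cov g1 g2 i q s q' t\<bar> \<le> e"
  shows "\<bar>cv M (B g1 i q) (B g2 i q')\<bar> \<le> e"
proof -
  have "\<bar>(\<Sum>p\<in>{1..N i} \<times> {1..N i}. lag_cov g1 g2 i q (fst p) q' (snd p)) / real (card ({1..N i} \<times> {1..N i})) - 0\<bar> \<le> e"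
    by (rule average_error) (use N_pos[of i] assms(3) in auto)
  then show ?thesis unfolding cv_B[OF g] by (simp add: sum.cartesian_product split_def)
qed

lemma adjacent_limit:
  assumes g: "adm c g1" "adm c g2"
  shows "(\<lambda>i. real k * cv M (B g1 i (q i)) (B g2 i (Suc (q i)))) \<longlonglongrightarrow> 0"
proof -
  let ?S = "\<lambda>i. {1..N i} \<times> {1..N i}"
  obtain \<epsilon> where \<epsilon>: "\<epsilon> \<longlonglongrightarrow> 0" "\<And>i p. p \<in> ?S i \<Longrightarrow> \<bar>(\<lambda>i p. lag_cov g1 g2 i (q i) (fst p) (Suc (q i)) (snd p)) i p - 0\<bar> \<le> \<epsilon> i" "\<And>i. 0 \<le> \<epsilon> i"
  proof (rule uniform_choice[of ?S "\<lambda>i p. lag_cov g1 g2 i (q i) (fst p) (Suc (q i)) (snd p)" 0])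
    show "?S i \<noteq> {}" for i using N_pos[of i] by auto
    fix p assume p: "\<And>i. p i \<in> ?S i"
    have s: "fst (p i) \<in> {1..N i}" "snd (p i) \<in> {1..N i}" for i using p[of i] by (auto simp: mem_Times_iff)
    show "(\<lambda>i. lag_cov g1 g2 i (q i) (fst (p i)) (Suc (q i)) (snd (p i))) \<longlonglongrightarrow> 0"
      unfolding lag_cov_def by (rule cv_adjacent[OF g s])
  qed auto
  have "\<bar>cv M (B g1 i (q i)) (B g2 i (Suc (q i)))\<bar> \<le> \<epsilon> i" for i
    by (rule double_average_le[OF g]) (use \<epsilon>(2)[of "(_, _)" i] in auto)
  then have "\<bar>real k * cv M (B g1 i (q i)) (B g2 i (Suc (q i))) - 0\<bar> \<le> real k * \<epsilon> i" for i
    by (simp add: abs_mult mult_left_mono)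
  then show ?thesis by (rule squeeze_limit[OF tendsto_const \<epsilon>(1)])
qed

section \<open>Blocks separated by at least one full block\<close>

definition blockset :: "nat \<Rightarrow> nat \<Rightarrow> int set" where
  "blockset i q = {int (q * N i) + 1..int (Suc q * N i)}"

lemma Zc_path:
  assumes J: "finite J" "cpos i q j \<subseteq> J"
  shows "Zc i q j \<in> borel_measurable (past_algebra J)"
proof -
  have "(\<lambda>y. rescale (a (R i)) (b (R i)) (cmax y (cpos i q j))) \<in> borel_measurable (Pi\<^sub>M J (\<lambda>_. borel))"
    using J by (intro measurable_compose[OF _ rescale_measurable] cmax_measurable[of "cpos i q j" "\<lambda>t y. y t", simplified] measurable_component_singleton) auto
  from past_measurable[OF this]
  have "(\<lambda>\<omega>. rescale (a (R i)) (b (R i)) (cmax (path J 0 \<omega>) (cpos i q j))) \<in> borel_measurable (past_algebra J)" .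
  moreover have "cmax (path J 0 \<omega>) (cpos i q j) = cmax (\<lambda>t. X t \<omega>) (cpos i q j)" for \<omega>
    by (rule cmax_cong) (use J in \<open>auto simp: path_def\<close>)
  ultimately show ?thesis unfolding Zc_def[abs_def] by simp
qed

text \<open>Indices that differ by at least 2 leave a complete block in between, which is longer
  than \<open>R i\<close>.\<close>

lemma blocks_alpha_bound:
  assumes I: "finite I" "finite J" and sep: "\<And>p q. p \<in> I \<Longrightarrow> q \<in> J \<Longrightarrow> p + 2 \<le> q"
  shows "alpha_bound M (past_algebra (\<Union>q\<in>I. blockset i q)) (past_algebra (\<Union>q\<in>J. blockset i q)) (alpha_mix M X (R i))"
proof -
  \<comment> \<open>For empty \<open>I\<close> the split point is free; \<open>- int (R i)\<close>
    puts all positions of \<open>J\<close> on the right, since they are positive.\<close>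
  define c where "c = (if I = {} then - int (R i) else int (Suc (Max I) * N i))"
  show ?thesis
  proof (rule alpha_bound_past)
    show "finite (\<Union>q\<in>I. blockset i q)" "finite (\<Union>q\<in>J. blockset i q)" using I by (auto simp: blockset_def)
    show "(\<Union>q\<in>I. blockset i q) \<subseteq> {..c}"
    proof (rule UN_least)
      fix q assume q: "q \<in> I"
      then have "Suc q * N i \<le> Suc (Max I) * N i" using Max_ge[OF I(1) q] by (intro mult_le_mono1) simp
      then have "int (Suc q * N i) \<le> int (Suc (Max I) * N i)" by (simp only: of_nat_le_iff)
      moreover have "c = int (Suc (Max I) * N i)" unfolding c_def by (rule if_not_P) (use q in blast)
      ultimately have "int (Suc q * N i) \<le> c" by (simp only:)
      then show "blockset i q \<subseteq> {..c}" by (auto simp: blockset_def simp del: of_nat_mult of_nat_Suc mult_Suc)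
    qed
    show "(\<Union>q\<in>J. blockset i q) \<subseteq> {c + int (R i)..}"
    proof (rule UN_least)
      fix q assume q: "q \<in> J"
      have "c + int (R i) \<le> int (q * N i) + 1"
      proof (cases "I = {}")
        case False
        have "Max I + 2 \<le> q" by (rule sep[OF Max_in[OF I(1) False] q])
        then have "(Max I + 2) * N i \<le> q * N i" by (rule mult_le_mono1)
        then have "Suc (Max I) * N i + N i \<le> q * N i" by (simp add: algebra_simps)
        then have "int (Suc (Max I) * N i) + int (N i) \<le> int (q * N i)" by linarith
        moreover have "c = int (Suc (Max I) * N i)" using False by (simp add: c_def)
        ultimately show ?thesis using R_le_N_int[of i] by linarith
      qed (simp add: c_def)
      then show "blockset i q \<subseteq> {c + int (R i)..}" by (auto simp: blockset_def simp del: of_nat_mult of_nat_Suc mult_Suc)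
    qed
  qed
qed

text \<open>This is n / r along the sequence, the base of the power in \<open>mix_R\<close>.\<close>

definition ratio :: "nat \<Rightarrow> real" where "ratio i = real (k * m i)"

lemma ratio_ge_1: "ratio i \<ge> 1"
proof -
  have "k * m i \<ge> 1" using k m_pos[of i] by simp
  then show ?thesis unfolding ratio_def by linarith
qed

text \<open>Truncating at \<open>(n/r)\<close> to the power \<open>\<omega>/2\<close> balances mixing against moments: both terms are \<open>o(r/n)\<close>, the
  second because \<open>\<nu> > 2/\<omega>\<close>.\<close>

definition far :: "real \<Rightarrow> nat \<Rightarrow> real" where
  "far c i = 4 * (ratio i powr (om / 2))\<^sup>2 * alpha_mix M X (R i) + (6 * c + 4) * (1 + c) * (ratio i powr (om / 2)) powr (- \<nu>)"

lemma far_bound: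
  assumes g: "adm c g1" "adm c g2" and q: "q + 2 \<le> q'"
  shows "\<bar>cv M (B g1 i q) (B g2 i q')\<bar> \<le> far c i"
proof (rule double_average_le[OF g])
  fix s t assume s: "s \<in> {1..N i}" and t: "t \<in> {1..N i}"
  define K where "K = ratio i powr (om / 2)"
  have K: "K \<ge> 1" unfolding K_def using ratio_ge_1 om by (intro ge_one_powr_ge_zero) auto
  have m: "mom M (2 + \<nu>) c (\<lambda>\<omega>. g1 (Zc i q s \<omega>))" "mom M (2 + \<nu>) c (\<lambda>\<omega>. g2 (Zc i q' t \<omega>))"
    using s t by (auto intro: adm_Zc[OF g(1)] adm_Zc[OF g(2)])
  have gm: "g1 \<in> borel_measurable borel" "g2 \<in> borel_measurable borel" using g by (auto simp: adm_def)
  have "\<bar>cv M (\<lambda>\<omega>. trunc K (g1 (Zc i q s \<omega>))) (\<lambda>\<omega>. trunc K (g2 (Zc i q' t \<omega>)))\<bar> \<le> 4 * K\<^sup>2 * alpha_mix M X (R i)"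
  proof (rule alpha_bound_cv[OF prob_space_axioms])
    show "alpha_bound M (past_algebra (\<Union>q\<in>{q}. blockset i q)) (past_algebra (\<Union>q\<in>{q'}. blockset i q)) (alpha_mix M X (R i))"
      by (rule blocks_alpha_bound) (use q in auto)
    show "(\<lambda>\<omega>. trunc K (g1 (Zc i q s \<omega>))) \<in> borel_measurable (past_algebra (\<Union>q\<in>{q}. blockset i q))"
      by (rule measurable_compose[OF measurable_compose[OF Zc_path gm(1)] trunc_borel]) (use cpos_subset in \<open>simp_all add: blockset_def\<close>)
    show "(\<lambda>\<omega>. trunc K (g2 (Zc i q' t \<omega>))) \<in> borel_measurable (past_algebra (\<Union>q\<in>{q'}. blockset i q))"
      by (rule measurable_compose[OF measurable_compose[OF Zc_path gm(2)] trunc_borel]) (use cpos_subset in \<open>simp_all add: blockset_def\<close>)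
  qed (use K trunc_bound in auto)
  then show "\<bar>lag_cov g1 g2 i q s q' t\<bar> \<le> far c i"
    using cv_trunc[OF m \<nu>_pos K] unfolding lag_cov_def far_def K_def[symmetric] by linarith
qed

lemma m_far_limit: "(\<lambda>i. real (m i) * far c i) \<longlonglongrightarrow> 0"
proof -
  have ytop: "filterlim ratio at_top sequentially"
  proof -
    have "filterlim (\<lambda>i. real k * real (m i)) at_top sequentially"
      using k by (intro filterlim_tendsto_pos_mult_at_top[OF tendsto_const _ filterlim_compose[OF filterlim_real_sequentially m_top]]) auto
    then show ?thesis by (simp add: ratio_def[abs_def])
  qed
  define D where "D = (6 * c + 4) * (1 + c)"
  \<comment> \<open>Multiplied by n / r, the two terms of \<open>far\<close> get the exponents 1 +
    om, as in \<open>mix_R\<close>, and 1 - om \<nu> / 2, which is negative.\<close>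
  have e: "1 - om / 2 * \<nu> < 0" using \<nu> om by (simp add: field_simps)
  have eq: "ratio i * far c i = 4 * (ratio i powr (1 + om) * alpha_mix M X (R i)) + D * ratio i powr (1 - om / 2 * \<nu>)" for i
  proof -
    have yp: "ratio i > 0" using ratio_ge_1[of i] by linarith
    have 1: "(ratio i powr (om / 2))\<^sup>2 = ratio i powr om" using yp by (simp add: power2_eq_square flip: powr_add)
    have 2: "(ratio i powr (om / 2)) powr (- \<nu>) = ratio i powr (- (om / 2 * \<nu>))" by (simp add: powr_powr)
    have 3: "ratio i * ratio i powr om = ratio i powr (1 + om)" using yp by (simp add: powr_add)
    have 4: "ratio i * ratio i powr (- (om / 2 * \<nu>)) = ratio i powr (1 - om / 2 * \<nu>)" using powr_add[of "ratio i" 1 "- (om / 2 * \<nu>)"] yp by (simp only: powr_one[OF less_imp_le[OF yp]] diff_conv_add_uminus)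
    show ?thesis unfolding far_def 1 2 D_def[symmetric] 3[symmetric] 4[symmetric] by (simp add: algebra_simps)
  qed
  have "(\<lambda>i. 4 * (ratio i powr (1 + om) * alpha_mix M X (R i)) + D * ratio i powr (1 - om / 2 * \<nu>)) \<longlonglongrightarrow> 4 * 0 + D * 0"
    using mix_R e unfolding ratio_def[symmetric] by (intro tendsto_intros tendsto_neg_powr ytop) auto
  then have lim: "(\<lambda>i. ratio i * far c i) \<longlonglongrightarrow> 0" unfolding eq by simp
  have "(\<lambda>i. 1 / real k * (ratio i * far c i)) \<longlonglongrightarrow> 1 / real k * 0" by (intro tendsto_intros lim)
  moreover have "1 / real k * (ratio i * far c i) = real (m i) * far c i" for i using k by (simp add: ratio_def)
  ultimately show ?thesis by simp
qed

section \<open>Normalised block averages and their sums\<close>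

definition T :: "(real^'d \<Rightarrow> real) \<Rightarrow> nat \<Rightarrow> nat \<Rightarrow> 'a \<Rightarrow> real" where
  "T g i q \<omega> = sqrt (real k) * (B g i q \<omega> - expectation (B g i q))"

lemma mom_B: "adm c g \<Longrightarrow> mom M (2 + \<nu>) (2 powr (2 + \<nu>) * (c + 1)) (B g i q)"
proof -
  assume g: "adm c g"
  have "mom M (2 + \<nu>) (2 powr (2 + \<nu>) * (c + 1)) (\<lambda>\<omega>. (\<Sum>j\<in>{1..N i}. g (Zc i q j \<omega>)) / real (card {1..N i}))"
    by (rule mom_average[OF _ _ exponent_bounds(1)]) (use N_pos[of i] in \<open>auto intro!: adm_Zc[OF g]\<close>)
  then show ?thesis by (simp add: B_def[abs_def])
qed

lemma mom_T: "adm c g \<Longrightarrow> \<exists>C. \<forall>i q. mom M (2 + \<nu>) C (T g i q)"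
  unfolding T_def[abs_def] using mom_scale[OF mom_centered[OF mom_B exponent_bounds(1)] exponent_bounds(3)] by blast

lemma T_moments:
  assumes g: "adm c g1" "adm c g2"
  shows "integrable M (T g1 i q)" "expectation (T g1 i q) = 0" "integrable M (\<lambda>\<omega>. T g1 i q \<omega> * T g2 i q' \<omega>)"
    and "cv M (T g1 i q) (T g2 i q') = real k * cv M (B g1 i q) (B g2 i q')"
    and "expectation (\<lambda>\<omega>. T g1 i q \<omega> * T g2 i q' \<omega>) = real k * cv M (B g1 i q) (B g2 i q')"
proof -
  have iB: "integrable M (B g1 i q)" "integrable M (B g2 i q')" "integrable M (\<lambda>\<omega>. B g1 i q \<omega> * B g2 i q' \<omega>)"
    using mom_abs(1)[OF mom_B[OF g(1)] exponent_bounds(1)] mom_abs(1)[OF mom_B[OF g(2)] exponent_bounds(1)] mom_prod(1)[OF mom_B[OF g(1)] mom_B[OF g(2)] exponent_bounds(2)] by auto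
  obtain C1 where C1: "\<And>i q. mom M (2 + \<nu>) C1 (T g1 i q)" using mom_T[OF g(1)] by blast
  obtain C2 where C2: "\<And>i q. mom M (2 + \<nu>) C2 (T g2 i q)" using mom_T[OF g(2)] by blast
  show i1: "integrable M (T g1 i q)" using mom_abs(1)[OF C1 exponent_bounds(1)] .
  show "integrable M (\<lambda>\<omega>. T g1 i q \<omega> * T g2 i q' \<omega>)"
    using mom_prod(1)[OF mom_mono[OF C1, of "max C1 C2"] mom_mono[OF C2, of "max C1 C2"] exponent_bounds(2)] by simp
  show E: "expectation (T g1 i q) = 0" unfolding T_def using iB by (simp add: prob_space)
  have "cv M (T g1 i q) (T g2 i q') = sqrt (real k) * sqrt (real k) * cv M (\<lambda>\<omega>. B g1 i q \<omega> - expectation (B g1 i q)) (\<lambda>\<omega>. B g2 i q' \<omega> - expectation (B g2 i q'))"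
    unfolding T_def[abs_def] by (rule cv_scale)
  also have "\<dots> = real k * cv M (B g1 i q) (B g2 i q')" using cv_center[OF iB] by simp
  finally show c: "cv M (T g1 i q) (T g2 i q') = real k * cv M (B g1 i q) (B g2 i q')" .
  show "expectation (\<lambda>\<omega>. T g1 i q \<omega> * T g2 i q' \<omega>) = real k * cv M (B g1 i q) (B g2 i q')"
    using c E by (simp add: cv_def)
qed

text \<open>\<open>diag_limit\<close> and \<open>adjacent_limit\<close> hold for every choice of
  blocks, hence uniformly over the blocks of a row.\<close>

lemma error_sequences:
  assumes g: "adm c g1" "adm c g2"
  obtains v e where "v \<longlonglongrightarrow> 0" "e \<longlonglongrightarrow> 0" "\<And>i. 0 \<le> v i" "\<And>i. 0 \<le> e i"
    "\<And>i q. q < m i \<Longrightarrow> \<bar>real k * cv M (B g1 i q) (B g2 i q) - 2 * I\<Gamma> g1 g2\<bar> \<le> v i"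
    "\<And>i q. q < m i \<Longrightarrow> \<bar>real k * cv M (B g1 i q) (B g2 i (Suc q))\<bar> \<le> e i"
proof -
  have ne: "{..<m i} \<noteq> {}" for i using m_pos[of i] by (auto simp: lessThan_empty_iff)
  obtain v where v: "v \<longlonglongrightarrow> 0" "\<And>i q. q \<in> {..<m i} \<Longrightarrow> \<bar>(\<lambda>i q. real k * cv M (B g1 i q) (B g2 i q)) i q - 2 * I\<Gamma> g1 g2\<bar> \<le> v i" "\<And>i. 0 \<le> v i"
    by (rule uniform_choice[of "\<lambda>i. {..<m i}" "\<lambda>i q. real k * cv M (B g1 i q) (B g2 i q)" "2 * I\<Gamma> g1 g2"])
      (use ne diag_limit[OF g] in auto)
  obtain e where e: "e \<longlonglongrightarrow> 0" "\<And>i q. q \<in> {..<m i} \<Longrightarrow> \<bar>(\<lambda>i q. real k * cv M (B g1 i q) (B g2 i (Suc q))) i q - 0\<bar> \<le> e i" "\<And>i. 0 \<le> e i"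
    by (rule uniform_choice[of "\<lambda>i. {..<m i}" "\<lambda>i q. real k * cv M (B g1 i q) (B g2 i (Suc q))" 0])
      (use ne adjacent_limit[OF g] in auto)
  show ?thesis by (rule that[of v e]) (use v e in auto)
qed

definition S :: "(real^'d \<Rightarrow> real) \<Rightarrow> nat \<Rightarrow> 'a \<Rightarrow> real" where
  "S g i \<omega> = (\<Sum>q<m i. T g i q \<omega>) / sqrt (m i)"

lemma cv_S:
  assumes g: "adm c g1" "adm c g2"
  shows "cv M (S g1 i) (S g2 i) = (\<Sum>q<m i. \<Sum>q'<m i. real k * cv M (B g1 i q) (B g2 i q')) / real (m i)"
proof -
  have "cv M (\<lambda>\<omega>. \<Sum>q<m i. T g1 i q \<omega>) (\<lambda>\<omega>. \<Sum>q<m i. T g2 i q \<omega>) = (\<Sum>q<m i. \<Sum>q'<m i. cv M (T g1 i q) (T g2 i q'))"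
    by (rule cv_sum) (use T_moments(1,3)[OF g] T_moments(1)[OF g(2,1)] in auto)
  then show ?thesis
    unfolding S_def[abs_def] using cv_scale[of M "1 / sqrt (m i)" _ "1 / sqrt (m i)"] T_moments(4)[OF g] by simp
qed

text \<open>The diagonal gives the limit; neighbouring pairs number O(m) and vanish after division
  by m; the distant ones are o(1/m) each. Neighbours on the two sides of the diagonal have separate
  error sequences, as \<open>g1\<close> and \<open>g2\<close> exchange roles.\<close>

lemma S_cov_limit:
  assumes g: "adm c g1" "adm c g2"
  shows "(\<lambda>i. cv M (S g1 i) (S g2 i)) \<longlonglongrightarrow> 2 * I\<Gamma> g1 g2"
proof -
  obtain v e where ve: "v \<longlonglongrightarrow> 0" "e \<longlonglongrightarrow> 0" "\<And>i. 0 \<le> v i" "\<And>i. 0 \<le> e i"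
    "\<And>i q. q < m i \<Longrightarrow> \<bar>real k * cv M (B g1 i q) (B g2 i q) - 2 * I\<Gamma> g1 g2\<bar> \<le> v i"
    "\<And>i q. q < m i \<Longrightarrow> \<bar>real k * cv M (B g1 i q) (B g2 i (Suc q))\<bar> \<le> e i"
    using error_sequences[OF g] by metis
  obtain v' e' where ve': "v' \<longlonglongrightarrow> 0" "e' \<longlonglongrightarrow> 0" "\<And>i. 0 \<le> v' i" "\<And>i. 0 \<le> e' i"
    "\<And>i q. q < m i \<Longrightarrow> \<bar>real k * cv M (B g2 i q) (B g1 i q) - 2 * I\<Gamma> g2 g1\<bar> \<le> v' i"
    "\<And>i q. q < m i \<Longrightarrow> \<bar>real k * cv M (B g2 i q) (B g1 i (Suc q))\<bar> \<le> e' i"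
    using error_sequences[OF g(2,1)] by metis
  define L where "L = 2 * I\<Gamma> g1 g2"
  define F where "F i = real k * \<bar>far c i\<bar>" for i
  have bound: "\<bar>real k * cv M (B g1 i q) (B g2 i q') - (if q' = q then L else 0)\<bar> \<le>
     (if q' = q then v i else 0) + (if q' = Suc q then e i else 0) + (if Suc q' = q then e' i else 0) + F i"
    if q: "q < m i" "q' < m i" for i q q'
  proof -
    have F0: "0 \<le> F i" by (simp add: F_def)
    have fb: "\<bar>real k * cv M (B h i p) (B h' i p')\<bar> \<le> F i" if "adm c h" "adm c h'" "p + 2 \<le> p'" for h h' p p'
      using far_bound[OF that, of i] by (simp add: F_def abs_mult mult_left_mono)
    consider "q' = q" | "q' = Suc q" | "q = Suc q'" | "q + 2 \<le> q'" | "q' + 2 \<le> q" by linarith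
    then show ?thesis
    proof cases
      case 1 then show ?thesis using ve(5)[OF q(1)] F0 by (simp add: L_def)
    next
      case 2 then show ?thesis using ve(6)[OF q(1)] F0 by simp
    next
      case 3 then show ?thesis using ve'(6)[OF q(2)] F0 by (simp add: cv_commute[of M "B g1 i (Suc q')"])
    next
      case 4 then show ?thesis using fb[OF g 4] by simp
    next
      case 5 then show ?thesis using fb[OF g(2,1) 5] by (simp add: cv_commute[of M "B g1 i q"])
    qed
  qed
  have main: "\<bar>cv M (S g1 i) (S g2 i) - L\<bar> \<le> 1 * (v i + e i + e' i + real (m i) * F i)" for i
  proof -
    have mp: "real (m i) > 0" using m_pos[of i] by simp
    have E: "cv M (S g1 i) (S g2 i) - L = (\<Sum>q<m i. \<Sum>q'<m i. real k * cv M (B g1 i q) (B g2 i q') - (if q' = q then L else 0)) / real (m i)"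
      unfolding cv_S[OF g] using mp by (simp add: sum_subtractf diff_divide_distrib)
    have "\<bar>cv M (S g1 i) (S g2 i) - L\<bar> \<le> (\<Sum>q<m i. \<Sum>q'<m i. (if q' = q then v i else 0) + (if q' = Suc q then e i else 0) + (if Suc q' = q then e' i else 0) + F i) / real (m i)"
      unfolding E abs_divide abs_of_nat
    proof (rule divide_right_mono[OF order_trans[OF sum_abs sum_mono[OF order_trans[OF sum_abs sum_mono]]] of_nat_0_le_iff])
      fix q q' assume "q \<in> {..<m i}" "q' \<in> {..<m i}"
      then have "q < m i" "q' < m i" unfolding lessThan_iff .
      then show "\<bar>real k * cv M (B g1 i q) (B g2 i q') - (if q' = q then L else 0)\<bar> \<le>
        (if q' = q then v i else 0) + (if q' = Suc q then e i else 0) + (if Suc q' = q then e' i else 0) + F i"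
        by (rule bound)
    qed
    also have "\<dots> \<le> (\<Sum>q<m i. v i + e i + e' i + real (m i) * F i) / real (m i)"
    proof (rule divide_right_mono, rule sum_mono)
      fix q assume q: "q \<in> {..<m i}"
      have "(\<Sum>q'<m i. if q' = Suc q then e i else 0) \<le> e i"
        unfolding sum.delta[OF finite_lessThan] using ve(4)[of i] by (simp split: if_split)
      moreover have "(\<Sum>q'<m i. if Suc q' = q then e' i else 0) \<le> e' i"
      proof -
        have "(\<Sum>q'<m i. if Suc q' = q then e' i else 0) \<le> (\<Sum>q'<m i. if q' = q - 1 then e' i else 0)"
          using ve'(4)[of i] by (intro sum_mono) auto
        also have "\<dots> \<le> e' i"
          unfolding sum.delta[OF finite_lessThan] using ve'(4)[of i] by (simp split: if_split)
        finally show ?thesis .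
      qed
      moreover have "(\<Sum>q'<m i. if q' = q then v i else 0) = v i"
        unfolding sum.delta[OF finite_lessThan] using q by (simp only: if_True)
      moreover have "(\<Sum>q'<m i. F i) = real (m i) * F i" by (simp only: sum_constant card_lessThan)
      ultimately show "(\<Sum>q'<m i. (if q' = q then v i else 0) + (if q' = Suc q then e i else 0) + (if Suc q' = q then e' i else 0) + F i) \<le>
        v i + e i + e' i + real (m i) * F i"
        unfolding sum.distrib by linarith
    qed (rule of_nat_0_le_iff)
    also have "\<dots> = v i + e i + e' i + real (m i) * F i" using mp by simp
    finally show ?thesis by simp
  qed
  have "(\<lambda>i. real k * \<bar>real (m i) * far c i\<bar>) \<longlonglongrightarrow> real k * \<bar>0\<bar>" by (intro tendsto_intros m_far_limit)
  then have F: "(\<lambda>i. real (m i) * F i) \<longlonglongrightarrow> 0" by (simp add: F_def abs_mult mult_ac)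
  have "(\<lambda>i. v i + e i + e' i + real (m i) * F i) \<longlonglongrightarrow> 0 + 0 + 0 + 0"
    by (intro tendsto_add ve(1,2) ve'(2) F)
  then have Z: "(\<lambda>i. v i + e i + e' i + real (m i) * F i) \<longlonglongrightarrow> 0" by simp
  show ?thesis unfolding L_def[symmetric] by (rule squeeze_limit[OF tendsto_const Z main])
qed

lemma B_measurable_past:
  assumes g: "g \<in> borel_measurable borel" and J: "finite J" "blockset i q \<subseteq> J"
  shows "B g i q \<in> borel_measurable (past_algebra J)"
  unfolding B_def[abs_def]
  by (intro borel_measurable_divide borel_measurable_const borel_measurable_sum measurable_compose[OF Zc_path g] J(1))
    (use order_trans[OF cpos_subset J(2)[unfolded blockset_def]] in blast)+

text \<open>The central limit theorem for arrays applies, with decoupling error 16 \<alpha>(R) from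
  \<open>alpha_bound_iexp\<close>. Its product with m vanishes by \<open>mix_R\<close>, as m is at
  most n / r and n / r is at least 1.\<close>

lemma S_char:
  assumes g: "adm c g"
  shows "(\<lambda>i. CLINT \<omega>|M. iexp (\<theta> * S g i \<omega>)) \<longlonglongrightarrow> of_real (exp (- (\<theta>\<^sup>2 * (2 * I\<Gamma> g g) / 2)))"
proof -
  obtain v e where ve: "v \<longlonglongrightarrow> 0" "e \<longlonglongrightarrow> 0" "\<And>i. 0 \<le> v i" "\<And>i. 0 \<le> e i"
    "\<And>i q. q < m i \<Longrightarrow> \<bar>real k * cv M (B g i q) (B g i q) - 2 * I\<Gamma> g g\<bar> \<le> v i"
    "\<And>i q. q < m i \<Longrightarrow> \<bar>real k * cv M (B g i q) (B g i (Suc q))\<bar> \<le> e i"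
    using error_sequences[OF g g] by metis
  obtain C where C: "\<And>i q. mom M (2 + \<nu>) C (T g i q)" using mom_T[OF g] by blast
  \<comment> \<open>The expansion takes exponents up to 3 only; lowering the exponent replaces
    \<open>C\<close> by \<open>1 + C\<close>.\<close>
  define \<delta> where "\<delta> = min \<nu> 1"
  have \<delta>: "0 < \<delta>" "\<delta> \<le> 1" "\<delta> \<le> \<nu>" using \<nu>_pos by (auto simp: \<delta>_def)
  have gm: "g \<in> borel_measurable borel" using g by (simp add: adm_def)
  interpret W: weakly_dependent_array M "T g" m \<delta> "1 + C" "2 * I\<Gamma> g g" v e "\<lambda>i. real k * \<bar>far c i\<bar>" "\<lambda>i. 16 * alpha_mix M X (R i)"
  proof
    show "filterlim m at_top sequentially" by (rule m_top)
    show "0 < \<delta>" "\<delta> \<le> 1" by (rule \<delta>)+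
    show "mom M (2 + \<delta>) (1 + C) (T g n i)" for n i using mom_lower[OF C] \<delta> by simp
    show "expectation (T g n i) = 0" for n i by (rule T_moments(2)[OF g g])
    \<comment> \<open>Nonnegativity of the integral is read off from the variances that converge to
      it.\<close>
    show "0 \<le> 2 * I\<Gamma> g g"
    proof (rule LIMSEQ_le_const[OF diag_limit[OF g g, of "\<lambda>_. 0"]])
      have "0 \<le> real k * cv M (B g i 0) (B g i 0)" for i
        unfolding T_moments(5)[OF g g, symmetric] by (rule Bochner_Integration.integral_nonneg) simp
      then show "\<exists>N. \<forall>n\<ge>N. 0 \<le> real k * cv M (B g n 0) (B g n 0)" by blast
    qed
    show "\<bar>expectation (\<lambda>x. T g n i x * T g n i x) - 2 * I\<Gamma> g g\<bar> \<le> v n" if "i < m n" for n i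
      using ve(5)[OF that] unfolding T_moments(5)[OF g g] .
    show "\<bar>expectation (\<lambda>x. T g n i x * T g n (Suc i) x)\<bar> \<le> e n" if "Suc i < m n" for n i
      using ve(6)[of i n] that unfolding T_moments(5)[OF g g] by simp
    show "\<bar>expectation (\<lambda>x. T g n i x * T g n j x)\<bar> \<le> real k * \<bar>far c n\<bar>" if "i + 2 \<le> j" "j < m n" for n i j
      using far_bound[OF g g that(1), of n] unfolding T_moments(5)[OF g g] by (simp add: abs_mult mult_left_mono)
    show "cmod ((CLINT x|M. iexp (t * (\<Sum>i\<in>I. T g n i x) + t * (\<Sum>j\<in>J. T g n j x))) -
        (CLINT x|M. iexp (t * (\<Sum>i\<in>I. T g n i x))) * (CLINT x|M. iexp (t * (\<Sum>j\<in>J. T g n j x)))) \<le> 16 * alpha_mix M X (R n)"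
      if I: "I \<subseteq> {..<m n}" and J: "J \<subseteq> {..<m n}" and sep: "\<And>i j. i \<in> I \<Longrightarrow> j \<in> J \<Longrightarrow> i + 2 \<le> j" for n I J t
    proof (rule alpha_bound_iexp[OF prob_space_axioms])
      have fin: "finite I" "finite J" using I J finite_subset by blast+
      show "alpha_bound M (past_algebra (\<Union>q\<in>I. blockset n q)) (past_algebra (\<Union>q\<in>J. blockset n q)) (alpha_mix M X (R n))"
        by (rule blocks_alpha_bound[OF fin sep])
      have Tm: "(\<lambda>x. t * (\<Sum>i\<in>I. T g n i x)) \<in> borel_measurable (past_algebra (\<Union>q\<in>I. blockset n q))" if "finite I" for I
        unfolding T_def using that
        by (intro borel_measurable_times borel_measurable_sum borel_measurable_diff borel_measurable_const B_measurable_past[OF gm])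
          (auto simp: blockset_def)
      show "(\<lambda>x. t * (\<Sum>i\<in>I. T g n i x)) \<in> borel_measurable (past_algebra (\<Union>q\<in>I. blockset n q))" by (rule Tm[OF fin(1)])
      show "(\<lambda>x. t * (\<Sum>i\<in>J. T g n i x)) \<in> borel_measurable (past_algebra (\<Union>q\<in>J. blockset n q))" by (rule Tm[OF fin(2)])
    qed
    show "(\<lambda>n. real (m n) * (real k * \<bar>far c n\<bar>)) \<longlonglongrightarrow> 0"
    proof -
      have "(\<lambda>i. real k * \<bar>real (m i) * far c i\<bar>) \<longlonglongrightarrow> real k * \<bar>0\<bar>" by (intro tendsto_intros m_far_limit)
      then show ?thesis by (simp add: abs_mult mult_ac)
    qed
    show "(\<lambda>n. real (m n) * (16 * alpha_mix M X (R n))) \<longlonglongrightarrow> 0"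
    proof (rule tendsto_sandwich[OF _ _ tendsto_const])
      show "\<forall>\<^sub>F n in sequentially. real (m n) * (16 * alpha_mix M X (R n)) \<le> 16 * (ratio n powr (1 + om) * alpha_mix M X (R n))"
      proof (rule always_eventually, rule allI)
        fix n
        have "m n \<le> k * m n" using k by simp
        then have "real (m n) \<le> ratio n" unfolding ratio_def by linarith
        also have "\<dots> = ratio n powr 1" using ratio_ge_1[of n] by simp
        also have "\<dots> \<le> ratio n powr (1 + om)" using ratio_ge_1[of n] om by (intro powr_mono) auto
        finally have "real (m n) * alpha_mix M X (R n) \<le> ratio n powr (1 + om) * alpha_mix M X (R n)"
          using alpha_mix_nonneg by (rule mult_right_mono)
        then show "real (m n) * (16 * alpha_mix M X (R n)) \<le> 16 * (ratio n powr (1 + om) * alpha_mix M X (R n))" by simp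
      qed
      show "(\<lambda>n. 16 * (ratio n powr (1 + om) * alpha_mix M X (R n))) \<longlonglongrightarrow> 0"
        using tendsto_mult_left[OF mix_R, of 16] by (simp add: ratio_def)
      show "\<forall>\<^sub>F n in sequentially. 0 \<le> real (m n) * (16 * alpha_mix M X (R n))" using alpha_mix_nonneg by simp
    qed
  qed (use ve alpha_mix_nonneg in auto)
  show ?thesis using W.char_convergence[of \<theta>] by (simp add: S_def)
qed

end

section \<open>Vector-valued integrands and bias\<close>

lemma sum_blocks:
  fixes f :: "nat \<Rightarrow> 'b::comm_monoid_add"
  shows "(\<Sum>s=1..m * N. f s) = (\<Sum>q<m. \<Sum>j=1..N. f (q * N + j))"
proof (induction m)
  case (Suc m)
  have "(\<Sum>s=1..Suc m * N. f s) = (\<Sum>s=1..m * N + N. f s)" by (simp add: add.commute)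
  also have "\<dots> = (\<Sum>s=1..m * N. f s) + (\<Sum>s=m * N + 1..m * N + N. f s)" by (rule sum.ub_add_nat) simp
  also have "(\<Sum>s=m * N + 1..m * N + N. f s) = (\<Sum>j=1..N. f (m * N + j))"
    using sum.shift_bounds_cl_nat_ivl[of f 1 "m * N" N] by (simp add: add.commute)
  finally show ?case using Suc by simp
qed simp

lemma integrable_vecI:
  fixes f :: "'a \<Rightarrow> real^'n"
  assumes "\<And>j. integrable M (\<lambda>x. f x $ j)"
  shows "integrable M f"
proof (rule Bochner_Integration.integrable_bound[of M "\<lambda>x. \<Sum>j\<in>UNIV. \<bar>f x $ j\<bar>"])
  show "integrable M (\<lambda>x. \<Sum>j\<in>UNIV. \<bar>f x $ j\<bar>)" using assms by auto
  show "f \<in> borel_measurable M" using assms by (intro borel_measurable_vecI) auto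
  show "AE x in M. norm (f x) \<le> norm (\<Sum>j\<in>UNIV. \<bar>f x $ j\<bar>)"
    by (rule AE_I2) (use norm_le_l1_cart in \<open>auto simp: sum_nonneg\<close>)
qed

lemma integral_vec_nth:
  fixes f :: "'a \<Rightarrow> real^'n"
  assumes "integrable M f"
  shows "(\<integral>x. f x \<partial>M) $ j = (\<integral>x. f x $ j \<partial>M)"
  using integral_bounded_linear[OF bounded_linear_vec_nth assms] by simp

section \<open>Normal limits from characteristic functions\<close>

lemma mv_normal_shift: "mv_normal v S = distr (mv_normal 0 S) borel (\<lambda>x. v + x)"
  unfolding mv_normal_def Let_def
  by (subst distr_distr[OF _ mv_normal_measurable]) (auto simp: comp_def)

lemma mv_normal_char_shift:
  fixes S :: "real^'q^'q"
  assumes "\<And>i j. S $ i $ j = S $ j $ i" "\<And>v. qform S v \<ge> 0"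
  shows "(CLINT x|mv_normal v S. iexp (l \<bullet> x)) = iexp (l \<bullet> v) * of_real (exp (- qform S (\<lambda>i. l $ i) / 2))"
proof -
  have "(CLINT x|mv_normal v S. iexp (l \<bullet> x)) = (CLINT x|mv_normal 0 S. iexp (l \<bullet> (v + x)))"
    unfolding mv_normal_shift[of v S]
    by (rule integral_distr) (auto simp: measurable_cong_sets[OF sets_mv_normal refl])
  also have "\<dots> = (CLINT x|mv_normal 0 S. iexp (l \<bullet> v) * iexp (l \<bullet> x))"
    by (simp add: inner_add_right exp_add[symmetric] distrib_left)
  also have "\<dots> = iexp (l \<bullet> v) * (CLINT x|mv_normal 0 S. iexp (l \<bullet> x))" by simp
  finally show ?thesis unfolding mv_normal_char[OF assms] .
qed

lemma (in prob_space) expectation_cos_sin: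
  assumes "f \<in> borel_measurable M"
  shows "(\<integral>x. cos (f x) \<partial>M) = Re (CLINT x|M. iexp (f x))" "(\<integral>x. sin (f x) \<partial>M) = Im (CLINT x|M. iexp (f x))"
proof -
  have i: "integrable M (\<lambda>x. iexp (f x))" by (rule integrable_iexp) (use assms in auto)
  show "(\<integral>x. cos (f x) \<partial>M) = Re (CLINT x|M. iexp (f x))" using integral_Re[OF i] by (simp add: Re_exp)
  show "(\<integral>x. sin (f x) \<partial>M) = Im (CLINT x|M. iexp (f x))" using integral_Im[OF i] by (simp add: Im_exp)
qed

text \<open>Real and imaginary parts give the integrals of cosines and sines, and a convergent shift
  is bounded, so it preserves tightness. With the shift included, the centred and both biased limits
  are instances of one statement.\<close>

lemma (in prob_space) weak_conv_normal:
  fixes V :: "nat \<Rightarrow> 'a \<Rightarrow> real^'q" and S :: "real^'q^'q"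
  assumes V: "\<And>i. V i \<in> borel_measurable M"
    and S: "\<And>i j. S $ i $ j = S $ j $ i" "\<And>v. qform S v \<ge> 0"
    and char: "\<And>l. (\<lambda>i. CLINT \<omega>|M. iexp (l \<bullet> V i \<omega>)) \<longlonglongrightarrow> of_real (exp (- qform S (\<lambda>i. l $ i) / 2))"
    and tight: "\<And>e. e > 0 \<Longrightarrow> \<exists>K. \<forall>i. prob {\<omega>\<in>space M. norm (V i \<omega>) > K} \<le> e"
    and c: "c \<longlonglongrightarrow> c0"
  shows "weak_conv_law (\<lambda>i. distr M borel (\<lambda>\<omega>. V i \<omega> + c i)) (mv_normal c0 S) sequentially"
proof -
  have m: "(\<lambda>\<omega>. V i \<omega> + c i) \<in> borel_measurable M" for i using V by auto
  have C: "(\<lambda>i. CLINT x|distr M borel (\<lambda>\<omega>. V i \<omega> + c i). iexp (l \<bullet> x)) \<longlonglongrightarrow> (CLINT x|mv_normal c0 S. iexp (l \<bullet> x))" for l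
  proof -
    have "(CLINT x|distr M borel (\<lambda>\<omega>. V i \<omega> + c i). iexp (l \<bullet> x)) = iexp (l \<bullet> c i) * (CLINT \<omega>|M. iexp (l \<bullet> V i \<omega>))" for i
    proof -
      have "(CLINT x|distr M borel (\<lambda>\<omega>. V i \<omega> + c i). iexp (l \<bullet> x)) = (CLINT \<omega>|M. iexp (l \<bullet> (V i \<omega> + c i)))"
        by (rule integral_distr[OF m]) auto
      also have "\<dots> = (CLINT \<omega>|M. iexp (l \<bullet> c i) * iexp (l \<bullet> V i \<omega>))"
        by (simp add: inner_add_right exp_add[symmetric] distrib_left add.commute)
      finally show ?thesis by simp
    qed
    moreover have "(\<lambda>i. iexp (l \<bullet> c i) * (CLINT \<omega>|M. iexp (l \<bullet> V i \<omega>))) \<longlonglongrightarrow> iexp (l \<bullet> c0) * of_real (exp (- qform S (\<lambda>i. l $ i) / 2))"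
      by (intro tendsto_intros char c)
    ultimately show ?thesis unfolding mv_normal_char_shift[OF S] by simp
  qed
  have ps: "prob_space (distr M borel (\<lambda>\<omega>. V i \<omega> + c i))" for i by (rule prob_space_distr[OF m])
  have lm: "(\<lambda>x. l \<bullet> x) \<in> borel_measurable N" if "sets N = sets borel" for l :: "real^'q" and N
    by (subst measurable_cong_sets[OF that refl]) simp
  show ?thesis
  proof (rule weak_conv_law_trig[OF ps _ prob_space_mv_normal sets_mv_normal])
    fix l :: "real^'q"
    show "(\<lambda>i. \<integral>x. cos (l \<bullet> x) \<partial>distr M borel (\<lambda>\<omega>. V i \<omega> + c i)) \<longlonglongrightarrow> (\<integral>x. cos (l \<bullet> x) \<partial>mv_normal c0 S)"
      unfolding prob_space.expectation_cos_sin(1)[OF ps lm[OF sets_distr]] prob_space.expectation_cos_sin(1)[OF prob_space_mv_normal lm[OF sets_mv_normal]]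
      by (intro tendsto_intros C)
    show "(\<lambda>i. \<integral>x. sin (l \<bullet> x) \<partial>distr M borel (\<lambda>\<omega>. V i \<omega> + c i)) \<longlonglongrightarrow> (\<integral>x. sin (l \<bullet> x) \<partial>mv_normal c0 S)"
      unfolding prob_space.expectation_cos_sin(2)[OF ps lm[OF sets_distr]] prob_space.expectation_cos_sin(2)[OF prob_space_mv_normal lm[OF sets_mv_normal]]
      by (intro tendsto_intros C)
  next
    fix e :: real assume "e > 0"
    then obtain K where K: "\<And>i. prob {\<omega>\<in>space M. norm (V i \<omega>) > K} \<le> e" using tight by blast
    obtain D where D: "\<And>i. norm (c i) \<le> D" using convergent_imp_Bseq[OF convergentI[OF c]] unfolding Bseq_def by blast
    have "measure (distr M borel (\<lambda>\<omega>. V i \<omega> + c i)) {x. norm x > K + D} \<le> e" for i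
    proof -
      have b: "{x::real^'q. norm x > K + D} \<in> sets borel" by measurable
      have "measure (distr M borel (\<lambda>\<omega>. V i \<omega> + c i)) {x. norm x > K + D} = prob ((\<lambda>\<omega>. V i \<omega> + c i) -` {x. norm x > K + D} \<inter> space M)"
        by (rule measure_distr[OF m b])
      also have "\<dots> \<le> prob {\<omega>\<in>space M. norm (V i \<omega>) > K}"
      proof (rule finite_measure_mono)
        show "(\<lambda>\<omega>. V i \<omega> + c i) -` {x. norm x > K + D} \<inter> space M \<subseteq> {\<omega>\<in>space M. norm (V i \<omega>) > K}"
        proof clarify
          fix \<omega> assume "K + D < norm (V i \<omega> + c i)"
          then show "K < norm (V i \<omega>)" using norm_triangle_ineq[of "V i \<omega>" "c i"] D[of i] by linarith
        qed
        show "{\<omega>\<in>space M. norm (V i \<omega>) > K} \<in> events" using V[of i] by measurable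
      qed
      finally show ?thesis using K[of i] by linarith
    qed
    then show "\<exists>K. \<forall>i. measure (distr M borel (\<lambda>\<omega>. V i \<omega> + c i)) {x. norm x > K} \<le> e" by blast
  qed simp
qed

text \<open>The moment bound holds at every index, not only eventually; the choice of subsequence
  arranges this.\<close>

locale vector_circular_process = circular_process M X a b \<gamma> P R L k m om \<nu>
  for M :: "'a measure" and X :: "int \<Rightarrow> 'a \<Rightarrow> real^'d" and a b \<gamma> P R L k m om \<nu> +
  fixes h :: "real^'d \<Rightarrow> real^'q" and C :: real
  assumes h_measurable: "h \<in> borel_measurable borel"
    and h_cont: "AE z in P. isCont h z"
    and C_nonneg: "C \<ge> 0"
    and h_moment: "\<And>i t. t \<in> {1..R i} \<Longrightarrow>
      (\<integral>\<^sup>+\<omega>. ennreal (norm (h (split_Z a b k (R i) t (\<lambda>u. X u \<omega>))) powr (2 + \<nu>)) \<partial>M) \<le> ennreal C"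
begin

lemma mom_norm_h:
  assumes t: "t \<in> {1..R i}"
  shows "mom M (2 + \<nu>) C (\<lambda>\<omega>. norm (h (split_Z a b k (R i) t (\<lambda>u. X u \<omega>))))"
proof -
  let ?f = "\<lambda>\<omega>. norm (h (split_Z a b k (R i) t (\<lambda>u. X u \<omega>)))"
  have m: "?f \<in> borel_measurable M"
    by (rule measurable_compose[OF measurable_compose[OF split_Z_measurable h_measurable] borel_measurable_norm])
  have m2: "(\<lambda>\<omega>. ?f \<omega> powr (2 + \<nu>)) \<in> borel_measurable M"
    using m by measurable
  have i: "integrable M (\<lambda>\<omega>. ?f \<omega> powr (2 + \<nu>))"
    by (rule integrableI_bounded[OF m2]) (use le_less_trans[OF h_moment[OF t] ennreal_less_top] in simp)
  have "ennreal (\<integral>\<omega>. ?f \<omega> powr (2 + \<nu>) \<partial>M) \<le> ennreal C"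
    using nn_integral_eq_integral[OF i] h_moment[OF t] by simp
  then have "(\<integral>\<omega>. ?f \<omega> powr (2 + \<nu>) \<partial>M) \<le> C" using C_nonneg by (simp add: ennreal_le_iff)
  with m i show ?thesis by (simp add: mom_def)
qed

text \<open>The entry to the scalar theory: by Cauchy-Schwarz a linear form inherits its moments
  from the norm of \<open>h\<close>.\<close>

lemma adm_linear: "adm (norm l powr (2 + \<nu>) * C) (\<lambda>z. l \<bullet> h z)"
  unfolding adm_def
proof (intro conjI allI ballI)
  have [measurable]: "h \<in> borel_measurable borel" by (rule h_measurable)
  show m: "(\<lambda>z. l \<bullet> h z) \<in> borel_measurable borel" by measurable
  show "AE z in P. isCont (\<lambda>z. l \<bullet> h z) z"
    using h_cont by eventually_elim (intro continuous_intros)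
  fix i t assume t: "t \<in> {1..R i}"
  have "mom M (2 + \<nu>) (\<bar>norm l\<bar> powr (2 + \<nu>) * C) (\<lambda>\<omega>. norm l * norm (h (split_Z a b k (R i) t (\<lambda>u. X u \<omega>))))"
    by (rule mom_scale[OF mom_norm_h[OF t] exponent_bounds(3)])
  then show "mom M (2 + \<nu>) (norm l powr (2 + \<nu>) * C) (\<lambda>\<omega>. l \<bullet> h (split_Z a b k (R i) t (\<lambda>u. X u \<omega>)))"
    unfolding abs_norm_cancel
  proof (rule mom_dominated[OF _ _ _ exponent_bounds(3)])
    show "(\<lambda>\<omega>. l \<bullet> h (split_Z a b k (R i) t (\<lambda>u. X u \<omega>))) \<in> borel_measurable M"
      by (rule measurable_compose[OF split_Z_measurable m])
    show "\<bar>l \<bullet> h (split_Z a b k (R i) t (\<lambda>u. X u \<omega>))\<bar> \<le> \<bar>norm l * norm (h (split_Z a b k (R i) t (\<lambda>u. X u \<omega>)))\<bar>" for \<omega>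
      using Cauchy_Schwarz_ineq2[of l "h (split_Z a b k (R i) t (\<lambda>u. X u \<omega>))"] by simp
  qed
qed

definition coord :: "'q \<Rightarrow> real^'d \<Rightarrow> real" where
  "coord j z = h z $ j"

lemma adm_coord: "adm C (coord j)"
  using adm_linear[of "axis j 1"] by (simp add: coord_def[abs_def] inner_axis' norm_axis_1)

text \<open>Blocks are translates of each other, so the centring computed on the first block serves
  for all.\<close>

lemma Zc_law_0: "1 \<le> j \<Longrightarrow> j \<le> N i \<Longrightarrow> distr M borel (Zc i q j) = distr M borel (Zc i 0 j)"
proof -
  assume j: "1 \<le> j" "j \<le> N i"
  obtain c t where ct: "cpos i 0 j = (\<lambda>p. p + c) ` split_set k (R i) t" by (rule cpos_split[OF j])
  have "cpos i q j = (\<lambda>p. p + int (q * N i)) ` cpos i 0 j" unfolding cpos_def image_image by simp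
  then have "cpos i q j = (\<lambda>p. p + (c + int (q * N i))) ` split_set k (R i) t" unfolding ct image_image by (simp only: add.assoc)
  from Zc_law[OF this] Zc_law[OF ct] show ?thesis by simp
qed

lemma expectation_B:
  assumes g: "adm c g"
  shows "expectation (B g i q) = (\<Sum>j=1..N i. expectation (\<lambda>\<omega>. g (Zc i 0 j \<omega>))) / real (N i)"
proof -
  have gm: "g \<in> borel_measurable borel" using g by (simp add: adm_def)
  have int: "integrable M (\<lambda>\<omega>. g (Zc i q j \<omega>))" if "j \<in> {1..N i}" for j
    using that by (intro mom_abs(1)[OF adm_Zc[OF g] exponent_bounds(1)]) auto
  have "expectation (B g i q) = (\<Sum>j=1..N i. expectation (\<lambda>\<omega>. g (Zc i q j \<omega>))) / real (N i)"
    unfolding B_def[abs_def] integral_divide_zero by (subst Bochner_Integration.integral_sum[OF int]) auto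
  also have "(\<Sum>j=1..N i. expectation (\<lambda>\<omega>. g (Zc i q j \<omega>))) = (\<Sum>j=1..N i. expectation (\<lambda>\<omega>. g (Zc i 0 j \<omega>)))"
  proof (rule sum.cong[OF refl])
    fix j assume j: "j \<in> {1..N i}"
    have "distr M borel (Zc i q j) = distr M borel (Zc i 0 j)" using j by (intro Zc_law_0) auto
    then show "expectation (\<lambda>\<omega>. g (Zc i q j \<omega>)) = expectation (\<lambda>\<omega>. g (Zc i 0 j \<omega>))"
      using integral_distr[OF Zc_measurable gm, of i q j] integral_distr[OF Zc_measurable gm, of i 0 j] by simp
  qed
  finally show ?thesis .
qed

text \<open>The factor sqrt k times m / sqrt m is sqrt (k m) = sqrt (n / r), which identifies the
  array sum with the empirical process.\<close>

lemma S_eq: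
  assumes g: "adm c g"
  shows "S g i \<omega> = sqrt (real k * real (m i)) * ((\<Sum>q<m i. B g i q \<omega>) / real (m i) - (\<Sum>j=1..N i. expectation (\<lambda>\<omega>. g (Zc i 0 j \<omega>))) / real (N i))"
proof -
  define \<mu> where "\<mu> = (\<Sum>j=1..N i. expectation (\<lambda>\<omega>. g (Zc i 0 j \<omega>))) / real (N i)"
  have mp: "real (m i) > 0" using m_pos[of i] by simp
  have "(\<Sum>q<m i. T g i q \<omega>) = sqrt (real k) * ((\<Sum>q<m i. B g i q \<omega>) - real (m i) * \<mu>)"
    unfolding T_def expectation_B[OF g] \<mu>_def[symmetric] by (simp add: sum_distrib_left[symmetric] sum_subtractf)
  also have "\<dots> = sqrt (real k) * (real (m i) * ((\<Sum>q<m i. B g i q \<omega>) / real (m i) - \<mu>))"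
    using mp by (simp add: right_diff_distrib)
  finally have "S g i \<omega> = sqrt (real k) * (real (m i) / sqrt (real (m i))) * ((\<Sum>q<m i. B g i q \<omega>) / real (m i) - \<mu>)"
    unfolding S_def by simp
  also have "real (m i) / sqrt (real (m i)) = sqrt (real (m i))" by (rule real_div_sqrt) simp
  finally show ?thesis unfolding \<mu>_def by (simp add: real_sqrt_mult)
qed

lemma h_Zc_integrable: "1 \<le> j \<Longrightarrow> j \<le> N i \<Longrightarrow> integrable M (\<lambda>\<omega>. h (Zc i q j \<omega>))"
proof (rule integrable_vecI)
  fix j' assume "1 \<le> j" "j \<le> N i"
  then have "mom M (2 + \<nu>) C (\<lambda>\<omega>. coord j' (Zc i q j \<omega>))" by (rule adm_Zc[OF adm_coord])
  from mom_abs(1)[OF this exponent_bounds(1)] show "integrable M (\<lambda>\<omega>. h (Zc i q j \<omega>) $ j')" by (simp add: coord_def)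
qed

definition W :: "nat \<Rightarrow> 'a \<Rightarrow> real^'q" where
  "W i = G_bar M X a b k (m i * N i) (R i) h"

lemma mean_circ_Zc: "mean_circ M X a b k (R i) h = (1 / real (N i)) *\<^sub>R (\<Sum>j=1..N i. \<integral>\<omega>. h (Zc i 0 j \<omega>) \<partial>M)"
  unfolding mean_circ_def using circ_Z_Zc[of _ i _ 0] by (intro arg_cong[where f="scaleR _"] sum.cong refl) simp

lemma W_component: "W i \<omega> $ j = S (coord j) i \<omega>"
proof -
  have Rp: "real (R i) > 0" and kp: "real k > 0" and mp: "real (m i) > 0" using R_pos[of i] k m_pos[of i] by simp_all
  have ratio: "real (m i * N i) / real (R i) = real k * real (m i)" using Rp by simp
  have "emp_circ X a b k (m i * N i) (R i) h \<omega> $ j = (\<Sum>s=1..m i * N i. coord j (circ_Z a b k (R i) (\<lambda>t. X t \<omega>) s)) / real (m i * N i)"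
    unfolding emp_circ_def coord_def by simp
  also have "(\<Sum>s=1..m i * N i. coord j (circ_Z a b k (R i) (\<lambda>t. X t \<omega>) s)) = (\<Sum>q<m i. \<Sum>s=1..N i. coord j (Zc i q s \<omega>))"
    by (subst sum_blocks, intro sum.cong refl arg_cong[where f="coord j"] circ_Z_Zc) auto
  also have "\<dots> / real (m i * N i) = (\<Sum>q<m i. B (coord j) i q \<omega>) / real (m i)"
    unfolding B_def by (simp add: sum_divide_distrib[symmetric] mult.commute)
  finally have e: "emp_circ X a b k (m i * N i) (R i) h \<omega> $ j = (\<Sum>q<m i. B (coord j) i q \<omega>) / real (m i)" .
  have c: "mean_circ M X a b k (R i) h $ j = (\<Sum>s=1..N i. expectation (\<lambda>\<omega>. coord j (Zc i 0 s \<omega>))) / real (N i)"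
  proof -
    have "(\<Sum>s=1..N i. \<integral>\<omega>. h (Zc i 0 s \<omega>) \<partial>M) $ j = (\<Sum>s=1..N i. expectation (\<lambda>\<omega>. coord j (Zc i 0 s \<omega>)))"
      unfolding coord_def sum_component by (intro sum.cong refl integral_vec_nth h_Zc_integrable) auto
    then show ?thesis unfolding mean_circ_Zc by simp
  qed
  show ?thesis unfolding W_def G_bar_def S_eq[OF adm_coord] ratio e[symmetric] c[symmetric] by simp
qed

lemma inner_W: "l \<bullet> W i \<omega> = S (\<lambda>z. l \<bullet> h z) i \<omega>"
proof -
  let ?g = "\<lambda>z. l \<bullet> h z"
  have inn: "l \<bullet> h z = (\<Sum>j\<in>UNIV. l $ j * coord j z)" for z by (simp add: inner_vec_def coord_def)
  have B: "(\<Sum>q<m i. B ?g i q \<omega>) = (\<Sum>j\<in>UNIV. l $ j * (\<Sum>q<m i. B (coord j) i q \<omega>))"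
  proof -
    have "B ?g i q \<omega> = (\<Sum>j\<in>UNIV. l $ j * B (coord j) i q \<omega>)" for q
    proof -
      define z where "z j = (\<Sum>s=1..N i. coord j (Zc i q s \<omega>))" for j
      have "(\<Sum>s=1..N i. ?g (Zc i q s \<omega>)) = (\<Sum>j\<in>UNIV. l $ j * z j)"
        unfolding inn z_def sum_distrib_left by (rule sum.swap)
      then show ?thesis unfolding B_def z_def[symmetric] by (simp add: sum_divide_distrib)
    qed
    then show ?thesis unfolding sum_distrib_left by (simp only: sum.swap[of _ "{..<m i}"])
  qed
  have E: "(\<Sum>s=1..N i. expectation (\<lambda>\<omega>. ?g (Zc i 0 s \<omega>))) = (\<Sum>j\<in>UNIV. l $ j * (\<Sum>s=1..N i. expectation (\<lambda>\<omega>. coord j (Zc i 0 s \<omega>))))"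
  proof -
    have "expectation (\<lambda>\<omega>. ?g (Zc i 0 s \<omega>)) = (\<Sum>j\<in>UNIV. l $ j * expectation (\<lambda>\<omega>. coord j (Zc i 0 s \<omega>)))" if "s \<in> {1..N i}" for s
    proof -
      have "integrable M (\<lambda>\<omega>. coord j (Zc i 0 s \<omega>))" for j
        using that by (intro mom_abs(1)[OF adm_Zc[OF adm_coord] exponent_bounds(1)]) auto
      then show ?thesis unfolding inn by (subst Bochner_Integration.integral_sum) auto
    qed
    then have "(\<Sum>s=1..N i. expectation (\<lambda>\<omega>. ?g (Zc i 0 s \<omega>))) = (\<Sum>s=1..N i. \<Sum>j\<in>UNIV. l $ j * expectation (\<lambda>\<omega>. coord j (Zc i 0 s \<omega>)))"
      by (rule sum.cong[OF refl])
    then show ?thesis unfolding sum_distrib_left by (simp only: sum.swap[of _ "{1..N i}"])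
  qed
  let ?c = "sqrt (real k * real (m i))"
  define p where "p j = (\<Sum>q<m i. B (coord j) i q \<omega>)" for j
  define e where "e j = (\<Sum>s=1..N i. expectation (\<lambda>\<omega>. coord j (Zc i 0 s \<omega>)))" for j
  have "l \<bullet> W i \<omega> = (\<Sum>j\<in>UNIV. l $ j * (?c * (p j / real (m i) - e j / real (N i))))"
    unfolding inner_vec_def inner_real_def W_component S_eq[OF adm_coord] p_def e_def by (rule refl)
  also have "\<dots> = (\<Sum>j\<in>UNIV. ?c * (l $ j * p j / real (m i) - l $ j * e j / real (N i)))"
    by (intro sum.cong refl) (simp add: algebra_simps)
  also have "\<dots> = ?c * ((\<Sum>j\<in>UNIV. l $ j * p j) / real (m i) - (\<Sum>j\<in>UNIV. l $ j * e j) / real (N i))"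
    by (simp only: sum_distrib_left[symmetric] sum_subtractf sum_divide_distrib[symmetric])
  also have "\<dots> = S ?g i \<omega>" unfolding S_eq[OF adm_linear] B E p_def e_def by (rule refl)
  finally show ?thesis .
qed

lemma S_moments:
  assumes g: "adm c g1" "adm c g2"
  shows "integrable M (S g1 i)" "expectation (S g1 i) = 0" "integrable M (\<lambda>\<omega>. S g1 i \<omega> * S g2 i \<omega>)"
proof -
  note T = T_moments[OF g]
  show "integrable M (S g1 i)" unfolding S_def[abs_def] using T(1) by auto
  show "expectation (S g1 i) = 0"
    unfolding S_def[abs_def] integral_divide_zero using T(1,2) by (subst Bochner_Integration.integral_sum) auto
  have "S g1 i \<omega> * S g2 i \<omega> = (\<Sum>q<m i. \<Sum>q'<m i. T g1 i q \<omega> * T g2 i q' \<omega>) / real (m i)" for \<omega>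
    unfolding S_def by (simp add: sum_product)
  then show "integrable M (\<lambda>\<omega>. S g1 i \<omega> * S g2 i \<omega>)"
    using T(3) by (auto intro!: Bochner_Integration.integrable_sum)
qed

abbreviation \<Sigma> :: "real^'q^'q" where "\<Sigma> \<equiv> Sigma_s P h"

text \<open>\<open>\<Gamma>\<close> is identified with the covariance in \<open>Sigma_s\<close> on
  the open interval only. Instead of comparing integrands, both integrals are recognised as the
  limit of the same Riemann sums.\<close>

lemma covariance_limit:
  "(\<lambda>i. cv M (S (coord j) i) (S (coord j') i)) \<longlonglongrightarrow> \<Sigma> $ j $ j'"
proof -
  let ?cov = "\<lambda>\<xi>. covariance (G_xi_law P \<xi>) (\<lambda>z. coord j (fst z)) (\<lambda>z. coord j' (snd z))"
  have eq: "\<Gamma> (coord j) (coord j') \<xi> = ?cov \<xi>" if \<xi>: "0 < \<xi>" "\<xi> < 1" for \<xi>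
  proof -
    have C: "coupling (G_xi_law P \<xi>)" by (rule is_G_xi_coupling[OF \<xi> G_xi_law_is_G_xi[OF \<xi>]])
    then interpret G: prob_space "G_xi_law P \<xi>" by (simp add: coupling_def)
    have m: "mom (G_xi_law P \<xi>) (2 + \<nu>) C (\<lambda>z. coord j (fst z))" "mom (G_xi_law P \<xi>) (2 + \<nu>) C (\<lambda>z. coord j' (snd z))"
      by (rule mom_fst[OF \<open>coupling (G_xi_law P \<xi>)\<close> adm_P[OF adm_coord]], rule mom_snd[OF \<open>coupling (G_xi_law P \<xi>)\<close> adm_P[OF adm_coord]])
    show ?thesis unfolding \<Gamma>_def
      by (rule G.covariance_eq_cv[symmetric])
        (rule G.mom_abs(1)[OF m(1) exponent_bounds(1)] G.mom_abs(1)[OF m(2) exponent_bounds(1)] G.mom_prod(1)[OF m exponent_bounds(2)])+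
  qed
  let ?s = "\<lambda>i. (\<Sum>d<R i. lagavg (coord j) (coord j') (\<lambda>_. 0) i d) / real (R i)"
  have l1: "?s \<longlonglongrightarrow> I\<Gamma> (coord j) (coord j')"
    unfolding I\<Gamma>_def
  proof (rule riemann_limit[OF R_pos])
    show "\<bar>lagavg (coord j) (coord j') (\<lambda>_. 0) i d\<bar> \<le> (1 + C) + (1 + C) * (1 + C)" for i d by (rule lagavg_bound[OF adm_coord adm_coord])
    show "(\<lambda>i. lagavg (coord j) (coord j') (\<lambda>_. 0) i (nat \<lfloor>real (R i) * \<xi>\<rfloor>)) \<longlonglongrightarrow> \<Gamma> (coord j) (coord j') \<xi>" if "0 < \<xi>" "\<xi> < 1" for \<xi>
      by (rule lagavg_limit[OF adm_coord adm_coord that])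
  qed
  have l2: "?s \<longlonglongrightarrow> (LBINT \<xi>:{0..1}. ?cov \<xi>)"
  proof (rule riemann_limit[OF R_pos])
    show "\<bar>lagavg (coord j) (coord j') (\<lambda>_. 0) i d\<bar> \<le> (1 + C) + (1 + C) * (1 + C)" for i d by (rule lagavg_bound[OF adm_coord adm_coord])
    show "(\<lambda>i. lagavg (coord j) (coord j') (\<lambda>_. 0) i (nat \<lfloor>real (R i) * \<xi>\<rfloor>)) \<longlonglongrightarrow> ?cov \<xi>" if "0 < \<xi>" "\<xi> < 1" for \<xi>
      unfolding eq[OF that, symmetric] by (rule lagavg_limit[OF adm_coord adm_coord that])
  qed
  have "\<Sigma> $ j $ j' = 2 * (LBINT \<xi>:{0..1}. ?cov \<xi>)" by (simp add: Sigma_s_def coord_def)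
  also have "\<dots> = 2 * I\<Gamma> (coord j) (coord j')" using LIMSEQ_unique[OF l1 l2] by simp
  finally show ?thesis using S_cov_limit[OF adm_coord adm_coord] by simp
qed

lemma \<Sigma>_sym: "\<Sigma> $ i $ j = \<Sigma> $ j $ i"
proof (rule LIMSEQ_unique[OF covariance_limit])
  show "(\<lambda>n. cv M (S (coord i) n) (S (coord j) n)) \<longlonglongrightarrow> \<Sigma> $ j $ i"
    using covariance_limit[of j i] by (subst cv_commute)
qed

text \<open>Both sides are limits of the variance of one linear form, taken directly on the right
  and expanded bilinearly on the left.\<close>

lemma qform_\<Sigma>: "qform \<Sigma> (\<lambda>j. l $ j) = 2 * I\<Gamma> (\<lambda>z. l \<bullet> h z) (\<lambda>z. l \<bullet> h z)"
proof (rule LIMSEQ_unique)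
  let ?g = "\<lambda>z. l \<bullet> h z"
  show "(\<lambda>i. cv M (S ?g i) (S ?g i)) \<longlonglongrightarrow> 2 * I\<Gamma> ?g ?g" by (rule S_cov_limit[OF adm_linear adm_linear])
  have "cv M (S ?g i) (S ?g i) = (\<Sum>j\<in>UNIV. \<Sum>j'\<in>UNIV. l $ j * l $ j' * cv M (S (coord j) i) (S (coord j') i))" for i
  proof -
    have e: "S ?g i = (\<lambda>\<omega>. \<Sum>j\<in>UNIV. l $ j * S (coord j) i \<omega>)"
      using inner_W[of l i] by (simp add: fun_eq_iff inner_vec_def W_component)
    have "integrable M (\<lambda>\<omega>. l $ j * S (coord j) i \<omega> * (l $ j' * S (coord j') i \<omega>))" for j j'
    proof -
      have "(\<lambda>\<omega>. l $ j * S (coord j) i \<omega> * (l $ j' * S (coord j') i \<omega>)) = (\<lambda>\<omega>. l $ j * l $ j' * (S (coord j) i \<omega> * S (coord j') i \<omega>))"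
        by (simp add: fun_eq_iff)
      then show ?thesis using S_moments(3)[OF adm_coord adm_coord] by simp
    qed
    then show ?thesis unfolding e
      by (subst cv_sum) (auto intro!: sum.cong S_moments(1)[OF adm_coord adm_coord] simp: cv_scale)
  qed
  moreover have "(\<lambda>i. \<Sum>j\<in>UNIV. \<Sum>j'\<in>UNIV. l $ j * l $ j' * cv M (S (coord j) i) (S (coord j') i)) \<longlonglongrightarrow> qform \<Sigma> (\<lambda>j. l $ j)"
    unfolding qform_def by (intro tendsto_intros covariance_limit)
  ultimately show "(\<lambda>i. cv M (S ?g i) (S ?g i)) \<longlonglongrightarrow> qform \<Sigma> (\<lambda>j. l $ j)" by simp
qed

lemma cv_S_square: "adm c g \<Longrightarrow> cv M (S g i) (S g i) = expectation (\<lambda>\<omega>. (S g i \<omega>)\<^sup>2)"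
  by (simp add: cv_def S_moments(2) power2_eq_square)

lemma qform_\<Sigma>_nonneg: "qform \<Sigma> v \<ge> 0"
proof -
  let ?g = "\<lambda>z. (\<chi> j. v j) \<bullet> h z"
  have "0 \<le> 2 * I\<Gamma> ?g ?g"
  proof (rule LIMSEQ_le_const[OF S_cov_limit[OF adm_linear adm_linear]])
    have "0 \<le> cv M (S ?g i) (S ?g i)" for i unfolding cv_S_square[OF adm_linear] by simp
    then show "\<exists>N. \<forall>n\<ge>N. 0 \<le> cv M (S ?g n) (S ?g n)" by blast
  qed
  then show ?thesis using qform_\<Sigma>[of "\<chi> j. v j"] by simp
qed

lemma W_measurable: "W i \<in> borel_measurable M"
  by (rule borel_measurable_vecI) (use S_moments(1)[OF adm_coord adm_coord] in \<open>auto simp: W_component\<close>)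

lemma cov_matrix_limit: "(\<lambda>i. cov_matrix M (W i)) \<longlonglongrightarrow> \<Sigma>"
proof (intro vec_tendstoI)
  fix j j'
  have "cov_matrix M (W i) $ j $ j' = cv M (S (coord j) i) (S (coord j') i)" for i
    unfolding cov_matrix_def W_component
    by (simp, rule covariance_eq_cv) (rule S_moments(1,3)[OF adm_coord adm_coord])+
  then show "(\<lambda>i. cov_matrix M (W i) $ j $ j') \<longlonglongrightarrow> \<Sigma> $ j $ j'" using covariance_limit by simp
qed

text \<open>Markov's inequality for the squared norm, whose mean is the sum of the component
  variances and is bounded because it converges.\<close>

lemma W_tight:
  assumes e: "e > 0"
  shows "\<exists>K. \<forall>i. prob {\<omega>\<in>space M. norm (W i \<omega>) > K} \<le> e"
proof -
  define nsq where "nsq i \<omega> = (\<Sum>j\<in>UNIV. (S (coord j) i \<omega>)\<^sup>2)" for i \<omega>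
  have int: "integrable M (\<lambda>\<omega>. (S (coord j) i \<omega>)\<^sup>2)" for i j
    using S_moments(3)[OF adm_coord adm_coord] by (simp add: power2_eq_square)
  then have insq: "integrable M (nsq i)" for i unfolding nsq_def[abs_def] by auto
  have EW: "expectation (nsq i) = (\<Sum>j\<in>UNIV. cv M (S (coord j) i) (S (coord j) i))" for i
    unfolding nsq_def[abs_def] cv_S_square[OF adm_coord] by (rule Bochner_Integration.integral_sum[OF int])
  have "convergent (\<lambda>i. expectation (nsq i))"
    unfolding EW by (intro convergentI[OF tendsto_sum[OF covariance_limit]])
  then obtain D where D: "D > 0" "\<And>i. \<bar>expectation (nsq i)\<bar> \<le> D"
    using convergent_imp_Bseq[of "\<lambda>i. expectation (nsq i)"] by (auto simp: Bseq_def)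
  define c where "c = D / e"
  have c: "c > 0" using D e by (simp add: c_def)
  have "prob {\<omega>\<in>space M. norm (W i \<omega>) > sqrt c} \<le> e" for i
  proof -
    have nnsq: "nsq i \<omega> = (norm (W i \<omega>))\<^sup>2" for \<omega>
      unfolding nsq_def power2_norm_eq_inner inner_vec_def by (simp add: W_component power2_eq_square)
    have "prob {\<omega>\<in>space M. norm (W i \<omega>) > sqrt c} \<le> prob {\<omega>\<in>space M. nsq i \<omega> \<ge> c}"
    proof (rule finite_measure_mono)
      show "{\<omega>\<in>space M. norm (W i \<omega>) > sqrt c} \<subseteq> {\<omega>\<in>space M. nsq i \<omega> \<ge> c}"
        unfolding nnsq using real_le_rsqrt sqrt_le_D by (auto simp: less_imp_le)
      show "{\<omega>\<in>space M. nsq i \<omega> \<ge> c} \<in> events" using insq[of i] by measurable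
    qed
    also have "\<dots> \<le> expectation (nsq i) / c"
      by (rule integral_Markov_inequality_measure[OF insq[of i], where A="{}"]) (use c in \<open>auto simp: nsq_def sum_nonneg\<close>)
    also have "\<dots> \<le> D / c"
      using D(2)[of i] c by (intro divide_right_mono) auto
    also have "\<dots> = e" using D e by (simp add: c_def)
    finally show ?thesis .
  qed
  then show ?thesis by blast
qed

lemma W_char: "(\<lambda>i. CLINT \<omega>|M. iexp (l \<bullet> W i \<omega>)) \<longlonglongrightarrow> of_real (exp (- qform \<Sigma> (\<lambda>j. l $ j) / 2))"
  using S_char[OF adm_linear[of l], of 1] unfolding inner_W qform_\<Sigma> by simp

lemma W_shift_limit:
  "c \<longlonglongrightarrow> c0 \<Longrightarrow> weak_conv_law (\<lambda>i. distr M borel (\<lambda>\<omega>. W i \<omega> + c i)) (mv_normal c0 \<Sigma>) sequentially"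
  by (rule weak_conv_normal[OF W_measurable \<Sigma>_sym qform_\<Sigma>_nonneg W_char W_tight])

section \<open>The bias of the circular mean\<close>

lemma h_split_integrable:
  assumes t: "t \<in> {1..R i}"
  shows "integrable M (\<lambda>\<omega>. h (split_Z a b k (R i) t (\<lambda>u. X u \<omega>)))"
proof (rule integrable_vecI)
  fix j
  have "mom M (2 + \<nu>) C (\<lambda>\<omega>. coord j (split_Z a b k (R i) t (\<lambda>u. X u \<omega>)))"
    using adm_coord[of j] t by (simp add: adm_def)
  from mom_abs(1)[OF this exponent_bounds(1)] show "integrable M (\<lambda>\<omega>. h (split_Z a b k (R i) t (\<lambda>u. X u \<omega>)) $ j)" by (simp add: coord_def)
qed

lemma mean_block_split: "mean_block M X a b (R i) h = (\<integral>\<omega>. h (split_Z a b k (R i) (R i) (\<lambda>u. X u \<omega>)) \<partial>M)"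
  unfolding mean_block_def block_Z_split by (rule refl)

lemma mean_Zc:
  assumes "cpos i 0 j = (\<lambda>p. p + c) ` split_set k (R i) t"
  shows "(\<integral>\<omega>. h (Zc i 0 j \<omega>) \<partial>M) = (\<integral>\<omega>. h (split_Z a b k (R i) t (\<lambda>u. X u \<omega>)) \<partial>M)"
  using integral_distr[OF Zc_measurable h_measurable, of i 0 j] integral_distr[OF split_Z_measurable h_measurable, of i t]
  unfolding Zc_law[OF assms] by simp

text \<open>A window that does not wrap has the law of a block maximum, so its term cancels.\<close>

lemma mean_difference:
  "mean_circ M X a b k (R i) h - mean_block M X a b (R i) h =
    (1 / real (N i)) *\<^sub>R (\<Sum>t=1..R i - 1. (\<integral>\<omega>. h (split_Z a b k (R i) t (\<lambda>u. X u \<omega>)) \<partial>M) - mean_block M X a b (R i) h)"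
proof -
  let ?mb = "mean_block M X a b (R i) h" and ?E = "\<lambda>j. \<integral>\<omega>. h (Zc i 0 j \<omega>) \<partial>M"
  \<comment> \<open>Windows starting at 1, ..., \<open>n0\<close> do not wrap, the remaining
    \<open>R i - 1\<close> do.\<close>
  define n0 where "n0 = (k - 1) * R i + 1"
  have N0: "N i = n0 + (R i - 1)" unfolding n0_def using k R_pos[of i] by (cases k) auto
  have np: "(1 / x) *\<^sub>R (x *\<^sub>R ?mb) = ?mb" if "x > 0" for x using that by simp
  have Np: "real (N i) > 0" using N_pos[of i] by simp
  have "(\<Sum>j=1..N i. ?E j - ?mb) = (\<Sum>j=1..n0. ?E j - ?mb) + (\<Sum>j=n0 + 1..n0 + (R i - 1). ?E j - ?mb)"
    unfolding N0 by (rule sum.ub_add_nat) simp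
  also have "(\<Sum>j=1..n0. ?E j - ?mb) = 0"
  proof (rule sum.neutral, rule ballI)
    fix j assume j: "j \<in> {1..n0}"
    then have "1 \<le> j" "j + R i - 1 \<le> N i" using N0 R_pos[of i] by auto
    from mean_Zc[OF cpos_inner[OF this]] show "?E j - ?mb = 0" by (simp add: mean_block_split)
  qed
  also have "(\<Sum>j=n0 + 1..n0 + (R i - 1). ?E j - ?mb) = (\<Sum>t=1..R i - 1. ?E (t + n0) - ?mb)"
    using sum.shift_bounds_cl_nat_ivl[of "\<lambda>j. ?E j - ?mb" 1 n0 "R i - 1"] by (simp add: add.commute)
  also have "\<dots> = (\<Sum>t=1..R i - 1. (\<integral>\<omega>. h (split_Z a b k (R i) t (\<lambda>u. X u \<omega>)) \<partial>M) - ?mb)"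
  proof (intro sum.cong refl arg_cong2[where f=minus])
    fix t assume t: "t \<in> {1..R i - 1}"
    then have tt: "1 \<le> t" "t \<le> R i" by auto
    have "t + n0 = (k - 1) * R i + t + 1" by (simp add: n0_def)
    then show "?E (t + n0) = (\<integral>\<omega>. h (split_Z a b k (R i) t (\<lambda>u. X u \<omega>)) \<partial>M)"
      using mean_Zc[OF cpos_outer[OF tt]] by (simp only:)
  qed
  finally have s: "(\<Sum>j=1..N i. ?E j - ?mb) = (\<Sum>t=1..R i - 1. (\<integral>\<omega>. h (split_Z a b k (R i) t (\<lambda>u. X u \<omega>)) \<partial>M) - ?mb)"
    by simp
  have "mean_circ M X a b k (R i) h - ?mb = (1 / real (N i)) *\<^sub>R ((\<Sum>j=1..N i. ?E j) - real (N i) *\<^sub>R ?mb)"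
    unfolding mean_circ_Zc scaleR_diff_right np[OF Np] by (rule refl)
  also have "(\<Sum>j=1..N i. ?E j) - real (N i) *\<^sub>R ?mb = (\<Sum>j=1..N i. ?E j - ?mb)"
    unfolding sum_subtractf sum_constant_scaleR by (simp only: card_atLeastAtMost diff_Suc_1)
  finally show ?thesis unfolding s .
qed

lemma integral_fst:
  fixes f :: "'a \<Rightarrow> real^'q"
  assumes f: "integrable M f"
  shows "integrable (M \<Otimes>\<^sub>M M) (\<lambda>w. f (fst w))" "(\<integral>w. f (fst w) \<partial>(M \<Otimes>\<^sub>M M)) = (\<integral>x. f x \<partial>M)"
proof -
  have d: "distr (M \<Otimes>\<^sub>M M) M fst = M" by (rule distr_pair_fst)
  have fm: "f \<in> borel_measurable M" using f by auto
  show "(\<integral>w. f (fst w) \<partial>(M \<Otimes>\<^sub>M M)) = (\<integral>x. f x \<partial>M)"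
    using integral_distr[OF measurable_fst[of M M] fm] unfolding d by simp
  show "integrable (M \<Otimes>\<^sub>M M) (\<lambda>w. f (fst w))"
    using integrable_distr_eq[OF measurable_fst[of M M] fm] f unfolding d by simp
qed

text \<open>The term with the independent copy occurs in both integrands with opposite
  signs.\<close>

lemma bias_split:
  assumes t: "t \<in> {1..R i - 1}"
    and D: "integrable (M \<Otimes>\<^sub>M M) (D_integrand X a b k h (R i) t)"
    and E: "integrable (M \<Otimes>\<^sub>M M) (E_integrand X a b h (R i) t)"
  shows "(\<integral>\<omega>. h (split_Z a b k (R i) t (\<lambda>u. X u \<omega>)) \<partial>M) - mean_block M X a b (R i) h =
    (\<integral>w. D_integrand X a b k h (R i) t w \<partial>(M \<Otimes>\<^sub>M M)) + (\<integral>w. E_integrand X a b h (R i) t w \<partial>(M \<Otimes>\<^sub>M M))"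
proof -
  have 1: "t \<in> {1..R i}" "R i \<in> {1..R i}" using t by auto
  have "(\<integral>w. D_integrand X a b k h (R i) t w \<partial>(M \<Otimes>\<^sub>M M)) + (\<integral>w. E_integrand X a b h (R i) t w \<partial>(M \<Otimes>\<^sub>M M)) =
    (\<integral>w. D_integrand X a b k h (R i) t w + E_integrand X a b h (R i) t w \<partial>(M \<Otimes>\<^sub>M M))"
    by (rule Bochner_Integration.integral_add[OF D E, symmetric])
  also have "\<dots> = (\<integral>w. h (split_Z a b k (R i) t (\<lambda>u. X u (fst w))) - h (split_Z a b k (R i) (R i) (\<lambda>u. X u (fst w))) \<partial>(M \<Otimes>\<^sub>M M))"
    unfolding D_integrand_def E_integrand_def block_Z_split by simp
  also have "\<dots> = (\<integral>\<omega>. h (split_Z a b k (R i) t (\<lambda>u. X u \<omega>)) \<partial>M) - (\<integral>\<omega>. h (split_Z a b k (R i) (R i) (\<lambda>u. X u \<omega>)) \<partial>M)"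
    by (subst Bochner_Integration.integral_diff[OF integral_fst(1)[OF h_split_integrable[OF 1(1)]] integral_fst(1)[OF h_split_integrable[OF 1(2)]]])
      (simp only: integral_fst(2)[OF h_split_integrable[OF 1(1)]] integral_fst(2)[OF h_split_integrable[OF 1(2)]])
  finally show ?thesis unfolding mean_block_split by simp
qed

lemma G_tilde_eq: "G_tilde M X a b k n (R i) h \<omega> = G_bar M X a b k n (R i) h \<omega> +
  sqrt (real n / real (R i)) *\<^sub>R (mean_circ M X a b k (R i) h - mean_block M X a b (R i) h)"
  unfolding G_tilde_def G_bar_def scaleR_add_right[symmetric] by simp

lemma G_circ_eq: "G_circ P X a b k n (R i) h \<omega> = G_bar M X a b k n (R i) h \<omega> +
  (sqrt (real n / real (R i)) *\<^sub>R (mean_block M X a b (R i) h - (\<integral>z. h z \<partial>P)) +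
   sqrt (real n / real (R i)) *\<^sub>R (mean_circ M X a b k (R i) h - mean_block M X a b (R i) h))"
  unfolding G_circ_def G_bar_def scaleR_add_right[symmetric] by simp

text \<open>The circular mean averages over N = k R windows, the bias conditions divide by R; this
  leaves the factor 1 / k.\<close>

lemma bias_limit:
  assumes int: "\<And>i t. t \<in> {1..R i - 1} \<Longrightarrow> integrable (M \<Otimes>\<^sub>M M) (D_integrand X a b k h (R i) t)"
      "\<And>i t. t \<in> {1..R i - 1} \<Longrightarrow> integrable (M \<Otimes>\<^sub>M M) (E_integrand X a b h (R i) t)"
    and D: "(\<lambda>i. (sqrt (real (n i) / real (R i)) * (1 / real (R i))) *\<^sub>R
        (\<Sum>t=1..R i - 1. \<integral>w. D_integrand X a b k h (R i) t w \<partial>(M \<Otimes>\<^sub>M M))) \<longlonglongrightarrow> D"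
    and E: "(\<lambda>i. (sqrt (real (n i) / real (R i)) * (1 / real (R i))) *\<^sub>R
        (\<Sum>t=1..R i - 1. \<integral>w. E_integrand X a b h (R i) t w \<partial>(M \<Otimes>\<^sub>M M))) \<longlonglongrightarrow> E"
  shows "(\<lambda>i. sqrt (real (n i) / real (R i)) *\<^sub>R (mean_circ M X a b k (R i) h - mean_block M X a b (R i) h)) \<longlonglongrightarrow>
    (1 / real k) *\<^sub>R (D + E)"
proof -
  have "sqrt (real (n i) / real (R i)) *\<^sub>R (mean_circ M X a b k (R i) h - mean_block M X a b (R i) h) =
    (1 / real k) *\<^sub>R ((sqrt (real (n i) / real (R i)) * (1 / real (R i))) *\<^sub>R
        (\<Sum>t=1..R i - 1. \<integral>w. D_integrand X a b k h (R i) t w \<partial>(M \<Otimes>\<^sub>M M)) +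
      (sqrt (real (n i) / real (R i)) * (1 / real (R i))) *\<^sub>R
        (\<Sum>t=1..R i - 1. \<integral>w. E_integrand X a b h (R i) t w \<partial>(M \<Otimes>\<^sub>M M)))" for i
  proof -
    have "(\<Sum>t=1..R i - 1. (\<integral>\<omega>. h (split_Z a b k (R i) t (\<lambda>u. X u \<omega>)) \<partial>M) - mean_block M X a b (R i) h) =
      (\<Sum>t=1..R i - 1. \<integral>w. D_integrand X a b k h (R i) t w \<partial>(M \<Otimes>\<^sub>M M)) +
      (\<Sum>t=1..R i - 1. \<integral>w. E_integrand X a b h (R i) t w \<partial>(M \<Otimes>\<^sub>M M))"
      unfolding sum.distrib[symmetric] by (intro sum.cong refl bias_split int)
    then show ?thesis
      unfolding mean_difference scaleR_add_right[symmetric] scaleR_scaleR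
      by (simp add: mult_ac)
  qed
  moreover have "(\<lambda>i. (1 / real k) *\<^sub>R ((sqrt (real (n i) / real (R i)) * (1 / real (R i))) *\<^sub>R
        (\<Sum>t=1..R i - 1. \<integral>w. D_integrand X a b k h (R i) t w \<partial>(M \<Otimes>\<^sub>M M)) +
      (sqrt (real (n i) / real (R i)) * (1 / real (R i))) *\<^sub>R
        (\<Sum>t=1..R i - 1. \<integral>w. E_integrand X a b h (R i) t w \<partial>(M \<Otimes>\<^sub>M M)))) \<longlonglongrightarrow> (1 / real k) *\<^sub>R (D + E)"
    by (intro tendsto_intros D E)
  ultimately show ?thesis by simp
qed

end

section \<open>Limits along the sample sizes\<close>

text \<open>If convergence failed, infinitely many sample sizes would miss some neighbourhood of the
  limit; enumerated, they form a subsequence that contradicts \<open>sub\<close>. The set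
  \<open>A\<close> retains only indices with \<open>Q\<close>, so eventual properties may be used at
  every index.\<close>

lemma limit_along_sample_sizes:
  fixes f :: "nat \<Rightarrow> 'b::topological_space"
  assumes Q: "eventually Q (sample_sizes k r)"
    and sub: "\<And>\<sigma>. strict_mono \<sigma> \<Longrightarrow> (\<And>i. k * r (\<sigma> i) dvd \<sigma> i) \<Longrightarrow> (\<And>i. Q (\<sigma> i)) \<Longrightarrow> (\<lambda>i. f (\<sigma> i)) \<longlonglongrightarrow> l"
  shows "(f \<longlongrightarrow> l) (sample_sizes k r)"
proof (rule topological_tendstoI, rule ccontr)
  fix U assume U: "open U" "l \<in> U" and n: "\<not> (\<forall>\<^sub>F n in sample_sizes k r. f n \<in> U)"
  define A where "A = {n. k * r n dvd n \<and> Q n \<and> f n \<notin> U}"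
  have inf: "infinite A"
  proof
    assume "finite A"
    then have "\<forall>\<^sub>F n in sequentially. n \<notin> A"
      by (simp add: eventually_cofinite cofinite_eq_sequentially[symmetric])
    moreover have "\<forall>\<^sub>F n in sequentially. k * r n dvd n \<longrightarrow> Q n"
      using Q unfolding sample_sizes_def eventually_inf_principal by simp
    ultimately have "\<forall>\<^sub>F n in sequentially. k * r n dvd n \<longrightarrow> f n \<in> U"
      by eventually_elim (auto simp: A_def)
    with n show False unfolding sample_sizes_def eventually_inf_principal by simp
  qed
  define \<sigma> where "\<sigma> = enumerate A"
  have \<sigma>: "\<sigma> i \<in> A" for i unfolding \<sigma>_def by (rule enumerate_in_set[OF inf])
  have "strict_mono \<sigma>" unfolding \<sigma>_def using enumerate_mono[OF _ inf] by (intro strict_monoI)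
  then have "(\<lambda>i. f (\<sigma> i)) \<longlonglongrightarrow> l" using \<sigma> by (intro sub) (auto simp: A_def)
  from topological_tendstoD[OF this U] obtain i where "f (\<sigma> i) \<in> U"
    using eventually_happens'[OF trivial_limit_sequentially] by blast
  with \<sigma>[of i] show False by (simp add: A_def)
qed

lemma weak_conv_along_sample_sizes:
  assumes Q: "eventually Q (sample_sizes k r)"
    and sub: "\<And>\<sigma>. strict_mono \<sigma> \<Longrightarrow> (\<And>i. k * r (\<sigma> i) dvd \<sigma> i) \<Longrightarrow> (\<And>i. Q (\<sigma> i)) \<Longrightarrow>
      weak_conv_law (\<lambda>i. \<mu> (\<sigma> i)) \<nu> sequentially"
  shows "weak_conv_law \<mu> \<nu> (sample_sizes k r)"
  unfolding weak_conv_law_def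
proof (intro allI impI)
  fix f :: "'a \<Rightarrow> real" assume f: "continuous_on UNIV f \<and> bounded (range f)"
  show "((\<lambda>n. \<integral>x. f x \<partial>\<mu> n) \<longlongrightarrow> (\<integral>x. f x \<partial>\<nu>)) (sample_sizes k r)"
    by (rule limit_along_sample_sizes[OF Q]) (use sub f in \<open>auto simp: weak_conv_law_def\<close>)
qed

lemma filterlim_sample_sizes:
  "strict_mono \<sigma> \<Longrightarrow> (\<And>i. k * r (\<sigma> i) dvd \<sigma> i) \<Longrightarrow> filterlim \<sigma> (sample_sizes k r) sequentially"
  unfolding sample_sizes_def by (simp add: filterlim_inf filterlim_principal filterlim_subseq)

lemma vector_circular_process_subsequence:
  fixes M :: "'a measure" and X :: "int \<Rightarrow> 'a \<Rightarrow> real^'d" and h :: "real^'d \<Rightarrow> real^'q"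
  assumes M: "prob_space M" and mda: "cond_MDA M X a b \<gamma> P" and k: "k \<ge> 2" and \<nu>: "\<nu> > 2 / om" and om: "om > 0"
    and h: "h \<in> borel_measurable borel" "AE z in P. isCont h z" and C: "C \<ge> 0"
    and r: "filterlim r at_top F" "(\<lambda>n. real (r n)) \<in> o[F](\<lambda>n. real n)"
    and l: "filterlim l at_top F" "(\<lambda>n. real (l n)) \<in> o[F](\<lambda>n. real (r n))"
      "((\<lambda>n. real n / real (r n) * alpha_mix M X (l n)) \<longlongrightarrow> 0) F"
    and mix: "((\<lambda>n. (real n / real (r n)) powr (1 + om) * alpha_mix M X (r n)) \<longlongrightarrow> 0) F"
    and \<sigma>: "filterlim \<sigma> F sequentially" "\<And>i. k * r (\<sigma> i) dvd \<sigma> i"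
    and pos: "\<And>i. r (\<sigma> i) \<ge> 1" "\<And>i. \<sigma> i \<ge> 1"
    and mom: "\<And>i t. t \<in> {1..r (\<sigma> i)} \<Longrightarrow>
      (\<integral>\<^sup>+\<omega>. ennreal (norm (h (split_Z a b k (r (\<sigma> i)) t (\<lambda>u. X u \<omega>))) powr (2 + \<nu>)) \<partial>M) \<le> ennreal C"
  shows "vector_circular_process M X a b \<gamma> P (\<lambda>i. r (\<sigma> i)) (\<lambda>i. l (\<sigma> i)) k (\<lambda>i. \<sigma> i div (k * r (\<sigma> i))) om \<nu> h C"
proof -
  let ?m = "\<lambda>i. \<sigma> i div (k * r (\<sigma> i))"
  interpret stationary_process M X
    using M mda by (auto simp: stationary_process_def stationary_process_axioms_def cond_MDA_def)
  have m_eq: "?m i * (k * r (\<sigma> i)) = \<sigma> i" for i using \<sigma>(2) by simp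
  have m_pos: "?m i \<ge> 1" for i
  proof (rule ccontr)
    assume "\<not> ?m i \<ge> 1"
    then have "?m i = 0" by linarith
    then show False using m_eq[of i] pos(2)[of i] by simp
  qed
  have ratio: "real (\<sigma> i) / real (r (\<sigma> i)) = real (k * ?m i)" for i
  proof -
    have "real (\<sigma> i) = real (k * ?m i) * real (r (\<sigma> i))"
      unfolding of_nat_mult[symmetric] by (subst m_eq[of i, symmetric]) (simp add: ac_simps)
    then show ?thesis using pos(1)[of i] by (simp del: of_nat_mult)
  qed
  have m_top: "filterlim ?m at_top sequentially"
  proof -
    have "((\<lambda>n. real (r n) / real n) \<longlongrightarrow> 0) F"
      by (rule smalloD_tendsto[OF r(2)])
    from filterlim_compose[OF this \<sigma>(1)] have "(\<lambda>i. real (r (\<sigma> i)) / real (\<sigma> i)) \<longlonglongrightarrow> 0" .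
    moreover have "\<forall>\<^sub>F i in sequentially. 0 < real (r (\<sigma> i)) / real (\<sigma> i)"
      using pos by (intro always_eventually allI) (simp add: Suc_le_eq)
    ultimately have "filterlim (\<lambda>i. inverse (real (r (\<sigma> i)) / real (\<sigma> i))) at_top sequentially"
      by (rule filterlim_inverse_at_top)
    then have t: "filterlim (\<lambda>i. real (k * ?m i)) at_top sequentially"
      unfolding inverse_divide ratio .
    show ?thesis unfolding filterlim_at_top
    proof
      fix Z :: nat
      have "\<forall>\<^sub>F i in sequentially. real (k * Z) \<le> real (k * ?m i)" using t unfolding filterlim_at_top by blast
      then show "\<forall>\<^sub>F i in sequentially. Z \<le> ?m i"
      proof eventually_elim
        case (elim i)
        then have "k * Z \<le> k * ?m i" by (simp only: of_nat_le_iff)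
        then show ?case using k by simp
      qed
    qed
  qed
  show ?thesis
  proof
    show "cond_MDA M X a b \<gamma> P" by (rule mda)
    show "1 \<le> r (\<sigma> i)" for i by (rule pos)
    show "filterlim (\<lambda>i. r (\<sigma> i)) at_top sequentially" by (rule filterlim_compose[OF r(1) \<sigma>(1)])
    show "filterlim (\<lambda>i. l (\<sigma> i)) at_top sequentially" by (rule filterlim_compose[OF l(1) \<sigma>(1)])
    show "(\<lambda>i. real (l (\<sigma> i)) / real (r (\<sigma> i))) \<longlonglongrightarrow> 0"
      by (rule filterlim_compose[OF smalloD_tendsto[OF l(2)] \<sigma>(1)])
    show "(\<lambda>i. alpha_mix M X (l (\<sigma> i))) \<longlonglongrightarrow> 0"
    proof (rule tendsto_sandwich[OF _ _ tendsto_const filterlim_compose[OF l(3) \<sigma>(1)]])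
      show "\<forall>\<^sub>F i in sequentially. 0 \<le> alpha_mix M X (l (\<sigma> i))" using alpha_mix_nonneg by simp
      \<comment> \<open>Since n / r >= 1, the vanishing of (n / r) \<alpha>(l) already gives
        \<alpha>(l) -> 0.\<close>
      have "1 * alpha_mix M X (l (\<sigma> i)) \<le> real (\<sigma> i) / real (r (\<sigma> i)) * alpha_mix M X (l (\<sigma> i))" for i
      proof (rule mult_right_mono[OF _ alpha_mix_nonneg])
        have "1 \<le> k * ?m i" using k m_pos[of i] by simp
        then show "1 \<le> real (\<sigma> i) / real (r (\<sigma> i))" unfolding ratio by linarith
      qed
      then show "\<forall>\<^sub>F i in sequentially. alpha_mix M X (l (\<sigma> i)) \<le> real (\<sigma> i) / real (r (\<sigma> i)) * alpha_mix M X (l (\<sigma> i))" by simp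
    qed
    show "2 \<le> k" "0 < om" "2 / om < \<nu>" by (rule k om \<nu>)+
    show "1 \<le> ?m i" for i by (rule m_pos)
    show "filterlim ?m at_top sequentially" by (rule m_top)
    show "(\<lambda>i. real (k * ?m i) powr (1 + om) * alpha_mix M X (r (\<sigma> i))) \<longlonglongrightarrow> 0"
      using filterlim_compose[OF mix \<sigma>(1)] unfolding ratio .
    show "h \<in> borel_measurable borel" "AE z in P. isCont h z" "0 \<le> C" by (rule h C)+
    show "(\<integral>\<^sup>+\<omega>. ennreal (norm (h (split_Z a b k (r (\<sigma> i)) t (\<lambda>u. X u \<omega>))) powr (2 + \<nu>)) \<partial>M) \<le> ennreal C"
      if "t \<in> {1..r (\<sigma> i)}" for i t by (rule mom[OF that])
  qed
qed

text \<open>A finite limsup yields one real bound for all large block sizes; as \<open>r\<close>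
  tends to infinity, it transfers to the filter.\<close>

lemma eventually_moment_bound:
  assumes INT: "cond_INT M X a b k h \<nu>" and r: "filterlim r at_top F"
  obtains C where "C \<ge> 0" "\<forall>\<^sub>F n in F. \<forall>t\<in>{1..r n}.
    (\<integral>\<^sup>+\<omega>. ennreal (norm (h (split_Z a b k (r n) t (\<lambda>u. X u \<omega>))) powr (2 + \<nu>)) \<partial>M) \<le> ennreal C"
proof -
  let ?I = "\<lambda>r t. \<integral>\<^sup>+\<omega>. ennreal (norm (h (split_Z a b k r t (\<lambda>u. X u \<omega>))) powr (2 + \<nu>)) \<partial>M"
  have "limsup (\<lambda>r. SUP t\<in>{1..r}. ?I r t) < \<infinity>" using INT by (simp add: cond_INT_def)
  then obtain c where c: "limsup (\<lambda>r. SUP t\<in>{1..r}. ?I r t) < c" "c < \<infinity>" using dense by blast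
  have "\<forall>\<^sub>F r in sequentially. (SUP t\<in>{1..r}. ?I r t) < c" by (rule Limsup_lessD[OF c(1)])
  from eventually_compose_filterlim[OF this r] have "\<forall>\<^sub>F n in F. \<forall>t\<in>{1..r n}. ?I (r n) t \<le> ennreal (enn2real c)"
  proof eventually_elim
    case (elim n)
    show ?case
    proof
      fix t assume "t \<in> {1..r n}"
      then have "?I (r n) t \<le> (SUP t\<in>{1..r n}. ?I (r n) t)" by (rule SUP_upper)
      also have "\<dots> \<le> c" using elim by simp
      also have "c = ennreal (enn2real c)" using c(2) by simp
      finally show "?I (r n) t \<le> ennreal (enn2real c)" .
    qed
  qed
  then show ?thesis by (rule that[OF enn2real_nonneg])
qed

theorem theorem3p2:
  fixes M :: "'a measure"
    and X :: "int \<Rightarrow> 'a \<Rightarrow> real^'d"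
    and a b :: "nat \<Rightarrow> real^'d"
    and \<gamma> :: "real^'d"
    and P :: "(real^'d) measure"
    and r :: "nat \<Rightarrow> nat"
    and k :: nat
    and \<omega> \<nu> :: real
    and h :: "real^'d \<Rightarrow> real^'q"
  assumes "prob_space M"
    and "cond_MDA M X a b \<gamma> P"
    and "cond_BM M X r \<omega> (sample_sizes k r)"
    and "k \<ge> 2"
    and "\<nu> > 2 / \<omega>"
    and "cond_INT M X a b k h \<nu>"
    and "limit_ae_continuous P h"
  shows "((\<lambda>n. cov_matrix M (G_bar M X a b k n (r n) h)) \<longlongrightarrow> Sigma_s P h) (sample_sizes k r) \<and>
    weak_conv_law (\<lambda>n. distr M borel (G_bar M X a b k n (r n) h))
      (mv_normal 0 (Sigma_s P h)) (sample_sizes k r) \<and>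
    (\<forall>D E. cond_CB M X a b k r h (sample_sizes k r) D E \<longrightarrow>
      weak_conv_law (\<lambda>n. distr M borel (G_tilde M X a b k n (r n) h))
        (mv_normal ((1 / real k) *\<^sub>R (D + E)) (Sigma_s P h)) (sample_sizes k r) \<and>
      (\<forall>B. cond_B M X a b P r h (sample_sizes k r) B \<longrightarrow>
        weak_conv_law (\<lambda>n. distr M borel (G_circ P X a b k n (r n) h))
          (mv_normal (B + (1 / real k) *\<^sub>R (D + E)) (Sigma_s P h)) (sample_sizes k r)))"
proof -
  let ?F = "sample_sizes k r" and ?m = "\<lambda>\<sigma> i. \<sigma> i div (k * r (\<sigma> i))"
  from assms(3) obtain l where om: "\<omega> > 0" and r: "filterlim r at_top ?F" "(\<lambda>n. real (r n)) \<in> o[?F](\<lambda>n. real n)"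
    and l: "filterlim l at_top ?F" "(\<lambda>n. real (l n)) \<in> o[?F](\<lambda>n. real (r n))"
      "((\<lambda>n. real n / real (r n) * alpha_mix M X (l n)) \<longlongrightarrow> 0) ?F"
    and mix: "((\<lambda>n. (real n / real (r n)) powr (1 + \<omega>) * alpha_mix M X (r n)) \<longlongrightarrow> 0) ?F"
    unfolding cond_BM_def by blast
  have h: "h \<in> borel_measurable borel" "AE z in P. isCont h z"
    using assms(6,7) by (auto simp: cond_INT_def limit_ae_continuous_def)
  obtain C where C: "C \<ge> 0" "\<forall>\<^sub>F n in ?F. \<forall>t\<in>{1..r n}.
    (\<integral>\<^sup>+\<omega>. ennreal (norm (h (split_Z a b k (r n) t (\<lambda>u. X u \<omega>))) powr (2 + \<nu>)) \<partial>M) \<le> ennreal C"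
    by (rule eventually_moment_bound[OF assms(6) r(1)])
  \<comment> \<open>Collects what holds eventually, so that it may be required at every index of a
    subsequence.\<close>
  define good where "good n \<longleftrightarrow> 1 \<le> r n \<and> 1 \<le> n \<and> (\<forall>t\<in>{1..r n}.
    (\<integral>\<^sup>+\<omega>. ennreal (norm (h (split_Z a b k (r n) t (\<lambda>u. X u \<omega>))) powr (2 + \<nu>)) \<partial>M) \<le> ennreal C)" for n
  have good: "eventually good ?F"
  proof -
    have "\<forall>\<^sub>F n in ?F. 1 \<le> r n" using r(1) unfolding filterlim_at_top by blast
    moreover have "\<forall>\<^sub>F n in ?F. 1 \<le> n"
      unfolding sample_sizes_def eventually_inf_principal using eventually_ge_at_top[of "1::nat"] by eventually_elim simp
    ultimately show ?thesis using C(2) by eventually_elim (simp add: good_def)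
  qed
  have loc: "vector_circular_process M X a b \<gamma> P (\<lambda>i. r (\<sigma> i)) (\<lambda>i. l (\<sigma> i)) k (?m \<sigma>) \<omega> \<nu> h C"
    if \<sigma>: "strict_mono \<sigma>" "\<And>i. k * r (\<sigma> i) dvd \<sigma> i" "\<And>i. good (\<sigma> i)" for \<sigma> :: "nat \<Rightarrow> nat"
    by (rule vector_circular_process_subsequence[OF assms(1,2,4,5) om h C(1) r l mix filterlim_sample_sizes[where k=k and r=r, OF \<sigma>(1,2)] \<sigma>(2)])
      (use \<sigma>(3) in \<open>auto simp: good_def\<close>)
  have W: "vector_circular_process.W M X a b (\<lambda>i. r (\<sigma> i)) k (?m \<sigma>) h i = G_bar M X a b k (\<sigma> i) (r (\<sigma> i)) h"
    if \<sigma>: "strict_mono \<sigma>" "\<And>i. k * r (\<sigma> i) dvd \<sigma> i" "\<And>i. good (\<sigma> i)" for \<sigma> :: "nat \<Rightarrow> nat" and i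
  proof -
    have "?m \<sigma> i * (k * r (\<sigma> i)) = \<sigma> i" using \<sigma>(2) by simp
    then show ?thesis using vector_circular_process.W_def[OF loc[OF \<sigma>], of i] by simp
  qed
  have "((\<lambda>n. cov_matrix M (G_bar M X a b k n (r n) h)) \<longlongrightarrow> Sigma_s P h) ?F"
  proof (rule limit_along_sample_sizes[OF good])
    fix \<sigma> :: "nat \<Rightarrow> nat" assume \<sigma>: "strict_mono \<sigma>" "\<And>i. k * r (\<sigma> i) dvd \<sigma> i" "\<And>i. good (\<sigma> i)"
    show "(\<lambda>i. cov_matrix M (G_bar M X a b k (\<sigma> i) (r (\<sigma> i)) h)) \<longlonglongrightarrow> Sigma_s P h"
      using vector_circular_process.cov_matrix_limit[OF loc[OF \<sigma>]] unfolding W[OF \<sigma>] .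
  qed
  moreover have "weak_conv_law (\<lambda>n. distr M borel (G_bar M X a b k n (r n) h)) (mv_normal 0 (Sigma_s P h)) ?F"
  proof (rule weak_conv_along_sample_sizes[OF good])
    fix \<sigma> :: "nat \<Rightarrow> nat" assume \<sigma>: "strict_mono \<sigma>" "\<And>i. k * r (\<sigma> i) dvd \<sigma> i" "\<And>i. good (\<sigma> i)"
    show "weak_conv_law (\<lambda>i. distr M borel (G_bar M X a b k (\<sigma> i) (r (\<sigma> i)) h)) (mv_normal 0 (Sigma_s P h)) sequentially"
      using vector_circular_process.W_shift_limit[OF loc[OF \<sigma>] tendsto_const[of 0]] unfolding W[OF \<sigma>] by simp
  qed
  moreover have "weak_conv_law (\<lambda>n. distr M borel (G_tilde M X a b k n (r n) h))
        (mv_normal ((1 / real k) *\<^sub>R (D + E)) (Sigma_s P h)) ?F"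
    and "cond_B M X a b P r h ?F B \<Longrightarrow> weak_conv_law (\<lambda>n. distr M borel (G_circ P X a b k n (r n) h))
          (mv_normal (B + (1 / real k) *\<^sub>R (D + E)) (Sigma_s P h)) ?F"
    if CB: "cond_CB M X a b k r h ?F D E" for D E B
  proof -
    let ?D = "\<lambda>n. (sqrt (real n / real (r n)) * (1 / real (r n))) *\<^sub>R
        (\<Sum>t=1..r n - 1. \<integral>w. D_integrand X a b k h (r n) t w \<partial>(M \<Otimes>\<^sub>M M))"
    let ?E = "\<lambda>n. (sqrt (real n / real (r n)) * (1 / real (r n))) *\<^sub>R
        (\<Sum>t=1..r n - 1. \<integral>w. E_integrand X a b h (r n) t w \<partial>(M \<Otimes>\<^sub>M M))"
    let ?c = "\<lambda>n. sqrt (real n / real (r n)) *\<^sub>R (mean_circ M X a b k (r n) h - mean_block M X a b (r n) h)"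
    \<comment> \<open>The bias condition grants integrability only eventually, so it is treated in
      the same way.\<close>
    define good' where "good' n \<longleftrightarrow> good n \<and> (\<forall>t\<in>{1..r n - 1}.
        integrable (M \<Otimes>\<^sub>M M) (D_integrand X a b k h (r n) t) \<and>
        integrable (M \<Otimes>\<^sub>M M) (E_integrand X a b h (r n) t))" for n
    have good': "eventually good' ?F"
      unfolding good'_def using good CB by (intro eventually_conj) (simp_all add: cond_CB_def)
    have DE: "(?D \<longlongrightarrow> D) ?F" "(?E \<longlongrightarrow> E) ?F" using CB unfolding cond_CB_def by blast+
    have shift: "(\<lambda>i. ?c (\<sigma> i)) \<longlonglongrightarrow> (1 / real k) *\<^sub>R (D + E)"
      if \<sigma>: "strict_mono \<sigma>" "\<And>i. k * r (\<sigma> i) dvd \<sigma> i" "\<And>i. good' (\<sigma> i)" for \<sigma> :: "nat \<Rightarrow> nat"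
    proof (rule vector_circular_process.bias_limit[OF loc[OF \<sigma>(1,2)]])
      have F: "filterlim \<sigma> ?F sequentially" by (rule filterlim_sample_sizes[OF \<sigma>(1,2)])
      show "(\<lambda>i. ?D (\<sigma> i)) \<longlonglongrightarrow> D" by (rule filterlim_compose[OF DE(1) F])
      show "(\<lambda>i. ?E (\<sigma> i)) \<longlonglongrightarrow> E" by (rule filterlim_compose[OF DE(2) F])
    qed (use \<sigma>(3) in \<open>auto simp: good'_def\<close>)
    show "weak_conv_law (\<lambda>n. distr M borel (G_tilde M X a b k n (r n) h))
        (mv_normal ((1 / real k) *\<^sub>R (D + E)) (Sigma_s P h)) ?F"
    proof (rule weak_conv_along_sample_sizes[OF good'])
      fix \<sigma> :: "nat \<Rightarrow> nat" assume \<sigma>: "strict_mono \<sigma>" "\<And>i. k * r (\<sigma> i) dvd \<sigma> i" "\<And>i. good' (\<sigma> i)"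
      then have g: "\<And>i. good (\<sigma> i)" by (simp add: good'_def)
      note \<sigma>' = \<sigma>(1,2) g
      have e: "G_tilde M X a b k (\<sigma> i) (r (\<sigma> i)) h = (\<lambda>\<omega>. G_bar M X a b k (\<sigma> i) (r (\<sigma> i)) h \<omega> + ?c (\<sigma> i))" for i
        by (rule ext) (rule vector_circular_process.G_tilde_eq[OF loc[OF \<sigma>']])
      show "weak_conv_law (\<lambda>i. distr M borel (G_tilde M X a b k (\<sigma> i) (r (\<sigma> i)) h))
        (mv_normal ((1 / real k) *\<^sub>R (D + E)) (Sigma_s P h)) sequentially"
        using vector_circular_process.W_shift_limit[OF loc[OF \<sigma>'] shift[OF \<sigma>]] unfolding W[OF \<sigma>'] e .
    qed
    assume B: "cond_B M X a b P r h ?F B"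
    let ?b = "\<lambda>n. sqrt (real n / real (r n)) *\<^sub>R (mean_block M X a b (r n) h - (\<integral>z. h z \<partial>P))"
    have B': "(?b \<longlongrightarrow> B) ?F" using B unfolding cond_B_def by blast
    show "weak_conv_law (\<lambda>n. distr M borel (G_circ P X a b k n (r n) h))
          (mv_normal (B + (1 / real k) *\<^sub>R (D + E)) (Sigma_s P h)) ?F"
    proof (rule weak_conv_along_sample_sizes[OF good'])
      fix \<sigma> :: "nat \<Rightarrow> nat" assume \<sigma>: "strict_mono \<sigma>" "\<And>i. k * r (\<sigma> i) dvd \<sigma> i" "\<And>i. good' (\<sigma> i)"
      then have g: "\<And>i. good (\<sigma> i)" by (simp add: good'_def)
      note \<sigma>' = \<sigma>(1,2) g
      have e: "G_circ P X a b k (\<sigma> i) (r (\<sigma> i)) h = (\<lambda>\<omega>. G_bar M X a b k (\<sigma> i) (r (\<sigma> i)) h \<omega> + (?b (\<sigma> i) + ?c (\<sigma> i)))" for i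
        by (rule ext) (rule vector_circular_process.G_circ_eq[OF loc[OF \<sigma>']])
      have "(\<lambda>i. ?b (\<sigma> i) + ?c (\<sigma> i)) \<longlonglongrightarrow> B + (1 / real k) *\<^sub>R (D + E)"
        by (intro tendsto_add shift \<sigma> filterlim_compose[OF B' filterlim_sample_sizes[where k=k and r=r, OF \<sigma>(1,2)]])
      from vector_circular_process.W_shift_limit[OF loc[OF \<sigma>'] this]
      show "weak_conv_law (\<lambda>i. distr M borel (G_circ P X a b k (\<sigma> i) (r (\<sigma> i)) h))
          (mv_normal (B + (1 / real k) *\<^sub>R (D + E)) (Sigma_s P h)) sequentially"
        unfolding W[OF \<sigma>'] e .
    qed
  qed
  ultimately show ?thesis by blast
qed

end
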